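(* Let $K$ be a perfect field with $\operatorname{char}(K)=p>0$. Let $f$ and $g$ be homogeneous polynomials in $S:=K[x,y,z,w]$ with $\deg(f)=3$ and $\deg(g)=2$ such that $\gcd(f,g)=1$ in $S$. Let $C=V(f,g)$ be the curve defined by the equations $f=0$ and $g=0$ in $\mathbf{P}^3=\operatorname{Proj}(S)$. Then the Hasse-Witt matrix of $C$ is $0$ if and only if the coefficients in $(fg)^{p-1}$ of all of the following $16$ monomials are equal to $0$: $$\begin{array}{cccc} (x^2yzw)^{p-1}, & x^{2p-1}y^{p-2}z^{p-1}w^{p-1}, & x^{2p-1}y^{p-1}z^{p-2}w^{p-1}, & x^{2p-1}y^{p-1}z^{p-1}w^{p-2},\\ x^{p-2}y^{2p-1}z^{p-1}w^{p-1}, & (xy^2zw)^{p-1}, & x^{p-1}y^{2p-1}z^{p-2}w^{p-1}, & x^{p-1}y^{2p-1}z^{p-1}w^{p-2},\\ x^{p-2}y^{p-1}z^{2p-1}w^{p-1}, & x^{p-1}y^{p-2}z^{2p-1}w^{p-1}, & (xyz^2w)^{p-1}, & x^{p-1}y^{p-1}z^{2p-1}w^{p-2},\\ x^{p-2}y^{p-1}z^{p-1}w^{2p-1}, & x^{p-1}y^{p-2}z^{p-1}w^{2p-1}, & x^{p-1}y^{p-1}z^{p-2}w^{2p-1}, & (xyzw^2)^{p-1}. \end{array}$$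
   Context: $C$ is the closed subscheme $\operatorname{Proj}(S/\langle f,g\rangle)$ of $\mathbf{P}^3$. The Hasse-Witt matrix of $C$ is the matrix representing the $p$-linear Frobenius map on $H^1(C,\mathcal{O}_C)$ with respect to a $K$-basis (its vanishing does not depend on the basis). *)

theory Defs
  imports
    "Jordan_Normal_Form.VS_Connect"
    "HOL-Algebra.QuotRing"
    "HOL-Library.Poly_Mapping"
    "HOL-Analysis.Function_Topology"
begin

section \<open>First cohomology of a sheaf\<close>

text \<open>
  A sheaf \<open>F\<close> of \<open>'k\<close>-algebras on a topological space \<open>X\<close> assigns to every open set \<open>U\<close> an algebra
  whose elements are (extensional) functions on \<open>U\<close>; the restriction maps are restrictions of
  functions.  For any sheaf the first cohomology group is the direct limit of the first Cech
  cohomology groups over all open coverings.  As in Godement, the coverings are indexed by the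
  points, \<open>x \<in> U x\<close>: they are cofinal among all coverings, and \<open>W\<close> refines \<open>U\<close> in the evident way
  if \<open>W x \<subseteq> U x\<close> for all \<open>x\<close>.  An element of the limit is a class of pairs of a covering \<open>U\<close> and a
  cocycle for \<open>U\<close>.  Nothing is required of \<open>U\<close> and \<open>c\<close> outside \<open>topspace X\<close>; such values are
  invisible to \<open>cohomologous\<close>.
\<close>

definition pointed_cover :: "'p topology \<Rightarrow> ('p \<Rightarrow> 'p set) \<Rightarrow> bool" where
  "pointed_cover X U \<longleftrightarrow> (\<forall>x\<in>topspace X. openin X (U x) \<and> x \<in> U x)"

type_synonym ('p, 's) cover_cochain = "('p \<Rightarrow> 'p set) \<times> ('p \<Rightarrow> 'p \<Rightarrow> 's)"

definition cocycles ::
  "'p topology \<Rightarrow> ('p set \<Rightarrow> ('k, 'p \<Rightarrow> 'v) module) \<Rightarrow> ('p, 'p \<Rightarrow> 'v) cover_cochain set" where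
  "cocycles X F = {(U, c). pointed_cover X U \<and>
     (\<forall>x\<in>topspace X. \<forall>y\<in>topspace X. c x y \<in> carrier (F (U x \<inter> U y))) \<and>
     (\<forall>x\<in>topspace X. \<forall>y\<in>topspace X. \<forall>z\<in>topspace X.
        let W = U x \<inter> U y \<inter> U z in
        restrict (c x z) W = restrict (c x y) W \<oplus>\<^bsub>F W\<^esub> restrict (c y z) W)}"

definition cohomologous ::
  "'p topology \<Rightarrow> ('p set \<Rightarrow> ('k, 'p \<Rightarrow> 'v) module) \<Rightarrow> ('p, 'p \<Rightarrow> 'v) cover_cochain rel" where
  "cohomologous X F = {((U, c), (V, d)). (U, c) \<in> cocycles X F \<and> (V, d) \<in> cocycles X F \<and>
     (\<exists>W b. pointed_cover X W \<and>
        (\<forall>x\<in>topspace X. W x \<subseteq> U x \<inter> V x \<and> b x \<in> carrier (F (W x))) \<and>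
        (\<forall>x\<in>topspace X. \<forall>y\<in>topspace X.
           let N = W x \<inter> W y in
           restrict (c x y) N \<ominus>\<^bsub>F N\<^esub> restrict (d x y) N
             = restrict (b y) N \<ominus>\<^bsub>F N\<^esub> restrict (b x) N))}"

definition H1_class where
  "H1_class X F U c = cohomologous X F `` {(U, c)}"

text \<open>The multiplicative fields of the record play no role for a module.\<close>

definition H1 ::
  "'p topology \<Rightarrow> ('p set \<Rightarrow> ('k, 'p \<Rightarrow> 'v) module) \<Rightarrow>
     ('k, ('p, 'p \<Rightarrow> 'v) cover_cochain set) module" where
  "H1 X F = \<lparr> carrier = cocycles X F // cohomologous X F,
     mult = undefined,
     one = undefined,
     zero = H1_class X F (\<lambda>x. topspace X) (\<lambda>x y. \<zero>\<^bsub>F (topspace X)\<^esub>),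
     add = (\<lambda>A B. \<Union>(U, c)\<in>A. \<Union>(V, d)\<in>B.
       H1_class X F (\<lambda>x. U x \<inter> V x)
         (\<lambda>x y. let N = (U x \<inter> V x) \<inter> (U y \<inter> V y) in
            restrict (c x y) N \<oplus>\<^bsub>F N\<^esub> restrict (d x y) N)),
     smult = (\<lambda>k A. \<Union>(U, c)\<in>A.
       H1_class X F U (\<lambda>x y. k \<odot>\<^bsub>F (U x \<inter> U y)\<^esub> c x y)) \<rparr>"

text \<open>
  The map induced on \<open>H\<^sup>1\<close> by the \<open>p\<close>-th power map of \<open>F\<close> (which is additive if \<open>F\<close> has prime
  characteristic \<open>p\<close>).
\<close>

definition H1_frobenius ::
  "'p topology \<Rightarrow> ('p set \<Rightarrow> ('k, 'p \<Rightarrow> 'v) module) \<Rightarrow> nat \<Rightarrow>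
     ('p, 'p \<Rightarrow> 'v) cover_cochain set \<Rightarrow> ('p, 'p \<Rightarrow> 'v) cover_cochain set" where
  "H1_frobenius X F p A = (\<Union>(U, c)\<in>A.
     H1_class X F U (\<lambda>x y. c x y [^]\<^bsub>F (U x \<inter> U y)\<^esub> p))"


section \<open>Proj of a graded ring\<close>

text \<open>\<open>R\<close> is a commutative ring, graded by the additive subgroups \<open>G d\<close>.\<close>

definition proj_points :: "'a ring \<Rightarrow> (nat \<Rightarrow> 'a set) \<Rightarrow> 'a set set" where
  "proj_points R G = {P. primeideal P R \<and> P = genideal R (P \<inter> (\<Union>d. G d)) \<and>
     \<not> genideal R (\<Union>d\<in>{1..}. G d) \<subseteq> P}"

definition basic_open :: "'a ring \<Rightarrow> (nat \<Rightarrow> 'a set) \<Rightarrow> 'a \<Rightarrow> 'a set set" where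
  "basic_open R G h = {P \<in> proj_points R G. h \<notin> P}"

definition proj_topology :: "'a ring \<Rightarrow> (nat \<Rightarrow> 'a set) \<Rightarrow> 'a set topology" where
  "proj_topology R G = topology_generated_by (basic_open R G ` (\<Union>d. G d))"

text \<open>
  The local ring at \<open>P\<close> consists of the fractions \<open>a / s\<close> with \<open>a\<close>, \<open>s\<close> homogeneous of the same
  degree and \<open>s \<notin> P\<close>, i.e. of the elements of degree zero in the localization of \<open>R\<close> at the
  homogeneous elements outside \<open>P\<close>.  A fraction is the set of all pairs representing it.
\<close>

definition hfrac :: "'a ring \<Rightarrow> (nat \<Rightarrow> 'a set) \<Rightarrow> 'a set \<Rightarrow> 'a \<Rightarrow> 'a \<Rightarrow> ('a \<times> 'a) set" where
  "hfrac R G P a s = {(b, t). (\<exists>e. b \<in> G e \<and> t \<in> G e) \<and> t \<notin> P \<and>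
     (\<exists>u\<in>(\<Union>e. G e) - P. u \<otimes>\<^bsub>R\<^esub> (a \<otimes>\<^bsub>R\<^esub> t \<ominus>\<^bsub>R\<^esub> b \<otimes>\<^bsub>R\<^esub> s) = \<zero>\<^bsub>R\<^esub>)}"

definition hlocal_ring :: "'a ring \<Rightarrow> (nat \<Rightarrow> 'a set) \<Rightarrow> 'a set \<Rightarrow> ('a \<times> 'a) set ring" where
  "hlocal_ring R G P = \<lparr> carrier = {hfrac R G P a s | a s d. a \<in> G d \<and> s \<in> G d \<and> s \<notin> P},
     mult = (\<lambda>q r. \<Union>(a, s)\<in>q. \<Union>(b, t)\<in>r. hfrac R G P (a \<otimes>\<^bsub>R\<^esub> b) (s \<otimes>\<^bsub>R\<^esub> t)),
     one = hfrac R G P \<one>\<^bsub>R\<^esub> \<one>\<^bsub>R\<^esub>,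
     zero = hfrac R G P \<zero>\<^bsub>R\<^esub> \<one>\<^bsub>R\<^esub>,
     add = (\<lambda>q r. \<Union>(a, s)\<in>q. \<Union>(b, t)\<in>r.
       hfrac R G P (a \<otimes>\<^bsub>R\<^esub> t \<oplus>\<^bsub>R\<^esub> b \<otimes>\<^bsub>R\<^esub> s) (s \<otimes>\<^bsub>R\<^esub> t)) \<rparr>"

definition proj_sections ::
  "'a ring \<Rightarrow> (nat \<Rightarrow> 'a set) \<Rightarrow> 'a set set \<Rightarrow> ('a set \<Rightarrow> ('a \<times> 'a) set) set" where
  "proj_sections R G U = {\<sigma> \<in> extensional U. \<forall>P\<in>U. \<exists>V. openin (proj_topology R G) V \<and> P \<in> V \<and> V \<subseteq> U \<and>
     (\<exists>d. \<exists>a\<in>G d. \<exists>h\<in>G d. \<forall>Q\<in>V. h \<notin> Q \<and> \<sigma> Q = hfrac R G Q a h)}"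

text \<open>
  The structure sheaf; \<open>\<phi>\<close> is a ring homomorphism from the base field to the degree zero part
  of \<open>R\<close>, which makes Proj a scheme over that field.
\<close>

definition structure_sheaf ::
  "'a ring \<Rightarrow> (nat \<Rightarrow> 'a set) \<Rightarrow> ('k \<Rightarrow> 'a) \<Rightarrow>
     'a set set \<Rightarrow> ('k, 'a set \<Rightarrow> ('a \<times> 'a) set) module" where
  "structure_sheaf R G \<phi> U = \<lparr> carrier = proj_sections R G U,
     mult = (\<lambda>\<sigma> \<tau>. \<lambda>P\<in>U. \<sigma> P \<otimes>\<^bsub>hlocal_ring R G P\<^esub> \<tau> P),
     one = (\<lambda>P\<in>U. \<one>\<^bsub>hlocal_ring R G P\<^esub>),
     zero = (\<lambda>P\<in>U. \<zero>\<^bsub>hlocal_ring R G P\<^esub>),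
     add = (\<lambda>\<sigma> \<tau>. \<lambda>P\<in>U. \<sigma> P \<oplus>\<^bsub>hlocal_ring R G P\<^esub> \<tau> P),
     smult = (\<lambda>k \<sigma>. \<lambda>P\<in>U. hfrac R G P (\<phi> k) \<one>\<^bsub>R\<^esub> \<otimes>\<^bsub>hlocal_ring R G P\<^esub> \<sigma> P) \<rparr>"


section \<open>Intersections of two surfaces in projective 3-space\<close>

datatype coord = Coord_x | Coord_y | Coord_z | Coord_w

type_synonym monom4 = "coord \<Rightarrow>\<^sub>0 nat"

text \<open>The polynomial ring \<open>K[x,y,z,w]\<close>, with multiplication the convolution of coefficients.\<close>

type_synonym 'k poly4 = "monom4 \<Rightarrow>\<^sub>0 'k"

definition mono4 :: "nat \<Rightarrow> nat \<Rightarrow> nat \<Rightarrow> nat \<Rightarrow> monom4" where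
  "mono4 i j k l = Poly_Mapping.single Coord_x i + Poly_Mapping.single Coord_y j
     + Poly_Mapping.single Coord_z k + Poly_Mapping.single Coord_w l"

definition mdegree :: "monom4 \<Rightarrow> nat" where
  "mdegree m = Poly_Mapping.lookup m Coord_x + Poly_Mapping.lookup m Coord_y
     + Poly_Mapping.lookup m Coord_z + Poly_Mapping.lookup m Coord_w"

text \<open>By convention the zero polynomial is homogeneous of every degree.\<close>

definition homogeneous :: "nat \<Rightarrow> 'k::zero poly4 \<Rightarrow> bool" where
  "homogeneous d f \<longleftrightarrow> (\<forall>m\<in>Poly_Mapping.keys f. mdegree m = d)"

definition curve_ideal :: "'k::field poly4 \<Rightarrow> 'k poly4 \<Rightarrow> 'k poly4 set" where
  "curve_ideal f g = genideal class_ring {f, g}"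

definition coord_ring :: "'k::field poly4 \<Rightarrow> 'k poly4 \<Rightarrow> 'k poly4 set ring" where
  "coord_ring f g = class_ring Quot curve_ideal f g"

definition residue_class :: "'k::field poly4 \<Rightarrow> 'k poly4 \<Rightarrow> 'k poly4 \<Rightarrow> 'k poly4 set" where
  "residue_class f g a = curve_ideal f g +>\<^bsub>class_ring\<^esub> a"

definition coord_grading :: "'k::field poly4 \<Rightarrow> 'k poly4 \<Rightarrow> nat \<Rightarrow> 'k poly4 set set" where
  "coord_grading f g d = residue_class f g ` {a. homogeneous d a}"

definition curve_space :: "'k::field poly4 \<Rightarrow> 'k poly4 \<Rightarrow> 'k poly4 set set topology" where
  "curve_space f g = proj_topology (coord_ring f g) (coord_grading f g)"

definition curve_sheaf ::
  "'k::field poly4 \<Rightarrow> 'k poly4 \<Rightarrow> 'k poly4 set set set \<Rightarrow>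
     ('k, 'k poly4 set set \<Rightarrow> ('k poly4 set \<times> 'k poly4 set) set) module" where
  "curve_sheaf f g = structure_sheaf (coord_ring f g) (coord_grading f g)
     (\<lambda>k. residue_class f g (Poly_Mapping.single 0 k))"

type_synonym 'k curve_H1 =
  "('k poly4 set set, 'k poly4 set set \<Rightarrow> ('k poly4 set \<times> 'k poly4 set) set) cover_cochain set"

definition curve_H1 :: "'k::field poly4 \<Rightarrow> 'k poly4 \<Rightarrow> ('k, 'k curve_H1) module" where
  "curve_H1 f g = H1 (curve_space f g) (curve_sheaf f g)"

definition curve_frobenius :: "'k::field poly4 \<Rightarrow> 'k poly4 \<Rightarrow> 'k curve_H1 \<Rightarrow> 'k curve_H1" where
  "curve_frobenius f g = H1_frobenius (curve_space f g) (curve_sheaf f g) CHAR('k)"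

definition H1_ordered_basis :: "'k::field poly4 \<Rightarrow> 'k poly4 \<Rightarrow> 'k curve_H1 list \<Rightarrow> bool" where
  "H1_ordered_basis f g es \<longleftrightarrow>
     distinct es \<and> vectorspace.basis class_ring (curve_H1 f g) (set es)"

text \<open>Column \<open>j\<close> holds the coordinates of the image of the \<open>j\<close>-th basis element.\<close>

definition hasse_witt_matrix :: "'k::field poly4 \<Rightarrow> 'k poly4 \<Rightarrow> 'k curve_H1 list \<Rightarrow> 'k mat" where
  "hasse_witt_matrix f g es = (THE A. A \<in> carrier_mat (length es) (length es) \<and>
     (\<forall>j<length es. curve_frobenius f g (es ! j) =
        (\<Oplus>\<^bsub>curve_H1 f g\<^esub>i\<in>{..<length es}. A $$ (i, j) \<odot>\<^bsub>curve_H1 f g\<^esub> es ! i)))"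

end

theory Submission
  imports Defs "Berlekamp_Zassenhaus.Unique_Factorization_Poly"
begin

text \<open>
  The Koszul resolution \<open>0 \<rightarrow> O(-5) \<rightarrow> O(-3) \<oplus> O(-2) \<rightarrow> O \<rightarrow> O\<^sub>C \<rightarrow> 0\<close> identifies \<open>H\<^sup>1(C, O\<^sub>C)\<close> with
  \<open>H\<^sup>3(P\<^sup>3, O(-5))\<close>, which has as a basis the four Laurent monomials of degree \<open>-5\<close> with only
  negative exponents.  Frobenius lifts to the resolution and becomes \<open>t \<mapsto> (f g)\<^sup>p\<^sup>-\<^sup>1 t\<^sup>p\<close> on
  \<open>H\<^sup>3(P\<^sup>3, O(-5))\<close>; its matrix consists of the 16 coefficients.  All of this takes place in Cech
  cochains with Laurent polynomial values for the covering by the four sets where a coordinate does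
  not vanish.  That this covering computes the limit over all coverings is due to the vanishing of
  the cohomology of \<open>O\<^sub>C\<close> on basic open sets, which follows from partitions of unity.
\<close>

text \<open>Coprimality of f and g serves to make the Koszul complex exact over every localization
  at coordinates. Clearing denominators reduces this to Euclid's lemma in K[x,y,z,w], which holds
  because that ring is an iterated univariate polynomial ring. Of the twists 0, -2, -3, -5 only -5
  lies below -3, so only O(-5) has third cohomology. The p-th power takes O(-3) to O(-3p) and
  f^(p-1) brings it back; with the same for g, the factor on O(-5) must be (f g)^(p-1). The obstacle
  is that classes are given by arbitrary pointed coverings with values in local rings. The passage
  from values at points to polynomials rests on one fact, proved with Zorn's lemma: if h,
  homogeneous of positive degree, vanishes at all points where a graded ideal I containing (f, g)
  vanishes, then a power of h lies in I. It yields quasi-compactness, partitions of unity and the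
  kernel of evaluation. The dimension of the first cohomology is never computed: a p-linear map is
  zero iff it kills a basis, so the matrix vanishes iff Frobenius kills every class.\<close>

instantiation coord :: linorder
begin
text \<open>An order of the variables orders the exponent vectors lexicographically, and with such
  an order the polynomial and Laurent polynomial rings have no zero divisors. It also fixes the
  signs in \<open>order_sign\<close>.\<close>

definition coord_idx :: "coord \<Rightarrow> nat" where
  "coord_idx i = (case i of Coord_x \<Rightarrow> 0 | Coord_y \<Rightarrow> 1 | Coord_z \<Rightarrow> 2 | Coord_w \<Rightarrow> 3)"
definition less_eq_coord :: "coord \<Rightarrow> coord \<Rightarrow> bool" where
  "i \<le> j \<longleftrightarrow> coord_idx i \<le> coord_idx j"
definition less_coord :: "coord \<Rightarrow> coord \<Rightarrow> bool" where
  "i < j \<longleftrightarrow> coord_idx i < coord_idx j"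
instance
  by standard (auto simp: less_eq_coord_def less_coord_def coord_idx_def split: coord.splits)
end

lemma UNIV_coord: "(UNIV :: coord set) = {Coord_x, Coord_y, Coord_z, Coord_w}"
  using coord.exhaust by auto

instance coord :: finite
  by standard (simp add: UNIV_coord)

hide_const (open) coord_idx

section \<open>Homomorphisms out of monoid algebras\<close>

lemma poly_mapping_eq_sum_single:
  "a = (\<Sum>m\<in>Poly_Mapping.keys a. Poly_Mapping.single m (Poly_Mapping.lookup a m))"
  by (rule poly_mapping_eqI)
     (auto simp: lookup_sum lookup_single when_def not_in_keys_iff_lookup_eq_zero if_distrib
       cong: if_cong)

lemma poly_mapping_induct [case_names zero single add]:
  assumes "P 0" "\<And>m c. P (Poly_Mapping.single m c)" "\<And>a b. P a \<Longrightarrow> P b \<Longrightarrow> P (a + b)"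
  shows "P (a :: 'm \<Rightarrow>\<^sub>0 'c::comm_monoid_add)"
proof -
  have "P (\<Sum>m\<in>A. Poly_Mapping.single m (Poly_Mapping.lookup a m))" if "finite A" for A
    using that by induction (use assms in auto)
  then show ?thesis
    by (subst poly_mapping_eq_sum_single) simp
qed

text \<open>A monoid algebra maps to a commutative ring as soon as the images of the terms are
  additive in the coefficient and multiplicative (\<open>monom_hom\<close>). Two instances follow:
  iterated polynomials and Laurent polynomials.\<close>

definition extend_monom :: "('m \<Rightarrow> 'c::zero \<Rightarrow> 'r) \<Rightarrow> ('m \<Rightarrow>\<^sub>0 'c) \<Rightarrow> 'r::comm_monoid_add" where
  "extend_monom h a = (\<Sum>m\<in>Poly_Mapping.keys a. h m (Poly_Mapping.lookup a m))"

locale monom_hom =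
  fixes h :: "'m::comm_monoid_add \<Rightarrow> 'c::comm_ring_1 \<Rightarrow> 'r::comm_ring_1"
  assumes h_add: "h m (a + b) = h m a + h m b"
    and h_mult: "h (m + n) (a * b) = h m a * h n b"
    and h_one: "h 0 1 = 1"
begin

lemma h_zero: "h m 0 = 0"
  using h_add[of m 0 0] by simp

lemma extend_monom_superset:
  assumes "finite A" "Poly_Mapping.keys a \<subseteq> A"
  shows "extend_monom h a = (\<Sum>m\<in>A. h m (Poly_Mapping.lookup a m))"
  unfolding extend_monom_def
  by (rule sum.mono_neutral_left) (use assms in \<open>auto simp: h_zero not_in_keys_iff_lookup_eq_zero\<close>)

lemma extend_monom_zero: "extend_monom h 0 = 0"
  by (simp add: extend_monom_def)

lemma extend_monom_add: "extend_monom h (a + b) = extend_monom h a + extend_monom h b"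
proof -
  let ?A = "Poly_Mapping.keys a \<union> Poly_Mapping.keys b"
  have "extend_monom h (a + b) = (\<Sum>m\<in>?A. h m (Poly_Mapping.lookup (a + b) m))"
    by (rule extend_monom_superset) (auto simp: keys_add)
  also have "\<dots> = (\<Sum>m\<in>?A. h m (Poly_Mapping.lookup a m)) + (\<Sum>m\<in>?A. h m (Poly_Mapping.lookup b m))"
    by (simp add: lookup_add h_add sum.distrib)
  also have "\<dots> = extend_monom h a + extend_monom h b"
    by (simp add: extend_monom_superset[of ?A])
  finally show ?thesis .
qed

lemma extend_monom_single: "extend_monom h (Poly_Mapping.single m c) = h m c"
  by (simp add: extend_monom_def h_zero)

lemma extend_monom_mult: "extend_monom h (a * b) = extend_monom h a * extend_monom h b"
proof (induction a rule: poly_mapping_induct)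
  case (single m c)
  show ?case
    by (induction b rule: poly_mapping_induct)
       (simp_all add: extend_monom_zero extend_monom_single extend_monom_add mult_single h_mult
         distrib_left)
qed (simp_all add: extend_monom_zero extend_monom_add distrib_right)

lemma extend_monom_one: "extend_monom h 1 = 1"
  using extend_monom_single[of 0 1] by (simp add: h_one)

end

section \<open>Coprimality in four variables\<close>

text \<open>The prime factors of \<open>f\<close> are cancelled one at a time: each of them divides
  the product but not \<open>g\<close>, hence the cofactor. The induction therefore runs over
  sub-multisets of the factors, with the cofactor \<open>c\<close> arbitrary.\<close>

lemma ufd_coprime_dvd_mult:
  fixes f g b :: "'a::ufd"
  assumes cop: "\<And>h. h dvd f \<Longrightarrow> h dvd g \<Longrightarrow> h dvd 1" and f0: "f \<noteq> 0" and dvd: "f dvd g * b"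
  shows "f dvd b"
proof (cases "f dvd 1")
  case True
  then show ?thesis by (rule dvd_trans[OF _ one_dvd])
next
  case False
  obtain F where "mset_factors F f"
    using mset_factors_exist[OF f0 False] by (rule exE)
  then have F: "f = prod_mset F" and irr: "\<And>q. q \<in># F \<Longrightarrow> irreducible q"
    using mset_factorsD[of F f] by simp_all
  have "prod_mset A dvd c" if "A \<subseteq># F" "prod_mset A dvd g * c" for A c
    using that
  proof (induction A arbitrary: c)
    case empty
    show ?case by simp
  next
    case (add q A)
    have q: "q \<in># F" and AF: "A \<subseteq># F"
      using mset_subset_eq_insertD[OF add.prems(1)] by (simp_all add: subset_mset.less_imp_le)
    have "irreducible q" using q by (rule irr)
    then have prime: "prime_elem q" by (rule prime_elem_iff_irreducible[THEN iffD2])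
    have qA: "q * prod_mset A dvd g * c" using add.prems(2) by simp
    have "q dvd f" unfolding F using q by (rule dvd_prod_mset)
    then have "\<not> q dvd g" using cop[of q] prime_elem_not_unit[OF prime] by fast
    moreover have "q dvd g * c" using qA by (rule dvd_mult_left)
    ultimately have "q dvd c" using prime_elem_dvd_multD[OF prime, of g c] by fast
    then obtain d where d: "c = q * d" by (rule dvdE)
    have "q * prod_mset A dvd q * (g * d)"
      using qA unfolding d by (simp only: mult.left_commute[of g q d])
    then have "prod_mset A dvd g * d"
      using prime_elem_not_zeroI[OF prime] by (simp only: dvd_mult_cancel_left) simp
    with AF have "prod_mset A dvd d" by (rule add.IH)
    then have "q * prod_mset A dvd q * d" by (rule mult_dvd_mono[OF dvd_refl])
    then show ?case unfolding d by simp
  qed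
  from this[OF subset_mset.order_refl, of b] dvd show ?thesis unfolding F by (simp only:)
qed

text \<open>Unique factorization passes from a ring to its univariate polynomials, so the four
  variables are nested, with \<open>Coord_w\<close> innermost and \<open>Coord_x\<close>
  outermost.\<close>

definition iterated_monom :: "monom4 \<Rightarrow> 'k::comm_ring_1 \<Rightarrow> 'k poly poly poly poly" where
  "iterated_monom m c = monom (monom (monom (monom c
     (Poly_Mapping.lookup m Coord_w)) (Poly_Mapping.lookup m Coord_z))
     (Poly_Mapping.lookup m Coord_y)) (Poly_Mapping.lookup m Coord_x)"

interpretation iterated: monom_hom "iterated_monom :: monom4 \<Rightarrow> 'k::comm_ring_1 \<Rightarrow> _"
  by standard (simp_all only: iterated_monom_def add_monom[symmetric] mult_monom lookup_add
    lookup_zero monom_eq_1)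

abbreviation iterated :: "'k::comm_ring_1 poly4 \<Rightarrow> 'k poly poly poly poly" where
  "iterated \<equiv> extend_monom iterated_monom"

lemma lookup_mono4 [simp]:
  "Poly_Mapping.lookup (mono4 i j k l) Coord_x = i" "Poly_Mapping.lookup (mono4 i j k l) Coord_y = j"
  "Poly_Mapping.lookup (mono4 i j k l) Coord_z = k" "Poly_Mapping.lookup (mono4 i j k l) Coord_w = l"
  by (simp_all add: mono4_def lookup_add lookup_single)

lemma monom4_eq_iff: "m = m' \<longleftrightarrow> (\<forall>i. Poly_Mapping.lookup m i = Poly_Mapping.lookup m' (i::coord))"
  by (auto intro: poly_mapping_eqI)

lemma coeff_iterated:
  "coeff (coeff (coeff (coeff (iterated a) (Poly_Mapping.lookup m Coord_x))
      (Poly_Mapping.lookup m Coord_y)) (Poly_Mapping.lookup m Coord_z)) (Poly_Mapping.lookup m Coord_w)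
     = Poly_Mapping.lookup a m"
proof (induction a rule: poly_mapping_induct)
  case (single n c)
  have "n = m \<longleftrightarrow> (\<forall>i\<in>{Coord_x, Coord_y, Coord_z, Coord_w}. Poly_Mapping.lookup n i = Poly_Mapping.lookup m i)"
    by (simp add: monom4_eq_iff flip: UNIV_coord)
  moreover have "coeff (coeff (coeff (coeff (iterated_monom n c) (Poly_Mapping.lookup m Coord_x))
      (Poly_Mapping.lookup m Coord_y)) (Poly_Mapping.lookup m Coord_z)) (Poly_Mapping.lookup m Coord_w)
     = (if \<forall>i\<in>{Coord_x, Coord_y, Coord_z, Coord_w}. Poly_Mapping.lookup n i = Poly_Mapping.lookup m i
        then c else 0)"
    by (simp add: iterated_monom_def)
  ultimately show ?case
    by (simp add: iterated.extend_monom_single lookup_single when_def)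
qed (simp_all add: iterated.extend_monom_zero iterated.extend_monom_add lookup_add)

lemma inj_iterated: "inj (iterated :: 'k::comm_ring_1 poly4 \<Rightarrow> _)"
proof (rule injI, rule poly_mapping_eqI)
  fix a b :: "'k poly4" and m
  assume "iterated a = iterated b"
  then show "Poly_Mapping.lookup a m = Poly_Mapping.lookup b m"
    unfolding coeff_iterated[symmetric] by (simp only:)
qed

lemma poly_monom_closed:
  assumes "P 0" "\<And>p q. P p \<Longrightarrow> P q \<Longrightarrow> P (p + q)" "\<And>c i. P (monom c i)"
  shows "P (p :: 'a::comm_monoid_add poly)"
proof -
  have "P (\<Sum>i\<in>A. monom (coeff p i) i)" if "finite A" for A
    using that by induction (use assms in auto)
  then show ?thesis using poly_as_sum_of_monoms[of p] by (metis finite_atMost)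
qed

lemma surj_iterated: "surj (iterated :: 'k::comm_ring_1 poly4 \<Rightarrow> _)"
proof -
  let ?I = "range (iterated :: 'k poly4 \<Rightarrow> _)"
  have zero: "0 \<in> ?I" by (rule range_eqI[of _ _ 0]) (simp add: iterated.extend_monom_zero)
  have add: "p + q \<in> ?I" if "p \<in> ?I" "q \<in> ?I" for p q
    using that by (auto simp flip: iterated.extend_monom_add)
  \<comment> \<open>From here the coefficients are expanded one variable at a time, starting with
    the innermost; each stage needs only that the range is closed under sums.\<close>
  have 4: "monom (monom (monom (monom c l) k) j) i \<in> ?I" for c i j k l
    by (rule range_eqI[of _ _ "Poly_Mapping.single (mono4 i j k l) c"])
       (simp add: iterated.extend_monom_single iterated_monom_def)
  have 3: "monom (monom (monom c k) j) i \<in> ?I" for c i j k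
  proof (rule poly_monom_closed[where P = "\<lambda>c. monom (monom (monom c k) j) i \<in> ?I"])
    show "monom (monom (monom (p + q) k) j) i \<in> ?I"
      if "monom (monom (monom p k) j) i \<in> ?I" "monom (monom (monom q k) j) i \<in> ?I" for p q
      unfolding add_monom[symmetric] using that by (rule add)
  qed (simp_all only: zero 4 monom_eq_0)
  have 2: "monom (monom c j) i \<in> ?I" for c i j
  proof (rule poly_monom_closed[where P = "\<lambda>c. monom (monom c j) i \<in> ?I"])
    show "monom (monom (p + q) j) i \<in> ?I"
      if "monom (monom p j) i \<in> ?I" "monom (monom q j) i \<in> ?I" for p q
      unfolding add_monom[symmetric] using that by (rule add)
  qed (simp_all only: zero 3 monom_eq_0)
  have 1: "monom c i \<in> ?I" for c i
  proof (rule poly_monom_closed[where P = "\<lambda>c. monom c i \<in> ?I"])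
    show "monom (p + q) i \<in> ?I" if "monom p i \<in> ?I" "monom q i \<in> ?I" for p q
      unfolding add_monom[symmetric] using that by (rule add)
  qed (simp_all only: zero 2 monom_eq_0)
  have "p \<in> ?I" for p
    by (rule poly_monom_closed[where P = "\<lambda>p. p \<in> ?I"]) (rule zero add 1; assumption?)+
  then show ?thesis by fast
qed

lemma iterated_dvd_iff: "iterated a dvd iterated b \<longleftrightarrow> a dvd (b :: 'k::comm_ring_1 poly4)"
proof
  assume "iterated a dvd iterated b"
  then obtain c where "iterated b = iterated a * c" by blast
  moreover obtain d where "c = iterated d" using surj_iterated by (rule surjE)
  ultimately have "iterated b = iterated (a * d)" by (simp add: iterated.extend_monom_mult)
  then show "a dvd b" using inj_iterated by (auto dest: injD)
qed (auto simp: iterated.extend_monom_mult)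

text \<open>\<open>iterated\<close> is a bijection that preserves and reflects divisibility, so both
  the common divisors and the conclusion can be moved across it.\<close>

lemma poly4_coprime_dvd_mult:
  fixes f g b :: "'k::field poly4"
  assumes cop: "\<forall>h. h dvd f \<longrightarrow> h dvd g \<longrightarrow> h dvd 1" and f0: "f \<noteq> 0" and dvd: "f dvd g * b"
  shows "f dvd b"
proof -
  have "iterated f dvd iterated b"
  proof (rule ufd_coprime_dvd_mult)
    fix h assume h: "h dvd iterated f" "h dvd iterated g"
    obtain h' where h': "h = iterated h'" using surj_iterated by (rule surjE)
    have "h' dvd 1" using cop h unfolding h' iterated_dvd_iff by blast
    then have "iterated h' dvd iterated 1" by (simp only: iterated_dvd_iff)
    then show "h dvd 1" by (simp only: h' iterated.extend_monom_one)
  next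
    show "iterated f \<noteq> 0" using f0 injD[OF inj_iterated, of f 0] by (auto simp: iterated.extend_monom_zero)
    show "iterated f dvd iterated g * iterated b"
      using dvd by (simp only: iterated_dvd_iff flip: iterated.extend_monom_mult)
  qed
  then show ?thesis by (simp add: iterated_dvd_iff)
qed

section \<open>Homogeneous polynomials\<close>

lemma mdegree_eq_sum: "mdegree m = (\<Sum>i\<in>UNIV. Poly_Mapping.lookup m i)"
  by (simp add: mdegree_def UNIV_coord)

lemma mdegree_add [simp]: "mdegree (m + n) = mdegree m + mdegree n"
  by (simp add: mdegree_def lookup_add)

lemma mdegree_zero [simp]: "mdegree 0 = 0"
  by (simp add: mdegree_def)

lemma mdegree_single [simp]: "mdegree (Poly_Mapping.single i n) = n"
  by (cases i) (simp_all add: mdegree_def lookup_single)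

lemma homogeneous_zero [simp]: "homogeneous d 0"
  by (simp add: homogeneous_def)

lemma homogeneous_single: "mdegree m = d \<Longrightarrow> homogeneous d (Poly_Mapping.single m c)"
  by (simp add: homogeneous_def)

lemma homogeneous_one [simp]: "homogeneous 0 (1 :: 'k::comm_ring_1 poly4)"
  using homogeneous_single[of 0 0 "1::'k"] by simp

lemma homogeneous_add: "homogeneous d a \<Longrightarrow> homogeneous d b \<Longrightarrow> homogeneous d (a + b)"
  using keys_add[of a b] by (auto simp: homogeneous_def)

lemma homogeneous_uminus: "homogeneous d a \<Longrightarrow> homogeneous d (- a :: 'k::comm_ring_1 poly4)"
  by (auto simp: homogeneous_def in_keys_iff)

lemma homogeneous_diff:
  "homogeneous d a \<Longrightarrow> homogeneous d b \<Longrightarrow> homogeneous d (a - b :: 'k::comm_ring_1 poly4)"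
  using homogeneous_add[of d a "- b"] homogeneous_uminus[of d b] by simp

lemma homogeneous_sum: "(\<And>x. x \<in> A \<Longrightarrow> homogeneous d (h x)) \<Longrightarrow> homogeneous d (sum h A)"
  by (induction A rule: infinite_finite_induct) (auto intro: homogeneous_add)

lemma homogeneous_mult:
  fixes a b :: "'k::comm_ring_1 poly4"
  shows "homogeneous d a \<Longrightarrow> homogeneous e b \<Longrightarrow> homogeneous (d + e) (a * b)"
  using keys_mult[of a b] by (fastforce simp: homogeneous_def)

lemma homogeneous_power:
  fixes a :: "'k::comm_ring_1 poly4"
  shows "homogeneous d a \<Longrightarrow> homogeneous (n * d) (a ^ n)"
  by (induction n) (auto intro: homogeneous_mult)

lemma homogeneous_prod:
  fixes h :: "'i \<Rightarrow> 'k::comm_ring_1 poly4"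
  shows "(\<And>i. i \<in> A \<Longrightarrow> homogeneous (d i) (h i)) \<Longrightarrow> homogeneous (sum d A) (prod h A)"
  by (induction A rule: infinite_finite_induct) (auto intro: homogeneous_mult)

section \<open>Projection onto sets of monomials, homogeneous parts\<close>

definition restrict_keys :: "('m \<Rightarrow> bool) \<Rightarrow> ('m \<Rightarrow>\<^sub>0 'c::zero) \<Rightarrow> 'm \<Rightarrow>\<^sub>0 'c" where
  "restrict_keys Q a = Abs_poly_mapping (\<lambda>m. if Q m then Poly_Mapping.lookup a m else 0)"

lemma lookup_restrict_keys [simp]:
  "Poly_Mapping.lookup (restrict_keys Q a) m = (if Q m then Poly_Mapping.lookup a m else 0)"
proof -
  have "{m. (if Q m then Poly_Mapping.lookup a m else 0) \<noteq> 0} \<subseteq> {m. Poly_Mapping.lookup a m \<noteq> 0}"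
    by (rule Collect_mono) presburger
  then have "finite {m. (if Q m then Poly_Mapping.lookup a m else 0) \<noteq> 0}"
    by (rule finite_subset) (rule finite_lookup)
  then show ?thesis by (simp add: restrict_keys_def)
qed

lemma keys_restrict_keys: "Poly_Mapping.keys (restrict_keys Q a) = {m \<in> Poly_Mapping.keys a. Q m}"
  by (auto simp: in_keys_iff split: if_splits)

lemma restrict_keys_zero [simp]: "restrict_keys Q 0 = 0"
  by (rule poly_mapping_eqI) simp

lemma restrict_keys_add: "restrict_keys Q (a + b) = restrict_keys Q a + restrict_keys Q b"
  by (rule poly_mapping_eqI) (simp add: lookup_add)

lemma restrict_keys_id: "(\<And>m. m \<in> Poly_Mapping.keys a \<Longrightarrow> Q m) \<Longrightarrow> restrict_keys Q a = a"
  by (rule poly_mapping_eqI) (auto simp: not_in_keys_iff_lookup_eq_zero[symmetric])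

lemma restrict_keys_single:
  "restrict_keys Q (Poly_Mapping.single m c) = (if Q m then Poly_Mapping.single m c else 0)"
  by (rule poly_mapping_eqI) (simp add: lookup_single when_def)

text \<open>Multiplication by \<open>a\<close> shifts exponents only by keys of \<open>a\<close>.
  With \<open>Q\<close> and \<open>R\<close> as degree conditions this says that taking homogeneous
  parts is linear over homogeneous factors.\<close>

lemma restrict_keys_mult:
  fixes a b :: "'m::comm_monoid_add \<Rightarrow>\<^sub>0 'c::comm_ring_1"
  assumes "\<And>m n. m \<in> Poly_Mapping.keys a \<Longrightarrow> Q (m + n) \<longleftrightarrow> R n"
  shows "restrict_keys Q (a * b) = a * restrict_keys R b"
proof (induction b rule: poly_mapping_induct)
  case (single n c)
  \<comment> \<open>The hypothesis concerns the keys of \<open>a\<close> alone, which structural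
    induction on \<open>a\<close> would lose; the induction is over partial sums of the terms of
    \<open>a\<close> instead.\<close>
  have "restrict_keys Q (a' * Poly_Mapping.single n c)
      = a' * restrict_keys R (Poly_Mapping.single n c)"
    if "Poly_Mapping.keys a' \<subseteq> Poly_Mapping.keys a" "a' = sum (\<lambda>m. Poly_Mapping.single m (h m)) A"
      "A \<subseteq> Poly_Mapping.keys a" "finite A" for a' A h
  proof -
    have "restrict_keys Q (sum (\<lambda>m. Poly_Mapping.single m (h m)) A * Poly_Mapping.single n c)
      = sum (\<lambda>m. Poly_Mapping.single m (h m)) A * restrict_keys R (Poly_Mapping.single n c)"
      using \<open>finite A\<close> \<open>A \<subseteq> Poly_Mapping.keys a\<close>
      by (induction A) (simp_all add: distrib_right restrict_keys_add mult_single
        restrict_keys_single assms)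
    then show ?thesis using that by simp
  qed
  from this[OF subset_refl poly_mapping_eq_sum_single[of a] subset_refl finite_keys] show ?case .
qed (simp_all add: restrict_keys_add distrib_left)

definition hpart :: "nat \<Rightarrow> 'k::zero poly4 \<Rightarrow> 'k poly4" where
  "hpart d = restrict_keys (\<lambda>m. mdegree m = d)"

lemma homogeneous_hpart [simp]: "homogeneous d (hpart d a)"
  by (simp add: homogeneous_def hpart_def keys_restrict_keys)

lemma hpart_homogeneous: "homogeneous d a \<Longrightarrow> hpart d a = a"
  unfolding hpart_def by (rule restrict_keys_id) (auto simp: homogeneous_def)

lemma hpart_add: "hpart d (a + b) = hpart d a + hpart d b"
  by (simp add: hpart_def restrict_keys_add)

lemma hpart_zero [simp]: "hpart d 0 = 0"
  by (simp add: hpart_def)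

lemma hpart_mult:
  fixes a b :: "'k::comm_ring_1 poly4"
  assumes "homogeneous d a"
  shows "hpart (d + e) (a * b) = a * hpart e b"
  unfolding hpart_def by (rule restrict_keys_mult) (use assms in \<open>auto simp: homogeneous_def\<close>)

lemma hpart_mult_less:
  fixes a b :: "'k::comm_ring_1 poly4"
  assumes "homogeneous d a" "e < d"
  shows "hpart e (a * b) = 0"
proof -
  have "hpart e (a * b) = a * restrict_keys (\<lambda>_. False) b"
    unfolding hpart_def by (rule restrict_keys_mult) (use assms in \<open>auto simp: homogeneous_def\<close>)
  moreover have "restrict_keys (\<lambda>_. False) b = 0" by (rule poly_mapping_eqI) simp
  ultimately show ?thesis by simp
qed

lemma sum_hpart:
  assumes "\<And>m. m \<in> Poly_Mapping.keys a \<Longrightarrow> mdegree m < N"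
  shows "(\<Sum>d<N. hpart d a) = a"
proof (rule poly_mapping_eqI)
  fix m
  show "Poly_Mapping.lookup (\<Sum>d<N. hpart d a) m = Poly_Mapping.lookup a m"
    using assms[of m] by (auto simp: lookup_sum hpart_def in_keys_iff)
qed

text \<open>Stated for all large \<open>n\<close>, so that the bound can be enlarged to a convenient
  value later.\<close>

lemma ex_sum_hpart: "\<exists>N. \<forall>n\<ge>N. (\<Sum>d<n. hpart d a) = a"
proof -
  obtain N where N: "\<And>m. m \<in> Poly_Mapping.keys a \<Longrightarrow> mdegree m < N"
    using finite_nat_set_iff_bounded[of "mdegree ` Poly_Mapping.keys a"] by auto
  show ?thesis by (rule exI[of _ N]) (auto intro!: sum_hpart dest: N)
qed

section \<open>Variables and their products\<close>

definition variable :: "coord \<Rightarrow> 'k::comm_ring_1 poly4" where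
  "variable i = Poly_Mapping.single (Poly_Mapping.single i 1) 1"

definition xprod :: "coord set \<Rightarrow> 'k::comm_ring_1 poly4" where
  "xprod I = (\<Prod>i\<in>I. variable i)"

lemma homogeneous_variable: "homogeneous 1 (variable i)"
  unfolding variable_def by (rule homogeneous_single) simp

lemma homogeneous_xprod: "homogeneous (card I) (xprod I)"
  using homogeneous_prod[of I "\<lambda>_. 1" variable, OF homogeneous_variable]
  by (simp add: xprod_def)

text \<open>Every monomial of positive degree contains some variable \<open>j\<close>; its quotient
  by \<open>j\<close> is added to the cofactor \<open>b j\<close>. This is what shows that no point
  of Proj can kill all four variables.\<close>

lemma homogeneous_pos_degree_variables:
  fixes a :: "'k::comm_ring_1 poly4"
  assumes "homogeneous (Suc d) a"
  shows "\<exists>b. (\<forall>i. homogeneous d (b i)) \<and> a = (\<Sum>i\<in>UNIV. variable i * b i)"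
  using assms
proof -
  have "\<exists>b. (\<forall>i. homogeneous d (b i)) \<and> a' = (\<Sum>i\<in>UNIV. variable i * b i)"
    if "finite A" "\<forall>m\<in>A. mdegree m = Suc d" "a' = (\<Sum>m\<in>A. Poly_Mapping.single m (h m))"
    for A h and a' :: "'k poly4"
    using that
  proof (induction A arbitrary: a')
    case empty
    show ?case by (rule exI[of _ "\<lambda>_. 0"]) (use empty in simp)
  next
    case (insert m A)
    from insert.IH[OF _ refl] insert.prems obtain b where b: "\<forall>i. homogeneous d (b i)"
        "(\<Sum>m\<in>A. Poly_Mapping.single m (h m)) = (\<Sum>i\<in>UNIV. variable i * b i)"
      by auto
    have "mdegree m \<noteq> 0" using insert.prems by simp
    then obtain j where j: "Poly_Mapping.lookup m j > 0"
      by (auto simp: mdegree_eq_sum)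
    have m: "m = Poly_Mapping.single j 1 + (m - Poly_Mapping.single j 1)"
      using j by (intro poly_mapping_eqI) (auto simp: lookup_add lookup_minus lookup_single when_def)
    then have deg: "mdegree (m - Poly_Mapping.single j 1) = d"
      using insert.prems(1) mdegree_add[of "Poly_Mapping.single j 1" "m - Poly_Mapping.single j 1"]
      by simp
    define q where "q = Poly_Mapping.single (m - Poly_Mapping.single j 1) (h m)"
    have q: "homogeneous d q" "Poly_Mapping.single m (h m) = variable j * q"
      using deg m by (simp_all add: q_def homogeneous_single variable_def mult_single)
    have "a' = (\<Sum>i\<in>UNIV. variable i * (if i = j then b i + q else b i))"
    proof -
      have "(\<Sum>i\<in>UNIV. variable i * (if i = j then b i + q else b i))
          = (\<Sum>i\<in>UNIV. variable i * b i + (if i = j then variable i * q else 0))"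
        by (rule sum.cong) (auto simp: distrib_left)
      also have "\<dots> = (\<Sum>i\<in>UNIV. variable i * b i) + variable j * q"
        by (simp add: sum.distrib)
      finally show ?thesis using insert b q by (simp add: add.commute)
    qed
    moreover have "\<forall>i. homogeneous d (if i = j then b i + q else b i)"
      using b q by (simp add: homogeneous_add)
    ultimately show ?case by (intro exI[of _ "\<lambda>i. if i = j then b i + q else b i"] conjI)
  qed
  from this[of "Poly_Mapping.keys a" a "Poly_Mapping.lookup a"] assms show ?thesis
    by (auto simp: homogeneous_def poly_mapping_eq_sum_single[symmetric])
qed

section \<open>Laurent polynomials\<close>

type_synonym 'k laurent4 = "(coord \<Rightarrow>\<^sub>0 int) \<Rightarrow>\<^sub>0 'k"

definition int_exponent :: "monom4 \<Rightarrow> (coord \<Rightarrow>\<^sub>0 int)" where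
  "int_exponent m = Poly_Mapping.map int m"

lemma lookup_int_exponent [simp]:
  "Poly_Mapping.lookup (int_exponent m) i = int (Poly_Mapping.lookup m i)"
  by (simp add: int_exponent_def Poly_Mapping.map.rep_eq when_def)

lemma int_exponent_add: "int_exponent (m + n) = int_exponent m + int_exponent n"
  by (rule poly_mapping_eqI) (simp add: lookup_add)

lemma int_exponent_zero [simp]: "int_exponent 0 = 0"
  by (rule poly_mapping_eqI) simp

lemma int_exponent_inject [simp]: "int_exponent m = int_exponent n \<longleftrightarrow> m = n"
proof
  assume eq: "int_exponent m = int_exponent n"
  show "m = n"
    by (rule poly_mapping_eqI) (metis eq lookup_int_exponent of_nat_eq_iff)
qed simp

interpretation laurent: monom_hom
  "\<lambda>m c. Poly_Mapping.single (int_exponent m) (c :: 'k::comm_ring_1)"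
  by standard (simp_all add: single_add mult_single int_exponent_add)

definition laurent :: "'k::comm_ring_1 poly4 \<Rightarrow> 'k laurent4" where
  "laurent = extend_monom (\<lambda>m c. Poly_Mapping.single (int_exponent m) c)"

lemma laurent_zero [simp]: "laurent 0 = 0"
  and laurent_one [simp]: "laurent 1 = 1"
  and laurent_add: "laurent (a + b) = laurent a + laurent b"
  and laurent_mult: "laurent (a * b) = laurent a * laurent b"
  and laurent_single: "laurent (Poly_Mapping.single m c) = Poly_Mapping.single (int_exponent m) c"
  by (simp_all add: laurent_def laurent.extend_monom_zero laurent.extend_monom_one
    laurent.extend_monom_add laurent.extend_monom_mult laurent.extend_monom_single)

lemma laurent_power: "laurent (a ^ n) = laurent a ^ n"
  by (induction n) (simp_all add: laurent_mult)

lemma laurent_uminus: "laurent (- a) = - laurent a"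
  using laurent_add[of a "- a"] by (simp add: eq_neg_iff_add_eq_0 add.commute)

lemma lookup_laurent [simp]:
  "Poly_Mapping.lookup (laurent a) (int_exponent m) = Poly_Mapping.lookup a m"
  by (induction a rule: poly_mapping_induct)
     (simp_all add: laurent_single laurent_add lookup_add lookup_single when_def)

lemma keys_laurent: "Poly_Mapping.keys (laurent a) = int_exponent ` Poly_Mapping.keys a"
proof
  show "int_exponent ` Poly_Mapping.keys a \<subseteq> Poly_Mapping.keys (laurent a)"
    by (auto simp: in_keys_iff)
  have "\<forall>e\<in>Poly_Mapping.keys (laurent a). e \<in> range int_exponent"
  proof (induction a rule: poly_mapping_induct)
    case (add a b)
    then show ?case using keys_add[of "laurent a" "laurent b"] by (auto simp: laurent_add)
  qed (auto simp: laurent_single)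
  then show "Poly_Mapping.keys (laurent a) \<subseteq> int_exponent ` Poly_Mapping.keys a"
    by (auto simp: in_keys_iff)
qed

lemma laurent_inject [simp]: "laurent a = laurent b \<longleftrightarrow> a = b"
proof
  assume eq: "laurent a = laurent b"
  show "a = b"
    by (rule poly_mapping_eqI) (metis eq lookup_laurent)
qed simp

lemma ex_laurent:
  assumes "\<And>m i. m \<in> Poly_Mapping.keys l \<Longrightarrow> 0 \<le> Poly_Mapping.lookup m i"
  shows "\<exists>a. l = laurent a"
proof -
  define e :: "(coord \<Rightarrow>\<^sub>0 int) \<Rightarrow> monom4" where "e = (\<lambda>m. Poly_Mapping.map nat m)"
  have e: "int_exponent (e m) = m" if "m \<in> Poly_Mapping.keys l" for m
    by (rule poly_mapping_eqI) (use assms[OF that] in \<open>simp add: e_def Poly_Mapping.map.rep_eq when_def\<close>)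
  have "laurent (\<Sum>m\<in>A. Poly_Mapping.single (e m) (Poly_Mapping.lookup l m))
      = (\<Sum>m\<in>A. Poly_Mapping.single m (Poly_Mapping.lookup l m))"
    if "finite A" "A \<subseteq> Poly_Mapping.keys l" for A
    using that by induction (simp_all add: laurent_add laurent_single e)
  from this[OF finite_keys subset_refl] show ?thesis
    by (metis poly_mapping_eq_sum_single)
qed

definition ldegree :: "(coord \<Rightarrow>\<^sub>0 int) \<Rightarrow> int" where
  "ldegree m = (\<Sum>i\<in>UNIV. Poly_Mapping.lookup m i)"

lemma ldegree_add [simp]: "ldegree (m + n) = ldegree m + ldegree n"
  by (simp add: ldegree_def lookup_add sum.distrib)

lemma ldegree_int_exponent [simp]: "ldegree (int_exponent m) = int (mdegree m)"
  by (simp add: ldegree_def mdegree_eq_sum)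

text \<open>The homogeneous elements of degree \<open>d\<close> of the localization of \<open>K[x,y,z,w]\<close> at the product of
  the coordinates in \<open>I\<close>.\<close>

definition localized :: "coord set \<Rightarrow> int \<Rightarrow> 'k::zero laurent4 set" where
  "localized I d = {l. \<forall>m\<in>Poly_Mapping.keys l. ldegree m = d \<and> (\<forall>i. Poly_Mapping.lookup m i < 0 \<longrightarrow> i \<in> I)}"

lemma localized_zero [simp]: "0 \<in> localized I d"
  by (simp add: localized_def)

lemma localized_add: "a \<in> localized I d \<Longrightarrow> b \<in> localized I d \<Longrightarrow> a + b \<in> localized I d"
  using keys_add[of a b] by (auto simp: localized_def)

lemma localized_uminus: "a \<in> localized I d \<Longrightarrow> - (a :: 'k::comm_ring_1 laurent4) \<in> localized I d"
  by (auto simp: localized_def in_keys_iff)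

lemma localized_diff:
  "a \<in> localized I d \<Longrightarrow> b \<in> localized I d \<Longrightarrow> a - (b :: 'k::comm_ring_1 laurent4) \<in> localized I d"
  using localized_add[of a I d "- b"] localized_uminus[of b] by simp

lemma localized_mult:
  fixes a b :: "'k::comm_ring_1 laurent4"
  assumes "a \<in> localized I d" "b \<in> localized I e"
  shows "a * b \<in> localized I (d + e)"
proof -
  have "ldegree m = d + e \<and> (\<forall>i. Poly_Mapping.lookup m i < 0 \<longrightarrow> i \<in> I)"
    if m: "m \<in> Poly_Mapping.keys (a * b)" for m
  proof -
    obtain u v where uv: "u \<in> Poly_Mapping.keys a" "v \<in> Poly_Mapping.keys b" "m = u + v"
      using subsetD[OF keys_mult m] by blast
    have "i \<in> I" if "Poly_Mapping.lookup m i < 0" for i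
    proof -
      have "Poly_Mapping.lookup u i < 0 \<or> Poly_Mapping.lookup v i < 0"
        using that uv(3) by (auto simp: lookup_add)
      then show ?thesis using assms uv by (auto simp: localized_def)
    qed
    then show ?thesis using assms uv by (auto simp: localized_def)
  qed
  then show ?thesis by (simp add: localized_def)
qed

lemma localized_mono: "a \<in> localized I d \<Longrightarrow> I \<subseteq> J \<Longrightarrow> a \<in> localized J d"
  by (auto simp: localized_def)

lemma localized_laurent: "homogeneous d a \<Longrightarrow> laurent a \<in> localized I (int d)"
  by (auto simp: localized_def homogeneous_def keys_laurent)

lemma localized_one [simp]: "(1 :: 'k::comm_ring_1 laurent4) \<in> localized I 0"
  using localized_laurent[of 0 1 I] by simp

lemma localized_power:
  fixes a :: "'k::comm_ring_1 laurent4"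
  shows "a \<in> localized I d \<Longrightarrow> a ^ n \<in> localized I (int n * d)"
proof (induction n)
  case (Suc n)
  then show ?case using localized_mult[of a I d "a ^ n" "int n * d"] by (simp add: algebra_simps)
qed simp

lemma localized_single:
  "ldegree m = d \<Longrightarrow> (\<And>i. Poly_Mapping.lookup m i < 0 \<Longrightarrow> i \<in> I) \<Longrightarrow> Poly_Mapping.single m c \<in> localized I d"
  by (auto simp: localized_def)

text \<open>The sign of \<open>n\<close> is free: a negative \<open>n\<close> gives the inverse of a
  power of \<open>xprod I\<close> as a Laurent monomial.\<close>

definition xprod_exponent :: "coord set \<Rightarrow> int \<Rightarrow> (coord \<Rightarrow>\<^sub>0 int)" where
  "xprod_exponent I n = (\<Sum>i\<in>I. Poly_Mapping.single i n)"

lemma lookup_xprod_exponent [simp]: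
  "Poly_Mapping.lookup (xprod_exponent I n) i = (if i \<in> I then n else 0)"
  by (simp add: xprod_exponent_def lookup_sum lookup_single when_def)

lemma xprod_exponent_add: "xprod_exponent I (m + n) = xprod_exponent I m + xprod_exponent I n"
  by (rule poly_mapping_eqI) (simp add: lookup_add)

lemma ldegree_xprod_exponent [simp]: "ldegree (xprod_exponent I n) = int (card I) * n"
proof -
  have "(\<Sum>i\<in>UNIV. if i \<in> I then n else 0) = (\<Sum>i\<in>I. n)"
    by (simp add: sum.If_cases)
  then show ?thesis by (simp add: ldegree_def)
qed

lemma laurent_xprod: "laurent (xprod I) = Poly_Mapping.single (xprod_exponent I 1) 1"
proof -
  have *: "int_exponent (Poly_Mapping.single i 1) = Poly_Mapping.single i 1" for i
    by (rule poly_mapping_eqI) (simp add: lookup_single when_def)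
  have "laurent (prod variable J) = Poly_Mapping.single (\<Sum>i\<in>J. Poly_Mapping.single i 1) 1" for J
  proof (induction J rule: infinite_finite_induct)
    case (insert j J)
    then show ?case
      using * by (simp add: laurent_mult variable_def laurent_single mult_single)
  qed simp_all
  then show ?thesis by (simp add: xprod_def xprod_exponent_def)
qed

lemma laurent_xprod_power: "laurent (xprod I ^ n) = Poly_Mapping.single (xprod_exponent I (int n)) 1"
proof (induction n)
  case 0
  have "xprod_exponent I 0 = 0" by (rule poly_mapping_eqI) simp
  then show ?case by simp
next
  case (Suc n)
  then show ?case
    using xprod_exponent_add[of I 1 "int n"] by (simp add: laurent_mult laurent_xprod mult_single)
qed

lemma xprod_power_unit:
  "laurent (xprod I ^ n) * Poly_Mapping.single (xprod_exponent I (- int n)) 1 = 1"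
proof -
  have "xprod_exponent I (int n) + xprod_exponent I (- int n) = 0"
    by (rule poly_mapping_eqI) (simp only: lookup_add lookup_xprod_exponent lookup_zero, simp)
  then show ?thesis by (simp only: laurent_xprod_power mult_single mult_1_left single_one)
qed

text \<open>Only the coordinates in \<open>I\<close> carry negative exponents, and finitely many of
  them; a power of \<open>xprod I\<close> beyond the largest one clears all denominators. It holds
  for all larger powers too, so several elements share one power.\<close>

lemma localized_eventually_polynomial:
  fixes l :: "'k::comm_ring_1 laurent4"
  assumes "l \<in> localized I d"
  shows "\<exists>N. \<forall>n\<ge>N. \<exists>a. l * laurent (xprod I ^ n) = laurent a"
proof -
  define B where "B = (\<lambda>(m, i). nat (- Poly_Mapping.lookup m i)) ` (Poly_Mapping.keys l \<times> UNIV)"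
  have "finite B" by (simp add: B_def)
  then obtain N where N: "\<forall>b\<in>B. b \<le> N"
    by (auto simp only: finite_nat_set_iff_bounded_le)
  have "\<exists>a. l * laurent (xprod I ^ n) = laurent a" if "n \<ge> N" for n
  proof (rule ex_laurent)
    fix m i assume "m \<in> Poly_Mapping.keys (l * laurent (xprod I ^ n))"
    then obtain u v where u: "u \<in> Poly_Mapping.keys l" "m = u + v"
      and v: "v \<in> Poly_Mapping.keys (laurent (xprod I ^ n) :: 'k laurent4)"
      using keys_mult[of l "laurent (xprod I ^ n)"] by blast
    from v have v: "v = xprod_exponent I (int n)"
      by (simp add: laurent_xprod_power split: if_splits)
    have "nat (- Poly_Mapping.lookup u i) \<le> N"
      using u by (intro N[rule_format]) (force simp: B_def)
    moreover have "Poly_Mapping.lookup u i < 0 \<longrightarrow> i \<in> I"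
      using assms u by (auto simp: localized_def)
    moreover have "Poly_Mapping.lookup m i = Poly_Mapping.lookup u i + (if i \<in> I then int n else 0)"
      unfolding u(2) v lookup_add lookup_xprod_exponent ..
    ultimately show "0 \<le> Poly_Mapping.lookup m i" using \<open>n \<ge> N\<close>
      by (cases "i \<in> I") simp_all
  qed
  then show ?thesis by blast
qed

lemma localized_polynomial_degree:
  assumes "l \<in> localized I d" "l * laurent (xprod I ^ n) = laurent a" "d + int (n * card I) = int e"
  shows "homogeneous e a"
proof -
  have "laurent a \<in> localized I (int e)"
    using localized_mult[OF assms(1) localized_laurent[OF homogeneous_power[OF homogeneous_xprod]]]
      assms(2,3) by metis
  then show ?thesis by (auto simp: localized_def homogeneous_def keys_laurent)
qed

lemma localized_fraction:
  assumes "l \<in> localized I 0"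
  shows "\<exists>N. \<forall>n\<ge>N. \<exists>a. homogeneous (n * card I) a \<and> l * laurent (xprod I ^ n) = laurent a"
  using localized_eventually_polynomial[OF assms] localized_polynomial_degree[OF assms]
  by (metis add_0)

text \<open>Exactness of the Koszul complex in the middle, over a localization and with degrees.
  After clearing denominators, Euclid's lemma gives the quotient as a polynomial; dividing by the
  power of \<open>xprod I\<close> returns it to the localization, and a projection corrects its
  degree.\<close>

lemma laurent_coprime:
  fixes f g :: "'k::field poly4"
  assumes cop: "\<forall>h. h dvd f \<longrightarrow> h dvd g \<longrightarrow> h dvd 1" and f0: "f \<noteq> 0"
    and fg: "homogeneous df f"
    and a: "a \<in> localized I da" and b: "b \<in> localized I db"
    and eq: "laurent f * a = laurent g * b"
  shows "\<exists>t\<in>localized I (db - int df). b = laurent f * t \<and> a = laurent g * t"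
proof -
  obtain N1 N2 where N: "\<forall>n\<ge>N1. \<exists>a'. a * laurent (xprod I ^ n) = laurent a'"
    "\<forall>n\<ge>N2. \<exists>b'. b * laurent (xprod I ^ n) = laurent b'"
    using localized_eventually_polynomial[OF a] localized_eventually_polynomial[OF b] by blast
  define n where "n = max N1 N2"
  obtain a' b' where a': "a * laurent (xprod I ^ n) = laurent a'"
    and b': "b * laurent (xprod I ^ n) = laurent b'"
    using N[rule_format, of n] by (auto simp: n_def)
  define q :: "'k laurent4" where "q = Poly_Mapping.single (xprod_exponent I (- int n)) 1"
  have q: "laurent (xprod I ^ n) * q = 1" by (simp add: q_def xprod_power_unit)
  have "laurent (f * a') = laurent (g * b')"
    using arg_cong[OF eq, of "\<lambda>l. l * laurent (xprod I ^ n)"]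
    unfolding laurent_mult mult.assoc a' b' .
  then have fgb: "f * a' = g * b'" by (simp only: laurent_inject)
  then have "f dvd g * b'" by (rule dvdI[OF sym])
  from poly4_coprime_dvd_mult[OF cop f0 this] obtain t' where t': "b' = f * t'" by (rule dvdE)
  then have at': "a' = g * t'" using fgb f0 by (simp add: mult.left_commute[of g])
  define t0 where "t0 = laurent t' * q"
  have bt0: "b = laurent f * t0" and at0: "a = laurent g * t0"
    using arg_cong[OF b', of "\<lambda>l. l * q"] arg_cong[OF a', of "\<lambda>l. l * q"]
    unfolding t0_def mult.assoc q t' at' laurent_mult by (simp_all only: mult_1_right)
  \<comment> \<open>A negative exponent of \<open>t0\<close> can come only from \<open>q\<close>,
    whose coordinates lie in \<open>I\<close>, because \<open>t'\<close> is a polynomial.\<close>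
  have t0I: "i \<in> I" if m: "m \<in> Poly_Mapping.keys t0" and mi: "Poly_Mapping.lookup m i < 0" for m i
  proof (rule ccontr)
    assume i: "i \<notin> I"
    obtain u v where uv: "u \<in> Poly_Mapping.keys (laurent t')" "v \<in> Poly_Mapping.keys q" "m = u + v"
      using subsetD[OF keys_mult m[unfolded t0_def]] by blast
    obtain w where w: "u = int_exponent w" using uv(1) unfolding keys_laurent by blast
    have v: "v = xprod_exponent I (- int n)" using uv(2) by (simp add: q_def)
    show False using mi i unfolding uv(3) lookup_add w v by simp
  qed
  \<comment> \<open>Nothing is known yet about the degrees in \<open>t0\<close>. As \<open>f\<close>
    is homogeneous, the part of degree \<open>db - int df\<close> alone already produces
    \<open>b\<close>; cancelling \<open>f\<close> shows that \<open>t0\<close> has no other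
    part.\<close>
  define P :: "int \<Rightarrow> 'k laurent4 \<Rightarrow> 'k laurent4"
    where "P e = restrict_keys (\<lambda>m. ldegree m = e)" for e
  have P: "P (int df + e) (laurent f * l) = laurent f * P e l" for e l
    unfolding P_def
  proof (rule restrict_keys_mult)
    fix m n assume "m \<in> Poly_Mapping.keys (laurent f)"
    then have "ldegree m = int df" using fg by (auto simp: keys_laurent homogeneous_def)
    then show "ldegree (m + n) = int df + e \<longleftrightarrow> ldegree n = e" by simp
  qed
  have "P db b = b"
    unfolding P_def by (rule restrict_keys_id) (use b in \<open>auto simp: localized_def\<close>)
  moreover have "P db b = laurent f * P (db - int df) t0"
  proof -
    have "int df + (db - int df) = db" by simp
    then show ?thesis using P[of "db - int df" t0] unfolding bt0[symmetric] by (simp only:)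
  qed
  ultimately have "b = laurent f * P (db - int df) t0" by (rule trans[OF sym])
  moreover have "laurent f \<noteq> 0" using f0 laurent_inject[of f 0] unfolding laurent_zero by (simp only: not_False_eq_True)
  ultimately have "t0 = P (db - int df) t0"
    unfolding bt0 by (simp only: mult_left_cancel[OF \<open>laurent f \<noteq> 0\<close>])
  moreover have "P (db - int df) t0 \<in> localized I (db - int df)"
    using t0I by (auto simp: P_def localized_def keys_restrict_keys)
  ultimately have "t0 \<in> localized I (db - int df)" by (simp only:)
  with bt0 at0 show ?thesis by blast
qed

section \<open>Cochains of the standard covering\<close>

text \<open>Full cochains, on all lists of coordinates; repeated indices are allowed and no sign rule is
  imposed.\<close>

fun coboundary :: "('i list \<Rightarrow> 'r::ab_group_add) \<Rightarrow> 'i list \<Rightarrow> 'r" where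
  "coboundary c [] = 0"
| "coboundary c (i # I) = c I - coboundary (\<lambda>J. c (i # J)) I"

lemma coboundary_hom:
  assumes "\<And>a b. \<phi> (a - b) = \<phi> a - \<phi> b" "\<phi> 0 = 0"
  shows "coboundary (\<lambda>I. \<phi> (c I)) I = \<phi> (coboundary c I)"
  by (induction I arbitrary: c) (simp_all add: assms)

lemma coboundary_add: "coboundary (\<lambda>I. c I + d I) I = coboundary c I + coboundary d I"
  by (induction I arbitrary: c d) simp_all

lemma coboundary_diff: "coboundary (\<lambda>I. c I - d I) I = coboundary c I - coboundary d I"
  by (induction I arbitrary: c d) simp_all

lemma coboundary_mult: "coboundary (\<lambda>I. r * c I) I = r * coboundary c I"
  for r :: "'r::ring"
  by (rule coboundary_hom) (simp_all add: right_diff_distrib)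

lemma coboundary_lookup:
  "Poly_Mapping.lookup (coboundary c I) m = coboundary (\<lambda>I. Poly_Mapping.lookup (c I) m) I"
  by (rule coboundary_hom[symmetric]) (simp_all add: lookup_minus)

lemma coboundary_cong:
  "(\<And>J. length I = Suc (length J) \<Longrightarrow> c J = d J) \<Longrightarrow> coboundary c I = coboundary d I"
proof (induction I arbitrary: c d)
  case (Cons i I)
  have "coboundary (\<lambda>J. c (i # J)) I = coboundary (\<lambda>J. d (i # J)) I"
    by (rule Cons.IH) (simp add: Cons.prems)
  moreover have "c I = d I" by (rule Cons.prems) simp
  ultimately show ?case by simp
qed simp

text \<open>By the recursion, the double coboundary at \<open>i # I\<close> is the coboundary at
  \<open>I\<close> minus itself, plus the double coboundary of \<open>c\<close> with
  \<open>i\<close> prepended.\<close>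

lemma coboundary_coboundary: "coboundary (coboundary c) I = 0"
proof (induction I arbitrary: c)
  case (Cons i I)
  have "coboundary (coboundary c) (i # I)
      = coboundary c I - (coboundary c I - coboundary (coboundary (\<lambda>J. c (i # J))) I)"
    by (simp add: coboundary_diff)
  then show ?case by (simp add: Cons.IH)
qed simp

text \<open>Indexed by the length of the lists, one more than the usual Cech degree: length 2 means
  1-cochains, length 4 means 3-cochains. Values on lists of other lengths are arbitrary.\<close>

definition cochains :: "nat \<Rightarrow> int \<Rightarrow> (coord list \<Rightarrow> 'k::zero laurent4) set" where
  "cochains n d = {c. \<forall>I. length I = n \<longrightarrow> c I \<in> localized (set I) d}"

lemma cochainsD: "c \<in> cochains n d \<Longrightarrow> length I = n \<Longrightarrow> c I \<in> localized (set I) d"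
  by (simp add: cochains_def)

lemma coboundary_localized:
  fixes c :: "coord list \<Rightarrow> 'k::comm_ring_1 laurent4"
  assumes "\<And>J. length I = Suc (length J) \<Longrightarrow> set J \<subseteq> set I \<Longrightarrow> c J \<in> localized S d"
  shows "coboundary c I \<in> localized S d"
  using assms
proof (induction I arbitrary: c)
  case (Cons i I)
  have "c I \<in> localized S d" by (rule Cons.prems) auto
  moreover have "coboundary (\<lambda>J. c (i # J)) I \<in> localized S d"
    by (rule Cons.IH, rule Cons.prems) auto
  ultimately show ?case by (simp add: localized_diff)
qed simp

lemma coboundary_cochains:
  fixes c :: "coord list \<Rightarrow> 'k::comm_ring_1 laurent4"
  assumes "c \<in> cochains n d"
  shows "coboundary c \<in> cochains (Suc n) d"
  unfolding cochains_def
proof (intro CollectI allI impI)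
  fix I :: "coord list" assume "length I = Suc n"
  then show "coboundary c I \<in> localized (set I) d"
    by (intro coboundary_localized)
       (use assms in \<open>auto intro: localized_mono[OF cochainsD]\<close>)
qed

lemma cochains_diff:
  fixes c e :: "coord list \<Rightarrow> 'k::comm_ring_1 laurent4"
  shows "c \<in> cochains n d \<Longrightarrow> e \<in> cochains n d \<Longrightarrow> (\<lambda>I. c I - e I) \<in> cochains n d"
  by (simp add: cochains_def localized_diff)

lemma cochains_add:
  "c \<in> cochains n d \<Longrightarrow> e \<in> cochains n d \<Longrightarrow> (\<lambda>I. c I + e I) \<in> cochains n d"
  by (simp add: cochains_def localized_add)

lemma cochains_mult:
  fixes c :: "coord list \<Rightarrow> 'k::comm_ring_1 laurent4"
  shows "r \<in> localized {} k \<Longrightarrow> c \<in> cochains n d \<Longrightarrow> (\<lambda>I. r * c I) \<in> cochains n (k + d)"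
  by (auto simp: cochains_def intro!: localized_mult intro: localized_mono)

lemma cochains_power:
  fixes c :: "coord list \<Rightarrow> 'k::comm_ring_1 laurent4"
  shows "c \<in> cochains n d \<Longrightarrow> (\<lambda>I. c I ^ k) \<in> cochains n (int k * d)"
  by (simp add: cochains_def localized_power)

definition all_negative :: "(coord \<Rightarrow>\<^sub>0 int) \<Rightarrow> bool" where
  "all_negative m \<longleftrightarrow> (\<forall>i. Poly_Mapping.lookup m i < 0)"

text \<open>On the monomials \<open>m\<close> with a nonnegative exponent at the coordinate \<open>i\<close>, prepending \<open>i\<close> to
  the index list is a contracting homotopy.\<close>

lemma cochain_exact:
  fixes c :: "coord list \<Rightarrow> 'k::comm_ring_1 laurent4"
  assumes c: "c \<in> cochains (Suc n) d"
    and closed: "\<And>I. length I = Suc (Suc n) \<Longrightarrow> coboundary c I = 0"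
    and some_nonneg: "\<And>I m. length I = Suc n \<Longrightarrow> all_negative m \<Longrightarrow> Poly_Mapping.lookup (c I) m = 0"
  obtains b where "b \<in> cochains n d" "\<And>I. length I = Suc n \<Longrightarrow> c I = coboundary b I"
proof -
  \<comment> \<open>The coordinate depends on the monomial only and not on the list, so that the
    homotopy, built monomial by monomial, is compatible with the coboundary.\<close>
  define q where "q m = (SOME i. Poly_Mapping.lookup m i \<ge> 0)" for m :: "coord \<Rightarrow>\<^sub>0 int"
  have q: "Poly_Mapping.lookup m (q m) \<ge> 0" if "\<not> all_negative m" for m
    unfolding q_def by (rule someI_ex) (use that in \<open>auto simp: all_negative_def not_less\<close>)
  define b where "b I = (\<Sum>i\<in>UNIV. restrict_keys (\<lambda>m. q m = i \<and> \<not> all_negative m) (c (i # I)))" for I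
  have lookup_b: "Poly_Mapping.lookup (b I) m
      = (if all_negative m then 0 else Poly_Mapping.lookup (c (q m # I)) m)" for I m
    by (simp add: b_def lookup_sum)
  have "b \<in> cochains n d"
  proof -
    have "ldegree m = d \<and> (\<forall>i. Poly_Mapping.lookup m i < 0 \<longrightarrow> i \<in> set I)"
      if "length I = n" "m \<in> Poly_Mapping.keys (b I)" for I m
    proof -
      have m: "\<not> all_negative m" "m \<in> Poly_Mapping.keys (c (q m # I))"
        using that by (auto simp: in_keys_iff lookup_b split: if_splits)
      then have "ldegree m = d \<and> (\<forall>i. Poly_Mapping.lookup m i < 0 \<longrightarrow> i \<in> set (q m # I))"
        using cochainsD[OF c, of "q m # I"] that by (simp add: localized_def)
      with q[OF m(1)] show ?thesis by fastforce
    qed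
    then show ?thesis by (simp add: cochains_def localized_def)
  qed
  moreover have "c I = coboundary b I" if I: "length I = Suc n" for I
  proof (rule poly_mapping_eqI)
    fix m
    show "Poly_Mapping.lookup (c I) m = Poly_Mapping.lookup (coboundary b I) m"
    proof (cases "all_negative m")
      case True
      then have "coboundary (\<lambda>J. Poly_Mapping.lookup (b J) m) I = coboundary (\<lambda>J. (0::'k)) I"
        by (intro coboundary_cong) (simp add: lookup_b)
      also have "\<dots> = 0" by (rule coboundary_hom[of "\<lambda>_. 0" "\<lambda>_. (0::'k)", simplified])
      finally show ?thesis using True some_nonneg[OF I True] by (simp add: coboundary_lookup)
    next
      case False
      \<comment> \<open>Closedness is used on the longer list beginning with \<open>q m\<close>; its
        first term is \<open>c I\<close> and the rest is the coboundary of \<open>b\<close>.\<close>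
      have "0 = Poly_Mapping.lookup (coboundary c (q m # I)) m"
        using closed[of "q m # I"] I by simp
      also have "\<dots> = Poly_Mapping.lookup (c I) m
          - coboundary (\<lambda>J. Poly_Mapping.lookup (c (q m # J)) m) I"
        by (simp add: lookup_minus coboundary_lookup)
      also have "coboundary (\<lambda>J. Poly_Mapping.lookup (c (q m # J)) m) I
          = coboundary (\<lambda>J. Poly_Mapping.lookup (b J) m) I"
        using False by (intro coboundary_cong) (simp add: lookup_b)
      finally show ?thesis by (simp add: coboundary_lookup)
    qed
  qed
  ultimately show ?thesis by (rule that)
qed

text \<open>Four negative exponents require all four coordinates as denominators and a degree of at
  most -4; each alternative of the hypothesis excludes one of these.\<close>

lemma localized_not_all_negative:
  assumes "l \<in> localized I d" "I \<noteq> UNIV \<or> d > -4" "all_negative m"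
  shows "Poly_Mapping.lookup l m = 0"
proof (rule ccontr)
  assume "Poly_Mapping.lookup l m \<noteq> 0"
  then have "ldegree m = d" "\<And>i. i \<in> I"
    using assms by (auto simp: localized_def in_keys_iff all_negative_def)
  moreover have "ldegree m \<le> -4"
  proof -
    have "Poly_Mapping.lookup m i < 0" for i using assms(3) by (simp add: all_negative_def)
    then have "Poly_Mapping.lookup m i \<le> -1" for i using zless_imp_add1_zle[of "Poly_Mapping.lookup m i" 0] by simp
    from this[of Coord_x] this[of Coord_y] this[of Coord_z] this[of Coord_w]
    show ?thesis by (simp add: ldegree_def UNIV_coord)
  qed
  ultimately show False using assms(2) by auto
qed

lemma set_length_less_4: "length I < 4 \<Longrightarrow> set I \<noteq> (UNIV :: coord set)"
proof
  assume I: "length I < 4" "set I = (UNIV :: coord set)"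
  have "card (UNIV :: coord set) = 4" by (simp add: UNIV_coord)
  then show False using card_length[of I] I by simp
qed

text \<open>The vanishing of the intermediate cohomology of O(d) on P^3, and of the third cohomology
  for d > -4. For lists of length 1 it says that sections agreeing on overlaps come from a global
  one.\<close>

lemma cochain_exact_low:
  fixes c :: "coord list \<Rightarrow> 'k::comm_ring_1 laurent4"
  assumes c: "c \<in> cochains (Suc n) d" and n: "Suc n < 4 \<or> d > -4"
    and closed: "\<And>I. length I = Suc (Suc n) \<Longrightarrow> coboundary c I = 0"
  obtains b where "b \<in> cochains n d" "\<And>I. length I = Suc n \<Longrightarrow> c I = coboundary b I"
proof (rule cochain_exact[OF c closed])
  fix I :: "coord list" and m assume I: "length I = Suc n" "all_negative m"
  show "Poly_Mapping.lookup (c I) m = 0"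
    by (rule localized_not_all_negative[OF cochainsD[OF c I(1)] _ I(2)])
       (use n set_length_less_4[of I] I in auto)
qed (auto intro: that)

section \<open>The p-th power map on monoid algebras in characteristic p\<close>

lemma CHAR_poly_mapping:
  "CHAR('m::comm_monoid_add \<Rightarrow>\<^sub>0 'k::comm_ring_1) = CHAR('k)"
proof (rule CHAR_eqI)
  have "(of_nat n :: 'm \<Rightarrow>\<^sub>0 'k) = 0 \<longleftrightarrow> (of_nat n :: 'k) = 0" for n
  proof -
    have "(of_nat n :: 'm \<Rightarrow>\<^sub>0 'k) = Poly_Mapping.single 0 (of_nat n)" by simp
    also have "\<dots> = 0 \<longleftrightarrow> (of_nat n :: 'k) = 0"
      by (metis lookup_single_eq lookup_zero single_zero)
    finally show ?thesis .
  qed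
  then show "of_nat CHAR('k) = (0 :: 'm \<Rightarrow>\<^sub>0 'k)"
    and "of_nat n = (0 :: 'm \<Rightarrow>\<^sub>0 'k) \<Longrightarrow> CHAR('k) dvd n" for n
    by (simp_all add: of_nat_eq_0_iff_char_dvd del: of_nat_CHAR)
qed

lemma CHAR_prime:
  assumes "CHAR('k::field) = p" "p > 0"
  shows "prime p"
  using prime_CHAR_semidom[where ?'a = 'k] assms by simp

lemma poly_mapping_frobenius_add:
  fixes a b :: "'m::comm_monoid_add \<Rightarrow>\<^sub>0 'k::field"
  assumes "CHAR('k) = p" "p > 0"
  shows "(a + b) ^ p = a ^ p + b ^ p"
proof -
  have "prime CHAR('m \<Rightarrow>\<^sub>0 'k)"
    using CHAR_prime[OF assms] assms by (simp add: CHAR_poly_mapping)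
  from freshmans_dream[OF this, where x = a and y = b] assms show ?thesis by (simp add: CHAR_poly_mapping)
qed

lemma poly_mapping_frobenius_diff:
  fixes a b :: "'m::comm_monoid_add \<Rightarrow>\<^sub>0 'k::field"
  assumes "CHAR('k) = p" "p > 0"
  shows "(a - b) ^ p = a ^ p - b ^ p"
  using poly_mapping_frobenius_add[OF assms, of "a - b" b] by simp

section \<open>The Koszul resolution\<close>

locale curve =
  fixes f g :: "'k::field poly4"
  assumes f: "homogeneous 3 f" "f \<noteq> 0" and g: "homogeneous 2 g" "g \<noteq> 0"
    and coprime: "\<forall>h. h dvd f \<longrightarrow> h dvd g \<longrightarrow> h dvd 1"
begin

abbreviation F :: "'k laurent4" where "F \<equiv> laurent f"
abbreviation G :: "'k laurent4" where "G \<equiv> laurent g"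

lemma F_localized: "F \<in> localized I 3" and G_localized: "G \<in> localized I 2"
  using localized_laurent[OF f(1)] localized_laurent[OF g(1)] by simp_all

lemma G_nonzero: "G \<noteq> 0"
  using g(2) laurent_inject[of g 0] by (simp del: laurent_inject)

text \<open>The degree zero part of the ideal (f, g) in the localization. It will turn out to be the
  kernel of the map from Laurent polynomials of degree zero to sections of O_C over the set where
  all coordinates in \<open>I\<close> are nonzero.\<close>

definition ideal_part :: "coord set \<Rightarrow> 'k laurent4 set" where
  "ideal_part I = {F * u + G * v | u v. u \<in> localized I (-3) \<and> v \<in> localized I (-2)}"

text \<open>A 1-cocycle of O_C given by lifts to Laurent polynomials: the lifts need not satisfy the
  cocycle rule, only up to the ideal. The failure is what the Koszul resolution records.\<close>

definition laurent_cocycle :: "(coord list \<Rightarrow> 'k laurent4) \<Rightarrow> bool" where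
  "laurent_cocycle c \<longleftrightarrow> c \<in> cochains 2 0 \<and> (\<forall>I. length I = 3 \<longrightarrow> coboundary c I \<in> ideal_part (set I))"

definition laurent_coboundary :: "(coord list \<Rightarrow> 'k laurent4) \<Rightarrow> bool" where
  "laurent_coboundary c \<longleftrightarrow>
     (\<exists>e\<in>cochains 1 0. \<forall>I. length I = 2 \<longrightarrow> c I - coboundary e I \<in> ideal_part (set I))"

text \<open>A lift of a cocycle of \<open>O\<^sub>C\<close> through the Koszul resolution
  \<open>O(-5) \<rightarrow> O(-3) \<oplus> O(-2) \<rightarrow> O\<close>; the cochain \<open>t\<close> represents its image in
  \<open>H\<^sup>3(P\<^sup>3, O(-5))\<close>.\<close>

definition koszul_lift where
  "koszul_lift c a b t \<longleftrightarrow> c \<in> cochains 2 0 \<and> a \<in> cochains 3 (-3) \<and> b \<in> cochains 3 (-2) \<and>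
     t \<in> cochains 4 (-5) \<and>
     (\<forall>I. length I = 3 \<longrightarrow> coboundary c I = F * a I + G * b I) \<and>
     (\<forall>I. length I = 4 \<longrightarrow> coboundary a I = G * t I \<and> coboundary b I = - (F * t I))"

text \<open>The relation reads \<open>F * u = G * (- v)\<close>, to which the coprimality of f and g
  applies.\<close>

lemma koszul_exact:
  assumes "u \<in> localized I (d - 3)" "v \<in> localized I (d - 2)" "F * u + G * v = 0"
  obtains t where "t \<in> localized I (d - 5)" "u = G * t" "v = - (F * t)"
proof -
  have "F * u = G * (- v)" using assms(3) by (simp add: add_eq_0_iff2)
  from laurent_coprime[OF coprime f(2,1) assms(1) localized_uminus[OF assms(2)] this]
  obtain t where t: "t \<in> localized I (d - 2 - int 3)" "- v = F * t" "u = G * t" by blast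
  have "v = - (F * t)" unfolding t(2)[symmetric] by simp
  with t show ?thesis by (intro that[of t]) simp_all
qed

text \<open>A diagram chase. Writing the failure of the cocycle rule as \<open>F * a + G * b\<close>
  gives \<open>a\<close> and \<open>b\<close>; since the double coboundary of \<open>c\<close> is
  zero, the coboundaries of \<open>a\<close> and \<open>b\<close> satisfy the Koszul relation and
  hence come from a common \<open>t\<close>.\<close>

lemma ex_koszul_lift:
  assumes "laurent_cocycle c"
  obtains a b t where "koszul_lift c a b t"
proof -
  have c: "c \<in> cochains 2 0" using assms by (simp add: laurent_cocycle_def)
  have "\<forall>I. \<exists>u v. length I = 3 \<longrightarrow> u \<in> localized (set I) (-3) \<and> v \<in> localized (set I) (-2) \<and>
      coboundary c I = F * u + G * v"
    using assms unfolding laurent_cocycle_def ideal_part_def by blast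
  then obtain a b where ab: "\<And>I. length I = 3 \<Longrightarrow> a I \<in> localized (set I) (-3) \<and>
      b I \<in> localized (set I) (-2) \<and> coboundary c I = F * a I + G * b I"
    by metis
  then have a: "a \<in> cochains 3 (-3)" and b: "b \<in> cochains 3 (-2)" by (simp_all add: cochains_def)
  have "\<exists>t. t \<in> localized (set I) (-5) \<and> coboundary a I = G * t \<and> coboundary b I = - (F * t)"
    if I: "length I = 4" for I
  proof -
    have "F * coboundary a I + G * coboundary b I = coboundary (\<lambda>I. F * a I + G * b I) I"
      by (simp only: coboundary_add coboundary_mult)
    also have "\<dots> = coboundary (coboundary c) I"
      by (rule coboundary_cong) (simp add: ab I)
    finally have "F * coboundary a I + G * coboundary b I = 0"
      by (simp only: coboundary_coboundary)
    moreover have "coboundary a I \<in> localized (set I) (0 - 3)" "coboundary b I \<in> localized (set I) (0 - 2)"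
      using cochainsD[OF coboundary_cochains[OF a]] cochainsD[OF coboundary_cochains[OF b]] I by simp_all
    ultimately show ?thesis using koszul_exact[of _ _ 0] by (metis diff_0)
  qed
  then obtain t where "\<And>I. length I = 4 \<Longrightarrow> t I \<in> localized (set I) (-5) \<and>
      coboundary a I = G * t I \<and> coboundary b I = - (F * t I)"
    by metis
  with ab a b c show ?thesis by (intro that[of a b t]) (simp add: koszul_lift_def cochains_def)
qed

lemma koszul_lift_cocycle: "koszul_lift c a b t \<Longrightarrow> laurent_cocycle c"
  unfolding koszul_lift_def laurent_cocycle_def ideal_part_def cochains_def by blast

text \<open>\<open>G\<close> times the coboundary of \<open>t\<close> is the double coboundary of
  \<open>a\<close>, and \<open>G\<close> is not a zero divisor.\<close>

lemma koszul_lift_closed: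
  assumes "koszul_lift c a b t" "length I = 5"
  shows "coboundary t I = 0"
proof -
  have "G * coboundary t I = coboundary (\<lambda>I. G * t I) I" by (rule coboundary_mult[symmetric])
  also have "\<dots> = coboundary (coboundary a) I"
    using assms by (intro coboundary_cong) (simp add: koszul_lift_def)
  also have "\<dots> = 0" by (rule coboundary_coboundary)
  finally show ?thesis using G_nonzero by (simp add: mult_eq_0_iff)
qed

text \<open>Without all-negative monomials \<open>t\<close> is the coboundary of some
  \<open>s\<close>, and the correction descends through the resolution: \<open>a - G * s\<close> and
  \<open>b + F * s\<close> become closed, hence coboundaries of \<open>u\<close> and
  \<open>v\<close>, and then \<open>c - (F * u + G * v)\<close> is closed, hence the coboundary of
  \<open>e\<close>. The groups that must vanish for this are the second cohomology of O(-3) and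
  O(-2) and the first of O.\<close>

lemma laurent_coboundary_if:
  assumes lift: "koszul_lift c a b t"
    and t: "\<And>I m. length I = 4 \<Longrightarrow> all_negative m \<Longrightarrow> Poly_Mapping.lookup (t I) m = 0"
  shows "laurent_coboundary c"
proof -
  have c: "c \<in> cochains 2 0" and a: "a \<in> cochains 3 (-3)" and b: "b \<in> cochains 3 (-2)"
    and t4: "t \<in> cochains 4 (-5)"
    and dc: "\<And>I. length I = 3 \<Longrightarrow> coboundary c I = F * a I + G * b I"
    and da: "\<And>I. length I = 4 \<Longrightarrow> coboundary a I = G * t I"
    and db: "\<And>I. length I = 4 \<Longrightarrow> coboundary b I = - (F * t I)"
    using lift by (simp_all add: koszul_lift_def)
  obtain s where s: "s \<in> cochains 3 (-5)" "\<And>I. length I = 4 \<Longrightarrow> t I = coboundary s I"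
    using cochain_exact[of t 3 "-5"] t4 t koszul_lift_closed[OF lift] by (auto simp: eval_nat_numeral)
  have Gs: "(\<lambda>I. G * s I) \<in> cochains 3 (-3)" and Fs: "(\<lambda>I. F * s I) \<in> cochains 3 (-2)"
    using cochains_mult[OF G_localized s(1)] cochains_mult[OF F_localized s(1)] by simp_all
  obtain u where u: "u \<in> cochains 2 (-3)" "\<And>I. length I = 3 \<Longrightarrow> a I - G * s I = coboundary u I"
  proof (rule cochain_exact_low[of "\<lambda>I. a I - G * s I" 2 "-3"])
    show "coboundary (\<lambda>I. a I - G * s I) I = 0" if "length I = Suc (Suc 2)" for I
      using that da s(2) by (simp add: coboundary_diff coboundary_mult)
  qed (use cochains_diff[OF a Gs] in \<open>auto simp: eval_nat_numeral\<close>)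
  obtain v where v: "v \<in> cochains 2 (-2)" "\<And>I. length I = 3 \<Longrightarrow> b I + F * s I = coboundary v I"
  proof (rule cochain_exact_low[of "\<lambda>I. b I + F * s I" 2 "-2"])
    show "coboundary (\<lambda>I. b I + F * s I) I = 0" if "length I = Suc (Suc 2)" for I
      using that db s(2) by (simp add: coboundary_add coboundary_mult)
  qed (use cochains_add[OF b Fs] in \<open>auto simp: eval_nat_numeral\<close>)
  define w where "w I = c I - (F * u I + G * v I)" for I
  have Fu: "(\<lambda>I. F * u I) \<in> cochains 2 0" and Gv: "(\<lambda>I. G * v I) \<in> cochains 2 0"
    using cochains_mult[OF F_localized u(1)] cochains_mult[OF G_localized v(1)] by simp_all
  have w: "w \<in> cochains 2 0"
    unfolding w_def by (rule cochains_diff[OF c cochains_add[OF Fu Gv]])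
  have dw: "coboundary w I = 0" if I: "length I = 3" for I
  proof -
    have "coboundary w I = coboundary c I - (F * coboundary u I + G * coboundary v I)"
      by (simp only: w_def[abs_def] coboundary_diff coboundary_add coboundary_mult)
    also have "\<dots> = F * a I + G * b I - (F * (a I - G * s I) + G * (b I + F * s I))"
      using I by (simp only: dc u(2) v(2))
    also have "\<dots> = 0" by (simp add: algebra_simps)
    finally show ?thesis .
  qed
  obtain e where e: "e \<in> cochains 1 0" "\<And>I. length I = 2 \<Longrightarrow> w I = coboundary e I"
    using cochain_exact_low[of w 1 0] w dw by (auto simp: eval_nat_numeral)
  have "c I - coboundary e I \<in> ideal_part (set I)" if I: "length I = 2" for I
  proof -
    have "c I - coboundary e I = F * u I + G * v I"
      unfolding e(2)[OF I, symmetric] w_def by simp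
    then show ?thesis using cochainsD[OF u(1) I] cochainsD[OF v(1) I]
      unfolding ideal_part_def by blast
  qed
  with e(1) show ?thesis by (auto simp: laurent_coboundary_def)
qed

text \<open>A splitting of \<open>c\<close> modulo the ideal supplies \<open>u\<close> and
  \<open>v\<close>; after subtracting their coboundaries, \<open>a\<close> and \<open>b\<close>
  satisfy the Koszul relation already on lists of length 3. So \<open>t\<close> is the coboundary of
  a cochain on such lists, each of which misses a coordinate and admits no all-negative
  monomial.\<close>

lemma laurent_coboundary_only_if:
  assumes lift: "koszul_lift c a b t" and "laurent_coboundary c"
    and I: "length I = 4" and m: "all_negative m"
  shows "Poly_Mapping.lookup (t I) m = 0"
proof -
  have c: "c \<in> cochains 2 0" and a: "a \<in> cochains 3 (-3)" and b: "b \<in> cochains 3 (-2)"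
    and dc: "\<And>I. length I = 3 \<Longrightarrow> coboundary c I = F * a I + G * b I"
    and da: "\<And>I. length I = 4 \<Longrightarrow> coboundary a I = G * t I"
    using lift by (simp_all add: koszul_lift_def)
  obtain e where e: "e \<in> cochains 1 0"
      "\<And>I. length I = 2 \<Longrightarrow> c I - coboundary e I \<in> ideal_part (set I)"
    using assms(2) by (auto simp: laurent_coboundary_def)
  then have "\<exists>u v. u \<in> localized (set I) (-3) \<and> v \<in> localized (set I) (-2) \<and>
      c I - coboundary e I = F * u + G * v" if "length I = 2" for I
    using that unfolding ideal_part_def by blast
  then obtain u v where uv: "\<And>I. length I = 2 \<Longrightarrow> u I \<in> localized (set I) (-3) \<and>
      v I \<in> localized (set I) (-2) \<and> c I - coboundary e I = F * u I + G * v I"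
    by metis
  then have u: "u \<in> cochains 2 (-3)" and v: "v \<in> cochains 2 (-2)" by (simp_all add: cochains_def)
  have "\<exists>s. s \<in> localized (set J) (-5) \<and> a J - coboundary u J = G * s" if J: "length J = 3" for J
  proof -
    have "F * coboundary u J + G * coboundary v J = coboundary (\<lambda>J. F * u J + G * v J) J"
      by (simp only: coboundary_add coboundary_mult)
    also have "\<dots> = coboundary (\<lambda>J. c J - coboundary e J) J"
      by (rule coboundary_cong) (simp add: uv J)
    also have "\<dots> = F * a J + G * b J"
      by (simp only: coboundary_diff coboundary_coboundary dc J diff_zero)
    finally have "F * (a J - coboundary u J) + G * (b J - coboundary v J) = 0"
      by (simp add: algebra_simps)
    moreover have "coboundary u J \<in> localized (set J) (-3)" "coboundary v J \<in> localized (set J) (-2)"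
      using cochainsD[OF coboundary_cochains[OF u]] cochainsD[OF coboundary_cochains[OF v]] J by simp_all
    then have "a J - coboundary u J \<in> localized (set J) (0 - 3)"
      "b J - coboundary v J \<in> localized (set J) (0 - 2)"
      using cochainsD[OF a J] cochainsD[OF b J] by (simp_all add: localized_diff)
    ultimately show ?thesis using koszul_exact[of _ _ 0] by (metis diff_0)
  qed
  then obtain s where s: "\<And>J. length J = 3 \<Longrightarrow> s J \<in> localized (set J) (-5) \<and>
      a J - coboundary u J = G * s J"
    by metis
  have "G * t I = coboundary (\<lambda>J. a J - coboundary u J) I"
    by (simp add: coboundary_diff coboundary_coboundary da I)
  also have "\<dots> = coboundary (\<lambda>J. G * s J) I"
    by (rule coboundary_cong) (simp add: s I)
  finally have "G * t I = G * coboundary s I" by (simp only: coboundary_mult)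
  then have "t I = coboundary s I" using mult_left_cancel[OF G_nonzero] by simp
  then have "Poly_Mapping.lookup (t I) m = coboundary (\<lambda>J. Poly_Mapping.lookup (s J) m) I"
    by (simp only: coboundary_lookup)
  also have "\<dots> = coboundary (\<lambda>J. (0::'k)) I"
  proof (rule coboundary_cong)
    fix J :: "coord list" assume "length I = Suc (length J)"
    then have J: "length J = 3" using I by simp
    show "Poly_Mapping.lookup (s J) m = 0"
      using s[OF J] set_length_less_4[of J] J by (intro localized_not_all_negative[OF _ _ m]) auto
  qed
  also have "\<dots> = 0" by (rule coboundary_hom[of "\<lambda>_. 0" "\<lambda>_. (0::'k)", simplified])
  finally show ?thesis .
qed

text \<open>The chase in the opposite direction: every top cocycle of O(-5) comes from a cocycle of
  O_C, because O(-3) and O(-2) have no third cohomology and O has no second.\<close>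

lemma koszul_lift_of_top_cocycle:
  assumes t: "t \<in> cochains 4 (-5)" and closed: "\<And>I. length I = 5 \<Longrightarrow> coboundary t I = 0"
  obtains c a b where "koszul_lift c a b t"
proof -
  have Gt: "(\<lambda>I. G * t I) \<in> cochains 4 (-3)" and Ft: "(\<lambda>I. - F * t I) \<in> cochains 4 (-2)"
    using cochains_mult[OF G_localized t] cochains_mult[OF localized_uminus[OF F_localized] t]
    by simp_all
  obtain a where a: "a \<in> cochains 3 (-3)" "\<And>I. length I = 4 \<Longrightarrow> G * t I = coboundary a I"
  proof (rule cochain_exact_low[of "\<lambda>I. G * t I" 3 "-3"])
    show "coboundary (\<lambda>I. G * t I) I = 0" if "length I = Suc (Suc 3)" for I
      using that closed[of I] by (simp only: coboundary_mult) simp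
  qed (use Gt in \<open>auto simp: eval_nat_numeral\<close>)
  obtain b where b: "b \<in> cochains 3 (-2)" "\<And>I. length I = 4 \<Longrightarrow> - F * t I = coboundary b I"
  proof (rule cochain_exact_low[of "\<lambda>I. - F * t I" 3 "-2"])
    show "coboundary (\<lambda>I. - F * t I) I = 0" if "length I = Suc (Suc 3)" for I
      using that closed[of I] by (simp only: coboundary_mult) simp
  qed (use Ft in \<open>auto simp: eval_nat_numeral\<close>)
  have Fa: "(\<lambda>I. F * a I) \<in> cochains 3 0" and Gb: "(\<lambda>I. G * b I) \<in> cochains 3 0"
    using cochains_mult[OF F_localized a(1)] cochains_mult[OF G_localized b(1)] by simp_all
  obtain c where c: "c \<in> cochains 2 0" "\<And>I. length I = 3 \<Longrightarrow> F * a I + G * b I = coboundary c I"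
  proof (rule cochain_exact_low[of "\<lambda>I. F * a I + G * b I" 2 0])
    show "coboundary (\<lambda>I. F * a I + G * b I) I = 0" if "length I = Suc (Suc 2)" for I
    proof -
      have I: "length I = 4" using that by simp
      show ?thesis unfolding coboundary_add coboundary_mult a(2)[OF I, symmetric] b(2)[OF I, symmetric]
        by (simp add: algebra_simps)
    qed
  qed (use cochains_add[OF Fa Gb] in \<open>auto simp: eval_nat_numeral\<close>)
  have "koszul_lift c a b t"
    using a b c t by (simp add: koszul_lift_def)
  then show ?thesis by (rule that)
qed

text \<open>Frobenius extends to a semilinear endomorphism of the resolution:
  \<open>F * (F ^ (p - 1) * a ^ p)\<close> equals \<open>(F * a) ^ p\<close>, and similarly for the
  other arrows. Degrees are restored, for instance 3 (p - 1) - 3 p = -3.\<close>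

lemma koszul_lift_frobenius:
  assumes lift: "koszul_lift c a b t" and p: "CHAR('k) = p" "p > 0"
  shows "koszul_lift (\<lambda>I. c I ^ p) (\<lambda>I. F ^ (p - 1) * a I ^ p) (\<lambda>I. G ^ (p - 1) * b I ^ p)
    (\<lambda>I. (F * G) ^ (p - 1) * t I ^ p)"
proof -
  have c: "c \<in> cochains 2 0" and a: "a \<in> cochains 3 (-3)" and b: "b \<in> cochains 3 (-2)"
    and t: "t \<in> cochains 4 (-5)"
    and dc: "\<And>I. length I = 3 \<Longrightarrow> coboundary c I = F * a I + G * b I"
    and da: "\<And>I. length I = 4 \<Longrightarrow> coboundary a I = G * t I"
    and db: "\<And>I. length I = 4 \<Longrightarrow> coboundary b I = - (F * t I)"
    using lift by (simp_all add: koszul_lift_def)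
  note frob = poly_mapping_frobenius_diff[OF p] poly_mapping_frobenius_add[OF p]
  \<comment> \<open>The coboundary is an alternating sum, and taking p-th powers is
    additive.\<close>
  have dpow: "coboundary (\<lambda>I. h I ^ p) I = coboundary h I ^ p" for h :: "coord list \<Rightarrow> 'k laurent4" and I
    by (rule coboundary_hom) (use p in \<open>simp_all add: frob\<close>)
  have pow: "r ^ (p - 1) * r ^ p = r ^ (p - 1) * r ^ (p - 1) * r" "r * r ^ (p - 1) = r ^ p" for r :: "'k laurent4"
    using p power_Suc[of r "p - 1"] by (simp_all add: mult.assoc mult.commute[of _ r])
  have "(\<lambda>I. c I ^ p) \<in> cochains 2 0" using cochains_power[OF c, of p] by simp
  moreover have "(\<lambda>I. F ^ (p - 1) * a I ^ p) \<in> cochains 3 (-3)"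
    using cochains_mult[OF localized_power[OF F_localized] cochains_power[OF a], of "p - 1" p] p
    by (simp add: algebra_simps of_nat_diff)
  moreover have "(\<lambda>I. G ^ (p - 1) * b I ^ p) \<in> cochains 3 (-2)"
    using cochains_mult[OF localized_power[OF G_localized] cochains_power[OF b], of "p - 1" p] p
    by (simp add: algebra_simps of_nat_diff)
  moreover have "(\<lambda>I. (F * G) ^ (p - 1) * t I ^ p) \<in> cochains 4 (-5)"
    using cochains_mult[OF localized_power[OF localized_mult[OF F_localized G_localized]]
        cochains_power[OF t], of "p - 1" p] p
    by (simp add: algebra_simps of_nat_diff)
  moreover have "coboundary (\<lambda>I. c I ^ p) I = F * (F ^ (p - 1) * a I ^ p) + G * (G ^ (p - 1) * b I ^ p)"
    if "length I = 3" for I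
    unfolding dpow dc[OF that] frob power_mult_distrib mult.assoc[symmetric] pow(2) ..
  moreover have "coboundary (\<lambda>I. F ^ (p - 1) * a I ^ p) I = G * ((F * G) ^ (p - 1) * t I ^ p)"
    if "length I = 4" for I
  proof -
    have "coboundary (\<lambda>I. F ^ (p - 1) * a I ^ p) I = F ^ (p - 1) * (G ^ p * t I ^ p)"
      unfolding coboundary_mult dpow da[OF that] power_mult_distrib ..
    then show ?thesis unfolding pow(2)[of G, symmetric] by (simp add: power_mult_distrib ac_simps)
  qed
  moreover have "coboundary (\<lambda>I. G ^ (p - 1) * b I ^ p) I = - (F * ((F * G) ^ (p - 1) * t I ^ p))"
    if "length I = 4" for I
  proof -
    \<comment> \<open>The negative is written as a difference from 0, so that additivity of the p-th
      power carries the sign through for odd p and for p = 2 alike.\<close>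
    have "coboundary (\<lambda>I. G ^ (p - 1) * b I ^ p) I = G ^ (p - 1) * (0 - F * t I) ^ p"
      unfolding coboundary_mult dpow db[OF that] by simp
    also have "(0 - F * t I) ^ p = 0 ^ p - F ^ p * t I ^ p"
      unfolding frob power_mult_distrib ..
    also have "(0 :: 'k laurent4) ^ p = 0" using p(2) by (rule zero_power)
    also have "G ^ (p - 1) * (0 - F ^ p * t I ^ p) = - (G ^ (p - 1) * (F ^ p * t I ^ p))"
      by simp
    finally show ?thesis unfolding pow(2)[of F, symmetric] by (simp add: power_mult_distrib ac_simps)
  qed
  ultimately show ?thesis by (simp add: koszul_lift_def)
qed

end

section \<open>Frobenius on the top cohomology of O(-5)\<close>

definition order_sign :: "coord \<Rightarrow> coord \<Rightarrow> int" where
  "order_sign i j = (if i < j then 1 else if i = j then 0 else -1)"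

text \<open>The sign of the permutation that sorts the list, and 0 if an entry repeats. It is an
  alternating integer cochain with value 1 on the sorted list of all coordinates.\<close>

primrec list_sign :: "coord list \<Rightarrow> int" where
  "list_sign [] = 1"
| "list_sign (i # I) = prod_list (map (order_sign i) I) * list_sign I"

lemma list_sign_nonzero: "list_sign I \<noteq> 0 \<Longrightarrow> distinct I"
proof (induction I)
  case (Cons i I)
  then have "0 \<notin> set (map (order_sign i) I)" by (auto simp: prod_list_zero_iff)
  then have "i \<notin> set I" by (force simp: order_sign_def)
  with Cons show ?case by simp
qed simp

lemma order_sign_simps [simp]:
  "order_sign i i = 0"
  "order_sign Coord_x Coord_y = 1" "order_sign Coord_x Coord_z = 1" "order_sign Coord_x Coord_w = 1"
  "order_sign Coord_y Coord_z = 1" "order_sign Coord_y Coord_w = 1" "order_sign Coord_z Coord_w = 1"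
  "order_sign Coord_y Coord_x = -1" "order_sign Coord_z Coord_x = -1" "order_sign Coord_w Coord_x = -1"
  "order_sign Coord_z Coord_y = -1" "order_sign Coord_w Coord_y = -1" "order_sign Coord_w Coord_z = -1"
  by (simp_all add: order_sign_def less_coord_def coord_idx_def)

text \<open>Five entries taken from four coordinates must repeat; the cancellation is verified on
  all 4^5 lists.\<close>

lemma coboundary_list_sign:
  assumes "length I = 5"
  shows "coboundary list_sign I = 0"
proof -
  obtain i j k l m where I: "I = [i, j, k, l, m]"
    using assms by (auto simp: length_Suc_conv eval_nat_numeral)
  show ?thesis unfolding I
    by (cases i; cases j; cases k; cases l; cases m; simp)
qed

definition top_exponent :: "coord \<Rightarrow> (coord \<Rightarrow>\<^sub>0 int)" where
  "top_exponent j = xprod_exponent UNIV (-1) - Poly_Mapping.single j 1"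

lemma lookup_top_exponent:
  "Poly_Mapping.lookup (top_exponent j) i = (if i = j then -2 else -1)"
  by (simp add: top_exponent_def lookup_minus lookup_single when_def)

lemma all_negative_top_exponent [simp]: "all_negative (top_exponent j)"
  by (simp add: all_negative_def lookup_top_exponent)

lemma ldegree_top_exponent [simp]: "ldegree (top_exponent j) = -5"
  by (cases j) (simp_all add: ldegree_def lookup_top_exponent UNIV_coord)

text \<open>Four integers of at most -1 with sum -5 are three times -1 and once -2.\<close>

lemma ex_top_exponent:
  assumes "all_negative m" "ldegree m = -5"
  shows "\<exists>j. m = top_exponent j"
proof -
  have neg: "Poly_Mapping.lookup m i \<le> -1" for i
    using assms(1) zless_imp_add1_zle[of "Poly_Mapping.lookup m i" 0] by (simp add: all_negative_def)
  have sum: "Poly_Mapping.lookup m Coord_x + Poly_Mapping.lookup m Coord_y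
      + Poly_Mapping.lookup m Coord_z + Poly_Mapping.lookup m Coord_w = -5"
    using assms(2) by (simp add: ldegree_def UNIV_coord)
  have "\<exists>j. \<forall>i\<in>{Coord_x, Coord_y, Coord_z, Coord_w}. Poly_Mapping.lookup m i = (if i = j then -2 else -1)"
  proof (rule ccontr)
    assume "\<not> ?thesis"
    then have "\<not> (\<forall>i\<in>{Coord_x, Coord_y, Coord_z, Coord_w}. Poly_Mapping.lookup m i = (if i = j then -2 else -1))" for j
      by blast
    from this[of Coord_x] this[of Coord_y] this[of Coord_z] this[of Coord_w]
      neg[of Coord_x] neg[of Coord_y] neg[of Coord_z] neg[of Coord_w] sum
    show False by simp presburger
  qed
  then obtain j where "\<forall>i. Poly_Mapping.lookup m i = (if i = j then -2 else -1)"
    by (simp flip: UNIV_coord) blast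
  then have "m = top_exponent j"
    by (intro poly_mapping_eqI) (simp add: lookup_top_exponent)
  then show ?thesis ..
qed

text \<open>A representative of the j-th basis class of the third cohomology of O(-5). Alternating
  signs make it closed as a full cochain, on lists in any order and with repetitions.\<close>

definition top_cochain :: "coord \<Rightarrow> coord list \<Rightarrow> 'k::comm_ring_1 laurent4" where
  "top_cochain j I = Poly_Mapping.single (top_exponent j) (of_int (list_sign I))"

lemma top_cochain_cochains: "(top_cochain j :: _ \<Rightarrow> 'k::comm_ring_1 laurent4) \<in> cochains 4 (-5)"
  unfolding cochains_def
proof (intro CollectI allI impI)
  fix I :: "coord list" assume I: "length I = 4"
  show "(top_cochain j I :: 'k laurent4) \<in> localized (set I) (- 5)"
  proof (cases "list_sign I = 0")
    case False
    \<comment> \<open>A nonzero sign means that the four entries are distinct, so all coordinates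
      may appear in the denominator.\<close>
    then have "card (set I) = card (UNIV :: coord set)"
      using distinct_card[OF list_sign_nonzero] I by (simp add: UNIV_coord)
    then have "set I = UNIV" by (intro card_subset_eq) auto
    then show ?thesis by (auto simp: top_cochain_def intro!: localized_single)
  qed (simp add: top_cochain_def)
qed

lemma coboundary_top_cochain:
  assumes "length I = 5"
  shows "coboundary (top_cochain j :: _ \<Rightarrow> 'k::comm_ring_1 laurent4) I = 0"
proof -
  have "coboundary (top_cochain j :: _ \<Rightarrow> 'k laurent4) I
      = Poly_Mapping.single (top_exponent j) (of_int (coboundary list_sign I))"
    unfolding top_cochain_def[abs_def]
    by (rule coboundary_hom[where \<phi> = "\<lambda>a. Poly_Mapping.single (top_exponent j) (of_int a)"])
       (simp_all add: single_diff)
  then show ?thesis by (simp add: coboundary_list_sign[OF assms])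
qed

lemma lookup_mult_single:
  fixes H :: "'m::ab_group_add \<Rightarrow>\<^sub>0 'k::comm_ring_1"
  shows "Poly_Mapping.lookup (H * Poly_Mapping.single n c) m = Poly_Mapping.lookup H (m - n) * c"
proof (induction H rule: poly_mapping_induct)
  case (single m' c')
  have "m' + n = m \<longleftrightarrow> m' = m - n" by (auto simp: algebra_simps)
  then show ?case by (simp add: mult_single lookup_single when_def)
qed (simp_all add: distrib_right lookup_add)

definition scale_exponent :: "nat \<Rightarrow> (coord \<Rightarrow>\<^sub>0 int) \<Rightarrow> (coord \<Rightarrow>\<^sub>0 int)" where
  "scale_exponent n m = (\<Sum>_<n. m)"

lemma lookup_scale_exponent [simp]:
  "Poly_Mapping.lookup (scale_exponent n m) i = int n * Poly_Mapping.lookup m i"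
  by (simp add: scale_exponent_def lookup_sum)

lemma single_power:
  "Poly_Mapping.single m (c :: 'k::comm_ring_1) ^ n = Poly_Mapping.single (scale_exponent n m) (c ^ n)"
  by (induction n) (simp_all add: scale_exponent_def mult_single add.commute)

text \<open>Since p-th powers are additive, \<open>l ^ p\<close> has one term for each term of
  \<open>l\<close>, with its exponent multiplied by \<open>p\<close>; no mixed products
  occur.\<close>

lemma lookup_mult_frobenius:
  fixes H l :: "'k::field laurent4"
  assumes p: "CHAR('k) = p" "p > 0"
  shows "Poly_Mapping.lookup (H * l ^ p) m
    = (\<Sum>n\<in>Poly_Mapping.keys l. Poly_Mapping.lookup H (m - scale_exponent p n) * Poly_Mapping.lookup l n ^ p)"
proof -
  have "(\<Sum>n\<in>A. Poly_Mapping.single n (h n)) ^ p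
      = (\<Sum>n\<in>A. Poly_Mapping.single (scale_exponent p n) (h n ^ p))"
    if "finite A" for A and h :: "_ \<Rightarrow> 'k"
    using that
  proof induction
    case empty
    show ?case using p(2) by (simp add: zero_power)
  qed (simp add: poly_mapping_frobenius_add[OF p] single_power)
  then have "l ^ p = (\<Sum>n\<in>Poly_Mapping.keys l.
      Poly_Mapping.single (scale_exponent p n) (Poly_Mapping.lookup l n ^ p))"
    by (subst poly_mapping_eq_sum_single[of l]) simp
  then show ?thesis by (simp add: sum_distrib_left lookup_sum lookup_mult_single)
qed

text \<open>The monomial by which Frobenius, composed with multiplication by \<open>(f g)\<^sup>p\<^sup>-\<^sup>1\<close>, takes the
  basis monomial \<open>top_exponent j\<close> of \<open>H\<^sup>3(P\<^sup>3, O(-5))\<close> to \<open>top_exponent i\<close>.\<close>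

definition hasse_witt_monom :: "nat \<Rightarrow> coord \<Rightarrow> coord \<Rightarrow> monom4" where
  "hasse_witt_monom p i j = (let h = \<lambda>k. (p - 1) + (if k = j then p else 0) - (if k = i then 1 else 0)
     in mono4 (h Coord_x) (h Coord_y) (h Coord_z) (h Coord_w))"

text \<open>At coordinate k the right side is p (1 + [k = j]) - (1 + [k = i]). With
  \<open>p \<ge> 2\<close> the subtraction of natural numbers in \<open>hasse_witt_monom\<close>
  never truncates, also at p - 2.\<close>

lemma int_exponent_hasse_witt_monom:
  assumes "p \<ge> 2"
  shows "int_exponent (hasse_witt_monom p i j) = top_exponent i - scale_exponent p (top_exponent j)"
proof (rule poly_mapping_eqI)
  fix k
  show "Poly_Mapping.lookup (int_exponent (hasse_witt_monom p i j)) k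
    = Poly_Mapping.lookup (top_exponent i - scale_exponent p (top_exponent j)) k"
    using assms
    by (cases k) (simp_all add: hasse_witt_monom_def lookup_minus lookup_top_exponent of_nat_diff)
qed

context curve
begin

text \<open>Through Koszul lifts, \<open>c ^ p\<close> splits iff
  \<open>(F * G) ^ (p - 1) * t ^ p\<close> has no all-negative monomial. On the basis cocycles this
  reads off the coefficients one by one; in general only the all-negative monomials of
  \<open>t\<close> can contribute.\<close>

theorem frobenius_trivial_iff:
  assumes p: "CHAR('k) = p" "p > 0"
  shows "(\<forall>c. laurent_cocycle c \<longrightarrow> laurent_coboundary (\<lambda>I. c I ^ p)) \<longleftrightarrow>
    (\<forall>i j. Poly_Mapping.lookup ((f * g) ^ (p - 1)) (hasse_witt_monom p i j) = 0)"
proof -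
  let ?H = "(F * G) ^ (p - 1)"
  have "p \<ge> 2" using prime_ge_2_nat[OF CHAR_prime[OF p]] .
  have H: "Poly_Mapping.lookup ((f * g) ^ (p - 1)) (hasse_witt_monom p i j)
      = Poly_Mapping.lookup ?H (top_exponent i - scale_exponent p (top_exponent j))" for i j
    unfolding int_exponent_hasse_witt_monom[OF \<open>p \<ge> 2\<close>, symmetric]
    by (simp flip: laurent_mult laurent_power)
  have H_nonneg: "Poly_Mapping.lookup ?H m = 0" if "Poly_Mapping.lookup m i < 0" for m i
  proof -
    have "m \<notin> Poly_Mapping.keys (laurent ((f * g) ^ (p - 1)))"
      using that by (auto simp: keys_laurent)
    then show ?thesis by (simp add: in_keys_iff laurent_mult laurent_power)
  qed
  show ?thesis
  proof
    assume L: "\<forall>c. laurent_cocycle c \<longrightarrow> laurent_coboundary (\<lambda>I. c I ^ p)"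
    show "\<forall>i j. Poly_Mapping.lookup ((f * g) ^ (p - 1)) (hasse_witt_monom p i j) = 0"
    proof (intro allI)
      fix i j
      obtain c a b where lift: "koszul_lift c a b (top_cochain j)"
        using koszul_lift_of_top_cocycle[OF top_cochain_cochains coboundary_top_cochain] by blast
      have "laurent_coboundary (\<lambda>I. c I ^ p)"
        using L koszul_lift_cocycle[OF lift] by blast
      \<comment> \<open>The sorted list has sign 1, so there the top cochain is the bare basis
        monomial, and its p-th power picks out a single coefficient of
        \<open>(f * g) ^ (p - 1)\<close>.\<close>
      from laurent_coboundary_only_if[OF koszul_lift_frobenius[OF lift p] this,
          of "[Coord_x, Coord_y, Coord_z, Coord_w]" "top_exponent i"]
      have "Poly_Mapping.lookup (?H * Poly_Mapping.single (top_exponent j) 1 ^ p) (top_exponent i) = 0"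
        by (simp add: top_cochain_def)
      then show "Poly_Mapping.lookup ((f * g) ^ (p - 1)) (hasse_witt_monom p i j) = 0"
        by (simp only: H single_power lookup_mult_single) simp
    qed
  next
    assume R: "\<forall>i j. Poly_Mapping.lookup ((f * g) ^ (p - 1)) (hasse_witt_monom p i j) = 0"
    show "\<forall>c. laurent_cocycle c \<longrightarrow> laurent_coboundary (\<lambda>I. c I ^ p)"
    proof (intro allI impI)
      fix c assume "laurent_cocycle c"
      then obtain a b t where lift: "koszul_lift c a b t" by (rule ex_koszul_lift)
      note lift' = koszul_lift_frobenius[OF lift p]
      show "laurent_coboundary (\<lambda>I. c I ^ p)"
      proof (rule laurent_coboundary_if[OF lift'])
        fix I :: "coord list" and m assume I: "length I = 4" and m: "all_negative m"
        have t': "?H * t I ^ p \<in> localized (set I) (-5)" and t: "t I \<in> localized (set I) (-5)"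
          using lift lift' I by (simp_all add: koszul_lift_def cochains_def)
        show "Poly_Mapping.lookup (?H * t I ^ p) m = 0"
        proof (cases "ldegree m = -5")
          case False
          then show ?thesis using t' by (auto simp: localized_def in_keys_iff)
        next
          case True
          then obtain i where i: "m = top_exponent i" using ex_top_exponent[OF m] by blast
          have "Poly_Mapping.lookup ?H (m - scale_exponent p n) = 0"
            if n: "n \<in> Poly_Mapping.keys (t I)" for n
          proof (cases "all_negative n")
            case True
            moreover have "ldegree n = -5" using t n by (simp add: localized_def)
            ultimately obtain j where "n = top_exponent j" using ex_top_exponent by blast
            then show ?thesis using R H[of i j] i by simp
          next
            case False
            then obtain k where k: "Poly_Mapping.lookup n k \<ge> 0" by (auto simp: all_negative_def not_less)
            \<comment> \<open>A monomial of \<open>t\<close> that is trivial in cohomology does not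
              interfere: at \<open>k\<close> the required exponent is negative, while
              \<open>(f * g) ^ (p - 1)\<close> is a polynomial.\<close>
            have "0 \<le> int p * Poly_Mapping.lookup n k" using k by simp
            moreover have "Poly_Mapping.lookup m k < 0" using m by (simp add: all_negative_def)
            ultimately show ?thesis by (intro H_nonneg[of _ k]) (simp add: lookup_minus)
          qed
          then show ?thesis by (simp add: lookup_mult_frobenius[OF p])
        qed
      qed
    qed
  qed
qed

end

section \<open>Homogeneous ideals\<close>

text \<open>Points of the curve are primes of the quotient ring, but the ideal arguments are carried
  out with their preimages in the polynomial ring, where homogeneous parts are available.\<close>

definition homogeneous_ideal :: "'k::comm_ring_1 poly4 set \<Rightarrow> bool" where
  "homogeneous_ideal I \<longleftrightarrow> 0 \<in> I \<and> (\<forall>a\<in>I. \<forall>b\<in>I. a + b \<in> I) \<and> (\<forall>r. \<forall>a\<in>I. r * a \<in> I) \<and>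
     (\<forall>a\<in>I. \<forall>d. hpart d a \<in> I)"

lemma homogeneous_idealD:
  assumes "homogeneous_ideal I"
  shows "0 \<in> I" "\<And>a b. a \<in> I \<Longrightarrow> b \<in> I \<Longrightarrow> a + b \<in> I" "\<And>r a. a \<in> I \<Longrightarrow> r * a \<in> I"
    "\<And>a d. a \<in> I \<Longrightarrow> hpart d a \<in> I" "\<And>r a. a \<in> I \<Longrightarrow> a * r \<in> I"
  using assms unfolding homogeneous_ideal_def by (auto simp: mult.commute)

lemma homogeneous_ideal_diff:
  assumes "homogeneous_ideal I" "a \<in> I" "b \<in> I"
  shows "a - b \<in> I"
  using homogeneous_idealD(2)[OF assms(1,2) homogeneous_idealD(3)[OF assms(1,3), of "-1"]] by simp

lemma homogeneous_ideal_sum: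
  "homogeneous_ideal I \<Longrightarrow> (\<And>x. x \<in> A \<Longrightarrow> h x \<in> I) \<Longrightarrow> sum h A \<in> I"
  by (induction A rule: infinite_finite_induct) (auto intro: homogeneous_idealD)

lemma hpart_sum: "hpart d (sum h A) = (\<Sum>x\<in>A. hpart d (h x))"
  by (induction A rule: infinite_finite_induct) (simp_all add: hpart_add)

lemma hpart_mult_homogeneous:
  fixes a :: "'k::comm_ring_1 poly4"
  assumes "homogeneous e a"
  shows "hpart d (r * a) = (if e \<le> d then hpart (d - e) r * a else 0)"
  using hpart_mult[OF assms, of "d - e" r] hpart_mult_less[OF assms, of d r]
  by (auto simp: mult.commute)

lemma hpart_mult_homogeneous_left:
  fixes a :: "'k::comm_ring_1 poly4"
  assumes "homogeneous e a"
  shows "hpart d (a * r) = (if e \<le> d then a * hpart (d - e) r else 0)"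
  using hpart_mult[OF assms, of "d - e" r] hpart_mult_less[OF assms, of d r]
  by (cases "e \<le> d") simp_all

lemma homogeneous_ideal_adjoin:
  assumes I: "homogeneous_ideal I" and a: "homogeneous e a"
  shows "homogeneous_ideal {x + r * a | x r. x \<in> I}"
  unfolding homogeneous_ideal_def
proof (intro conjI ballI allI)
  show "0 \<in> {x + r * a | x r. x \<in> I}"
    using homogeneous_idealD(1)[OF I] by (intro CollectI exI[of _ 0]) simp
  fix u assume "u \<in> {x + r * a | x r. x \<in> I}"
  then obtain x r where u: "u = x + r * a" "x \<in> I" by blast
  show "q * u \<in> {x + r * a | x r. x \<in> I}" for q
    using homogeneous_idealD(3)[OF I u(2), of q]
    by (intro CollectI exI[of _ "q * x"] exI[of _ "q * r"]) (simp add: u distrib_left mult.assoc)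
  show "hpart d u \<in> {x + r * a | x r. x \<in> I}" for d
    using homogeneous_idealD(4)[OF I u(2), of d]
    by (intro CollectI exI[of _ "hpart d x"] exI[of _ "if e \<le> d then hpart (d - e) r else 0"])
       (simp add: u hpart_add hpart_mult_homogeneous[OF a])
  show "u + v \<in> {x + r * a | x r. x \<in> I}" if v: "v \<in> {x + r * a | x r. x \<in> I}" for v
  proof -
    obtain y s where "v = y + s * a" "y \<in> I" using v by blast
    then show ?thesis using homogeneous_idealD(2)[OF I u(2), of y]
      by (intro CollectI exI[of _ "x + y"] exI[of _ "r + s"]) (simp add: u distrib_right)
  qed
qed

lemma homogeneous_ideal_adjoin_finite:
  assumes I: "homogeneous_ideal I" and A: "finite A" and h: "\<And>k. k \<in> A \<Longrightarrow> \<exists>d. homogeneous d (h k)"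
  shows "homogeneous_ideal {x + (\<Sum>k\<in>A. r k * h k) | x r. x \<in> I}"
  using A h
proof (induction A)
  case empty
  then show ?case using I by simp
next
  case (insert k A)
  let ?I = "{x + (\<Sum>k\<in>A. r k * h k) | x r. x \<in> I}"
  obtain d where d: "homogeneous d (h k)" using insert.prems by blast
  have "homogeneous_ideal {x + r * h k | x r. x \<in> ?I}"
    by (rule homogeneous_ideal_adjoin[OF _ d], rule insert.IH) (use insert.prems in auto)
  moreover have "{x + r * h k | x r. x \<in> ?I} = {x + (\<Sum>k\<in>insert k A. r k * h k) | x r. x \<in> I}"
  proof (intro equalityI subsetI)
    fix u assume "u \<in> {x + r * h k | x r. x \<in> ?I}"
    then obtain x r q where u: "u = x + (\<Sum>k\<in>A. r k * h k) + q * h k" "x \<in> I" by blast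
    have "(\<Sum>k'\<in>A. (r(k := q)) k' * h k') = (\<Sum>k\<in>A. r k * h k)"
      using insert.hyps by (intro sum.cong) auto
    then have "u = x + (\<Sum>k'\<in>insert k A. (r(k := q)) k' * h k')"
      using insert.hyps u by (simp add: add_ac)
    then show "u \<in> {x + (\<Sum>k\<in>insert k A. r k * h k) | x r. x \<in> I}" using u by blast
  next
    fix u assume "u \<in> {x + (\<Sum>k\<in>insert k A. r k * h k) | x r. x \<in> I}"
    then obtain x r where u: "u = x + (\<Sum>k\<in>insert k A. r k * h k)" "x \<in> I" by blast
    then have "u = (x + (\<Sum>k\<in>A. r k * h k)) + r k * h k"
      using insert.hyps by (simp add: add_ac)
    then show "u \<in> {x + r * h k | x r. x \<in> ?I}" using u by blast
  qed
  ultimately show ?case by simp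
qed

text \<open>The colon ideal (I : w), graded because \<open>w\<close> is homogeneous. Applied to an
  element that is locally zero, it turns local annihilators into one power of the
  denominator.\<close>

lemma homogeneous_ideal_annihilator:
  assumes I: "homogeneous_ideal I" and w: "homogeneous d w"
  shows "homogeneous_ideal {a. w * a \<in> I}"
  unfolding homogeneous_ideal_def
proof (intro conjI ballI allI)
  show "hpart e a \<in> {a. w * a \<in> I}" if "a \<in> {a. w * a \<in> I}" for a e
    using homogeneous_idealD(4)[OF I, of "w * a" "d + e"] that by (simp add: hpart_mult[OF w])
  show "r * a \<in> {a. w * a \<in> I}" if "a \<in> {a. w * a \<in> I}" for a r
    using homogeneous_idealD(3)[OF I, of "w * a" r] that unfolding mem_Collect_eq mult.left_commute[of w r a] .
qed (use I in \<open>auto simp: homogeneous_idealD distrib_left\<close>)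

text \<open>Let i and j be the top degrees in which \<open>a\<close> and \<open>b\<close> have a
  part outside \<open>I\<close>. In degree i + j of the product all contributions except the product
  of these two parts lie in \<open>I\<close>, so that product does as well.\<close>

lemma homogeneous_ideal_prime:
  assumes I: "homogeneous_ideal I"
    and hprime: "\<And>a b d e. homogeneous d a \<Longrightarrow> homogeneous e b \<Longrightarrow> a * b \<in> I \<Longrightarrow> a \<in> I \<or> b \<in> I"
    and ab: "a * b \<in> I"
  shows "a \<in> I \<or> b \<in> I"
proof (rule ccontr)
  assume neg: "\<not> ?thesis"
  have top: "\<exists>i. hpart i c \<notin> I \<and> (\<forall>k>i. hpart k c \<in> I)" if c: "c \<notin> I" for c
  proof -
    obtain N where N: "\<forall>n\<ge>N. (\<Sum>d<n. hpart d c) = c" using ex_sum_hpart by blast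
    have "hpart n c = 0" if "n \<ge> N" for n
      using N[rule_format, of n] N[rule_format, of "Suc n"] that by simp
    then have bound: "hpart n c \<in> I" if "n \<ge> N" for n
      using that homogeneous_idealD(1)[OF I] by simp
    have "{i. hpart i c \<notin> I} \<subseteq> {..<N}" using bound by (auto simp: not_le[symmetric])
    then have fin: "finite {i. hpart i c \<notin> I}" by (rule finite_subset) simp
    have ne: "{i. hpart i c \<notin> I} \<noteq> {}"
    proof
      assume "{i. hpart i c \<notin> I} = {}"
      then have "(\<Sum>d<N. hpart d c) \<in> I" by (intro homogeneous_ideal_sum[OF I]) auto
      then show False using N[rule_format, of N] c by simp
    qed
    show ?thesis
      using Max_in[OF fin ne] Max_ge[OF fin] by (intro exI[of _ "Max {i. hpart i c \<notin> I}"]) force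
  qed
  obtain i where i: "hpart i a \<notin> I" "\<And>k. k > i \<Longrightarrow> hpart k a \<in> I" using top neg by blast
  obtain j where j: "hpart j b \<notin> I" "\<And>k. k > j \<Longrightarrow> hpart k b \<in> I" using top neg by blast
  obtain N where N: "\<forall>n\<ge>N. (\<Sum>d<n. hpart d a) = a" using ex_sum_hpart by blast
  define M where "M = max N (Suc i)"
  \<comment> \<open>The contribution of the k-th part of \<open>a\<close> to degree i + j of the
    product; it is 0 when k exceeds i + j.\<close>
  define T where "T k = (if k \<le> i + j then hpart k a * hpart (i + j - k) b else 0)" for k
  have "hpart (i + j) (a * b) = hpart (i + j) ((\<Sum>k<M. hpart k a) * b)"
    using N by (simp add: M_def)
  also have "\<dots> = (\<Sum>k<M. hpart (i + j) (hpart k a * b))"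
    by (simp only: sum_distrib_right hpart_sum)
  also have "\<dots> = sum T {..<M}"
    unfolding T_def by (intro sum.cong refl) (rule hpart_mult_homogeneous_left[OF homogeneous_hpart])
  also have "\<dots> = T i + sum T ({..<M} - {i})"
    by (rule sum.remove) (auto simp: M_def)
  finally have Ti: "T i = hpart (i + j) (a * b) - sum T ({..<M} - {i})" by simp
  have "sum T ({..<M} - {i}) \<in> I"
  proof (rule homogeneous_ideal_sum[OF I])
    fix k assume k: "k \<in> {..<M} - {i}"
    show "T k \<in> I"
    proof (cases "k > i")
      case True
      then show ?thesis using i(2)[of k] homogeneous_idealD(1,5)[OF I] by (simp add: T_def)
    next
      case False
      then have "i + j - k > j" using k by auto
      then show ?thesis using j(2) homogeneous_idealD(1,3)[OF I] by (simp add: T_def)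
    qed
  qed
  then have "T i \<in> I"
    unfolding Ti using homogeneous_idealD(4)[OF I ab] by (rule homogeneous_ideal_diff[OF I, rotated])
  then have "hpart i a * hpart j b \<in> I" by (simp add: T_def)
  then show False using hprime[OF homogeneous_hpart homogeneous_hpart] i(1) j(1) by blast
qed

text \<open>A maximal element among the graded ideals over \<open>I\<close> that avoid all powers of
  \<open>h\<close>. Primality is tested on homogeneous elements only, because only by adjoining
  those does the ideal stay graded.\<close>

lemma ex_homogeneous_prime_ideal:
  assumes I: "homogeneous_ideal I" and h: "\<And>n. h ^ n \<notin> I"
  obtains Q where "homogeneous_ideal Q" "I \<subseteq> Q" "h \<notin> Q" "1 \<notin> Q"
    "\<And>a b. a * b \<in> Q \<Longrightarrow> a \<in> Q \<or> b \<in> Q"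
proof -
  let ?A = "{Q. homogeneous_ideal Q \<and> I \<subseteq> Q \<and> (\<forall>n. h ^ n \<notin> Q)}"
  have "\<exists>M\<in>?A. \<forall>X\<in>?A. M \<subseteq> X \<longrightarrow> X = M"
  proof (rule subset_Zorn_nonempty)
    show "?A \<noteq> {}" using I h by blast
  next
    fix C assume C: "C \<noteq> {}" "subset.chain ?A C"
    have CA: "Q \<in> ?A" if "Q \<in> C" for Q using C(2) that by (auto simp: subset.chain_def)
    have lin: "Q \<subseteq> Q' \<or> Q' \<subseteq> Q" if "Q \<in> C" "Q' \<in> C" for Q Q'
      using C(2) that by (auto simp: subset.chain_def)
    have hC: "homogeneous_ideal Q" if "Q \<in> C" for Q using CA[OF that] by simp
    have "homogeneous_ideal (\<Union>C)"
      unfolding homogeneous_ideal_def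
    proof (intro conjI ballI allI)
      show "0 \<in> \<Union>C" using C(1) hC homogeneous_idealD(1) by blast
      fix a assume "a \<in> \<Union>C"
      then obtain Q where Q: "Q \<in> C" "a \<in> Q" by blast
      show "r * a \<in> \<Union>C" for r using Q homogeneous_idealD(3)[OF hC[OF Q(1)] Q(2), of r] by blast
      show "hpart d a \<in> \<Union>C" for d using Q homogeneous_idealD(4)[OF hC[OF Q(1)] Q(2), of d] by blast
      show "a + b \<in> \<Union>C" if b: "b \<in> \<Union>C" for b
      proof -
        obtain Q' where Q': "Q' \<in> C" "b \<in> Q'" using b by blast
        from lin[OF Q(1) Q'(1)] show ?thesis
        proof
          assume "Q \<subseteq> Q'"
          then show ?thesis using Q Q' homogeneous_idealD(2)[OF hC[OF Q'(1)], of a b] by blast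
        next
          assume "Q' \<subseteq> Q"
          then show ?thesis using Q Q' homogeneous_idealD(2)[OF hC[OF Q(1)], of a b] by blast
        qed
      qed
    qed
    moreover have "I \<subseteq> \<Union>C" using C(1) CA by blast
    moreover have "\<forall>n. h ^ n \<notin> \<Union>C" using CA by blast
    ultimately show "\<Union>C \<in> ?A" by blast
  qed
  then obtain M where "M \<in> ?A" and max': "\<forall>X\<in>?A. M \<subseteq> X \<longrightarrow> X = M" by (rule bexE)
  then have M: "homogeneous_ideal M" "I \<subseteq> M" "\<And>n. h ^ n \<notin> M" by simp_all
  have max: "X = M" if "homogeneous_ideal X" "I \<subseteq> X" "\<forall>n. h ^ n \<notin> X" "M \<subseteq> X" for X
    using bspec[OF max', of X] that by simp
  have adjoin: "\<exists>n x r. x \<in> M \<and> h ^ n = x + r * a" if a: "homogeneous d a" "a \<notin> M" for a d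
  proof (rule ccontr)
    assume neg: "\<not> ?thesis"
    let ?X = "{x + r * a | x r. x \<in> M}"
    have MX: "M \<subseteq> ?X"
    proof
      fix x assume "x \<in> M"
      then show "x \<in> ?X" by (intro CollectI exI[of _ x] exI[of _ 0]) simp
    qed
    have "?X = M"
    proof (rule max[OF homogeneous_ideal_adjoin[OF M(1) a(1)] _ _ MX])
      show "I \<subseteq> ?X" using M(2) MX by (rule subset_trans)
      show "\<forall>n. h ^ n \<notin> ?X" using neg by blast
    qed
    moreover have "a \<in> ?X"
      using homogeneous_idealD(1)[OF M(1)] by (intro CollectI exI[of _ 0] exI[of _ 1]) simp
    ultimately show False using a(2) by blast
  qed
  have hprime: "a \<in> M \<or> b \<in> M" if a: "homogeneous d a" and b: "homogeneous e b" and ab: "a * b \<in> M" for a b d e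
  proof (rule ccontr)
    assume neg: "\<not> ?thesis"
    obtain n x r where 1: "x \<in> M" "h ^ n = x + r * a" using adjoin[OF a] neg by blast
    obtain n' x' r' where 2: "x' \<in> M" "h ^ n' = x' + r' * b" using adjoin[OF b] neg by blast
    \<comment> \<open>The product of the two memberships, arranged so that every summand has a
      factor in \<open>M\<close>; the last one is \<open>a * b\<close>.\<close>
    have "h ^ (n + n') = (x' + r' * b) * x + (r * a) * x' + (r * r') * (a * b)"
      by (simp add: power_add 1(2) 2(2) algebra_simps)
    also have "\<dots> \<in> M"
      by (intro homogeneous_idealD(2,3)[OF M(1)] 1(1) 2(1) ab)
    finally show False using M(3) by blast
  qed
  show ?thesis
  proof (rule that[OF M(1,2)])
    show "h \<notin> M" using M(3)[of 1] by simp
    show "1 \<notin> M" using M(3)[of 0] by simp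
    show "a \<in> M \<or> b \<in> M" if "a * b \<in> M" for a b
    proof (rule homogeneous_ideal_prime[OF M(1) _ that])
      fix a b d e
      assume "homogeneous d a" "homogeneous e b" "a * b \<in> M"
      then show "a \<in> M \<or> b \<in> M" by (rule hprime)
    qed
  qed
qed

section \<open>Points of the curve\<close>

context curve
begin

abbreviation R :: "'k poly4 set ring" where "R \<equiv> coord_ring f g"
abbreviation Gr :: "nat \<Rightarrow> 'k poly4 set set" where "Gr \<equiv> coord_grading f g"
abbreviation res :: "'k poly4 \<Rightarrow> 'k poly4 set" where "res \<equiv> residue_class f g"
abbreviation X :: "'k poly4 set set set" where "X \<equiv> proj_points R Gr"

definition J :: "'k poly4 set" where "J = {f * u + g * v | u v. True}"

lemma J_homogeneous_ideal: "homogeneous_ideal J"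
proof -
  have 0: "homogeneous_ideal {0 :: 'k poly4}" by (simp add: homogeneous_ideal_def)
  have "{x + r * g | x r. x \<in> {x + r * f | x r. x \<in> {0 :: 'k poly4}}} = J"
    unfolding J_def by (auto simp: mult.commute)
  then show ?thesis
    using homogeneous_ideal_adjoin[OF homogeneous_ideal_adjoin[OF 0 f(1)] g(1)] by simp
qed

lemmas J_closed = homogeneous_idealD[OF J_homogeneous_ideal]
lemmas J_diff = homogeneous_ideal_diff[OF J_homogeneous_ideal]

lemma J_uminus: "a \<in> J \<Longrightarrow> - a \<in> J"
  using J_diff[OF J_closed(1)] by simp

lemma curve_ideal_eq: "curve_ideal f g = J"
proof (rule antisym)
  have "ideal J (class_ring :: 'k poly4 ring)"
  proof (rule idealI)
    show "ring (class_ring :: 'k poly4 ring)" by (rule class_ring.ring_axioms)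
    show "subgroup J (add_monoid (class_ring :: 'k poly4 ring))"
    proof
      fix x assume "x \<in> J"
      then show "inv\<^bsub>add_monoid class_ring\<^esub> x \<in> J"
        unfolding a_inv_def[symmetric] by (simp only: class_ring_simps J_uminus)
    qed (use J_closed in auto)
  qed (use J_closed in auto)
  moreover have "f \<in> J" "g \<in> J"
    unfolding J_def by (intro CollectI exI[of _ 1] exI[of _ 0]; simp) (intro CollectI exI[of _ 0] exI[of _ 1]; simp)
  ultimately show "curve_ideal f g \<subseteq> J"
    unfolding curve_ideal_def by (intro ring.genideal_minimal[OF class_ring.ring_axioms]) auto
  interpret I: ideal "curve_ideal f g" "class_ring :: 'k poly4 ring"
    unfolding curve_ideal_def by (rule ring.genideal_ideal[OF class_ring.ring_axioms]) simp
  have "{f, g} \<subseteq> curve_ideal f g" unfolding curve_ideal_def by (rule ring.genideal_self[OF class_ring.ring_axioms]) simp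
  then show "J \<subseteq> curve_ideal f g"
    using I.I_r_closed[of f] I.I_r_closed[of g] I.a_closed unfolding J_def by auto
qed

sublocale J: ideal J "class_ring :: 'k poly4 ring"
  unfolding curve_ideal_eq[symmetric] curve_ideal_def by (rule ring.genideal_ideal[OF class_ring.ring_axioms]) simp

lemma R_eq: "R = class_ring Quot J" and res_eq: "res a = J +>\<^bsub>class_ring\<^esub> a"
  by (simp_all add: coord_ring_def residue_class_def curve_ideal_eq)

lemma cring_R: "cring R"
  unfolding R_eq by (rule J.quotient_is_cring[OF class_cring.cring_axioms])

lemma res_ring_hom: "res \<in> Ring.ring_hom class_ring R"
  using J.rcos_ring_hom unfolding R_eq res_eq[abs_def] .

lemma carrier_R: "carrier R = range res"
  unfolding R_eq res_eq[abs_def] by (auto simp: FactRing_def A_RCOSETS_def')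

lemma res_carrier [simp]: "res a \<in> carrier R" by (simp add: carrier_R)

lemma res_add: "res a \<oplus>\<^bsub>R\<^esub> res b = res (a + b)"
  and res_mult: "res a \<otimes>\<^bsub>R\<^esub> res b = res (a * b)"
  and res_one: "\<one>\<^bsub>R\<^esub> = res 1"
  using Ring.ring_hom_add[OF res_ring_hom, of a b] Ring.ring_hom_mult[OF res_ring_hom, of a b]
    Ring.ring_hom_one[OF res_ring_hom] by simp_all

lemma res_eq_iff: "res a = res b \<longleftrightarrow> a - b \<in> J"
proof -
  have *: "res a = {j + a | j. j \<in> J}" for a
    unfolding res_eq by (auto simp: a_r_coset_def')
  show ?thesis
  proof
    assume "res a = res b"
    moreover have "a \<in> res a" unfolding * using J_closed(1) by force
    ultimately obtain j where "j \<in> J" "a = j + b" unfolding * by blast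
    then show "a - b \<in> J" by simp
  next
    assume ab: "a - b \<in> J"
    have "res c \<subseteq> res d" if "c - d \<in> J" for c d
    proof
      fix x assume "x \<in> res c"
      then obtain j where "j \<in> J" "x = j + c" unfolding * by blast
      then have "j + (c - d) \<in> J" "x = (j + (c - d)) + d" using J_closed(2)[OF _ that] by simp_all
      then show "x \<in> res d" unfolding * by blast
    qed
    from this[OF ab] this[of b a] J_uminus[OF ab] show "res a = res b" by simp
  qed
qed

lemma res_zero: "\<zero>\<^bsub>R\<^esub> = res 0"
proof -
  interpret cring R by (rule cring_R)
  have "res 0 \<oplus>\<^bsub>R\<^esub> res 0 = res 0" by (simp add: res_add)
  then show ?thesis using add.l_cancel_one'[of "res 0" "res 0"] by simp
qed

lemma res_minus: "res a \<ominus>\<^bsub>R\<^esub> res b = res (a - b)"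
proof -
  interpret cring R by (rule cring_R)
  have "res (- b) \<oplus>\<^bsub>R\<^esub> res b = \<zero>\<^bsub>R\<^esub>" by (simp add: res_add res_zero)
  then have "\<ominus>\<^bsub>R\<^esub> res b = res (- b)" using minus_equality by simp
  then show ?thesis by (simp add: a_minus_def res_add)
qed

lemma Gr_iff: "q \<in> Gr d \<longleftrightarrow> (\<exists>a. homogeneous d a \<and> q = res a)"
  by (auto simp: coord_grading_def)

text \<open>Lets the later arguments speak of polynomials at a point, without residue
  classes.\<close>

definition nonvanishing :: "'k poly4 set set \<Rightarrow> 'k poly4 \<Rightarrow> bool" where
  "nonvanishing P a \<longleftrightarrow> res a \<notin> P"

lemma point_primeideal: "P \<in> X \<Longrightarrow> primeideal P R"
  by (simp add: proj_points_def)

lemma nonvanishing_mult: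
  assumes "P \<in> X"
  shows "nonvanishing P (a * b) \<longleftrightarrow> nonvanishing P a \<and> nonvanishing P b"
proof -
  interpret primeideal P R by (rule point_primeideal[OF assms])
  show ?thesis
    using I_prime[of "res a" "res b"] I_l_closed[of "res b" "res a"] I_r_closed[of "res a" "res b"]
    by (auto simp: nonvanishing_def res_mult)
qed

lemma nonvanishing_one: "P \<in> X \<Longrightarrow> nonvanishing P 1"
proof -
  assume "P \<in> X"
  then interpret primeideal P R by (rule point_primeideal)
  show ?thesis using one_imp_carrier I_notcarr by (auto simp: nonvanishing_def res_one)
qed

lemma vanishing_J: "P \<in> X \<Longrightarrow> a \<in> J \<Longrightarrow> \<not> nonvanishing P a"
proof -
  assume P: "P \<in> X" and a: "a \<in> J"
  interpret primeideal P R by (rule point_primeideal[OF P])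
  have "res a = \<zero>\<^bsub>R\<^esub>" using a by (simp add: res_zero res_eq_iff)
  then show ?thesis by (simp add: nonvanishing_def)
qed

lemma nonvanishing_power: "P \<in> X \<Longrightarrow> nonvanishing P a \<Longrightarrow> nonvanishing P (a ^ n)"
  by (induction n) (simp_all add: nonvanishing_mult nonvanishing_one)

lemma nonvanishing_prod:
  assumes "P \<in> X" "finite A"
  shows "nonvanishing P (prod h A) \<longleftrightarrow> (\<forall>x\<in>A. nonvanishing P (h x))"
  using assms(2)
  by (induction A rule: finite_induct) (simp_all add: nonvanishing_mult nonvanishing_one assms(1))

lemma vanishing_sum: "P \<in> X \<Longrightarrow> nonvanishing P (sum h A) \<Longrightarrow> \<exists>x\<in>A. nonvanishing P (h x)"
proof (rule ccontr)
  assume P: "P \<in> X" and nv: "nonvanishing P (sum h A)" and "\<not> (\<exists>x\<in>A. nonvanishing P (h x))"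
  then have h: "\<And>x. x \<in> A \<Longrightarrow> res (h x) \<in> P" by (auto simp: nonvanishing_def)
  interpret primeideal P R by (rule point_primeideal[OF P])
  have "res (sum h A) \<in> P"
    using h
  proof (induction A rule: infinite_finite_induct)
    case (insert x A)
    have "res (h x) \<oplus>\<^bsub>R\<^esub> res (sum h A) \<in> P"
      by (rule additive_subgroup.a_closed[OF ideal.axioms(1)[OF is_ideal]]) (use insert in auto)
    then show ?case using insert.hyps by (simp add: res_add)
  qed (simp_all flip: res_zero)
  then show False using nv by (simp add: nonvanishing_def)
qed

text \<open>If all variables vanished at \<open>P\<close>, so would everything of positive degree,
  and \<open>P\<close> would contain the irrelevant ideal. Hence the four coordinate sets cover the
  curve.\<close>

lemma ex_nonvanishing_variable:
  assumes P: "P \<in> X"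
  shows "\<exists>i. nonvanishing P (variable i)"
proof (rule ccontr)
  assume "\<not> ?thesis"
  then have van: "\<not> nonvanishing P (variable i)" for i by blast
  interpret primeideal P R by (rule point_primeideal[OF P])
  have "(\<Union>d\<in>{1..}. Gr d) \<subseteq> P"
  proof
    fix q assume "q \<in> (\<Union>d\<in>{1..}. Gr d)"
    then obtain d a where d: "d \<ge> 1" "homogeneous d a" "q = res a" by (auto simp: Gr_iff)
    then obtain e where e: "d = Suc e" by (cases d) auto
    from homogeneous_pos_degree_variables[of e a] d(2) e
    obtain b where b: "a = (\<Sum>i\<in>UNIV. variable i * b i)" by auto
    have "\<not> nonvanishing P a"
    proof
      assume "nonvanishing P a"
      from vanishing_sum[OF P this[unfolded b]] show False
        using van P by (auto simp: nonvanishing_mult)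
    qed
    then show "q \<in> P" using d(3) by (simp add: nonvanishing_def)
  qed
  then have "genideal R (\<Union>d\<in>{1..}. Gr d) \<subseteq> P"
    by (rule genideal_minimal[OF is_ideal])
  then show False using P by (simp add: proj_points_def)
qed

text \<open>Graded primes over \<open>J\<close> correspond to graded primes of the quotient, since
  \<open>J \<subseteq> Q\<close> makes membership independent of the representative. The element
  \<open>h\<close> of positive degree outside \<open>Q\<close> shows that the irrelevant ideal is
  not contained in the image.\<close>

lemma point_of_homogeneous_prime:
  assumes Q: "homogeneous_ideal Q" "J \<subseteq> Q" "1 \<notin> Q" "\<And>a b. a * b \<in> Q \<Longrightarrow> a \<in> Q \<or> b \<in> Q"
    and h: "homogeneous d h" "d > 0" "h \<notin> Q"
  shows "res ` Q \<in> X" "\<And>a. nonvanishing (res ` Q) a \<longleftrightarrow> a \<notin> Q"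
proof -
  have mem: "res a \<in> res ` Q \<longleftrightarrow> a \<in> Q" for a
  proof
    assume "res a \<in> res ` Q"
    then obtain b where b: "b \<in> Q" "a - b \<in> J" by (auto simp: res_eq_iff)
    then show "a \<in> Q" using homogeneous_idealD(2)[OF Q(1) b(1), of "a - b"] Q(2) by auto
  qed simp
  then show nv: "nonvanishing (res ` Q) a \<longleftrightarrow> a \<notin> Q" for a by (simp add: nonvanishing_def)
  interpret R: cring R by (rule cring_R)
  have ideal: "ideal (res ` Q) R"
  proof (rule idealI)
    show "ring R" by (rule R.ring_axioms)
    show "subgroup (res ` Q) (add_monoid R)"
    proof (rule R.add.subgroupI)
      fix q q' assume "q \<in> res ` Q" "q' \<in> res ` Q"
      then obtain a b where ab: "a \<in> Q" "b \<in> Q" "q = res a" "q' = res b" by blast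
      show "q \<oplus>\<^bsub>R\<^esub> q' \<in> res ` Q" using ab homogeneous_idealD(2)[OF Q(1)] by (simp add: res_add)
      have "\<ominus>\<^bsub>R\<^esub> q = res (0 - a)" using res_minus[of 0 a] ab by (simp add: R.minus_eq flip: res_zero)
      then show "\<ominus>\<^bsub>R\<^esub> q \<in> res ` Q"
        using homogeneous_ideal_diff[OF Q(1) homogeneous_idealD(1)[OF Q(1)] ab(1)] by blast
    qed (use homogeneous_idealD(1)[OF Q(1)] in auto)
  next
    fix q x assume "q \<in> res ` Q" "x \<in> carrier R"
    then obtain a r where ar: "a \<in> Q" "q = res a" "x = res r" by (auto simp: carrier_R)
    show "x \<otimes>\<^bsub>R\<^esub> q \<in> res ` Q" "q \<otimes>\<^bsub>R\<^esub> x \<in> res ` Q"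
      using ar homogeneous_idealD(3,5)[OF Q(1)] by (simp_all add: res_mult)
  qed
  have prime: "primeideal (res ` Q) R"
  proof (rule primeidealI[OF ideal cring_R])
    show "carrier R \<noteq> res ` Q" using mem[of 1] Q(3) by (auto simp: carrier_R)
    fix q q' assume q: "q \<in> carrier R" "q' \<in> carrier R" "q \<otimes>\<^bsub>R\<^esub> q' \<in> res ` Q"
    obtain a b where "q = res a" "q' = res b" using q(1,2) unfolding carrier_R by blast
    moreover from this have "a * b \<in> Q" using q(3) by (simp only: res_mult mem)
    ultimately show "q \<in> res ` Q \<or> q' \<in> res ` Q" using Q(4) mem by blast
  qed
  have gen: "res ` Q = genideal R (res ` Q \<inter> (\<Union>d. Gr d))"
  proof (rule antisym)
    show "genideal R (res ` Q \<inter> (\<Union>d. Gr d)) \<subseteq> res ` Q"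
      by (rule R.genideal_minimal[OF ideal]) simp
    have sub: "res ` Q \<inter> (\<Union>d. Gr d) \<subseteq> carrier R" by (auto simp: carrier_R)
    interpret I: ideal "genideal R (res ` Q \<inter> (\<Union>d. Gr d))" R by (rule R.genideal_ideal[OF sub])
    show "res ` Q \<subseteq> genideal R (res ` Q \<inter> (\<Union>d. Gr d))"
    proof
      fix q assume "q \<in> res ` Q"
      then obtain a where a: "a \<in> Q" "q = res a" by blast
      obtain N where N: "(\<Sum>d<N. hpart d a) = a" using ex_sum_hpart[of a] by blast
      have "res (\<Sum>d<n. hpart d a) \<in> genideal R (res ` Q \<inter> (\<Union>d. Gr d))" for n
      proof (induction n)
        case 0
        show ?case by (simp flip: res_zero)
      next
        case (Suc n)
        have "res (hpart n a) \<in> res ` Q \<inter> (\<Union>d. Gr d)"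
        proof (intro IntI imageI UN_I[of n])
          show "hpart n a \<in> Q" by (rule homogeneous_idealD(4)[OF Q(1) a(1)])
          show "res (hpart n a) \<in> Gr n" using homogeneous_hpart[of n a] unfolding Gr_iff by blast
        qed simp
        then have "res (hpart n a) \<in> genideal R (res ` Q \<inter> (\<Union>d. Gr d))"
          using R.genideal_self[OF sub] by blast
        from I.a_closed[OF Suc this] show ?case by (simp add: res_add)
      qed
      from this[of N] show "q \<in> genideal R (res ` Q \<inter> (\<Union>d. Gr d))" using N a by simp
    qed
  qed
  have "res h \<in> genideal R (\<Union>d\<in>{1..}. Gr d)"
  proof -
    have "(\<Union>d\<in>{1..}. Gr d) \<subseteq> carrier R" by (auto simp: carrier_R Gr_iff)
    moreover have "res h \<in> Gr d" using h(1) unfolding Gr_iff by blast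
    then have "res h \<in> (\<Union>d\<in>{1..}. Gr d)" using h(2) by (intro UN_I[of d]) simp_all
    ultimately show ?thesis using R.genideal_self by blast
  qed
  then show "res ` Q \<in> X"
    using prime gen mem[of h] h(3) by (auto simp: proj_points_def)
qed

text \<open>The projective Nullstellensatz in the language of primes. It is used in contrapositive
  form: if \<open>h\<close> vanishes at every point of the curve where \<open>I\<close> vanishes,
  then some power of \<open>h\<close> lies in \<open>I\<close>.\<close>

lemma ex_point:
  assumes "homogeneous_ideal I" "J \<subseteq> I" "homogeneous d h" "d > 0" "\<And>n. h ^ n \<notin> I"
  shows "\<exists>P\<in>X. nonvanishing P h \<and> (\<forall>a\<in>I. \<not> nonvanishing P a)"
proof -
  from ex_homogeneous_prime_ideal[OF assms(1,5)] obtain Q where Q: "homogeneous_ideal Q" "I \<subseteq> Q" "h \<notin> Q"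
    "1 \<notin> Q" "\<And>a b. a * b \<in> Q \<Longrightarrow> a \<in> Q \<or> b \<in> Q" by blast
  have "J \<subseteq> Q" using assms(2) Q(2) by blast
  from point_of_homogeneous_prime[OF Q(1) this Q(4,5) assms(3,4) Q(3)] show ?thesis
    using Q by (intro bexI[of _ "res ` Q"]) auto
qed

end

section \<open>The local rings\<close>

lemma UN_const_eq: "(\<And>x. x \<in> A \<Longrightarrow> H x = C) \<Longrightarrow> A \<noteq> {} \<Longrightarrow> (\<Union>x\<in>A. H x) = C"
  by auto

text \<open>The operations on classes are unions over all representatives; once the value is seen to
  be independent of the choice, the union is that value.\<close>

lemma UN2_const:
  assumes "\<And>x y. x \<in> A \<Longrightarrow> y \<in> B \<Longrightarrow> H x y = C" "A \<noteq> {}" "B \<noteq> {}"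
  shows "(\<Union>x\<in>A. \<Union>y\<in>B. H x y) = C"
proof -
  have "(\<Union>x\<in>A. \<Union>y\<in>B. H x y) = (\<Union>x\<in>A. \<Union>y\<in>B. C)" using assms(1) by simp
  then show ?thesis using assms(2,3) by simp
qed

context curve
begin

abbreviation fr :: "'k poly4 set set \<Rightarrow> 'k poly4 \<Rightarrow> 'k poly4 \<Rightarrow> ('k poly4 set \<times> 'k poly4 set) set" where
  "fr P a s \<equiv> hfrac R Gr P (res a) (res s)"

abbreviation L :: "'k poly4 set set \<Rightarrow> ('k poly4 set \<times> 'k poly4 set) set ring" where
  "L P \<equiv> hlocal_ring R Gr P"

definition fraction :: "'k poly4 set set \<Rightarrow> 'k poly4 \<Rightarrow> 'k poly4 \<Rightarrow> bool" where
  "fraction P a s \<longleftrightarrow> P \<in> X \<and> nonvanishing P s \<and> (\<exists>d. homogeneous d a \<and> homogeneous d s)"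

text \<open>Equality in a localization. The curve may be reducible or nonreduced, so the coordinate
  ring may have zero divisors, and cross multiplication has to be relaxed by the factor
  \<open>w\<close>.\<close>

definition frac_rel where
  "frac_rel P a s b t \<longleftrightarrow> (\<exists>e w. homogeneous e w \<and> nonvanishing P w \<and> w * (a * t - b * s) \<in> J)"

lemma mem_fr_iff:
  "q \<in> fr P a s \<longleftrightarrow> (\<exists>b t. q = (res b, res t) \<and> (\<exists>e. homogeneous e b \<and> homogeneous e t) \<and>
     nonvanishing P t \<and> frac_rel P a s b t)"
proof -
  have *: "(\<exists>u\<in>(\<Union>e. Gr e) - P. u \<otimes>\<^bsub>R\<^esub> (res a \<otimes>\<^bsub>R\<^esub> res t \<ominus>\<^bsub>R\<^esub> res b \<otimes>\<^bsub>R\<^esub> res s) = \<zero>\<^bsub>R\<^esub>)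
      \<longleftrightarrow> frac_rel P a s b t" for b t
  proof
    assume "\<exists>u\<in>(\<Union>e. Gr e) - P. u \<otimes>\<^bsub>R\<^esub> (res a \<otimes>\<^bsub>R\<^esub> res t \<ominus>\<^bsub>R\<^esub> res b \<otimes>\<^bsub>R\<^esub> res s) = \<zero>\<^bsub>R\<^esub>"
    then obtain e w where "homogeneous e w" "res w \<notin> P" "w * (a * t - b * s) \<in> J"
      by (auto simp: res_mult res_minus res_zero res_eq_iff Gr_iff)
    then show "frac_rel P a s b t" unfolding frac_rel_def nonvanishing_def by blast
  next
    assume "frac_rel P a s b t"
    then obtain e w where w: "homogeneous e w" "res w \<notin> P" "w * (a * t - b * s) \<in> J"
      unfolding frac_rel_def nonvanishing_def by blast
    then have "res w \<in> (\<Union>e. Gr e) - P" by (auto simp: Gr_iff)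
    then show "\<exists>u\<in>(\<Union>e. Gr e) - P. u \<otimes>\<^bsub>R\<^esub> (res a \<otimes>\<^bsub>R\<^esub> res t \<ominus>\<^bsub>R\<^esub> res b \<otimes>\<^bsub>R\<^esub> res s) = \<zero>\<^bsub>R\<^esub>"
      by (rule bexI[rotated]) (use w(3) in \<open>simp add: res_mult res_minus res_zero res_eq_iff\<close>)
  qed
  show ?thesis
  proof
    assume "q \<in> fr P a s"
    then obtain b t e where q: "q = (res b, res t)" "homogeneous e b" "homogeneous e t" "res t \<notin> P"
      "\<exists>u\<in>(\<Union>e. Gr e) - P. u \<otimes>\<^bsub>R\<^esub> (res a \<otimes>\<^bsub>R\<^esub> res t \<ominus>\<^bsub>R\<^esub> res b \<otimes>\<^bsub>R\<^esub> res s) = \<zero>\<^bsub>R\<^esub>"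
      unfolding hfrac_def Gr_iff by blast
    then show "\<exists>b t. q = (res b, res t) \<and> (\<exists>e. homogeneous e b \<and> homogeneous e t) \<and>
        nonvanishing P t \<and> frac_rel P a s b t"
      unfolding * nonvanishing_def by blast
  next
    assume "\<exists>b t. q = (res b, res t) \<and> (\<exists>e. homogeneous e b \<and> homogeneous e t) \<and>
        nonvanishing P t \<and> frac_rel P a s b t"
    then obtain b t e where q: "q = (res b, res t)" "homogeneous e b" "homogeneous e t" "res t \<notin> P"
      "frac_rel P a s b t" unfolding nonvanishing_def by blast
    then show "q \<in> fr P a s" unfolding hfrac_def Gr_iff *[symmetric] by blast
  qed
qed

lemma frac_rel_sym: "frac_rel P a s b t \<Longrightarrow> frac_rel P b t a s"
  unfolding frac_rel_def
proof (elim exE conjE)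
  fix e w assume w: "homogeneous e w" "nonvanishing P w" "w * (a * t - b * s) \<in> J"
  have "w * (b * s - a * t) = - (w * (a * t - b * s))" by (simp add: algebra_simps)
  also have "\<dots> \<in> J" by (rule J_uminus[OF w(3)])
  finally show "\<exists>e w. homogeneous e w \<and> nonvanishing P w \<and> w * (b * s - a * t) \<in> J"
    using w(1,2) by blast
qed

lemma frac_rel_trans:
  assumes "fraction P b t" "frac_rel P a s b t" "frac_rel P b t c u"
  shows "frac_rel P a s c u"
proof -
  obtain e w where w: "homogeneous e w" "nonvanishing P w" "w * (a * t - b * s) \<in> J"
    using assms(2) by (auto simp: frac_rel_def)
  obtain e' w' where w': "homogeneous e' w'" "nonvanishing P w'" "w' * (b * u - c * t) \<in> J"
    using assms(3) by (auto simp: frac_rel_def)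
  obtain d where t: "P \<in> X" "nonvanishing P t" "homogeneous d t"
    using assms(1) by (auto simp: fraction_def)
  have "w * w' * t * (a * u - c * s) = (w' * u) * (w * (a * t - b * s)) + (w * s) * (w' * (b * u - c * t))"
    by (simp add: algebra_simps)
  also have "\<dots> \<in> J" by (intro J_closed(2,3) w(3) w'(3))
  finally show ?thesis
    using w w' t unfolding frac_rel_def
    by (intro exI[of _ "e + e' + d"] exI[of _ "w * w' * t"])
       (auto simp: nonvanishing_mult intro: homogeneous_mult)
qed

lemma frac_rel_if: "P \<in> X \<Longrightarrow> a * t - b * s \<in> J \<Longrightarrow> frac_rel P a s b t"
  unfolding frac_rel_def by (rule exI[of _ 0], rule exI[of _ 1]) (simp add: nonvanishing_one)

lemma fr_eq_iff:
  assumes "fraction P a s" "fraction P b t"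
  shows "fr P a s = fr P b t \<longleftrightarrow> frac_rel P a s b t"
proof
  assume eq: "fr P a s = fr P b t"
  have "frac_rel P b t b t" using assms(2) J_closed(1) by (intro frac_rel_if) (auto simp: fraction_def)
  then have "(res b, res t) \<in> fr P b t" using assms(2) unfolding mem_fr_iff fraction_def by blast
  then obtain b' t' where bt: "res b = res b'" "res t = res t'" "nonvanishing P t'" "frac_rel P a s b' t'"
    "\<exists>e. homogeneous e b' \<and> homogeneous e t'"
    unfolding eq[symmetric] mem_fr_iff by blast
  \<comment> \<open>A class consists of pairs of residues, so membership recovers numerator and
    denominator only modulo \<open>J\<close>; this difference bridges the two choices.\<close>
  have "b' * t - b * t' = - (t * (b - b')) + b * (t - t')" by (simp add: algebra_simps)
  also have "\<dots> \<in> J"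
    using bt(1,2) unfolding res_eq_iff by (intro J_closed(2) J_uminus J_closed(3))
  finally have "frac_rel P b' t' b t" using assms(1) by (intro frac_rel_if) (auto simp: fraction_def)
  moreover have "fraction P b' t'" using bt assms(1) by (simp add: fraction_def)
  ultimately show "frac_rel P a s b t" using frac_rel_trans bt(4) by blast
next
  assume rel: "frac_rel P a s b t"
  have *: "fr P c u \<subseteq> fr P d v" if "fraction P c u" "frac_rel P d v c u" for c u d v
  proof
    fix q assume "q \<in> fr P c u"
    then show "q \<in> fr P d v"
      unfolding mem_fr_iff using frac_rel_trans[OF that] by blast
  qed
  show "fr P a s = fr P b t"
    using *[OF assms(1) frac_rel_sym[OF rel]] *[OF assms(2) rel] by (rule equalityI)
qed

lemma fr_eqI:
  assumes "fraction P a s" "fraction P b t" "a * t = b * s"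
  shows "fr P a s = fr P b t"
  unfolding fr_eq_iff[OF assms(1,2)]
  using assms J_closed(1) by (intro frac_rel_if) (auto simp: fraction_def)

lemma fr_self_mem: "fraction P a s \<Longrightarrow> (res a, res s) \<in> fr P a s"
  using frac_rel_if[of P a s a s] J_closed(1) unfolding mem_fr_iff fraction_def by auto

lemma fr_repr:
  assumes "fraction P a s" "q \<in> fr P a s"
  obtains b t where "q = (res b, res t)" "fraction P b t" "fr P a s = fr P b t"
proof -
  obtain b t where q: "q = (res b, res t)" "\<exists>e. homogeneous e b \<and> homogeneous e t" "nonvanishing P t"
    "frac_rel P a s b t" using assms(2) unfolding mem_fr_iff by blast
  then have "fraction P b t" using assms(1) by (simp add: fraction_def)
  with q fr_eq_iff[OF assms(1) this] show ?thesis by (intro that) auto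
qed

lemma fraction_mult: "fraction P a s \<Longrightarrow> fraction P b t \<Longrightarrow> fraction P (a * b) (s * t)"
  unfolding fraction_def by (auto simp: nonvanishing_mult intro: homogeneous_mult)

lemma fraction_add:
  assumes "fraction P a s" "fraction P b t"
  shows "fraction P (a * t + b * s) (s * t)"
proof -
  obtain d e where d: "homogeneous d a" "homogeneous d s" and e: "homogeneous e b" "homogeneous e t"
    using assms by (auto simp: fraction_def)
  have "homogeneous (d + e) (a * t + b * s)"
    using homogeneous_mult[OF d(1) e(2)] homogeneous_mult[OF e(1) d(2)]
    by (intro homogeneous_add) (simp_all add: add.commute)
  with homogeneous_mult[OF d(2) e(2)] assms show ?thesis
    unfolding fraction_def by (auto simp: nonvanishing_mult)
qed

lemma fraction_uminus: "fraction P a s \<Longrightarrow> fraction P (- a) s"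
  unfolding fraction_def by (auto intro: homogeneous_uminus)

lemma fraction_const: "P \<in> X \<Longrightarrow> homogeneous 0 c \<Longrightarrow> fraction P c 1"
  by (auto simp: fraction_def nonvanishing_one)

lemma L_carrier: "P \<in> X \<Longrightarrow> carrier (L P) = {fr P a s | a s. fraction P a s}"
  unfolding hlocal_ring_def fraction_def nonvanishing_def Gr_iff by auto

lemma fr_carrier: "fraction P a s \<Longrightarrow> fr P a s \<in> carrier (L P)"
  by (subst L_carrier) (auto simp: fraction_def)

lemma fr_mult:
  assumes "fraction P a s" "fraction P b t"
  shows "fr P a s \<otimes>\<^bsub>L P\<^esub> fr P b t = fr P (a * b) (s * t)"
proof -
  have "(\<Union>q\<in>fr P a s. \<Union>r\<in>fr P b t. case q of (a, s) \<Rightarrow> case r of (b, t) \<Rightarrow>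
      hfrac R Gr P (a \<otimes>\<^bsub>R\<^esub> b) (s \<otimes>\<^bsub>R\<^esub> t)) = fr P (a * b) (s * t)"
  proof (rule UN2_const)
    fix q r assume "q \<in> fr P a s" "r \<in> fr P b t"
    then obtain a' s' b' t' where q: "q = (res a', res s')" "fraction P a' s'" "fr P a s = fr P a' s'"
      and r: "r = (res b', res t')" "fraction P b' t'" "fr P b t = fr P b' t'"
      using fr_repr assms by metis
    obtain e w where w: "homogeneous e w" "nonvanishing P w" "w * (a * s' - a' * s) \<in> J"
      using fr_eq_iff[OF assms(1) q(2)] q(3) by (auto simp: frac_rel_def)
    obtain e' v where v: "homogeneous e' v" "nonvanishing P v" "v * (b * t' - b' * t) \<in> J"
      using fr_eq_iff[OF assms(2) r(2)] r(3) by (auto simp: frac_rel_def)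
    have "w * v * (a * b * (s' * t') - a' * b' * (s * t))
        = (v * b * t') * (w * (a * s' - a' * s)) + (w * a' * s) * (v * (b * t' - b' * t))"
      by (simp add: algebra_simps)
    also have "\<dots> \<in> J" by (intro J_closed(2,3) w(3) v(3))
    finally have "frac_rel P (a * b) (s * t) (a' * b') (s' * t')"
      using w v assms unfolding frac_rel_def fraction_def
      by (intro exI[of _ "e + e'"] exI[of _ "w * v"]) (auto simp: nonvanishing_mult intro: homogeneous_mult)
    then show "(case q of (a, s) \<Rightarrow> case r of (b, t) \<Rightarrow> hfrac R Gr P (a \<otimes>\<^bsub>R\<^esub> b) (s \<otimes>\<^bsub>R\<^esub> t))
        = fr P (a * b) (s * t)"
      using fr_eq_iff[OF fraction_mult[OF assms] fraction_mult[OF q(2) r(2)]]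
      by (simp add: q(1) r(1) res_mult)
  qed (use fr_self_mem assms in auto)
  then show ?thesis by (simp add: hlocal_ring_def split_def)
qed

lemma fr_add:
  assumes "fraction P a s" "fraction P b t"
  shows "fr P a s \<oplus>\<^bsub>L P\<^esub> fr P b t = fr P (a * t + b * s) (s * t)"
proof -
  have "(\<Union>q\<in>fr P a s. \<Union>r\<in>fr P b t. case q of (a, s) \<Rightarrow> case r of (b, t) \<Rightarrow>
      hfrac R Gr P (a \<otimes>\<^bsub>R\<^esub> t \<oplus>\<^bsub>R\<^esub> b \<otimes>\<^bsub>R\<^esub> s) (s \<otimes>\<^bsub>R\<^esub> t)) = fr P (a * t + b * s) (s * t)"
  proof (rule UN2_const)
    fix q r assume "q \<in> fr P a s" "r \<in> fr P b t"
    then obtain a' s' b' t' where q: "q = (res a', res s')" "fraction P a' s'" "fr P a s = fr P a' s'"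
      and r: "r = (res b', res t')" "fraction P b' t'" "fr P b t = fr P b' t'"
      using fr_repr assms by metis
    obtain e w where w: "homogeneous e w" "nonvanishing P w" "w * (a * s' - a' * s) \<in> J"
      using fr_eq_iff[OF assms(1) q(2)] q(3) by (auto simp: frac_rel_def)
    obtain e' v where v: "homogeneous e' v" "nonvanishing P v" "v * (b * t' - b' * t) \<in> J"
      using fr_eq_iff[OF assms(2) r(2)] r(3) by (auto simp: frac_rel_def)
    have "w * v * ((a * t + b * s) * (s' * t') - (a' * t' + b' * s') * (s * t))
        = (v * t * t') * (w * (a * s' - a' * s)) + (w * s * s') * (v * (b * t' - b' * t))"
      by (simp add: algebra_simps)
    also have "\<dots> \<in> J" by (intro J_closed(2,3) w(3) v(3))
    finally have "frac_rel P (a * t + b * s) (s * t) (a' * t' + b' * s') (s' * t')"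
      using w v assms unfolding frac_rel_def fraction_def
      by (intro exI[of _ "e + e'"] exI[of _ "w * v"]) (auto simp: nonvanishing_mult intro: homogeneous_mult)
    then show "(case q of (a, s) \<Rightarrow> case r of (b, t) \<Rightarrow>
        hfrac R Gr P (a \<otimes>\<^bsub>R\<^esub> t \<oplus>\<^bsub>R\<^esub> b \<otimes>\<^bsub>R\<^esub> s) (s \<otimes>\<^bsub>R\<^esub> t)) = fr P (a * t + b * s) (s * t)"
      using fr_eq_iff[OF fraction_add[OF assms] fraction_add[OF q(2) r(2)]]
      by (simp add: q(1) r(1) res_mult res_add)
  qed (use fr_self_mem assms in auto)
  then show ?thesis by (simp add: hlocal_ring_def split_def)
qed

lemma fr_zero: "\<zero>\<^bsub>L P\<^esub> = fr P 0 1" and fr_one: "\<one>\<^bsub>L P\<^esub> = fr P 1 1"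
  by (simp_all add: hlocal_ring_def res_zero res_one)

lemma fr_eq_zeroI: "fraction P a s \<Longrightarrow> homogeneous e w \<Longrightarrow> nonvanishing P w \<Longrightarrow> w * a \<in> J \<Longrightarrow> fr P a s = \<zero>\<^bsub>L P\<^esub>"
  unfolding fr_zero using fraction_const[of P 0]
  by (subst fr_eq_iff) (auto simp: frac_rel_def fraction_def)

lemma cring_L:
  assumes P: "P \<in> X"
  shows "cring (L P)"
proof (rule cringI)
  note 0 = fraction_const[OF P homogeneous_zero]
  note 1 = fraction_const[OF P homogeneous_one]
  note frac = fraction_add fraction_mult 0 1
  have elem: "\<exists>a s. fraction P a s \<and> x = fr P a s" if "x \<in> carrier (L P)" for x
    using that unfolding L_carrier[OF P] by blast
  show "abelian_group (L P)"
  proof (rule abelian_groupI)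
    show "\<zero>\<^bsub>L P\<^esub> \<in> carrier (L P)" unfolding fr_zero by (rule fr_carrier[OF 0])
    fix x assume "x \<in> carrier (L P)"
    then obtain a s where x: "fraction P a s" "x = fr P a s" using elem by blast
    show "\<zero>\<^bsub>L P\<^esub> \<oplus>\<^bsub>L P\<^esub> x = x"
      unfolding x(2) fr_zero fr_add[OF 0 x(1)] by (rule fr_eqI) (simp_all add: frac x)
    show "\<exists>y\<in>carrier (L P). y \<oplus>\<^bsub>L P\<^esub> x = \<zero>\<^bsub>L P\<^esub>"
    proof (rule bexI[OF _ fr_carrier[OF fraction_uminus[OF x(1)]]])
      show "fr P (- a) s \<oplus>\<^bsub>L P\<^esub> x = \<zero>\<^bsub>L P\<^esub>"
        unfolding x(2) fr_zero fr_add[OF fraction_uminus[OF x(1)] x(1)]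
        by (rule fr_eqI[OF fraction_add[OF fraction_uminus[OF x(1)] x(1)] 0]) simp
    qed
    fix y assume "y \<in> carrier (L P)"
    then obtain b t where y: "fraction P b t" "y = fr P b t" using elem by blast
    show "x \<oplus>\<^bsub>L P\<^esub> y \<in> carrier (L P)"
      unfolding x(2) y(2) fr_add[OF x(1) y(1)] by (rule fr_carrier[OF fraction_add[OF x(1) y(1)]])
    show "x \<oplus>\<^bsub>L P\<^esub> y = y \<oplus>\<^bsub>L P\<^esub> x"
      unfolding x(2) y(2) fr_add[OF x(1) y(1)] fr_add[OF y(1) x(1)]
      by (rule fr_eqI[OF fraction_add[OF x(1) y(1)] fraction_add[OF y(1) x(1)]]) (simp add: algebra_simps)
    fix z assume "z \<in> carrier (L P)"
    then obtain c u where z: "fraction P c u" "z = fr P c u" using elem by blast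
    show "x \<oplus>\<^bsub>L P\<^esub> y \<oplus>\<^bsub>L P\<^esub> z = x \<oplus>\<^bsub>L P\<^esub> (y \<oplus>\<^bsub>L P\<^esub> z)"
      unfolding x(2) y(2) z(2) fr_add[OF x(1) y(1)] fr_add[OF y(1) z(1)]
        fr_add[OF fraction_add[OF x(1) y(1)] z(1)] fr_add[OF x(1) fraction_add[OF y(1) z(1)]]
      by (rule fr_eqI[OF fraction_add[OF fraction_add[OF x(1) y(1)] z(1)]
            fraction_add[OF x(1) fraction_add[OF y(1) z(1)]]]) (simp add: algebra_simps)
  qed
  show "comm_monoid (L P)"
  proof (rule comm_monoidI)
    show "\<one>\<^bsub>L P\<^esub> \<in> carrier (L P)" unfolding fr_one by (rule fr_carrier[OF 1])
    fix x assume "x \<in> carrier (L P)"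
    then obtain a s where x: "fraction P a s" "x = fr P a s" using elem by blast
    show "\<one>\<^bsub>L P\<^esub> \<otimes>\<^bsub>L P\<^esub> x = x"
      unfolding x(2) fr_one fr_mult[OF 1 x(1)] by simp
    fix y assume "y \<in> carrier (L P)"
    then obtain b t where y: "fraction P b t" "y = fr P b t" using elem by blast
    show "x \<otimes>\<^bsub>L P\<^esub> y \<in> carrier (L P)"
      unfolding x(2) y(2) fr_mult[OF x(1) y(1)] by (rule fr_carrier[OF fraction_mult[OF x(1) y(1)]])
    show "x \<otimes>\<^bsub>L P\<^esub> y = y \<otimes>\<^bsub>L P\<^esub> x"
      unfolding x(2) y(2) fr_mult[OF x(1) y(1)] fr_mult[OF y(1) x(1)] by (simp only: mult.commute)
    fix z assume "z \<in> carrier (L P)"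
    then obtain c u where z: "fraction P c u" "z = fr P c u" using elem by blast
    show "x \<otimes>\<^bsub>L P\<^esub> y \<otimes>\<^bsub>L P\<^esub> z = x \<otimes>\<^bsub>L P\<^esub> (y \<otimes>\<^bsub>L P\<^esub> z)"
      unfolding x(2) y(2) z(2) fr_mult[OF x(1) y(1)] fr_mult[OF y(1) z(1)]
        fr_mult[OF fraction_mult[OF x(1) y(1)] z(1)] fr_mult[OF x(1) fraction_mult[OF y(1) z(1)]]
      by (simp only: mult.assoc)
  qed
  fix x y z assume "x \<in> carrier (L P)" "y \<in> carrier (L P)" "z \<in> carrier (L P)"
  then obtain a s b t c u where x: "fraction P a s" "x = fr P a s" and y: "fraction P b t" "y = fr P b t"
    and z: "fraction P c u" "z = fr P c u" using elem by metis
  show "(x \<oplus>\<^bsub>L P\<^esub> y) \<otimes>\<^bsub>L P\<^esub> z = x \<otimes>\<^bsub>L P\<^esub> z \<oplus>\<^bsub>L P\<^esub> y \<otimes>\<^bsub>L P\<^esub> z"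
    unfolding x(2) y(2) z(2) fr_add[OF x(1) y(1)] fr_mult[OF x(1) z(1)] fr_mult[OF y(1) z(1)]
      fr_mult[OF fraction_add[OF x(1) y(1)] z(1)]
      fr_add[OF fraction_mult[OF x(1) z(1)] fraction_mult[OF y(1) z(1)]]
    by (rule fr_eqI[OF fraction_mult[OF fraction_add[OF x(1) y(1)] z(1)]
          fraction_add[OF fraction_mult[OF x(1) z(1)] fraction_mult[OF y(1) z(1)]]])
       (simp add: algebra_simps)
qed

lemma fr_uminus:
  assumes "fraction P a s"
  shows "\<ominus>\<^bsub>L P\<^esub> fr P a s = fr P (- a) s"
proof -
  have P: "P \<in> X" using assms by (simp add: fraction_def)
  interpret cring "L P" by (rule cring_L[OF P])
  note u = fraction_uminus[OF assms]
  have "fr P (- a) s \<oplus>\<^bsub>L P\<^esub> fr P a s = \<zero>\<^bsub>L P\<^esub>"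
    unfolding fr_add[OF u assms] fr_zero
    by (rule fr_eqI[OF fraction_add[OF u assms] fraction_const[OF P homogeneous_zero]]) simp
  then show ?thesis using fr_carrier[OF assms] fr_carrier[OF u] by (rule minus_equality)
qed

lemma fr_power:
  assumes "fraction P a s"
  shows "fraction P (a ^ n) (s ^ n)" "fr P a s [^]\<^bsub>L P\<^esub> n = fr P (a ^ n) (s ^ n)"
proof -
  have P: "P \<in> X" using assms by (simp add: fraction_def)
  interpret cring "L P" by (rule cring_L[OF P])
  show *: "fraction P (a ^ n) (s ^ n)" for n
    using assms by (induction n) (simp_all add: fraction_mult fraction_const[OF P])
  show "fr P a s [^]\<^bsub>L P\<^esub> n = fr P (a ^ n) (s ^ n)"
  proof (induction n)
    case (Suc n)
    then show ?case by (simp add: fr_mult[OF * assms] mult.commute)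
  qed (simp add: fr_one)
qed

end

section \<open>The first cohomology module of a sheaf of functions\<close>

context abelian_group
begin

lemma diff_telescope:
  assumes "a \<in> carrier G" "b \<in> carrier G" "c \<in> carrier G"
  shows "(a \<ominus> b) \<oplus> (b \<ominus> c) = a \<ominus> c"
  using assms by (simp add: a_minus_def a_assoc r_neg1)

lemma add_diff_add:
  assumes "a \<in> carrier G" "b \<in> carrier G" "c \<in> carrier G" "d \<in> carrier G"
  shows "(a \<oplus> b) \<ominus> (c \<oplus> d) = (a \<ominus> c) \<oplus> (b \<ominus> d)"
  using assms by (simp add: a_minus_def minus_add a_ac)

lemma minus_diff:
  assumes "a \<in> carrier G" "b \<in> carrier G"
  shows "\<ominus> (a \<ominus> b) = b \<ominus> a"
  using assms by (simp add: a_minus_def minus_add a_ac)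

lemma minus_diff_minus:
  assumes "a \<in> carrier G" "b \<in> carrier G"
  shows "(\<ominus> a) \<ominus> (\<ominus> b) = b \<ominus> a"
  using assms by (simp add: a_minus_def a_ac)

lemma diff_eq_iff:
  assumes "a \<in> carrier G" "b \<in> carrier G" "c \<in> carrier G"
  shows "a \<ominus> b = c \<longleftrightarrow> a = c \<oplus> b"
proof
  assume "a \<ominus> b = c"
  then have "c \<oplus> b = (a \<ominus> b) \<oplus> b" by simp
  also have "\<dots> = a" using assms by (simp add: a_minus_def a_assoc l_neg)
  finally show "a = c \<oplus> b" by simp
next
  assume "a = c \<oplus> b"
  then show "a \<ominus> b = c" using assms by (simp add: a_minus_def a_assoc r_neg)
qed

end

text \<open>Sections over \<open>U\<close> are functions with values in rings \<open>A p\<close>,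
  and all operations are pointwise, so an identity of sections can be checked in one ring at a time.
  The map \<open>\<kappa>\<close> gives the image of the base field in each of these rings.\<close>

locale function_sheaf =
  fixes T :: "'p topology" and F :: "'p set \<Rightarrow> ('k::field, 'p \<Rightarrow> 'v) module"
    and A :: "'p \<Rightarrow> 'v ring" and \<kappa> :: "'k \<Rightarrow> 'p \<Rightarrow> 'v"
  assumes stalk: "p \<in> topspace T \<Longrightarrow> cring (A p)"
    and sheaf_extensional: "\<sigma> \<in> carrier (F U) \<Longrightarrow> \<sigma> \<in> extensional U"
    and sheaf_stalk: "openin T U \<Longrightarrow> \<sigma> \<in> carrier (F U) \<Longrightarrow> p \<in> U \<Longrightarrow> \<sigma> p \<in> carrier (A p)"
    and sheaf_add: "\<sigma> \<oplus>\<^bsub>F U\<^esub> \<tau> = (\<lambda>p\<in>U. \<sigma> p \<oplus>\<^bsub>A p\<^esub> \<tau> p)"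
    and sheaf_mult: "\<sigma> \<otimes>\<^bsub>F U\<^esub> \<tau> = (\<lambda>p\<in>U. \<sigma> p \<otimes>\<^bsub>A p\<^esub> \<tau> p)"
    and sheaf_zero: "\<zero>\<^bsub>F U\<^esub> = (\<lambda>p\<in>U. \<zero>\<^bsub>A p\<^esub>)"
    and sheaf_one: "\<one>\<^bsub>F U\<^esub> = (\<lambda>p\<in>U. \<one>\<^bsub>A p\<^esub>)"
    and sheaf_smult: "k \<odot>\<^bsub>F U\<^esub> \<sigma> = (\<lambda>p\<in>U. \<kappa> k p \<otimes>\<^bsub>A p\<^esub> \<sigma> p)"
    and scalar_carrier: "p \<in> topspace T \<Longrightarrow> \<kappa> k p \<in> carrier (A p)"
    and scalar_add: "p \<in> topspace T \<Longrightarrow> \<kappa> (k + l) p = \<kappa> k p \<oplus>\<^bsub>A p\<^esub> \<kappa> l p"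
    and scalar_mult: "p \<in> topspace T \<Longrightarrow> \<kappa> (k * l) p = \<kappa> k p \<otimes>\<^bsub>A p\<^esub> \<kappa> l p"
    and scalar_one: "p \<in> topspace T \<Longrightarrow> \<kappa> 1 p = \<one>\<^bsub>A p\<^esub>"
    and add_closed: "openin T U \<Longrightarrow> \<sigma> \<in> carrier (F U) \<Longrightarrow> \<tau> \<in> carrier (F U) \<Longrightarrow> \<sigma> \<oplus>\<^bsub>F U\<^esub> \<tau> \<in> carrier (F U)"
    and mult_closed: "openin T U \<Longrightarrow> \<sigma> \<in> carrier (F U) \<Longrightarrow> \<tau> \<in> carrier (F U) \<Longrightarrow> \<sigma> \<otimes>\<^bsub>F U\<^esub> \<tau> \<in> carrier (F U)"
    and zero_closed: "openin T U \<Longrightarrow> \<zero>\<^bsub>F U\<^esub> \<in> carrier (F U)"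
    and one_closed: "openin T U \<Longrightarrow> \<one>\<^bsub>F U\<^esub> \<in> carrier (F U)"
    and uminus_closed: "openin T U \<Longrightarrow> \<sigma> \<in> carrier (F U) \<Longrightarrow> (\<lambda>p\<in>U. \<ominus>\<^bsub>A p\<^esub> \<sigma> p) \<in> carrier (F U)"
    and smult_closed: "openin T U \<Longrightarrow> \<sigma> \<in> carrier (F U) \<Longrightarrow> k \<odot>\<^bsub>F U\<^esub> \<sigma> \<in> carrier (F U)"
    and restrict_closed: "openin T U \<Longrightarrow> openin T V \<Longrightarrow> V \<subseteq> U \<Longrightarrow> \<sigma> \<in> carrier (F U) \<Longrightarrow> restrict \<sigma> V \<in> carrier (F V)"
begin

lemma open_point: "openin T U \<Longrightarrow> p \<in> U \<Longrightarrow> p \<in> topspace T"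
  using openin_subset by blast

lemma stalk_group: "p \<in> topspace T \<Longrightarrow> abelian_group (A p)"
  using stalk by (auto simp: cring_def ring_def)

lemma sections_eqI:
  "\<sigma> \<in> carrier (F U) \<Longrightarrow> \<tau> \<in> carrier (F U) \<Longrightarrow> (\<And>p. p \<in> U \<Longrightarrow> \<sigma> p = \<tau> p) \<Longrightarrow> \<sigma> = \<tau>"
  by (rule extensionalityI[of _ U]) (auto dest: sheaf_extensional)

lemma sections_abelian_group:
  assumes U: "openin T U"
  shows "abelian_group (F U)"
proof (rule abelian_groupI)
  note pt = open_point[OF U]
  note st = sheaf_stalk[OF U]
  show "\<zero>\<^bsub>F U\<^esub> \<in> carrier (F U)" by (rule zero_closed[OF U])
  fix \<sigma> assume \<sigma>: "\<sigma> \<in> carrier (F U)"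
  show "\<zero>\<^bsub>F U\<^esub> \<oplus>\<^bsub>F U\<^esub> \<sigma> = \<sigma>"
  proof (rule sections_eqI[OF add_closed[OF U zero_closed[OF U] \<sigma>] \<sigma>])
    fix p assume p: "p \<in> U"
    interpret abelian_group "A p" by (rule stalk_group[OF pt[OF p]])
    show "(\<zero>\<^bsub>F U\<^esub> \<oplus>\<^bsub>F U\<^esub> \<sigma>) p = \<sigma> p" using p st[OF \<sigma> p] by (simp add: sheaf_add sheaf_zero)
  qed
  show "\<exists>\<tau>\<in>carrier (F U). \<tau> \<oplus>\<^bsub>F U\<^esub> \<sigma> = \<zero>\<^bsub>F U\<^esub>"
  proof (rule bexI[OF _ uminus_closed[OF U \<sigma>]])
    show "(\<lambda>p\<in>U. \<ominus>\<^bsub>A p\<^esub> \<sigma> p) \<oplus>\<^bsub>F U\<^esub> \<sigma> = \<zero>\<^bsub>F U\<^esub>"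
    proof (rule sections_eqI[OF add_closed[OF U uminus_closed[OF U \<sigma>] \<sigma>] zero_closed[OF U]])
      fix p assume p: "p \<in> U"
      interpret abelian_group "A p" by (rule stalk_group[OF pt[OF p]])
      show "((\<lambda>p\<in>U. \<ominus>\<^bsub>A p\<^esub> \<sigma> p) \<oplus>\<^bsub>F U\<^esub> \<sigma>) p = \<zero>\<^bsub>F U\<^esub> p"
        using p st[OF \<sigma> p] by (simp add: sheaf_add sheaf_zero l_neg)
    qed
  qed
  fix \<tau> assume \<tau>: "\<tau> \<in> carrier (F U)"
  show "\<sigma> \<oplus>\<^bsub>F U\<^esub> \<tau> \<in> carrier (F U)" by (rule add_closed[OF U \<sigma> \<tau>])
  show "\<sigma> \<oplus>\<^bsub>F U\<^esub> \<tau> = \<tau> \<oplus>\<^bsub>F U\<^esub> \<sigma>"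
  proof (rule sections_eqI[OF add_closed[OF U \<sigma> \<tau>] add_closed[OF U \<tau> \<sigma>]])
    fix p assume p: "p \<in> U"
    interpret abelian_group "A p" by (rule stalk_group[OF pt[OF p]])
    show "(\<sigma> \<oplus>\<^bsub>F U\<^esub> \<tau>) p = (\<tau> \<oplus>\<^bsub>F U\<^esub> \<sigma>) p" using p st[OF \<sigma> p] st[OF \<tau> p] by (simp add: sheaf_add a_comm)
  qed
  fix \<upsilon> assume \<upsilon>: "\<upsilon> \<in> carrier (F U)"
  show "\<sigma> \<oplus>\<^bsub>F U\<^esub> \<tau> \<oplus>\<^bsub>F U\<^esub> \<upsilon> = \<sigma> \<oplus>\<^bsub>F U\<^esub> (\<tau> \<oplus>\<^bsub>F U\<^esub> \<upsilon>)"
  proof (rule sections_eqI[OF add_closed[OF U add_closed[OF U \<sigma> \<tau>] \<upsilon>] add_closed[OF U \<sigma> add_closed[OF U \<tau> \<upsilon>]]])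
    fix p assume p: "p \<in> U"
    interpret abelian_group "A p" by (rule stalk_group[OF pt[OF p]])
    show "(\<sigma> \<oplus>\<^bsub>F U\<^esub> \<tau> \<oplus>\<^bsub>F U\<^esub> \<upsilon>) p = (\<sigma> \<oplus>\<^bsub>F U\<^esub> (\<tau> \<oplus>\<^bsub>F U\<^esub> \<upsilon>)) p"
      using p st[OF \<sigma> p] st[OF \<tau> p] st[OF \<upsilon> p] by (simp add: sheaf_add a_assoc)
  qed
qed

lemma sections_diff:
  assumes U: "openin T U" and \<sigma>: "\<sigma> \<in> carrier (F U)" and \<tau>: "\<tau> \<in> carrier (F U)"
  shows "\<sigma> \<ominus>\<^bsub>F U\<^esub> \<tau> = (\<lambda>p\<in>U. \<sigma> p \<ominus>\<^bsub>A p\<^esub> \<tau> p)"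
proof -
  interpret G: abelian_group "F U" by (rule sections_abelian_group[OF U])
  have "\<ominus>\<^bsub>F U\<^esub> \<tau> = (\<lambda>p\<in>U. \<ominus>\<^bsub>A p\<^esub> \<tau> p)"
  proof (rule G.minus_equality[OF _ \<tau> uminus_closed[OF U \<tau>]])
    show "(\<lambda>p\<in>U. \<ominus>\<^bsub>A p\<^esub> \<tau> p) \<oplus>\<^bsub>F U\<^esub> \<tau> = \<zero>\<^bsub>F U\<^esub>"
    proof (rule sections_eqI[OF add_closed[OF U uminus_closed[OF U \<tau>] \<tau>] zero_closed[OF U]])
      fix p assume p: "p \<in> U"
      interpret abelian_group "A p" by (rule stalk_group[OF open_point[OF U p]])
      show "((\<lambda>p\<in>U. \<ominus>\<^bsub>A p\<^esub> \<tau> p) \<oplus>\<^bsub>F U\<^esub> \<tau>) p = \<zero>\<^bsub>F U\<^esub> p"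
        using p sheaf_stalk[OF U \<tau> p] by (simp add: sheaf_add sheaf_zero l_neg)
    qed
  qed
  then show ?thesis by (auto simp: a_minus_def[of "F U"] a_minus_def[of "A _"] sheaf_add)
qed

lemma sections_power:
  "\<sigma> [^]\<^bsub>F U\<^esub> (n :: nat) = (\<lambda>p\<in>U. \<sigma> p [^]\<^bsub>A p\<^esub> n)"
proof (induction n)
  case (Suc n)
  have "\<sigma> [^]\<^bsub>F U\<^esub> Suc n = (\<sigma> [^]\<^bsub>F U\<^esub> n) \<otimes>\<^bsub>F U\<^esub> \<sigma>" by (simp add: nat_pow_def)
  also have "\<dots> = (\<lambda>p\<in>U. \<sigma> p [^]\<^bsub>A p\<^esub> n \<otimes>\<^bsub>A p\<^esub> \<sigma> p)"
    unfolding Suc.IH sheaf_mult by (rule restrict_ext) simp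
  also have "\<dots> = (\<lambda>p\<in>U. \<sigma> p [^]\<^bsub>A p\<^esub> Suc n)" by (simp add: nat_pow_def)
  finally show ?case .
qed (simp add: sheaf_one nat_pow_def)

lemma power_closed:
  "openin T U \<Longrightarrow> \<sigma> \<in> carrier (F U) \<Longrightarrow> \<sigma> [^]\<^bsub>F U\<^esub> (n :: nat) \<in> carrier (F U)"
proof (induction n)
  case (Suc n)
  have "\<sigma> [^]\<^bsub>F U\<^esub> Suc n = (\<sigma> [^]\<^bsub>F U\<^esub> n) \<otimes>\<^bsub>F U\<^esub> \<sigma>" by (simp add: nat_pow_def)
  then show ?case using Suc mult_closed by simp
qed (simp add: one_closed nat_pow_def)

lemma sections_plus_closed:
  assumes "openin T U" "openin T V" "openin T W" "W \<subseteq> U" "W \<subseteq> V" "\<sigma> \<in> carrier (F U)" "\<tau> \<in> carrier (F V)"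
  shows "(\<lambda>p\<in>W. \<sigma> p \<oplus>\<^bsub>A p\<^esub> \<tau> p) \<in> carrier (F W)"
proof -
  have "restrict \<sigma> W \<oplus>\<^bsub>F W\<^esub> restrict \<tau> W \<in> carrier (F W)"
    using assms by (intro add_closed restrict_closed)
  moreover have "restrict \<sigma> W \<oplus>\<^bsub>F W\<^esub> restrict \<tau> W = (\<lambda>p\<in>W. \<sigma> p \<oplus>\<^bsub>A p\<^esub> \<tau> p)"
    unfolding sheaf_add by (rule restrict_ext) simp
  ultimately show ?thesis by simp
qed

section \<open>Cocycles and coboundaries in pointwise form\<close>

abbreviation "pcover \<equiv> pointed_cover T"

lemma pcoverD: "pcover U \<Longrightarrow> x \<in> topspace T \<Longrightarrow> openin T (U x) \<and> x \<in> U x"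
  by (simp add: pointed_cover_def)

lemma cover_point: "pcover U \<Longrightarrow> x \<in> topspace T \<Longrightarrow> p \<in> U x \<Longrightarrow> p \<in> topspace T"
  using pcoverD open_point by blast

lemma pcover_Int: "pcover U \<Longrightarrow> pcover V \<Longrightarrow> pcover (\<lambda>x. U x \<inter> V x)"
  by (simp add: pointed_cover_def openin_Int)

lemma pcover_openin_Int:
  "pcover U \<Longrightarrow> x \<in> topspace T \<Longrightarrow> y \<in> topspace T \<Longrightarrow> openin T (U x \<inter> U y)"
  by (simp add: pointed_cover_def openin_Int)

text \<open>With values compared point by point, the restrictions in \<open>cocycles\<close>
  disappear; \<open>cobounds\<close> does the same for \<open>cohomologous\<close> and names the
  refinement and the cochain.\<close>

definition pointwise_cocycle :: "('p \<Rightarrow> 'p set) \<Rightarrow> ('p \<Rightarrow> 'p \<Rightarrow> 'p \<Rightarrow> 'v) \<Rightarrow> bool" where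
  "pointwise_cocycle U c \<longleftrightarrow> pcover U \<and>
     (\<forall>x\<in>topspace T. \<forall>y\<in>topspace T. c x y \<in> carrier (F (U x \<inter> U y))) \<and>
     (\<forall>x\<in>topspace T. \<forall>y\<in>topspace T. \<forall>z\<in>topspace T. \<forall>p\<in>U x \<inter> U y \<inter> U z.
        c x z p = c x y p \<oplus>\<^bsub>A p\<^esub> c y z p)"

lemma cocycles_iff: "(U, c) \<in> cocycles T F \<longleftrightarrow> pointwise_cocycle U c"
proof -
  have "restrict (c x z) W = restrict (c x y) W \<oplus>\<^bsub>F W\<^esub> restrict (c y z) W
    \<longleftrightarrow> (\<forall>p\<in>W. c x z p = c x y p \<oplus>\<^bsub>A p\<^esub> c y z p)" for x y z W
    by (auto simp: sheaf_add fun_eq_iff restrict_def)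
  then show ?thesis by (simp add: cocycles_def pointwise_cocycle_def Let_def)
qed

lemma cocycle_cover: "pointwise_cocycle U c \<Longrightarrow> pcover U"
  by (simp add: pointwise_cocycle_def)

lemma cocycle_section:
  "pointwise_cocycle U c \<Longrightarrow> x \<in> topspace T \<Longrightarrow> y \<in> topspace T \<Longrightarrow> c x y \<in> carrier (F (U x \<inter> U y))"
  by (simp add: pointwise_cocycle_def)

lemma cocycle_stalk:
  assumes "pointwise_cocycle U c" "x \<in> topspace T" "y \<in> topspace T" "p \<in> U x" "p \<in> U y"
  shows "c x y p \<in> carrier (A p)"
  using sheaf_stalk[OF pcover_openin_Int[OF cocycle_cover[OF assms(1)] assms(2,3)] cocycle_section[OF assms(1-3)], of p]
    assms(4,5) by simp

lemma cocycle_eq: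
  "pointwise_cocycle U c \<Longrightarrow> x \<in> topspace T \<Longrightarrow> y \<in> topspace T \<Longrightarrow> z \<in> topspace T \<Longrightarrow>
    p \<in> U x \<Longrightarrow> p \<in> U y \<Longrightarrow> p \<in> U z \<Longrightarrow> c x z p = c x y p \<oplus>\<^bsub>A p\<^esub> c y z p"
  unfolding pointwise_cocycle_def by blast

definition cobounds where
  "cobounds W b U c V d \<longleftrightarrow> pcover W \<and>
    (\<forall>x\<in>topspace T. W x \<subseteq> U x \<inter> V x \<and> b x \<in> carrier (F (W x))) \<and>
    (\<forall>x\<in>topspace T. \<forall>y\<in>topspace T. \<forall>p\<in>W x \<inter> W y.
       c x y p \<ominus>\<^bsub>A p\<^esub> d x y p = b y p \<ominus>\<^bsub>A p\<^esub> b x p)"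

lemma cobounds_stalk:
  "cobounds W b U c V d \<Longrightarrow> x \<in> topspace T \<Longrightarrow> p \<in> W x \<Longrightarrow> b x p \<in> carrier (A p)"
  using sheaf_stalk[of "W x" "b x" p] pcoverD[of W x] by (simp add: cobounds_def)

lemma cohomologous_iff:
  assumes c: "pointwise_cocycle U c" and d: "pointwise_cocycle V d"
  shows "((U, c), (V, d)) \<in> cohomologous T F \<longleftrightarrow> (\<exists>W b. cobounds W b U c V d)"
proof -
  have "(let N = W x \<inter> W y in restrict (c x y) N \<ominus>\<^bsub>F N\<^esub> restrict (d x y) N
          = restrict (b y) N \<ominus>\<^bsub>F N\<^esub> restrict (b x) N)
      \<longleftrightarrow> (\<forall>p\<in>W x \<inter> W y. c x y p \<ominus>\<^bsub>A p\<^esub> d x y p = b y p \<ominus>\<^bsub>A p\<^esub> b x p)"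
    if W: "pcover W" and b: "\<forall>x\<in>topspace T. W x \<subseteq> U x \<inter> V x \<and> b x \<in> carrier (F (W x))"
      and x: "x \<in> topspace T" and y: "y \<in> topspace T" for W b x y
  proof -
    let ?N = "W x \<inter> W y"
    have N: "openin T ?N" by (rule pcover_openin_Int[OF W x y])
    have 1: "restrict (c x y) ?N \<in> carrier (F ?N)"
      using b x y by (intro restrict_closed[OF pcover_openin_Int[OF cocycle_cover[OF c] x y] N _ cocycle_section[OF c x y]]) blast
    have 2: "restrict (d x y) ?N \<in> carrier (F ?N)"
      using b x y by (intro restrict_closed[OF pcover_openin_Int[OF cocycle_cover[OF d] x y] N _ cocycle_section[OF d x y]]) blast
    have 3: "restrict (b y) ?N \<in> carrier (F ?N)" "restrict (b x) ?N \<in> carrier (F ?N)"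
      using b x y pcoverD[OF W x] pcoverD[OF W y]
      by (auto intro: restrict_closed[of "W y", OF _ N] restrict_closed[of "W x", OF _ N])
    show ?thesis
      unfolding Let_def sections_diff[OF N 1 2] sections_diff[OF N 3]
      by (auto simp: fun_eq_iff restrict_def)
  qed
  then show ?thesis
    using c d unfolding cohomologous_def cobounds_def mem_Collect_eq prod.case cocycles_iff by blast
qed

lemma cobounds_refl:
  assumes c: "pointwise_cocycle U c"
  shows "cobounds U (\<lambda>x. \<zero>\<^bsub>F (U x)\<^esub>) U c U c"
  unfolding cobounds_def
proof (intro conjI ballI)
  show "pcover U" by (rule cocycle_cover[OF c])
  fix x assume x: "x \<in> topspace T"
  show "\<zero>\<^bsub>F (U x)\<^esub> \<in> carrier (F (U x))" using pcoverD[OF cocycle_cover[OF c] x] zero_closed by blast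
  fix y p assume y: "y \<in> topspace T" and p: "p \<in> U x \<inter> U y"
  interpret abelian_group "A p"
    using pcover_openin_Int[OF cocycle_cover[OF c] x y] p by (intro stalk_group open_point)
  show "c x y p \<ominus>\<^bsub>A p\<^esub> c x y p = \<zero>\<^bsub>F (U y)\<^esub> p \<ominus>\<^bsub>A p\<^esub> \<zero>\<^bsub>F (U x)\<^esub> p"
    using p cocycle_stalk[OF c x y, of p] by (simp add: sheaf_zero a_minus_def r_neg)
qed simp

lemma cobounds_sym:
  assumes c: "pointwise_cocycle U c" and d: "pointwise_cocycle V d" and b: "cobounds W b U c V d"
  shows "cobounds W (\<lambda>x. \<lambda>p\<in>W x. \<ominus>\<^bsub>A p\<^esub> b x p) V d U c"
  unfolding cobounds_def
proof (intro conjI ballI)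
  show W: "pcover W" using b by (simp add: cobounds_def)
  fix x assume x: "x \<in> topspace T"
  show "W x \<subseteq> V x \<inter> U x" using b x by (auto simp: cobounds_def)
  show "(\<lambda>p\<in>W x. \<ominus>\<^bsub>A p\<^esub> b x p) \<in> carrier (F (W x))"
    using b x pcoverD[OF W x] by (intro uminus_closed) (auto simp: cobounds_def)
  fix y p assume y: "y \<in> topspace T" and p: "p \<in> W x \<inter> W y"
  interpret abelian_group "A p"
    using pcover_openin_Int[OF W x y] p by (intro stalk_group open_point)
  have sub: "p \<in> U x" "p \<in> U y" "p \<in> V x" "p \<in> V y" using b x y p by (auto simp: cobounds_def)
  note st = cocycle_stalk[OF c x y sub(1,2)] cocycle_stalk[OF d x y sub(3,4)]
    cobounds_stalk[OF b x, of p] cobounds_stalk[OF b y, of p]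
  have "d x y p \<ominus>\<^bsub>A p\<^esub> c x y p = \<ominus>\<^bsub>A p\<^esub> (c x y p \<ominus>\<^bsub>A p\<^esub> d x y p)"
    using st p by (simp add: minus_diff)
  also have "c x y p \<ominus>\<^bsub>A p\<^esub> d x y p = b y p \<ominus>\<^bsub>A p\<^esub> b x p"
    using b x y p by (simp add: cobounds_def)
  finally show "d x y p \<ominus>\<^bsub>A p\<^esub> c x y p = (\<lambda>p\<in>W y. \<ominus>\<^bsub>A p\<^esub> b y p) p \<ominus>\<^bsub>A p\<^esub> (\<lambda>p\<in>W x. \<ominus>\<^bsub>A p\<^esub> b x p) p"
    using st p by (simp add: minus_diff minus_diff_minus)
qed

text \<open>Covers transitivity and compatibility with addition: in both cases the cochains add up.\<close>

lemma cobounds_plus: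
  assumes b: "cobounds W b U c V d" and b': "cobounds W' b' U' c' V' d'"
    and sub: "\<And>x. x \<in> topspace T \<Longrightarrow> W x \<inter> W' x \<subseteq> U'' x \<inter> V'' x"
    and eq: "\<And>x y p. x \<in> topspace T \<Longrightarrow> y \<in> topspace T \<Longrightarrow> p \<in> W x \<inter> W' x \<Longrightarrow> p \<in> W y \<inter> W' y \<Longrightarrow>
      c'' x y p \<ominus>\<^bsub>A p\<^esub> d'' x y p = (c x y p \<ominus>\<^bsub>A p\<^esub> d x y p) \<oplus>\<^bsub>A p\<^esub> (c' x y p \<ominus>\<^bsub>A p\<^esub> d' x y p)"
  shows "cobounds (\<lambda>x. W x \<inter> W' x) (\<lambda>x. \<lambda>p\<in>W x \<inter> W' x. b x p \<oplus>\<^bsub>A p\<^esub> b' x p) U'' c'' V'' d''"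
  unfolding cobounds_def
proof (intro conjI ballI)
  have W: "pcover W" "pcover W'" using b b' by (simp_all add: cobounds_def)
  show WW: "pcover (\<lambda>x. W x \<inter> W' x)" using W by (rule pcover_Int)
  fix x assume x: "x \<in> topspace T"
  show "W x \<inter> W' x \<subseteq> U'' x \<inter> V'' x" by (rule sub[OF x])
  show "(\<lambda>p\<in>W x \<inter> W' x. b x p \<oplus>\<^bsub>A p\<^esub> b' x p) \<in> carrier (F (W x \<inter> W' x))"
    using b b' x pcoverD[OF W(1) x] pcoverD[OF W(2) x]
    by (intro sections_plus_closed[of "W x" "W' x"]) (auto simp: cobounds_def)
  fix y p assume y: "y \<in> topspace T" and p: "p \<in> W x \<inter> W' x \<inter> (W y \<inter> W' y)"
  interpret abelian_group "A p"
    using pcover_openin_Int[OF WW x y] p by (intro stalk_group open_point)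
  have "c'' x y p \<ominus>\<^bsub>A p\<^esub> d'' x y p = (b y p \<ominus>\<^bsub>A p\<^esub> b x p) \<oplus>\<^bsub>A p\<^esub> (b' y p \<ominus>\<^bsub>A p\<^esub> b' x p)"
    using eq[OF x y, of p] b b' x y p by (simp add: cobounds_def)
  also have "\<dots> = (b y p \<oplus>\<^bsub>A p\<^esub> b' y p) \<ominus>\<^bsub>A p\<^esub> (b x p \<oplus>\<^bsub>A p\<^esub> b' x p)"
    using p cobounds_stalk[OF b x, of p] cobounds_stalk[OF b y, of p] cobounds_stalk[OF b' x, of p]
      cobounds_stalk[OF b' y, of p] by (simp add: add_diff_add)
  finally show "c'' x y p \<ominus>\<^bsub>A p\<^esub> d'' x y p = (\<lambda>p\<in>W y \<inter> W' y. b y p \<oplus>\<^bsub>A p\<^esub> b' y p) p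
      \<ominus>\<^bsub>A p\<^esub> (\<lambda>p\<in>W x \<inter> W' x. b x p \<oplus>\<^bsub>A p\<^esub> b' x p) p"
    using p by simp
qed

lemma equiv_cohomologous: "equiv (cocycles T F) (cohomologous T F)"
proof (rule equivI)
  show "cohomologous T F \<subseteq> cocycles T F \<times> cocycles T F" by (auto simp: cohomologous_def)
  show "refl_on (cocycles T F) (cohomologous T F)"
  proof (rule refl_onI)
    fix z assume "z \<in> cocycles T F"
    then obtain U c where z: "z = (U, c)" "pointwise_cocycle U c" by (cases z) (auto simp: cocycles_iff)
    then show "(z, z) \<in> cohomologous T F" using cobounds_refl[OF z(2)] cohomologous_iff by blast
  qed
  show "sym (cohomologous T F)"
  proof (rule symI)
    fix z z' assume r: "(z, z') \<in> cohomologous T F"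
    then obtain U c V d where z: "z = (U, c)" "z' = (V, d)" "pointwise_cocycle U c" "pointwise_cocycle V d"
      by (cases z; cases z') (auto simp: cohomologous_def cocycles_iff)
    then show "(z', z) \<in> cohomologous T F"
      using r cobounds_sym[OF z(3,4)] cohomologous_iff by blast
  qed
  show "trans (cohomologous T F)"
  proof (rule transI)
    fix z z' z'' assume r: "(z, z') \<in> cohomologous T F" "(z', z'') \<in> cohomologous T F"
    obtain U c V d E e where z: "z = (U, c)" "z' = (V, d)" "z'' = (E, e)"
      by (cases z; cases z'; cases z'') blast
    have c: "pointwise_cocycle U c" and d: "pointwise_cocycle V d" and e: "pointwise_cocycle E e"
      using r by (auto simp: z cohomologous_def cocycles_iff)
    obtain W b W' b' where b: "cobounds W b U c V d" and b': "cobounds W' b' V d E e"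
      using r cohomologous_iff[OF c d] cohomologous_iff[OF d e] unfolding z by blast
    have "cobounds (\<lambda>x. W x \<inter> W' x) (\<lambda>x. \<lambda>p\<in>W x \<inter> W' x. b x p \<oplus>\<^bsub>A p\<^esub> b' x p) U c E e"
    proof (rule cobounds_plus[OF b b'])
      show "W x \<inter> W' x \<subseteq> U x \<inter> E x" if "x \<in> topspace T" for x
        using b b' that by (auto simp: cobounds_def)
      fix x y p assume xy: "x \<in> topspace T" "y \<in> topspace T" and p: "p \<in> W x \<inter> W' x" "p \<in> W y \<inter> W' y"
      have sub: "p \<in> U x" "p \<in> U y" "p \<in> V x" "p \<in> V y" "p \<in> E x" "p \<in> E y"
        using b b' xy p by (auto simp: cobounds_def)
      interpret abelian_group "A p"
        by (rule stalk_group[OF cover_point[OF cocycle_cover[OF c] xy(1) sub(1)]])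
      show "c x y p \<ominus>\<^bsub>A p\<^esub> e x y p = (c x y p \<ominus>\<^bsub>A p\<^esub> d x y p) \<oplus>\<^bsub>A p\<^esub> (d x y p \<ominus>\<^bsub>A p\<^esub> e x y p)"
        using cocycle_stalk[OF c xy] cocycle_stalk[OF d xy] cocycle_stalk[OF e xy] sub
        by (simp add: diff_telescope)
    qed
    then show "(z, z'') \<in> cohomologous T F" unfolding z cohomologous_iff[OF c e] by blast
  qed
qed

section \<open>The module of classes\<close>

abbreviation "cls \<equiv> H1_class T F"

lemma cls_eq_iff:
  assumes "pointwise_cocycle U c" "pointwise_cocycle V d"
  shows "cls U c = cls V d \<longleftrightarrow> (\<exists>W b. cobounds W b U c V d)"
  using eq_equiv_class_iff[OF equiv_cohomologous, of "(U, c)" "(V, d)"] assms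
  by (simp add: H1_class_def cocycles_iff cohomologous_iff)

text \<open>On the common refinement the zero cochain is a witness. The module laws reduce to
  pointwise identities in this way, although the two sides may live on different coverings.\<close>

lemma cls_eqI:
  assumes c: "pointwise_cocycle U c" and d: "pointwise_cocycle V d"
    and eq: "\<And>x y p. x \<in> topspace T \<Longrightarrow> y \<in> topspace T \<Longrightarrow> p \<in> U x \<Longrightarrow> p \<in> U y \<Longrightarrow> p \<in> V x \<Longrightarrow> p \<in> V y \<Longrightarrow>
      c x y p = d x y p"
  shows "cls U c = cls V d"
proof -
  let ?W = "\<lambda>x. U x \<inter> V x"
  have W: "pcover ?W" by (rule pcover_Int[OF cocycle_cover[OF c] cocycle_cover[OF d]])
  have "cobounds ?W (\<lambda>x. \<zero>\<^bsub>F (?W x)\<^esub>) U c V d"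
    unfolding cobounds_def
  proof (intro conjI ballI)
    fix x assume x: "x \<in> topspace T"
    show "\<zero>\<^bsub>F (?W x)\<^esub> \<in> carrier (F (?W x))" using pcoverD[OF W x] zero_closed by blast
    fix y p assume y: "y \<in> topspace T" and p: "p \<in> ?W x \<inter> ?W y"
    interpret abelian_group "A p"
      using pcover_openin_Int[OF W x y] p by (intro stalk_group open_point)
    show "c x y p \<ominus>\<^bsub>A p\<^esub> d x y p = \<zero>\<^bsub>F (?W y)\<^esub> p \<ominus>\<^bsub>A p\<^esub> \<zero>\<^bsub>F (?W x)\<^esub> p"
      using eq[OF x y, of p] p cocycle_stalk[OF d x y, of p] by (simp add: sheaf_zero a_minus_def r_neg)
  qed (use W in auto)
  then show ?thesis using cls_eq_iff[OF c d] by blast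
qed

lemma carrier_H1: "carrier (H1 T F) = {cls U c | U c. pointwise_cocycle U c}"
proof -
  have "carrier (H1 T F) = {cls U c | U c. (U, c) \<in> cocycles T F}"
    unfolding H1_def quotient_def H1_class_def by (auto intro: exI)
  then show ?thesis unfolding cocycles_iff .
qed

lemma cls_carrier: "pointwise_cocycle U c \<Longrightarrow> cls U c \<in> carrier (H1 T F)"
  unfolding carrier_H1 by blast

lemma cls_mem:
  "pointwise_cocycle U c \<Longrightarrow> (V, d) \<in> cls U c \<Longrightarrow> pointwise_cocycle V d \<and> cls V d = cls U c"
  unfolding H1_class_def
  using equiv_class_eq[OF equiv_cohomologous, of "(U, c)" "(V, d)"]
  by (auto simp: cohomologous_def cocycles_iff)

lemma cls_self: "pointwise_cocycle U c \<Longrightarrow> (U, c) \<in> cls U c"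
  unfolding H1_class_def using equiv_class_self[OF equiv_cohomologous] by (simp add: cocycles_iff)

definition add_cochain where
  "add_cochain U c V d = (\<lambda>x y. \<lambda>p\<in>U x \<inter> V x \<inter> (U y \<inter> V y). c x y p \<oplus>\<^bsub>A p\<^esub> d x y p)"

lemma add_cocycle:
  assumes c: "pointwise_cocycle U c" and d: "pointwise_cocycle V d"
  shows "pointwise_cocycle (\<lambda>x. U x \<inter> V x) (add_cochain U c V d)"
  unfolding pointwise_cocycle_def
proof (intro conjI ballI)
  note U = cocycle_cover[OF c] and V = cocycle_cover[OF d]
  show W: "pcover (\<lambda>x. U x \<inter> V x)" by (rule pcover_Int[OF U V])
  fix x y assume x: "x \<in> topspace T" and y: "y \<in> topspace T"
  show "add_cochain U c V d x y \<in> carrier (F (U x \<inter> V x \<inter> (U y \<inter> V y)))"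
    unfolding add_cochain_def
    by (rule sections_plus_closed[OF pcover_openin_Int[OF U x y] pcover_openin_Int[OF V x y]
          pcover_openin_Int[OF W x y] _ _ cocycle_section[OF c x y] cocycle_section[OF d x y]]) auto
  fix z p assume z: "z \<in> topspace T" and p: "p \<in> U x \<inter> V x \<inter> (U y \<inter> V y) \<inter> (U z \<inter> V z)"
  interpret abelian_group "A p"
    using pcover_openin_Int[OF W x y] p by (intro stalk_group open_point) auto
  show "add_cochain U c V d x z p = add_cochain U c V d x y p \<oplus>\<^bsub>A p\<^esub> add_cochain U c V d y z p"
    using p cocycle_eq[OF c x y z, of p] cocycle_eq[OF d x y z, of p]
      cocycle_stalk[OF c x y, of p] cocycle_stalk[OF c y z, of p]
      cocycle_stalk[OF d x y, of p] cocycle_stalk[OF d y z, of p]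
    by (simp add: add_cochain_def a_ac)
qed

lemma add_cochain_cong:
  assumes c: "pointwise_cocycle U c" "pointwise_cocycle U' c'" "cls U c = cls U' c'"
    and d: "pointwise_cocycle V d" "pointwise_cocycle V' d'" "cls V d = cls V' d'"
  shows "cls (\<lambda>x. U x \<inter> V x) (add_cochain U c V d) = cls (\<lambda>x. U' x \<inter> V' x) (add_cochain U' c' V' d')"
proof -
  obtain W b where b: "cobounds W b U c U' c'" using c cls_eq_iff[OF c(1,2)] by blast
  obtain W' b' where b': "cobounds W' b' V d V' d'" using d cls_eq_iff[OF d(1,2)] by blast
  have "cobounds (\<lambda>x. W x \<inter> W' x) (\<lambda>x. \<lambda>p\<in>W x \<inter> W' x. b x p \<oplus>\<^bsub>A p\<^esub> b' x p)
    (\<lambda>x. U x \<inter> V x) (add_cochain U c V d) (\<lambda>x. U' x \<inter> V' x) (add_cochain U' c' V' d')"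
  proof (rule cobounds_plus[OF b b'])
    show "W x \<inter> W' x \<subseteq> U x \<inter> V x \<inter> (U' x \<inter> V' x)" if "x \<in> topspace T" for x
      using b b' that by (auto simp: cobounds_def)
    fix x y p assume xy: "x \<in> topspace T" "y \<in> topspace T" and p: "p \<in> W x \<inter> W' x" "p \<in> W y \<inter> W' y"
    have sub: "p \<in> U x" "p \<in> U y" "p \<in> U' x" "p \<in> U' y" "p \<in> V x" "p \<in> V y" "p \<in> V' x" "p \<in> V' y"
      using b b' xy p by (auto simp: cobounds_def)
    interpret abelian_group "A p"
      by (rule stalk_group[OF cover_point[OF cocycle_cover[OF c(1)] xy(1) sub(1)]])
    show "add_cochain U c V d x y p \<ominus>\<^bsub>A p\<^esub> add_cochain U' c' V' d' x y p
        = (c x y p \<ominus>\<^bsub>A p\<^esub> c' x y p) \<oplus>\<^bsub>A p\<^esub> (d x y p \<ominus>\<^bsub>A p\<^esub> d' x y p)"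
      using sub cocycle_stalk[OF c(1) xy, of p] cocycle_stalk[OF c(2) xy, of p]
        cocycle_stalk[OF d(1) xy, of p] cocycle_stalk[OF d(2) xy, of p]
      by (simp add: add_cochain_def add_diff_add)
  qed
  then show ?thesis
    using cls_eq_iff[OF add_cocycle[OF c(1) d(1)] add_cocycle[OF c(2) d(2)]] by blast
qed

lemma H1_add:
  assumes c: "pointwise_cocycle U c" and d: "pointwise_cocycle V d"
  shows "cls U c \<oplus>\<^bsub>H1 T F\<^esub> cls V d = cls (\<lambda>x. U x \<inter> V x) (add_cochain U c V d)"
proof -
  have add: "(\<lambda>x y. let N = U x \<inter> V x \<inter> (U y \<inter> V y) in restrict (c x y) N \<oplus>\<^bsub>F N\<^esub> restrict (d x y) N)
    = add_cochain U c V d" for U c V d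
    by (intro ext) (simp add: add_cochain_def Let_def sheaf_add restrict_def)
  have "(\<Union>q\<in>cls U c. \<Union>r\<in>cls V d. case q of (U, c) \<Rightarrow> case r of (V, d) \<Rightarrow>
      cls (\<lambda>x. U x \<inter> V x) (add_cochain U c V d)) = cls (\<lambda>x. U x \<inter> V x) (add_cochain U c V d)"
  proof (rule UN2_const)
    fix q r assume "q \<in> cls U c" "r \<in> cls V d"
    then obtain U' c' V' d' where q: "q = (U', c')" "pointwise_cocycle U' c'" "cls U' c' = cls U c"
      and r: "r = (V', d')" "pointwise_cocycle V' d'" "cls V' d' = cls V d"
      using cls_mem[OF c] cls_mem[OF d] by (cases q; cases r) blast
    show "(case q of (U, c) \<Rightarrow> case r of (V, d) \<Rightarrow> cls (\<lambda>x. U x \<inter> V x) (add_cochain U c V d))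
        = cls (\<lambda>x. U x \<inter> V x) (add_cochain U c V d)"
      using add_cochain_cong[OF q(2) c q(3) r(2) d r(3)] by (simp add: q(1) r(1))
  qed (use cls_self[OF c] cls_self[OF d] in auto)
  then show ?thesis by (simp add: H1_def add split_def)
qed

lemma H1_zero: "\<zero>\<^bsub>H1 T F\<^esub> = cls (\<lambda>x. topspace T) (\<lambda>x y. \<zero>\<^bsub>F (topspace T)\<^esub>)"
  by (simp add: H1_def)

lemma zero_cocycle: "pointwise_cocycle (\<lambda>x. topspace T) (\<lambda>x y. \<zero>\<^bsub>F (topspace T)\<^esub>)"
  unfolding pointwise_cocycle_def
proof (intro conjI ballI)
  show "pcover (\<lambda>x. topspace T)" by (simp add: pointed_cover_def)
  show "\<zero>\<^bsub>F (topspace T)\<^esub> \<in> carrier (F (topspace T \<inter> topspace T))" by (simp add: zero_closed)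
  fix p assume p: "p \<in> topspace T \<inter> topspace T \<inter> topspace T"
  interpret abelian_group "A p" using p by (intro stalk_group) simp
  show "\<zero>\<^bsub>F (topspace T)\<^esub> p = \<zero>\<^bsub>F (topspace T)\<^esub> p \<oplus>\<^bsub>A p\<^esub> \<zero>\<^bsub>F (topspace T)\<^esub> p"
    using p by (simp add: sheaf_zero)
qed

lemma cls_eq_zero_iff:
  assumes c: "pointwise_cocycle U c"
  shows "cls U c = \<zero>\<^bsub>H1 T F\<^esub> \<longleftrightarrow> (\<exists>W b. pcover W \<and>
    (\<forall>x\<in>topspace T. W x \<subseteq> U x \<and> b x \<in> carrier (F (W x))) \<and>
    (\<forall>x\<in>topspace T. \<forall>y\<in>topspace T. \<forall>p\<in>W x \<inter> W y. c x y p = b y p \<ominus>\<^bsub>A p\<^esub> b x p))"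
proof -
  have "cobounds W b U c (\<lambda>x. topspace T) (\<lambda>x y. \<zero>\<^bsub>F (topspace T)\<^esub>) \<longleftrightarrow> pcover W \<and>
    (\<forall>x\<in>topspace T. W x \<subseteq> U x \<and> b x \<in> carrier (F (W x))) \<and>
    (\<forall>x\<in>topspace T. \<forall>y\<in>topspace T. \<forall>p\<in>W x \<inter> W y. c x y p = b y p \<ominus>\<^bsub>A p\<^esub> b x p)" (is "?L \<longleftrightarrow> ?R") for W b
  proof -
    have sub: "W x \<subseteq> U x \<inter> topspace T \<longleftrightarrow> W x \<subseteq> U x" if "pcover W" "x \<in> topspace T" for x
      using pcoverD[OF that] openin_subset by blast
    have val: "c x y p \<ominus>\<^bsub>A p\<^esub> \<zero>\<^bsub>F (topspace T)\<^esub> p = c x y p"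
      if "x \<in> topspace T" "y \<in> topspace T" "p \<in> U x" "p \<in> U y" for x y p
    proof -
      have p: "p \<in> topspace T"
        by (rule cover_point[OF cocycle_cover[OF c] that(1,3)])
      interpret abelian_group "A p" by (rule stalk_group[OF p])
      show ?thesis using p cocycle_stalk[OF c that] by (simp add: sheaf_zero a_minus_def)
    qed
    show ?thesis
    proof
      assume L: ?L
      then have W: "pcover W" by (simp add: cobounds_def)
      show ?R
      proof (intro conjI ballI)
        fix x y p assume x: "x \<in> topspace T" "y \<in> topspace T" "p \<in> W x \<inter> W y"
        then have "p \<in> U x" "p \<in> U y" using L by (auto simp: cobounds_def)
        then show "c x y p = b y p \<ominus>\<^bsub>A p\<^esub> b x p"
          using L x val[OF x(1,2), of p] by (simp add: cobounds_def)
      qed (use L W in \<open>auto simp: cobounds_def\<close>)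
    next
      assume R: ?R
      show ?L
        unfolding cobounds_def
      proof (intro conjI ballI)
        fix x y p assume x: "x \<in> topspace T" "y \<in> topspace T" "p \<in> W x \<inter> W y"
        then have "p \<in> U x" "p \<in> U y" using R by auto
        then show "c x y p \<ominus>\<^bsub>A p\<^esub> \<zero>\<^bsub>F (topspace T)\<^esub> p = b y p \<ominus>\<^bsub>A p\<^esub> b x p"
          using R x val[OF x(1,2), of p] by simp
      qed (use R sub in auto)
    qed
  qed
  then show ?thesis unfolding H1_zero cls_eq_iff[OF c zero_cocycle] by simp
qed

text \<open>Negation, scalar multiplication and Frobenius are all families of additive maps of the
  stalks, and such families take cocycles to cocycles; \<open>map_cobounds\<close> is the
  counterpart for coboundaries.\<close>

lemma map_cocycle:
  assumes c: "pointwise_cocycle U c"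
    and sec: "\<And>x y. x \<in> topspace T \<Longrightarrow> y \<in> topspace T \<Longrightarrow> h x y \<in> carrier (F (U x \<inter> U y))"
    and val: "\<And>x y p. x \<in> topspace T \<Longrightarrow> y \<in> topspace T \<Longrightarrow> p \<in> U x \<inter> U y \<Longrightarrow> h x y p = \<phi> p (c x y p)"
    and hom: "\<And>p u v. p \<in> topspace T \<Longrightarrow> u \<in> carrier (A p) \<Longrightarrow> v \<in> carrier (A p) \<Longrightarrow>
      \<phi> p (u \<oplus>\<^bsub>A p\<^esub> v) = \<phi> p u \<oplus>\<^bsub>A p\<^esub> \<phi> p v"
  shows "pointwise_cocycle U h"
  unfolding pointwise_cocycle_def
proof (intro conjI ballI)
  show "pcover U" by (rule cocycle_cover[OF c])
  fix x y assume x: "x \<in> topspace T" and y: "y \<in> topspace T"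
  show "h x y \<in> carrier (F (U x \<inter> U y))" by (rule sec[OF x y])
  fix z p assume z: "z \<in> topspace T" and p: "p \<in> U x \<inter> U y \<inter> U z"
  have "p \<in> topspace T"
    using pcover_openin_Int[OF cocycle_cover[OF c] x y] p by (intro open_point) auto
  then show "h x z p = h x y p \<oplus>\<^bsub>A p\<^esub> h y z p"
    using p val x y z cocycle_eq[OF c x y z, of p] hom cocycle_stalk[OF c x y, of p]
      cocycle_stalk[OF c y z, of p] by simp
qed

lemma uminus_cocycle:
  assumes c: "pointwise_cocycle U c"
  shows "pointwise_cocycle U (\<lambda>x y. \<lambda>p\<in>U x \<inter> U y. \<ominus>\<^bsub>A p\<^esub> c x y p)"
proof (rule map_cocycle[OF c, where \<phi> = "\<lambda>p. a_inv (A p)"])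
  fix p u v assume p: "p \<in> topspace T" and uv: "u \<in> carrier (A p)" "v \<in> carrier (A p)"
  interpret abelian_group "A p" by (rule stalk_group[OF p])
  show "\<ominus>\<^bsub>A p\<^esub> (u \<oplus>\<^bsub>A p\<^esub> v) = \<ominus>\<^bsub>A p\<^esub> u \<oplus>\<^bsub>A p\<^esub> \<ominus>\<^bsub>A p\<^esub> v" using uv by (rule minus_add)
next
  fix x y assume xy: "x \<in> topspace T" "y \<in> topspace T"
  show "(\<lambda>p\<in>U x \<inter> U y. \<ominus>\<^bsub>A p\<^esub> c x y p) \<in> carrier (F (U x \<inter> U y))"
    by (rule uminus_closed[OF pcover_openin_Int[OF cocycle_cover[OF c] xy] cocycle_section[OF c xy]])
qed simp

lemma smult_cocycle:
  assumes c: "pointwise_cocycle U c"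
  shows "pointwise_cocycle U (\<lambda>x y. k \<odot>\<^bsub>F (U x \<inter> U y)\<^esub> c x y)"
proof (rule map_cocycle[OF c, where \<phi> = "\<lambda>p u. \<kappa> k p \<otimes>\<^bsub>A p\<^esub> u"])
  fix p u v assume p: "p \<in> topspace T" and uv: "u \<in> carrier (A p)" "v \<in> carrier (A p)"
  interpret cring "A p" by (rule stalk[OF p])
  show "\<kappa> k p \<otimes>\<^bsub>A p\<^esub> (u \<oplus>\<^bsub>A p\<^esub> v) = \<kappa> k p \<otimes>\<^bsub>A p\<^esub> u \<oplus>\<^bsub>A p\<^esub> \<kappa> k p \<otimes>\<^bsub>A p\<^esub> v"
    using uv scalar_carrier[OF p] by (simp add: r_distr)
next
  fix x y assume xy: "x \<in> topspace T" "y \<in> topspace T"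
  show "k \<odot>\<^bsub>F (U x \<inter> U y)\<^esub> c x y \<in> carrier (F (U x \<inter> U y))"
    by (rule smult_closed[OF pcover_openin_Int[OF cocycle_cover[OF c] xy] cocycle_section[OF c xy]])
qed (simp add: sheaf_smult)

lemma map_cobounds:
  assumes b: "cobounds W b U c V d"
    and sec: "\<And>x. x \<in> topspace T \<Longrightarrow> e x \<in> carrier (F (W x))"
    and val: "\<And>x p. x \<in> topspace T \<Longrightarrow> p \<in> W x \<Longrightarrow> e x p = \<phi> p (b x p)"
      "\<And>x y p. x \<in> topspace T \<Longrightarrow> y \<in> topspace T \<Longrightarrow> p \<in> U x \<inter> U y \<Longrightarrow> h x y p = \<phi> p (c x y p)"
      "\<And>x y p. x \<in> topspace T \<Longrightarrow> y \<in> topspace T \<Longrightarrow> p \<in> V x \<inter> V y \<Longrightarrow> h' x y p = \<phi> p (d x y p)"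
    and c: "pointwise_cocycle U c" and d: "pointwise_cocycle V d"
    and hom: "\<And>p u v. p \<in> topspace T \<Longrightarrow> u \<in> carrier (A p) \<Longrightarrow> v \<in> carrier (A p) \<Longrightarrow>
      \<phi> p (u \<ominus>\<^bsub>A p\<^esub> v) = \<phi> p u \<ominus>\<^bsub>A p\<^esub> \<phi> p v"
  shows "cobounds W e U h V h'"
  unfolding cobounds_def
proof (intro conjI ballI)
  show W: "pcover W" using b by (simp add: cobounds_def)
  fix x assume x: "x \<in> topspace T"
  show "W x \<subseteq> U x \<inter> V x" using b x by (simp add: cobounds_def)
  show "e x \<in> carrier (F (W x))" by (rule sec[OF x])
  fix y p assume y: "y \<in> topspace T" and p: "p \<in> W x \<inter> W y"
  have pT: "p \<in> topspace T" using pcover_openin_Int[OF W x y] p by (rule open_point)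
  have sub: "p \<in> U x" "p \<in> U y" "p \<in> V x" "p \<in> V y" using b x y p by (auto simp: cobounds_def)
  have "h x y p \<ominus>\<^bsub>A p\<^esub> h' x y p = \<phi> p (c x y p \<ominus>\<^bsub>A p\<^esub> d x y p)"
    using sub val(2,3)[OF x y, of p] hom[OF pT] cocycle_stalk[OF c x y, of p] cocycle_stalk[OF d x y, of p] by simp
  also have "c x y p \<ominus>\<^bsub>A p\<^esub> d x y p = b y p \<ominus>\<^bsub>A p\<^esub> b x p" using b x y p by (simp add: cobounds_def)
  also have "\<phi> p \<dots> = e y p \<ominus>\<^bsub>A p\<^esub> e x p"
    using hom[OF pT] cobounds_stalk[OF b x, of p] cobounds_stalk[OF b y, of p] val(1) x y p by simp
  finally show "h x y p \<ominus>\<^bsub>A p\<^esub> h' x y p = e y p \<ominus>\<^bsub>A p\<^esub> e x p" .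
qed

lemma H1_smult:
  assumes c: "pointwise_cocycle U c"
  shows "k \<odot>\<^bsub>H1 T F\<^esub> cls U c = cls U (\<lambda>x y. k \<odot>\<^bsub>F (U x \<inter> U y)\<^esub> c x y)"
proof -
  have "(\<Union>q\<in>cls U c. case q of (V, d) \<Rightarrow> cls V (\<lambda>x y. k \<odot>\<^bsub>F (V x \<inter> V y)\<^esub> d x y))
      = cls U (\<lambda>x y. k \<odot>\<^bsub>F (U x \<inter> U y)\<^esub> c x y)"
  proof (rule UN_const_eq)
    fix q assume "q \<in> cls U c"
    then obtain V d where q: "q = (V, d)" "pointwise_cocycle V d" "cls V d = cls U c"
      using cls_mem[OF c] by (cases q) blast
    obtain W b where b: "cobounds W b V d U c" using q cls_eq_iff[OF q(2) c] by blast
    have "cobounds W (\<lambda>x. k \<odot>\<^bsub>F (W x)\<^esub> b x) V (\<lambda>x y. k \<odot>\<^bsub>F (V x \<inter> V y)\<^esub> d x y)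
        U (\<lambda>x y. k \<odot>\<^bsub>F (U x \<inter> U y)\<^esub> c x y)"
    proof (rule map_cobounds[OF b _ _ _ _ q(2) c, where \<phi> = "\<lambda>p u. \<kappa> k p \<otimes>\<^bsub>A p\<^esub> u"])
      show "k \<odot>\<^bsub>F (W x)\<^esub> b x \<in> carrier (F (W x))" if "x \<in> topspace T" for x
        using b that by (intro smult_closed) (auto simp: cobounds_def pointed_cover_def)
      fix p u v assume p: "p \<in> topspace T" and uv: "u \<in> carrier (A p)" "v \<in> carrier (A p)"
      interpret cring "A p" by (rule stalk[OF p])
      show "\<kappa> k p \<otimes>\<^bsub>A p\<^esub> (u \<ominus>\<^bsub>A p\<^esub> v) = \<kappa> k p \<otimes>\<^bsub>A p\<^esub> u \<ominus>\<^bsub>A p\<^esub> \<kappa> k p \<otimes>\<^bsub>A p\<^esub> v"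
        using uv scalar_carrier[OF p] by (simp add: a_minus_def r_distr r_minus)
    qed (simp_all add: sheaf_smult)
    then show "(case q of (V, d) \<Rightarrow> cls V (\<lambda>x y. k \<odot>\<^bsub>F (V x \<inter> V y)\<^esub> d x y))
        = cls U (\<lambda>x y. k \<odot>\<^bsub>F (U x \<inter> U y)\<^esub> c x y)"
      using cls_eq_iff[OF smult_cocycle[OF q(2)] smult_cocycle[OF c]] by (auto simp: q(1))
  qed (use cls_self[OF c] in auto)
  then show ?thesis by (simp add: H1_def split_def)
qed

lemma H1_module: "Module.module class_ring (H1 T F)"
proof (rule Module.moduleI)
  have elem: "\<exists>U c. pointwise_cocycle U c \<and> Z = cls U c" if "Z \<in> carrier (H1 T F)" for Z
    using that unfolding carrier_H1 by blast
  show "cring (class_ring :: 'k ring)" by (rule class_cring.cring_axioms)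
  have pt: "p \<in> topspace T" if "pointwise_cocycle U c" "x \<in> topspace T" "p \<in> U x" for U c x p
    using pcoverD[OF cocycle_cover[OF that(1)] that(2)] that(3) open_point by blast
  show "abelian_group (H1 T F)"
  proof (rule abelian_groupI)
    show "\<zero>\<^bsub>H1 T F\<^esub> \<in> carrier (H1 T F)" unfolding H1_zero by (rule cls_carrier[OF zero_cocycle])
    fix Z assume "Z \<in> carrier (H1 T F)"
    then obtain U c where Z: "pointwise_cocycle U c" "Z = cls U c" using elem by blast
    show "\<zero>\<^bsub>H1 T F\<^esub> \<oplus>\<^bsub>H1 T F\<^esub> Z = Z"
      unfolding Z(2) H1_zero H1_add[OF zero_cocycle Z(1)]
    proof (rule cls_eqI[OF add_cocycle[OF zero_cocycle Z(1)] Z(1)])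
      fix x y p assume xy: "x \<in> topspace T" "y \<in> topspace T" and p: "p \<in> U x" "p \<in> U y"
      interpret abelian_group "A p" by (rule stalk_group[OF pt[OF Z(1) xy(1) p(1)]])
      show "add_cochain (\<lambda>x. topspace T) (\<lambda>x y. \<zero>\<^bsub>F (topspace T)\<^esub>) U c x y p = c x y p"
        using pt[OF Z(1) xy(1) p(1)] p cocycle_stalk[OF Z(1) xy p] by (simp add: add_cochain_def sheaf_zero)
    qed
    show "\<exists>Y\<in>carrier (H1 T F). Y \<oplus>\<^bsub>H1 T F\<^esub> Z = \<zero>\<^bsub>H1 T F\<^esub>"
    proof (rule bexI[OF _ cls_carrier[OF uminus_cocycle[OF Z(1)]]])
      show "cls U (\<lambda>x y. \<lambda>p\<in>U x \<inter> U y. \<ominus>\<^bsub>A p\<^esub> c x y p) \<oplus>\<^bsub>H1 T F\<^esub> Z = \<zero>\<^bsub>H1 T F\<^esub>"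
        unfolding Z(2) H1_zero H1_add[OF uminus_cocycle[OF Z(1)] Z(1)]
      proof (rule cls_eqI[OF add_cocycle[OF uminus_cocycle[OF Z(1)] Z(1)] zero_cocycle])
        fix x y p assume xy: "x \<in> topspace T" "y \<in> topspace T" and p: "p \<in> U x \<inter> U x" "p \<in> U y \<inter> U y" "p \<in> topspace T"
        interpret abelian_group "A p" by (rule stalk_group[OF p(3)])
        show "add_cochain U (\<lambda>x y. \<lambda>p\<in>U x \<inter> U y. \<ominus>\<^bsub>A p\<^esub> c x y p) U c x y p = \<zero>\<^bsub>F (topspace T)\<^esub> p"
          using p cocycle_stalk[OF Z(1) xy, of p] by (simp add: add_cochain_def sheaf_zero l_neg)
      qed
    qed
    fix Y assume "Y \<in> carrier (H1 T F)"
    then obtain V d where Y: "pointwise_cocycle V d" "Y = cls V d" using elem by blast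
    show "Z \<oplus>\<^bsub>H1 T F\<^esub> Y \<in> carrier (H1 T F)"
      unfolding Z(2) Y(2) H1_add[OF Z(1) Y(1)] by (rule cls_carrier[OF add_cocycle[OF Z(1) Y(1)]])
    show "Z \<oplus>\<^bsub>H1 T F\<^esub> Y = Y \<oplus>\<^bsub>H1 T F\<^esub> Z"
      unfolding Z(2) Y(2) H1_add[OF Z(1) Y(1)] H1_add[OF Y(1) Z(1)]
    proof (rule cls_eqI[OF add_cocycle[OF Z(1) Y(1)] add_cocycle[OF Y(1) Z(1)]])
      fix x y p assume xy: "x \<in> topspace T" "y \<in> topspace T" and p: "p \<in> U x \<inter> V x" "p \<in> U y \<inter> V y"
      interpret abelian_group "A p" using pt[OF Z(1) xy(1), of p] p by (intro stalk_group) auto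
      show "add_cochain U c V d x y p = add_cochain V d U c x y p"
        using p cocycle_stalk[OF Z(1) xy, of p] cocycle_stalk[OF Y(1) xy, of p]
        by (simp add: add_cochain_def a_comm)
    qed
    fix S assume "S \<in> carrier (H1 T F)"
    then obtain E e where S: "pointwise_cocycle E e" "S = cls E e" using elem by blast
    note ZY = add_cocycle[OF Z(1) Y(1)] and YS = add_cocycle[OF Y(1) S(1)]
    show "Z \<oplus>\<^bsub>H1 T F\<^esub> Y \<oplus>\<^bsub>H1 T F\<^esub> S = Z \<oplus>\<^bsub>H1 T F\<^esub> (Y \<oplus>\<^bsub>H1 T F\<^esub> S)"
      unfolding Z(2) Y(2) S(2) H1_add[OF Z(1) Y(1)] H1_add[OF Y(1) S(1)] H1_add[OF ZY S(1)] H1_add[OF Z(1) YS]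
    proof (rule cls_eqI[OF add_cocycle[OF ZY S(1)] add_cocycle[OF Z(1) YS]])
      fix x y p assume xy: "x \<in> topspace T" "y \<in> topspace T"
        and p: "p \<in> U x \<inter> V x \<inter> E x" "p \<in> U y \<inter> V y \<inter> E y"
      interpret abelian_group "A p" using pt[OF Z(1) xy(1), of p] p by (intro stalk_group) auto
      show "add_cochain (\<lambda>x. U x \<inter> V x) (add_cochain U c V d) E e x y p
          = add_cochain U c (\<lambda>x. V x \<inter> E x) (add_cochain V d E e) x y p"
        using p cocycle_stalk[OF Z(1) xy, of p] cocycle_stalk[OF Y(1) xy, of p] cocycle_stalk[OF S(1) xy, of p]
        by (simp add: add_cochain_def a_assoc)
    qed
  qed
  fix k l :: 'k and Z assume "Z \<in> carrier (H1 T F)"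
  then obtain U c where Z: "pointwise_cocycle U c" "Z = cls U c" using elem by blast
  note sc = smult_cocycle[OF Z(1)]
  show "k \<odot>\<^bsub>H1 T F\<^esub> Z \<in> carrier (H1 T F)"
    unfolding Z(2) H1_smult[OF Z(1)] by (rule cls_carrier[OF sc])
  show "(k \<oplus>\<^bsub>class_ring\<^esub> l) \<odot>\<^bsub>H1 T F\<^esub> Z = k \<odot>\<^bsub>H1 T F\<^esub> Z \<oplus>\<^bsub>H1 T F\<^esub> l \<odot>\<^bsub>H1 T F\<^esub> Z"
    unfolding Z(2) H1_smult[OF Z(1)] H1_add[OF sc sc]
  proof (rule cls_eqI[OF sc add_cocycle[OF sc sc]])
    fix x y p assume xy: "x \<in> topspace T" "y \<in> topspace T" and p: "p \<in> U x" "p \<in> U y"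
    have pT: "p \<in> topspace T" by (rule pt[OF Z(1) xy(1) p(1)])
    interpret cring "A p" by (rule stalk[OF pT])
    show "((k \<oplus>\<^bsub>class_ring\<^esub> l) \<odot>\<^bsub>F (U x \<inter> U y)\<^esub> c x y) p = add_cochain U (\<lambda>x y. k \<odot>\<^bsub>F (U x \<inter> U y)\<^esub> c x y)
        U (\<lambda>x y. l \<odot>\<^bsub>F (U x \<inter> U y)\<^esub> c x y) x y p"
      using p cocycle_stalk[OF Z(1) xy p] scalar_carrier[OF pT]
      by (simp add: add_cochain_def sheaf_smult scalar_add[OF pT] l_distr)
  qed
  show "(k \<otimes>\<^bsub>class_ring\<^esub> l) \<odot>\<^bsub>H1 T F\<^esub> Z = k \<odot>\<^bsub>H1 T F\<^esub> (l \<odot>\<^bsub>H1 T F\<^esub> Z)"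
    unfolding Z(2) H1_smult[OF Z(1)] H1_smult[OF sc]
  proof (rule cls_eqI[OF sc smult_cocycle[OF sc]])
    fix x y p assume xy: "x \<in> topspace T" "y \<in> topspace T" and p: "p \<in> U x" "p \<in> U y"
    have pT: "p \<in> topspace T" by (rule pt[OF Z(1) xy(1) p(1)])
    interpret cring "A p" by (rule stalk[OF pT])
    show "((k \<otimes>\<^bsub>class_ring\<^esub> l) \<odot>\<^bsub>F (U x \<inter> U y)\<^esub> c x y) p
        = (k \<odot>\<^bsub>F (U x \<inter> U y)\<^esub> (l \<odot>\<^bsub>F (U x \<inter> U y)\<^esub> c x y)) p"
      using p cocycle_stalk[OF Z(1) xy p] scalar_carrier[OF pT]
      by (simp add: sheaf_smult scalar_mult[OF pT] m_assoc)
  qed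
  show "\<one>\<^bsub>class_ring\<^esub> \<odot>\<^bsub>H1 T F\<^esub> Z = Z"
    unfolding Z(2) H1_smult[OF Z(1)]
  proof (rule cls_eqI[OF sc Z(1)])
    fix x y p assume xy: "x \<in> topspace T" "y \<in> topspace T" and p: "p \<in> U x" "p \<in> U y"
    have pT: "p \<in> topspace T" by (rule pt[OF Z(1) xy(1) p(1)])
    interpret cring "A p" by (rule stalk[OF pT])
    show "(\<one>\<^bsub>class_ring\<^esub> \<odot>\<^bsub>F (U x \<inter> U y)\<^esub> c x y) p = c x y p"
      using p cocycle_stalk[OF Z(1) xy p] by (simp add: sheaf_smult scalar_one[OF pT])
  qed
  fix Y assume "Y \<in> carrier (H1 T F)"
  then obtain V d where Y: "pointwise_cocycle V d" "Y = cls V d" using elem by blast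
  note sd = smult_cocycle[OF Y(1)]
  show "k \<odot>\<^bsub>H1 T F\<^esub> (Z \<oplus>\<^bsub>H1 T F\<^esub> Y) = k \<odot>\<^bsub>H1 T F\<^esub> Z \<oplus>\<^bsub>H1 T F\<^esub> k \<odot>\<^bsub>H1 T F\<^esub> Y"
    unfolding Z(2) Y(2) H1_smult[OF Z(1)] H1_smult[OF Y(1)] H1_add[OF Z(1) Y(1)] H1_add[OF sc sd]
      H1_smult[OF add_cocycle[OF Z(1) Y(1)]]
  proof (rule cls_eqI[OF smult_cocycle[OF add_cocycle[OF Z(1) Y(1)]] add_cocycle[OF sc sd]])
    fix x y p assume xy: "x \<in> topspace T" "y \<in> topspace T" and p: "p \<in> U x \<inter> V x" "p \<in> U y \<inter> V y"
    have pT: "p \<in> topspace T" using pt[OF Z(1) xy(1), of p] p by simp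
    interpret cring "A p" by (rule stalk[OF pT])
    show "(k \<odot>\<^bsub>F (U x \<inter> V x \<inter> (U y \<inter> V y))\<^esub> add_cochain U c V d x y) p
        = add_cochain U (\<lambda>x y. k \<odot>\<^bsub>F (U x \<inter> U y)\<^esub> c x y) V (\<lambda>x y. k \<odot>\<^bsub>F (V x \<inter> V y)\<^esub> d x y) x y p"
      using p cocycle_stalk[OF Z(1) xy, of p] cocycle_stalk[OF Y(1) xy, of p] scalar_carrier[OF pT]
      by (simp add: add_cochain_def sheaf_smult r_distr)
  qed
qed

end

text \<open>Formulated for any exponent whose power map is additive on the stalks; the
  characteristic of the field enters with the interpretation for the curve.\<close>

locale frobenius_sheaf = function_sheaf T F A \<kappa>
  for T :: "'p topology" and F :: "'p set \<Rightarrow> ('k::field, 'p \<Rightarrow> 'v) module" and A \<kappa> +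
  fixes q :: nat
  assumes frobenius_add: "p \<in> topspace T \<Longrightarrow> u \<in> carrier (A p) \<Longrightarrow> v \<in> carrier (A p) \<Longrightarrow>
    (u \<oplus>\<^bsub>A p\<^esub> v) [^]\<^bsub>A p\<^esub> q = u [^]\<^bsub>A p\<^esub> q \<oplus>\<^bsub>A p\<^esub> v [^]\<^bsub>A p\<^esub> q"
begin

lemma frobenius_diff:
  assumes p: "p \<in> topspace T" and u: "u \<in> carrier (A p)" and v: "v \<in> carrier (A p)"
  shows "(u \<ominus>\<^bsub>A p\<^esub> v) [^]\<^bsub>A p\<^esub> q = u [^]\<^bsub>A p\<^esub> q \<ominus>\<^bsub>A p\<^esub> v [^]\<^bsub>A p\<^esub> q"
proof -
  interpret cring "A p" by (rule stalk[OF p])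
  have "u = (u \<ominus>\<^bsub>A p\<^esub> v) \<oplus>\<^bsub>A p\<^esub> v" using u v by (simp add: a_minus_def a_assoc l_neg)
  then have "u [^]\<^bsub>A p\<^esub> q = (u \<ominus>\<^bsub>A p\<^esub> v) [^]\<^bsub>A p\<^esub> q \<oplus>\<^bsub>A p\<^esub> v [^]\<^bsub>A p\<^esub> q"
    using frobenius_add[OF p, of "u \<ominus>\<^bsub>A p\<^esub> v" v] u v by simp
  then show ?thesis using diff_eq_iff[of "u [^]\<^bsub>A p\<^esub> q" "v [^]\<^bsub>A p\<^esub> q" "(u \<ominus>\<^bsub>A p\<^esub> v) [^]\<^bsub>A p\<^esub> q"] u v by simp
qed

lemma frobenius_cocycle:
  assumes c: "pointwise_cocycle U c"
  shows "pointwise_cocycle U (\<lambda>x y. c x y [^]\<^bsub>F (U x \<inter> U y)\<^esub> q)"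
proof (rule map_cocycle[OF c, where \<phi> = "\<lambda>p u. u [^]\<^bsub>A p\<^esub> q"])
  fix x y assume xy: "x \<in> topspace T" "y \<in> topspace T"
  show "c x y [^]\<^bsub>F (U x \<inter> U y)\<^esub> q \<in> carrier (F (U x \<inter> U y))"
    by (rule power_closed[OF pcover_openin_Int[OF cocycle_cover[OF c] xy] cocycle_section[OF c xy]])
qed (simp_all add: sections_power frobenius_add)

lemma H1_frobenius_cls:
  assumes c: "pointwise_cocycle U c"
  shows "H1_frobenius T F q (cls U c) = cls U (\<lambda>x y. c x y [^]\<^bsub>F (U x \<inter> U y)\<^esub> q)"
  unfolding H1_frobenius_def
proof (rule UN_const_eq)
  fix z assume "z \<in> cls U c"
  then obtain V d where z: "z = (V, d)" "pointwise_cocycle V d" "cls V d = cls U c"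
    using cls_mem[OF c] by (cases z) blast
  obtain W b where b: "cobounds W b V d U c" using z cls_eq_iff[OF z(2) c] by blast
  have "cobounds W (\<lambda>x. b x [^]\<^bsub>F (W x)\<^esub> q) V (\<lambda>x y. d x y [^]\<^bsub>F (V x \<inter> V y)\<^esub> q)
      U (\<lambda>x y. c x y [^]\<^bsub>F (U x \<inter> U y)\<^esub> q)"
  proof (rule map_cobounds[OF b _ _ _ _ z(2) c, where \<phi> = "\<lambda>p u. u [^]\<^bsub>A p\<^esub> q"])
    show "b x [^]\<^bsub>F (W x)\<^esub> q \<in> carrier (F (W x))" if "x \<in> topspace T" for x
      using b that by (intro power_closed) (auto simp: cobounds_def pointed_cover_def)
  qed (simp_all add: sections_power frobenius_diff)
  then show "(case z of (V, d) \<Rightarrow> cls V (\<lambda>x y. d x y [^]\<^bsub>F (V x \<inter> V y)\<^esub> q))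
      = cls U (\<lambda>x y. c x y [^]\<^bsub>F (U x \<inter> U y)\<^esub> q)"
    using cls_eq_iff[OF frobenius_cocycle[OF z(2)] frobenius_cocycle[OF c]] by (auto simp: z(1))
qed (use cls_self[OF c] in auto)

lemma H1_frobenius_closed: "Z \<in> carrier (H1 T F) \<Longrightarrow> H1_frobenius T F q Z \<in> carrier (H1 T F)"
  unfolding carrier_H1 using frobenius_cocycle H1_frobenius_cls by blast

lemma H1_frobenius_add:
  assumes "Z \<in> carrier (H1 T F)" "Y \<in> carrier (H1 T F)"
  shows "H1_frobenius T F q (Z \<oplus>\<^bsub>H1 T F\<^esub> Y) = H1_frobenius T F q Z \<oplus>\<^bsub>H1 T F\<^esub> H1_frobenius T F q Y"
proof -
  obtain U c V d where Z: "pointwise_cocycle U c" "Z = cls U c" and Y: "pointwise_cocycle V d" "Y = cls V d"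
    using assms unfolding carrier_H1 by blast
  note fc = frobenius_cocycle[OF Z(1)] and fd = frobenius_cocycle[OF Y(1)]
    and cd = add_cocycle[OF Z(1) Y(1)]
  show ?thesis
    unfolding Z(2) Y(2) H1_add[OF Z(1) Y(1)] H1_frobenius_cls[OF Z(1)] H1_frobenius_cls[OF Y(1)]
      H1_frobenius_cls[OF cd] H1_add[OF fc fd]
  proof (rule cls_eqI[OF frobenius_cocycle[OF cd] add_cocycle[OF fc fd]])
    fix x y p assume xy: "x \<in> topspace T" "y \<in> topspace T" and p: "p \<in> U x \<inter> V x" "p \<in> U y \<inter> V y"
    have "p \<in> topspace T"
      using cover_point[OF cocycle_cover[OF Z(1)] xy(1), of p] p by simp
    then show "(add_cochain U c V d x y [^]\<^bsub>F (U x \<inter> V x \<inter> (U y \<inter> V y))\<^esub> q) p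
        = add_cochain U (\<lambda>x y. c x y [^]\<^bsub>F (U x \<inter> U y)\<^esub> q) V (\<lambda>x y. d x y [^]\<^bsub>F (V x \<inter> V y)\<^esub> q) x y p"
      using p cocycle_stalk[OF Z(1) xy, of p] cocycle_stalk[OF Y(1) xy, of p]
      by (simp add: add_cochain_def sections_power frobenius_add)
  qed
qed

lemma H1_frobenius_smult:
  assumes "Z \<in> carrier (H1 T F)"
  shows "H1_frobenius T F q (k \<odot>\<^bsub>H1 T F\<^esub> Z) = (k ^ q) \<odot>\<^bsub>H1 T F\<^esub> H1_frobenius T F q Z"
proof -
  obtain U c where Z: "pointwise_cocycle U c" "Z = cls U c" using assms unfolding carrier_H1 by blast
  note fc = frobenius_cocycle[OF Z(1)] and sc = smult_cocycle[OF Z(1), of k]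
  show ?thesis
    unfolding Z(2) H1_smult[OF Z(1)] H1_frobenius_cls[OF Z(1)] H1_frobenius_cls[OF sc] H1_smult[OF fc]
  proof (rule cls_eqI[OF frobenius_cocycle[OF sc] smult_cocycle[OF fc]])
    fix x y p assume xy: "x \<in> topspace T" "y \<in> topspace T" and p: "p \<in> U x" "p \<in> U y"
    have pT: "p \<in> topspace T"
      using cover_point[OF cocycle_cover[OF Z(1)] xy(1), of p] p by simp
    interpret cring "A p" by (rule stalk[OF pT])
    have "\<kappa> (k ^ n) p = \<kappa> k p [^]\<^bsub>A p\<^esub> n" for n
      by (induction n) (simp_all add: scalar_one[OF pT] scalar_mult[OF pT] m_comm scalar_carrier[OF pT])
    then show "((k \<odot>\<^bsub>F (U x \<inter> U y)\<^esub> c x y) [^]\<^bsub>F (U x \<inter> U y)\<^esub> q) p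
        = ((k ^ q) \<odot>\<^bsub>F (U x \<inter> U y)\<^esub> (c x y [^]\<^bsub>F (U x \<inter> U y)\<^esub> q)) p"
      using p cocycle_stalk[OF Z(1) xy p] scalar_carrier[OF pT]
      by (simp add: sections_power sheaf_smult nat_pow_distrib)
  qed
qed

end

section \<open>The structure sheaf of the curve\<close>

context curve
begin

section \<open>Zariski topology of the curve\<close>

definition D :: "'k poly4 \<Rightarrow> 'k poly4 set set set" where
  "D h = {P \<in> X. nonvanishing P h}"

lemma D_mult: "D (a * b) = D a \<inter> D b"
  by (auto simp: D_def nonvanishing_mult)

lemma D_iff: "P \<in> D h \<longleftrightarrow> P \<in> X \<and> nonvanishing P h"
  by (simp add: D_def)

lemma D_one: "D 1 = X"
  by (auto simp: D_def nonvanishing_one)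

lemma basic_open_res: "basic_open R Gr (res h) = D h"
  by (simp add: basic_open_def D_def nonvanishing_def)

abbreviation T :: "'k poly4 set set topology" where "T \<equiv> curve_space f g"

lemma openin_D: "homogeneous d h \<Longrightarrow> openin T (D h)"
  unfolding curve_space_def proj_topology_def openin_topology_generated_by_iff basic_open_res[symmetric]
  by (rule generate_topology_on.Basis, rule imageI, rule UN_I[of d]) (auto simp: Gr_iff)

text \<open>Basic open sets of homogeneous elements are closed under intersection, by multiplying
  the elements, so this generating family is a basis.\<close>

lemma openin_iff:
  "openin T U \<longleftrightarrow> (\<forall>P\<in>U. \<exists>d h. homogeneous d h \<and> P \<in> D h \<and> D h \<subseteq> U)"
proof
  assume "openin T U"
  then have "generate_topology_on (basic_open R Gr ` (\<Union>d. Gr d)) U"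
    by (simp add: curve_space_def proj_topology_def openin_topology_generated_by_iff)
  then show "\<forall>P\<in>U. \<exists>d h. homogeneous d h \<and> P \<in> D h \<and> D h \<subseteq> U"
  proof induction
    case (Int U V)
    show ?case
    proof
      fix P assume P: "P \<in> U \<inter> V"
      obtain d h where h: "homogeneous d h" "P \<in> D h" "D h \<subseteq> U" using Int.IH(1) P by blast
      obtain e k where k: "homogeneous e k" "P \<in> D k" "D k \<subseteq> V" using Int.IH(2) P by blast
      show "\<exists>d h. homogeneous d h \<and> P \<in> D h \<and> D h \<subseteq> U \<inter> V"
        using h k homogeneous_mult[OF h(1) k(1)]
        by (intro exI[of _ "d + e"] exI[of _ "h * k"]) (auto simp: D_mult)
    qed
  next
    case (UN K)
    show ?case
    proof
      fix P assume "P \<in> \<Union>K"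
      then obtain k where k: "k \<in> K" "P \<in> k" by blast
      then obtain d h where "homogeneous d h" "P \<in> D h" "D h \<subseteq> k" using UN.IH by blast
      then show "\<exists>d h. homogeneous d h \<and> P \<in> D h \<and> D h \<subseteq> \<Union>K" using k by blast
    qed
  next
    case (Basis B)
    then obtain d h where h: "homogeneous d h" "B = D h" by (auto simp: Gr_iff basic_open_res)
    then show ?case by blast
  qed simp
next
  assume U: "\<forall>P\<in>U. \<exists>d h. homogeneous d h \<and> P \<in> D h \<and> D h \<subseteq> U"
  have "openin T (\<Union>{D h | h. (\<exists>d. homogeneous d h) \<and> D h \<subseteq> U})"
    using openin_D by (intro openin_Union) blast
  also have "\<Union>{D h | h. (\<exists>d. homogeneous d h) \<and> D h \<subseteq> U} = U"
  proof (intro equalityI subsetI)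
    fix P assume "P \<in> U"
    then obtain d h where h: "homogeneous d h" "P \<in> D h" "D h \<subseteq> U" using U by blast
    then show "P \<in> \<Union>{D h | h. (\<exists>d. homogeneous d h) \<and> D h \<subseteq> U}" by (intro UnionI[of "D h"]) auto
  qed blast
  finally show "openin T U" .
qed

lemma topspace_T: "topspace T = X"
proof
  show "topspace T \<subseteq> X"
    using openin_topspace[of T] unfolding openin_iff by (auto simp: D_iff)
  show "X \<subseteq> topspace T" using openin_D[OF homogeneous_one] openin_subset by (auto simp: D_one)
qed

abbreviation SF where "SF \<equiv> curve_sheaf f g"

text \<open>Sections as total functions, of which only the values on \<open>U\<close> matter.\<close>

definition is_section where
  "is_section U \<sigma> \<longleftrightarrow> (\<forall>P\<in>U. \<exists>d w a s. homogeneous d w \<and> P \<in> D w \<and> D w \<subseteq> U \<and>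
     (\<forall>Q\<in>D w. fraction Q a s \<and> \<sigma> Q = fr Q a s))"

lemma is_sectionD:
  assumes "is_section U \<sigma>" "P \<in> U"
  obtains d w a s where "homogeneous d w" "P \<in> D w" "D w \<subseteq> U"
    "\<And>Q. Q \<in> D w \<Longrightarrow> fraction Q a s" "\<And>Q. Q \<in> D w \<Longrightarrow> \<sigma> Q = fr Q a s"
  using assms unfolding is_section_def by metis

lemma is_section_local:
  assumes "\<And>P. P \<in> U \<Longrightarrow> \<exists>V \<tau>. P \<in> V \<and> V \<subseteq> U \<and> is_section V \<tau> \<and> (\<forall>Q\<in>V. \<sigma> Q = \<tau> Q)"
  shows "is_section U \<sigma>"
  unfolding is_section_def
proof
  fix P assume P: "P \<in> U"
  obtain V \<tau> where V: "P \<in> V" "V \<subseteq> U" "is_section V \<tau>" "\<forall>Q\<in>V. \<sigma> Q = \<tau> Q"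
    using assms[OF P] by (elim exE conjE)
  obtain d w a s where w: "homogeneous d w" "P \<in> D w" "D w \<subseteq> V"
    "\<And>Q. Q \<in> D w \<Longrightarrow> fraction Q a s" "\<And>Q. Q \<in> D w \<Longrightarrow> \<tau> Q = fr Q a s"
    by (rule is_sectionD[OF V(3,1)]) blast
  have "\<forall>Q\<in>D w. fraction Q a s \<and> \<sigma> Q = fr Q a s" using V(4) w(3-5) by auto
  then show "\<exists>d w a s. homogeneous d w \<and> P \<in> D w \<and> D w \<subseteq> U \<and>
      (\<forall>Q\<in>D w. fraction Q a s \<and> \<sigma> Q = fr Q a s)"
    using w(1-3) V(2) by blast
qed

lemma is_section_cong: "is_section U \<sigma> \<Longrightarrow> (\<And>P. P \<in> U \<Longrightarrow> \<tau> P = \<sigma> P) \<Longrightarrow> is_section U \<tau>"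
  by (rule is_section_local) blast

lemma is_section_fraction:
  assumes "homogeneous d w" "\<And>Q. Q \<in> D w \<Longrightarrow> fraction Q a s"
  shows "is_section (D w) (\<lambda>Q. fr Q a s)"
  unfolding is_section_def using assms by blast

lemma is_section_subset:
  assumes "is_section U \<sigma>" "openin T V" "V \<subseteq> U"
  shows "is_section V \<sigma>"
  unfolding is_section_def
proof
  fix P assume P: "P \<in> V"
  obtain d w a s where w: "homogeneous d w" "P \<in> D w" "D w \<subseteq> U"
    "\<And>Q. Q \<in> D w \<Longrightarrow> fraction Q a s" "\<And>Q. Q \<in> D w \<Longrightarrow> \<sigma> Q = fr Q a s"
    using P assms(3) by (blast intro: is_sectionD[OF assms(1), of P])
  obtain e v where v: "homogeneous e v" "P \<in> D v" "D v \<subseteq> V" using assms(2) P unfolding openin_iff by blast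
  have "\<forall>Q\<in>D (w * v). fraction Q a s \<and> \<sigma> Q = fr Q a s" using w(4,5) by (simp add: D_mult)
  moreover have "P \<in> D (w * v)" "D (w * v) \<subseteq> V" using w v by (auto simp: D_mult)
  ultimately show "\<exists>d w a s. homogeneous d w \<and> P \<in> D w \<and> D w \<subseteq> V \<and>
      (\<forall>Q\<in>D w. fraction Q a s \<and> \<sigma> Q = fr Q a s)"
    using homogeneous_mult[OF w(1) v(1)] by blast
qed

text \<open>The functions \<open>num\<close> and \<open>den\<close> prescribe the resulting
  fraction, valid on the intersection of the two neighbourhoods. Unary operations fit in as binary
  ones that ignore the second argument.\<close>

lemma is_section_binop:
  assumes \<sigma>: "is_section U \<sigma>" and \<tau>: "is_section U \<tau>"
    and H: "\<And>Q a s b t. fraction Q a s \<Longrightarrow> fraction Q b t \<Longrightarrow>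
      fraction Q (num a s b t) (den s t) \<and> H Q (fr Q a s) (fr Q b t) = fr Q (num a s b t) (den s t)"
  shows "is_section U (\<lambda>Q. H Q (\<sigma> Q) (\<tau> Q))"
  unfolding is_section_def
proof
  fix P assume P: "P \<in> U"
  obtain d w a s where w: "homogeneous d w" "P \<in> D w" "D w \<subseteq> U"
    "\<And>Q. Q \<in> D w \<Longrightarrow> fraction Q a s" "\<And>Q. Q \<in> D w \<Longrightarrow> \<sigma> Q = fr Q a s"
    by (rule is_sectionD[OF \<sigma> P]) blast
  obtain e v b t where v: "homogeneous e v" "P \<in> D v" "D v \<subseteq> U"
    "\<And>Q. Q \<in> D v \<Longrightarrow> fraction Q b t" "\<And>Q. Q \<in> D v \<Longrightarrow> \<tau> Q = fr Q b t"
    by (rule is_sectionD[OF \<tau> P]) blast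
  have "\<forall>Q\<in>D (w * v). fraction Q (num a s b t) (den s t) \<and> H Q (\<sigma> Q) (\<tau> Q) = fr Q (num a s b t) (den s t)"
    using w(4,5) v(4,5) H by (simp add: D_mult)
  moreover have "P \<in> D (w * v)" "D (w * v) \<subseteq> U" using w v by (auto simp: D_mult)
  ultimately show "\<exists>d w a s. homogeneous d w \<and> P \<in> D w \<and> D w \<subseteq> U \<and>
      (\<forall>Q\<in>D w. fraction Q a s \<and> H Q (\<sigma> Q) (\<tau> Q) = fr Q a s)"
    using homogeneous_mult[OF w(1) v(1)] by blast
qed

lemma is_section_add:
  "is_section U \<sigma> \<Longrightarrow> is_section U \<tau> \<Longrightarrow> is_section U (\<lambda>Q. \<sigma> Q \<oplus>\<^bsub>L Q\<^esub> \<tau> Q)"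
  by (rule is_section_binop[where num = "\<lambda>a s b t. a * t + b * s" and den = "\<lambda>s t. s * t"
        and H = "\<lambda>Q. (\<oplus>\<^bsub>L Q\<^esub>)"]) (simp_all add: fr_add fraction_add)

lemma is_section_mult:
  "is_section U \<sigma> \<Longrightarrow> is_section U \<tau> \<Longrightarrow> is_section U (\<lambda>Q. \<sigma> Q \<otimes>\<^bsub>L Q\<^esub> \<tau> Q)"
  by (rule is_section_binop[where num = "\<lambda>a s b t. a * b" and den = "\<lambda>s t. s * t"
        and H = "\<lambda>Q. (\<otimes>\<^bsub>L Q\<^esub>)"]) (simp_all add: fr_mult fraction_mult)

lemma is_section_uminus: "is_section U \<sigma> \<Longrightarrow> is_section U (\<lambda>Q. \<ominus>\<^bsub>L Q\<^esub> \<sigma> Q)"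
  by (rule is_section_binop[of U \<sigma> \<sigma> "\<lambda>a s b t. - a" "\<lambda>s t. s" "\<lambda>Q x y. \<ominus>\<^bsub>L Q\<^esub> x"])
     (simp_all add: fr_uminus fraction_uminus)

lemma is_section_diff:
  "is_section U \<sigma> \<Longrightarrow> is_section U \<tau> \<Longrightarrow> is_section U (\<lambda>Q. \<sigma> Q \<ominus>\<^bsub>L Q\<^esub> \<tau> Q)"
  unfolding a_minus_def by (rule is_section_add[OF _ is_section_uminus])

lemma is_section_const:
  assumes "openin T U" "homogeneous 0 c"
  shows "is_section U (\<lambda>Q. fr Q c 1)"
proof (rule is_section_subset[OF _ assms(1)])
  show "is_section X (\<lambda>Q. fr Q c 1)"
    using is_section_fraction[OF homogeneous_one, of c 1] fraction_const[OF _ assms(2)] by (simp add: D_one)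
  show "U \<subseteq> X" using openin_subset[OF assms(1)] by (simp add: topspace_T)
qed

lemma carrier_SF: "\<sigma> \<in> carrier (SF U) \<longleftrightarrow> \<sigma> \<in> extensional U \<and> is_section U \<sigma>"
proof -
  have "(\<forall>P\<in>U. \<exists>V. openin T V \<and> P \<in> V \<and> V \<subseteq> U \<and>
      (\<exists>d. \<exists>a\<in>Gr d. \<exists>h\<in>Gr d. \<forall>Q\<in>V. h \<notin> Q \<and> \<sigma> Q = hfrac R Gr Q a h)) \<longleftrightarrow> is_section U \<sigma>" (is "?L \<longleftrightarrow> ?R")
  proof
    assume L: ?L
    show ?R
      unfolding is_section_def
    proof
      fix P assume "P \<in> U"
      from bspec[OF L this] obtain V where V: "openin T V" "P \<in> V" "V \<subseteq> U"
        and ex: "\<exists>d. \<exists>a\<in>Gr d. \<exists>h\<in>Gr d. \<forall>Q\<in>V. h \<notin> Q \<and> \<sigma> Q = hfrac R Gr Q a h"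
        by blast
      from ex obtain d q r where qr: "q \<in> Gr d" "r \<in> Gr d"
        "\<forall>Q\<in>V. r \<notin> Q \<and> \<sigma> Q = hfrac R Gr Q q r"
        by (elim exE bexE)
      then obtain d a h where h: "homogeneous d a" "homogeneous d h"
        "\<forall>Q\<in>V. nonvanishing Q h \<and> \<sigma> Q = fr Q a h"
        unfolding Gr_iff nonvanishing_def by blast
      obtain e w where w: "homogeneous e w" "P \<in> D w" "D w \<subseteq> V" using V(1,2) unfolding openin_iff by blast
      have "fraction Q a h \<and> \<sigma> Q = fr Q a h" if "Q \<in> D w" for Q
        using that w(3) h unfolding fraction_def by (auto simp: D_iff)
      then show "\<exists>d w a s. homogeneous d w \<and> P \<in> D w \<and> D w \<subseteq> U \<and> (\<forall>Q\<in>D w. fraction Q a s \<and> \<sigma> Q = fr Q a s)"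
        using w V(3) by blast
    qed
  next
    assume R: ?R
    show ?L
    proof
      fix P assume P: "P \<in> U"
      obtain d w a s where w: "homogeneous d w" "P \<in> D w" "D w \<subseteq> U"
        "\<And>Q. Q \<in> D w \<Longrightarrow> fraction Q a s" "\<And>Q. Q \<in> D w \<Longrightarrow> \<sigma> Q = fr Q a s"
        by (rule is_sectionD[OF R P]) blast
      obtain e where e: "homogeneous e a" "homogeneous e s" using w(4)[OF w(2)] by (auto simp: fraction_def)
      then have "res a \<in> Gr e" "res s \<in> Gr e" by (auto simp: Gr_iff)
      moreover have "\<forall>Q\<in>D w. res s \<notin> Q \<and> \<sigma> Q = fr Q a s"
        using w(4,5) by (auto simp: fraction_def nonvanishing_def)
      ultimately show "\<exists>V. openin T V \<and> P \<in> V \<and> V \<subseteq> U \<and>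
          (\<exists>d. \<exists>a\<in>Gr d. \<exists>h\<in>Gr d. \<forall>Q\<in>V. h \<notin> Q \<and> \<sigma> Q = hfrac R Gr Q a h)"
        using openin_D[OF w(1)] w(2,3) by blast
    qed
  qed
  then show ?thesis
    by (simp add: curve_sheaf_def structure_sheaf_def proj_sections_def curve_space_def)
qed

lemma restrict_carrier_SF: "is_section U \<sigma> \<Longrightarrow> restrict \<sigma> U \<in> carrier (SF U)"
  unfolding carrier_SF by (auto intro: is_section_cong)

abbreviation scalar :: "'k \<Rightarrow> 'k poly4" where "scalar k \<equiv> Poly_Mapping.single 0 k"

lemma homogeneous_scalar: "homogeneous 0 (scalar k)"
  by (rule homogeneous_single) simp

lemma is_section_stalk: "is_section U \<sigma> \<Longrightarrow> P \<in> U \<Longrightarrow> \<sigma> P \<in> carrier (L P)"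
  by (erule is_sectionD, assumption) (simp add: fr_carrier)

sublocale sheaf: function_sheaf T SF L "\<lambda>k P. fr P (scalar k) 1"
proof (rule function_sheaf.intro)
  note SF_def = curve_sheaf_def structure_sheaf_def
  fix U \<sigma> \<tau> k l P and V
  show "P \<in> topspace T \<Longrightarrow> cring (L P)" by (simp add: topspace_T cring_L)
  show "\<sigma> \<in> carrier (SF U) \<Longrightarrow> \<sigma> \<in> extensional U" by (simp add: carrier_SF)
  show "\<sigma> \<in> carrier (SF U) \<Longrightarrow> P \<in> U \<Longrightarrow> \<sigma> P \<in> carrier (L P)"
    unfolding carrier_SF using is_section_stalk by blast
  show add: "\<sigma> \<oplus>\<^bsub>SF U\<^esub> \<tau> = (\<lambda>p\<in>U. \<sigma> p \<oplus>\<^bsub>L p\<^esub> \<tau> p)" for U \<sigma> \<tau> by (simp add: SF_def)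
  show mult: "\<sigma> \<otimes>\<^bsub>SF U\<^esub> \<tau> = (\<lambda>p\<in>U. \<sigma> p \<otimes>\<^bsub>L p\<^esub> \<tau> p)" for U \<sigma> \<tau> by (simp add: SF_def)
  show zero: "\<zero>\<^bsub>SF U\<^esub> = (\<lambda>p\<in>U. \<zero>\<^bsub>L p\<^esub>)" for U by (simp add: SF_def)
  show one: "\<one>\<^bsub>SF U\<^esub> = (\<lambda>p\<in>U. \<one>\<^bsub>L p\<^esub>)" for U by (simp add: SF_def)
  show smult: "k \<odot>\<^bsub>SF U\<^esub> \<sigma> = (\<lambda>p\<in>U. fr p (scalar k) 1 \<otimes>\<^bsub>L p\<^esub> \<sigma> p)" for U k \<sigma>
    by (simp add: SF_def res_one)
  show "P \<in> topspace T \<Longrightarrow> fr P (scalar k) 1 \<in> carrier (L P)"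
    by (simp add: topspace_T fr_carrier fraction_const homogeneous_scalar)
  show "P \<in> topspace T \<Longrightarrow> fr P (scalar (k + l)) 1 = fr P (scalar k) 1 \<oplus>\<^bsub>L P\<^esub> fr P (scalar l) 1"
    by (simp add: topspace_T fr_add fraction_const homogeneous_scalar single_add)
  show "P \<in> topspace T \<Longrightarrow> fr P (scalar (k * l)) 1 = fr P (scalar k) 1 \<otimes>\<^bsub>L P\<^esub> fr P (scalar l) 1"
    by (simp add: topspace_T fr_mult fraction_const homogeneous_scalar mult_single)
  show "P \<in> topspace T \<Longrightarrow> fr P (scalar 1) 1 = \<one>\<^bsub>L P\<^esub>" by (simp add: fr_one)
  assume U: "openin T U"
  show "\<sigma> \<in> carrier (SF U) \<Longrightarrow> \<tau> \<in> carrier (SF U) \<Longrightarrow> \<sigma> \<oplus>\<^bsub>SF U\<^esub> \<tau> \<in> carrier (SF U)"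
    unfolding add by (rule restrict_carrier_SF) (simp add: carrier_SF is_section_add)
  show "\<sigma> \<in> carrier (SF U) \<Longrightarrow> \<tau> \<in> carrier (SF U) \<Longrightarrow> \<sigma> \<otimes>\<^bsub>SF U\<^esub> \<tau> \<in> carrier (SF U)"
    unfolding mult by (rule restrict_carrier_SF) (simp add: carrier_SF is_section_mult)
  show "\<zero>\<^bsub>SF U\<^esub> \<in> carrier (SF U)"
    unfolding zero fr_zero by (rule restrict_carrier_SF[OF is_section_const[OF U homogeneous_zero]])
  show "\<one>\<^bsub>SF U\<^esub> \<in> carrier (SF U)"
    unfolding one fr_one by (rule restrict_carrier_SF[OF is_section_const[OF U homogeneous_one]])
  show "\<sigma> \<in> carrier (SF U) \<Longrightarrow> (\<lambda>p\<in>U. \<ominus>\<^bsub>L p\<^esub> \<sigma> p) \<in> carrier (SF U)"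
    by (rule restrict_carrier_SF) (simp add: carrier_SF is_section_uminus)
  show "\<sigma> \<in> carrier (SF U) \<Longrightarrow> k \<odot>\<^bsub>SF U\<^esub> \<sigma> \<in> carrier (SF U)"
    unfolding smult
    by (rule restrict_carrier_SF[OF is_section_mult[OF is_section_const[OF U homogeneous_scalar]]])
       (simp add: carrier_SF)
  show "openin T V \<Longrightarrow> V \<subseteq> U \<Longrightarrow> \<sigma> \<in> carrier (SF U) \<Longrightarrow> restrict \<sigma> V \<in> carrier (SF V)"
    by (rule restrict_carrier_SF) (auto simp: carrier_SF intro: is_section_subset)
qed

section \<open>Sections over basic open sets\<close>

text \<open>The local hypothesis says that the graded ideal (J : a) has no zero in
  \<open>D h\<close>, so it contains a power of \<open>h\<close> by \<open>ex_point\<close>.\<close>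

lemma annihilated_by_power:
  assumes a: "homogeneous d a" and h: "homogeneous e h" "e > 0"
    and loc: "\<And>P. P \<in> D h \<Longrightarrow> \<exists>w. nonvanishing P w \<and> a * w \<in> J"
  obtains N where "\<And>n. n \<ge> N \<Longrightarrow> h ^ n * a \<in> J"
proof -
  have "\<exists>n. h ^ n \<in> {w. a * w \<in> J}"
  proof (rule ccontr)
    assume "\<not> ?thesis"
    then have "\<exists>P\<in>X. nonvanishing P h \<and> (\<forall>w\<in>{w. a * w \<in> J}. \<not> nonvanishing P w)"
      using J_closed(3) by (intro ex_point[OF homogeneous_ideal_annihilator[OF J_homogeneous_ideal a] _ h]) auto
    then show False using loc by (auto simp: D_iff)
  qed
  then obtain N where N: "h ^ N * a \<in> J" by (auto simp: mult.commute)
  have "h ^ n * a \<in> J" if "n \<ge> N" for n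
  proof -
    have "h ^ n = h ^ (n - N) * h ^ N" using that by (simp add: power_add[symmetric])
    then show ?thesis using J_closed(3)[OF N, of "h ^ (n - N)"] by (simp add: mult.assoc)
  qed
  then show ?thesis by (rule that)
qed

lemma fr_eq_imp_power:
  assumes h: "homogeneous e h" "e > 0" and ab: "homogeneous d (a * t - b * s)"
    and eq: "\<And>P. P \<in> D h \<Longrightarrow> fraction P a s \<and> fraction P b t \<and> fr P a s = fr P b t"
  obtains N where "\<And>n. n \<ge> N \<Longrightarrow> h ^ n * (a * t - b * s) \<in> J"
proof (rule annihilated_by_power[OF ab h])
  fix P assume "P \<in> D h"
  then have "frac_rel P a s b t" using eq fr_eq_iff by blast
  then show "\<exists>w. nonvanishing P w \<and> (a * t - b * s) * w \<in> J"
    unfolding frac_rel_def by (auto simp: mult.commute)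
qed (rule that)

text \<open>Let \<open>Q\<close> be generated by \<open>J\<close> and \<open>W\<close>. The elements
  of \<open>W\<close> have no common zero in \<open>D h\<close>, so a power of \<open>h\<close> lies
  in \<open>Q\<close>; that membership involves finitely many elements of \<open>W\<close>, and
  those already suffice.\<close>

lemma quasi_compact:
  assumes h: "homogeneous e h" "e > 0" and W: "\<And>w. w \<in> W \<Longrightarrow> \<exists>d. homogeneous d w"
    and cover: "\<And>P. P \<in> D h \<Longrightarrow> \<exists>w\<in>W. nonvanishing P w"
  obtains A where "finite A" "A \<subseteq> W" "\<And>P. P \<in> D h \<Longrightarrow> \<exists>w\<in>A. nonvanishing P w"
proof -
  define I where "I A = {x + (\<Sum>k\<in>A. r k * k) | x r. x \<in> J}" for A
  have I: "homogeneous_ideal (I A)" if "finite A" "A \<subseteq> W" for A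
    unfolding I_def using that W
    by (intro homogeneous_ideal_adjoin_finite[OF J_homogeneous_ideal, of A "\<lambda>k. k"]) auto
  have mono: "I A \<subseteq> I B" if "A \<subseteq> B" "finite B" for A B
  proof
    fix a assume "a \<in> I A"
    then obtain x r where a: "x \<in> J" "a = x + (\<Sum>k\<in>A. r k * k)" unfolding I_def by blast
    have "(\<Sum>k\<in>A. r k * k) = (\<Sum>k\<in>B. (if k \<in> A then r k else 0) * k)"
      using that by (intro sum.mono_neutral_cong_left) auto
    then show "a \<in> I B" using a unfolding I_def by auto
  qed
  define Q where "Q = \<Union>{I A | A. finite A \<and> A \<subseteq> W}"
  have "homogeneous_ideal Q"
    unfolding homogeneous_ideal_def
  proof (intro conjI ballI allI)
    show "0 \<in> Q" using homogeneous_idealD(1)[OF I[of "{}"]] unfolding Q_def by blast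
    fix a assume "a \<in> Q"
    then obtain A where A: "finite A" "A \<subseteq> W" "a \<in> I A" unfolding Q_def by blast
    show "r * a \<in> Q" for r using homogeneous_idealD(3)[OF I[OF A(1,2)] A(3)] A unfolding Q_def by blast
    show "hpart d a \<in> Q" for d using homogeneous_idealD(4)[OF I[OF A(1,2)] A(3)] A unfolding Q_def by blast
    show "a + b \<in> Q" if b: "b \<in> Q" for b
    proof -
      obtain B where B: "finite B" "B \<subseteq> W" "b \<in> I B" using b unfolding Q_def by blast
      have AB: "finite (A \<union> B)" "A \<union> B \<subseteq> W" using A B by auto
      have "a \<in> I (A \<union> B)" "b \<in> I (A \<union> B)" using mono[of A "A \<union> B"] mono[of B "A \<union> B"] A B by auto
      then show ?thesis using homogeneous_idealD(2)[OF I[OF AB]] AB unfolding Q_def by blast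
    qed
  qed
  moreover have "J \<subseteq> Q"
  proof
    fix x assume "x \<in> J"
    then have "x \<in> I {}" unfolding I_def by simp
    then show "x \<in> Q" unfolding Q_def by blast
  qed
  moreover have "W \<subseteq> Q"
  proof
    fix w assume w: "w \<in> W"
    have "w \<in> I {w}"
      unfolding I_def by (rule CollectI, rule exI[of _ 0], rule exI[of _ "\<lambda>_. 1"]) (simp add: J_closed(1))
    then show "w \<in> Q" unfolding Q_def using w by blast
  qed
  ultimately have Q: "homogeneous_ideal Q" "J \<subseteq> Q" "W \<subseteq> Q" by blast+
  have "\<exists>n. h ^ n \<in> Q"
  proof (rule ccontr)
    assume "\<not> ?thesis"
    then obtain P where P: "P \<in> X" "nonvanishing P h" "\<forall>a\<in>Q. \<not> nonvanishing P a"
      using ex_point[OF Q(1,2) h] by blast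
    then show False using cover[of P] Q(3) by (auto simp: D_iff)
  qed
  then obtain n A where A: "finite A" "A \<subseteq> W" "h ^ n \<in> I A" unfolding Q_def by blast
  then obtain x r where x: "x \<in> J" "h ^ n = x + (\<Sum>k\<in>A. r k * k)" unfolding I_def by blast
  show ?thesis
  proof (rule that[OF A(1,2)])
    fix P assume P: "P \<in> D h"
    then have PX: "P \<in> X" by (simp add: D_iff)
    \<comment> \<open>The two summands are written as a sum over booleans so that
      \<open>vanishing_sum\<close> applies; the summand in \<open>J\<close> vanishes at every
      point.\<close>
    have "nonvanishing P (\<Sum>i\<in>{False, True}. if i then x else (\<Sum>k\<in>A. r k * k))"
      using nonvanishing_power[OF PX, of h n] P x(2) by (simp add: D_iff add.commute)
    then have "nonvanishing P (\<Sum>k\<in>A. r k * k)"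
      using vanishing_sum[OF PX] vanishing_J[OF PX x(1)] by fastforce
    then show "\<exists>w\<in>A. nonvanishing P w"
      using vanishing_sum[OF PX] nonvanishing_mult[OF PX] by blast
  qed
qed

text \<open>Division by \<open>h ^ n\<close> turns the congruence into 1 = sum of r k * u k / h ^ n
  on \<open>D h\<close>. It comes from \<open>ex_point\<close> for the ideal generated by
  \<open>J\<close> and the \<open>u k\<close>.\<close>

lemma partition_of_unity:
  assumes h: "homogeneous e h" "e > 0" and A: "finite A" and u: "\<And>k. k \<in> A \<Longrightarrow> homogeneous (d k) (u k)"
    and cover: "\<And>P. P \<in> D h \<Longrightarrow> \<exists>k\<in>A. nonvanishing P (u k)"
  obtains N where "\<And>n. n \<ge> N \<Longrightarrow> \<exists>r. (\<forall>k\<in>A. homogeneous (n * e - d k) (r k) \<and> d k \<le> n * e) \<and>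
    h ^ n - (\<Sum>k\<in>A. r k * u k) \<in> J"
proof -
  let ?I = "{x + (\<Sum>k\<in>A. r k * u k) | x r. x \<in> J}"
  have I: "homogeneous_ideal ?I"
    using u by (intro homogeneous_ideal_adjoin_finite[OF J_homogeneous_ideal A]) blast
  have "J \<subseteq> ?I"
  proof
    fix x assume "x \<in> J"
    then show "x \<in> ?I" by (intro CollectI exI[of _ x] exI[of _ "\<lambda>_. 0"]) simp
  qed
  have uI: "u k \<in> ?I" if "k \<in> A" for k
  proof -
    have "(\<Sum>k'\<in>A. (if k' = k then 1 else 0) * u k') = (\<Sum>k'\<in>A. if k' = k then u k' else 0)"
      by (intro sum.cong) auto
    also have "\<dots> = u k" using A that by simp
    finally show ?thesis
      by (intro CollectI exI[of _ 0] exI[of _ "\<lambda>k'. if k' = k then 1 else 0"]) (simp add: J_closed(1))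
  qed
  have "\<exists>n. h ^ n \<in> ?I"
  proof (rule ccontr)
    assume "\<not> ?thesis"
    then obtain P where P: "P \<in> X" "nonvanishing P h" "\<forall>a\<in>?I. \<not> nonvanishing P a"
      using ex_point[OF I \<open>J \<subseteq> ?I\<close> h] by blast
    obtain k where "k \<in> A" "nonvanishing P (u k)" using cover[of P] P by (auto simp: D_iff)
    then show False using P(3) uI by blast
  qed
  then obtain N0 where N0: "h ^ N0 \<in> ?I" by blast
  \<comment> \<open>The added sum forces \<open>d k \<le> n * e\<close>, because
    \<open>e > 0\<close>, so that the degrees \<open>n * e - d k\<close> are true
    differences.\<close>
  define N where "N = N0 + sum d A"
  have "\<exists>r. (\<forall>k\<in>A. homogeneous (n * e - d k) (r k) \<and> d k \<le> n * e) \<and> h ^ n - (\<Sum>k\<in>A. r k * u k) \<in> J"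
    if n: "n \<ge> N" for n
  proof -
    have "h ^ n = h ^ (n - N0) * h ^ N0" using n by (simp add: N_def power_add[symmetric])
    then have "h ^ n \<in> ?I" using homogeneous_idealD(3)[OF I N0] by simp
    then obtain x r where x: "x \<in> J" "h ^ n = x + (\<Sum>k\<in>A. r k * u k)" by blast
    have dk: "d k \<le> n * e" if "k \<in> A" for k
    proof -
      have "d k \<le> n" using member_le_sum[of k A d] A that n by (simp add: N_def)
      also have "n \<le> n * e" using h(2) by simp
      finally show ?thesis .
    qed
    \<comment> \<open>Taking the part of degree \<open>n * e\<close> on both sides makes the
      cofactors homogeneous and stays within \<open>J\<close>.\<close>
    have "h ^ n = hpart (n * e) (h ^ n)" using hpart_homogeneous[OF homogeneous_power[OF h(1)]] by simp
    also have "\<dots> = hpart (n * e) x + (\<Sum>k\<in>A. hpart (n * e - d k) (r k) * u k)"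
      unfolding x(2) hpart_add hpart_sum
      by (intro arg_cong2[of _ _ _ _ "(+)"] refl sum.cong) (simp add: hpart_mult_homogeneous[OF u] dk)
    finally have "h ^ n - (\<Sum>k\<in>A. hpart (n * e - d k) (r k) * u k) \<in> J"
      using J_closed(4)[OF x(1), of "n * e"] by (simp add: algebra_simps)
    then show ?thesis using dk by (intro exI[of _ "\<lambda>k. hpart (n * e - d k) (r k)"]) auto
  qed
  then show ?thesis by (rule that)
qed

lemma finite_uniform_bound:
  assumes "finite A" "\<And>k. k \<in> A \<Longrightarrow> \<exists>N. \<forall>n\<ge>N. Q k n"
  obtains N :: nat where "\<And>k n. k \<in> A \<Longrightarrow> n \<ge> N \<Longrightarrow> Q k n"
proof -
  obtain M where M: "\<And>k. k \<in> A \<Longrightarrow> \<forall>n\<ge>M k. Q k n" using assms(2) by metis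
  have "M k \<le> sum M A" if "k \<in> A" for k using member_le_sum[of k A M] assms(1) that by simp
  then have "Q k n" if "k \<in> A" "n \<ge> sum M A" for k n using M that order_trans by blast
  then show ?thesis by (rule that)
qed

text \<open>The sections over \<open>D h\<close> are the degree zero part of the localization at
  \<open>h\<close>. Finitely many local fractions are normalized until they agree on overlaps up to
  \<open>J\<close> without further factors; a partition of unity then combines them into one
  fraction.\<close>

theorem section_is_global_fraction:
  assumes h: "homogeneous e h" "e > 0" and \<sigma>: "is_section (D h) \<sigma>"
  obtains N where "\<And>n. n \<ge> N \<Longrightarrow> \<exists>a. homogeneous (n * e) a \<and> (\<forall>P\<in>D h. \<sigma> P = fr P a (h ^ n))"
proof -
  define W where "W = {w. (\<exists>d. homogeneous d w \<and> d > 0 \<and>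
      (\<exists>a. homogeneous d a \<and> D w \<subseteq> D h \<and> (\<forall>P\<in>D w. \<sigma> P = fr P a w)))}"
  have cov: "\<exists>w\<in>W. nonvanishing P w" if P: "P \<in> D h" for P
  proof -
    obtain d w a s where w: "homogeneous d w" "P \<in> D w" "D w \<subseteq> D h"
      "\<And>Q. Q \<in> D w \<Longrightarrow> fraction Q a s" "\<And>Q. Q \<in> D w \<Longrightarrow> \<sigma> Q = fr Q a s"
      by (rule is_sectionD[OF \<sigma> P]) blast
    obtain d' where d': "homogeneous d' a" "homogeneous d' s" using w(4)[OF w(2)] by (auto simp: fraction_def)
    \<comment> \<open>One element serves both as denominator and as equation of the neighbourhood;
      the factor \<open>h\<close> makes its degree positive.\<close>
    define v where "v = h * w * s"
    have Dv: "D v = D w" using w(3,4) unfolding v_def D_mult by (auto simp: fraction_def D_iff)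
    have v: "homogeneous (e + d + d') v" "homogeneous (e + d + d') (h * w * a)"
      unfolding v_def by (intro homogeneous_mult h(1) w(1) d')+
    have "\<sigma> Q = fr Q (h * w * a) v" if Q: "Q \<in> D v" for Q
    proof -
      have "fraction Q (h * w * a) v" using v Q unfolding fraction_def by (auto simp: D_iff)
      moreover have "a * v = (h * w * a) * s" by (simp add: v_def)
      ultimately have "fr Q a s = fr Q (h * w * a) v" using w(4)[of Q] Q unfolding Dv by (intro fr_eqI)
      then show ?thesis using w(5)[of Q] Q unfolding Dv by simp
    qed
    moreover have "D v \<subseteq> D h" using w(3) Dv by simp
    ultimately have "v \<in> W" unfolding W_def using v h(2) by (intro CollectI exI[of _ "e + d + d'"]) auto
    moreover have "nonvanishing P v" using w(2) Dv by (auto simp: D_iff)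
    ultimately show ?thesis by blast
  qed
  have hom_W: "\<exists>d. homogeneous d w" if "w \<in> W" for w using that unfolding W_def by blast
  obtain A where A: "finite A" "A \<subseteq> W" "\<And>P. P \<in> D h \<Longrightarrow> \<exists>w\<in>A. nonvanishing P w"
    by (rule quasi_compact[OF h hom_W cov]; blast)
  have "\<forall>w\<in>A. \<exists>d a. homogeneous d w \<and> d > 0 \<and> homogeneous d a \<and> D w \<subseteq> D h \<and> (\<forall>P\<in>D w. \<sigma> P = fr P a w)"
    using A(2) unfolding W_def by blast
  then obtain d a where da: "\<And>w. w \<in> A \<Longrightarrow> homogeneous (d w) w \<and> d w > 0 \<and> homogeneous (d w) (a w) \<and>
      D w \<subseteq> D h \<and> (\<forall>P\<in>D w. \<sigma> P = fr P (a w) w)" by metis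
  have frac: "fraction P (a w) w" if "w \<in> A" "P \<in> D w" for w P
    using da[OF that(1)] that(2) unfolding fraction_def by (auto simp: D_iff)
  have "\<exists>N. \<forall>n\<ge>N. case k of (w, v) \<Rightarrow> (w * v) ^ n * (a w * v - a v * w) \<in> J" if k: "k \<in> A \<times> A" for k
  proof -
    obtain w v where wv: "k = (w, v)" "w \<in> A" "v \<in> A" using k by blast
    have 1: "homogeneous (d w + d v) (a w * v - a v * w)"
      using da[OF wv(2)] da[OF wv(3)] homogeneous_mult[of "d w" "a w" "d v" v]
        homogeneous_mult[of "d v" "a v" "d w" w] by (intro homogeneous_diff) (auto simp: add.commute)
    have 2: "homogeneous (d w + d v) (w * v)" "d w + d v > 0"
      using da[OF wv(2)] da[OF wv(3)] homogeneous_mult by auto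
    have 3: "fraction P (a w) w \<and> fraction P (a v) v \<and> fr P (a w) w = fr P (a v) v"
      if "P \<in> D (w * v)" for P
      using that da[OF wv(2)] da[OF wv(3)] frac[OF wv(2)] frac[OF wv(3)] unfolding D_mult by auto
    obtain N where "\<And>n. n \<ge> N \<Longrightarrow> (w * v) ^ n * (a w * v - a v * w) \<in> J"
      by (rule fr_eq_imp_power[OF 2 1 3]; blast)
    then show ?thesis using wv(1) by auto
  qed
  then obtain N where N: "\<And>k n. k \<in> A \<times> A \<Longrightarrow> n \<ge> N \<Longrightarrow> (case k of (w, v) \<Rightarrow> (w * v) ^ n * (a w * v - a v * w) \<in> J)"
    by (rule finite_uniform_bound[of "A \<times> A", rotated]) (use A(1) in auto)
  \<comment> \<open>Expanding the fraction \<open>a w / w\<close> by \<open>w ^ N\<close> absorbs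
    the annihilating power, and the compatibility \<open>bw\<close> then holds in the quotient
    itself.\<close>
  define b where "b w = a w * w ^ N" for w
  have bw: "b w * v ^ Suc N - b v * w ^ Suc N \<in> J" if "w \<in> A" "v \<in> A" for w v
  proof -
    have "b w * v ^ Suc N - b v * w ^ Suc N = (w * v) ^ N * (a w * v - a v * w)"
      by (simp add: b_def power_mult_distrib algebra_simps)
    then show ?thesis using N[of "(w, v)" N] that by simp
  qed
  have cover: "\<exists>w\<in>A. nonvanishing P (w ^ Suc N)" if P: "P \<in> D h" for P
  proof -
    obtain w where w: "w \<in> A" "nonvanishing P w" using A(3)[OF P] by blast
    moreover have "nonvanishing P (w ^ Suc N)" using P w(2) by (intro nonvanishing_power) (simp add: D_iff)
    ultimately show ?thesis by blast
  qed
  have hom: "homogeneous (Suc N * d w) (w ^ Suc N)" if "w \<in> A" for w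
    using da[OF that] homogeneous_power[of "d w" w "Suc N"] by blast
  obtain M where M: "\<And>n. n \<ge> M \<Longrightarrow> \<exists>r. (\<forall>w\<in>A. homogeneous (n * e - Suc N * d w) (r w) \<and> Suc N * d w \<le> n * e) \<and>
      h ^ n - (\<Sum>w\<in>A. r w * w ^ Suc N) \<in> J"
    using partition_of_unity[OF h A(1) hom cover] by blast
  have "\<exists>c. homogeneous (n * e) c \<and> (\<forall>P\<in>D h. \<sigma> P = fr P c (h ^ n))" if n: "n \<ge> M" for n
  proof -
    obtain r where r: "\<And>w. w \<in> A \<Longrightarrow> homogeneous (n * e - Suc N * d w) (r w) \<and> Suc N * d w \<le> n * e"
      and x: "h ^ n - (\<Sum>w\<in>A. r w * w ^ Suc N) \<in> J" using M[OF n] by blast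
    \<comment> \<open>The glued numerator: the local fractions \<open>b w / w ^ Suc N\<close>,
      weighted by \<open>r w * w ^ Suc N / h ^ n\<close>.\<close>
    define c where "c = (\<Sum>w\<in>A. r w * b w)"
    have bhom: "homogeneous (Suc N * d w) (b w)" if "w \<in> A" for w
      using homogeneous_mult[of "d w" "a w" "N * d w" "w ^ N"] homogeneous_power[of "d w" w N] da[OF that]
      by (simp add: b_def)
    have c: "homogeneous (n * e) c"
      unfolding c_def
    proof (rule homogeneous_sum)
      fix w assume w: "w \<in> A"
      show "homogeneous (n * e) (r w * b w)"
        using homogeneous_mult[of "n * e - Suc N * d w" "r w" "Suc N * d w" "b w"] r[OF w] bhom[OF w] by simp
    qed
    have "\<sigma> P = fr P c (h ^ n)" if P: "P \<in> D h" for P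
    proof -
      have PX: "P \<in> X" using P by (simp add: D_iff)
      obtain v where v: "v \<in> A" "P \<in> D v" using A(3)[OF P] PX by (auto simp: D_iff)
      have fb: "fraction P (b v) (v ^ Suc N)"
        using bhom[OF v(1)] hom[OF v(1)] nonvanishing_power[OF PX, of v "Suc N"] v(2) PX
        unfolding fraction_def by (auto simp: D_iff simp del: power_Suc)
      have fc: "fraction P c (h ^ n)"
        using c homogeneous_power[OF h(1), of n] nonvanishing_power[OF PX, of h n] P PX
        unfolding fraction_def by (auto simp: D_iff)
      have "\<sigma> P = fr P (a v) v" using da[OF v(1)] v(2) by blast
      also have "\<dots> = fr P (b v) (v ^ Suc N)"
        by (rule fr_eqI[OF frac[OF v] fb]) (simp add: b_def)
      also have "\<dots> = fr P c (h ^ n)"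
        unfolding fr_eq_iff[OF fb fc]
      proof (rule frac_rel_if[OF PX])
        \<comment> \<open>First \<open>h ^ n\<close> is exchanged for the partition sum, at the cost
          of an element of \<open>J\<close>; what remains is a combination of the overlap relations
          \<open>bw\<close>.\<close>
        have "b v * h ^ n - c * v ^ Suc N = b v * (h ^ n - (\<Sum>w\<in>A. r w * w ^ Suc N))
            + (\<Sum>w\<in>A. r w * (b v * w ^ Suc N - b w * v ^ Suc N))"
          by (simp add: c_def sum_distrib_left sum_distrib_right sum_subtractf right_diff_distrib
              mult.left_commute[of "b v"] mult.assoc del: power_Suc)
        also have "\<dots> \<in> J"
          by (intro J_closed(2,3) x homogeneous_ideal_sum[OF J_homogeneous_ideal] bw v(1))
        finally show "b v * h ^ n - c * v ^ Suc N \<in> J" .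
      qed
      finally show ?thesis .
    qed
    then show ?thesis using c by blast
  qed
  then show ?thesis by (rule that)
qed

end

section \<open>Vanishing of cohomology on basic open sets\<close>

context curve
begin

text \<open>Multiplying the equation of a neighbourhood by \<open>h\<close> moves it inside
  \<open>D h\<close> and raises its degree to at least \<open>e\<close>, hence makes it positive
  where \<open>e\<close> is.\<close>

lemma local_open_refinement:
  assumes h: "homogeneous e h" and U: "openin T U" and P: "P \<in> U" "P \<in> D h"
  obtains d v where "homogeneous d v" "P \<in> D v" "D v \<subseteq> U" "D v \<subseteq> D h" "d \<ge> e"
proof -
  obtain d w where "homogeneous d w" "P \<in> D w" "D w \<subseteq> U" using U P(1) unfolding openin_iff by blast
  with P(2) show ?thesis using homogeneous_mult[OF h, of d w] by (intro that[of "e + d" "h * w"]) (auto simp: D_mult)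
qed

lemma cocycle_is_section:
  assumes "sheaf.pointwise_cocycle U c" "x \<in> X" "y \<in> X"
  shows "is_section (U x \<inter> U y) (c x y)"
  using sheaf.cocycle_section[OF assms(1), of x y] assms(2,3) unfolding topspace_T carrier_SF by blast

lemma cocycle_equation:
  assumes c: "sheaf.pointwise_cocycle U c" and "x \<in> X" "y \<in> X" "z \<in> X" "P \<in> U x" "P \<in> U y" "P \<in> U z"
  shows "c x z P = c x y P \<oplus>\<^bsub>L P\<^esub> c y z P"
  by (rule sheaf.cocycle_eq[OF c]) (simp_all add: topspace_T assms(2-7))

text \<open>On each overlap the cocycle is a global fraction for all large exponents, and finitely
  many pairs allow a common one.\<close>

lemma cocycle_fractions:
  assumes c: "sheaf.pointwise_cocycle U c"
    and A: "finite A" "A \<subseteq> X" and v: "\<And>k. k \<in> A \<Longrightarrow> homogeneous (d k) (v k) \<and> d k > 0 \<and> D (v k) \<subseteq> U k"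
  obtains N a where "N > 0"
    "\<And>k l. k \<in> A \<Longrightarrow> l \<in> A \<Longrightarrow> homogeneous (N * (d k + d l)) (a k l)"
    "\<And>k l P. k \<in> A \<Longrightarrow> l \<in> A \<Longrightarrow> P \<in> D (v k) \<Longrightarrow> P \<in> D (v l) \<Longrightarrow>
      fraction P (a k l) ((v k * v l) ^ N) \<and> c k l P = fr P (a k l) ((v k * v l) ^ N)"
proof -
  have "\<exists>N. \<forall>n\<ge>N. case q of (k, l) \<Rightarrow> \<exists>a. homogeneous (n * (d k + d l)) a \<and>
      (\<forall>P\<in>D (v k * v l). c k l P = fr P a ((v k * v l) ^ n))" if q: "q \<in> A \<times> A" for q
  proof -
    obtain k l where kl: "q = (k, l)" "k \<in> A" "l \<in> A" using q by blast
    have hom: "homogeneous (d k + d l) (v k * v l)" "d k + d l > 0"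
      using v[OF kl(2)] v[OF kl(3)] homogeneous_mult by auto
    have "is_section (D (v k * v l)) (c k l)"
      using v[OF kl(2)] v[OF kl(3)] A(2) kl
      by (intro is_section_subset[OF cocycle_is_section[OF c] openin_D[OF hom(1)]]) (auto simp: D_mult)
    then show ?thesis
      by (rule section_is_global_fraction[OF hom]) (use kl(1) in auto)
  qed
  then obtain N where N: "\<And>q n. q \<in> A \<times> A \<Longrightarrow> n \<ge> N \<Longrightarrow> (case q of (k, l) \<Rightarrow> \<exists>a. homogeneous (n * (d k + d l)) a \<and>
      (\<forall>P\<in>D (v k * v l). c k l P = fr P a ((v k * v l) ^ n)))"
    by (rule finite_uniform_bound[of "A \<times> A", rotated]) (use A(1) in auto)
  \<comment> \<open>The bound is passed by one to obtain the promised positive exponent.\<close>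
  have "\<exists>a. homogeneous (Suc N * (d k + d l)) a \<and>
      (\<forall>P\<in>D (v k * v l). c k l P = fr P a ((v k * v l) ^ Suc N))" if "k \<in> A" "l \<in> A" for k l
    using N[of "(k, l)" "Suc N"] that by (simp del: power_Suc mult_Suc)
  then obtain a where a: "\<And>k l. k \<in> A \<Longrightarrow> l \<in> A \<Longrightarrow> homogeneous (Suc N * (d k + d l)) (a k l) \<and>
      (\<forall>P\<in>D (v k * v l). c k l P = fr P (a k l) ((v k * v l) ^ Suc N))" by metis
  show ?thesis
  proof (rule that[of "Suc N" a])
    fix k l P assume kl: "k \<in> A" "l \<in> A" and P: "P \<in> D (v k)" "P \<in> D (v l)"
    have PX: "P \<in> X" using P by (simp add: D_iff)
    have "homogeneous (Suc N * (d k + d l)) ((v k * v l) ^ Suc N)"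
      using v[OF kl(1)] v[OF kl(2)] by (intro homogeneous_power homogeneous_mult) auto
    moreover have "nonvanishing P ((v k * v l) ^ Suc N)"
      using P by (intro nonvanishing_power[OF PX]) (simp add: nonvanishing_mult[OF PX] D_iff)
    ultimately show "fraction P (a k l) ((v k * v l) ^ Suc N) \<and> c k l P = fr P (a k l) ((v k * v l) ^ Suc N)"
      using a[OF kl] P PX unfolding fraction_def by (auto simp: D_mult)
  qed (use a in auto)
qed

text \<open>The classical averaging: with a partition of unity \<rho>, let \<beta> m be the sum of
  \<rho> k * c k m. Then \<beta> m - \<beta> l is the sum of \<rho> k * (c k m - c k l), which
  equals c l m by the cocycle rule. The work lies in doing this with numerators modulo
  \<open>J\<close>.\<close>

lemma cocycle_splits_finite:
  assumes c: "sheaf.pointwise_cocycle U c" and h: "homogeneous e h" "e > 0"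
    and A: "finite A" "A \<subseteq> X" and v: "\<And>k. k \<in> A \<Longrightarrow> homogeneous (d k) (v k) \<and> d k > 0 \<and> D (v k) \<subseteq> U k \<and> D (v k) \<subseteq> D h"
    and cover: "\<And>P. P \<in> D h \<Longrightarrow> \<exists>k\<in>A. nonvanishing P (v k)"
  obtains \<beta> where "\<And>k. k \<in> A \<Longrightarrow> is_section (D (v k)) (\<beta> k)"
    "\<And>k l P. k \<in> A \<Longrightarrow> l \<in> A \<Longrightarrow> P \<in> D (v k) \<Longrightarrow> P \<in> D (v l) \<Longrightarrow> c k l P = \<beta> l P \<ominus>\<^bsub>L P\<^esub> \<beta> k P"
proof -
  have vU: "\<And>k. k \<in> A \<Longrightarrow> homogeneous (d k) (v k) \<and> d k > 0 \<and> D (v k) \<subseteq> U k" using v by blast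
  obtain N a where N: "N > 0"
    and a: "\<And>k l. k \<in> A \<Longrightarrow> l \<in> A \<Longrightarrow> homogeneous (N * (d k + d l)) (a k l)"
    and ca: "\<And>k l P. k \<in> A \<Longrightarrow> l \<in> A \<Longrightarrow> P \<in> D (v k) \<Longrightarrow> P \<in> D (v l) \<Longrightarrow>
      fraction P (a k l) ((v k * v l) ^ N) \<and> c k l P = fr P (a k l) ((v k * v l) ^ N)"
    by (rule cocycle_fractions[OF c A vU]; blast)
  \<comment> \<open>The numerator of c k m - c k l - c l m over the common denominator
    \<open>(v k * v l * v m) ^ N\<close>. The cocycle rule kills it only after multiplication by a
    power of that product.\<close>
  define t where "t k l m = a k m * v l ^ N - a k l * v m ^ N - a l m * v k ^ N" for k l m
  have t_hom: "homogeneous (N * (d k + d l + d m)) (t k l m)" if "k \<in> A" "l \<in> A" "m \<in> A" for k l m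
  proof -
    have *: "homogeneous (N * (d k + d l + d m)) (a i j * v q ^ N)"
      if "i \<in> A" "j \<in> A" "q \<in> A" "d i + d j + d q = d k + d l + d m" for i j q
      using homogeneous_mult[OF a[OF that(1,2)] homogeneous_power[of "d q" "v q" N]] v[OF that(3)]
      unfolding that(4)[symmetric] by (simp add: distrib_left)
    show ?thesis unfolding t_def using that by (intro homogeneous_diff *) auto
  qed
  have "\<exists>M. \<forall>n\<ge>M. case q of (k, l, m) \<Rightarrow> (v k * v l * v m) ^ n * t k l m \<in> J" if q: "q \<in> A \<times> A \<times> A" for q
  proof -
    obtain k l m where klm: "q = (k, l, m)" "k \<in> A" "l \<in> A" "m \<in> A" using q by blast
    have hom: "homogeneous (d k + d l + d m) (v k * v l * v m)" "d k + d l + d m > 0"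
      using v[OF klm(2)] v[OF klm(3)] v[OF klm(4)] by (auto intro!: homogeneous_mult)
    obtain M where "\<And>n. n \<ge> M \<Longrightarrow> (v k * v l * v m) ^ n * t k l m \<in> J"
    proof (rule annihilated_by_power[OF t_hom[OF klm(2-4)] hom])
      fix P assume "P \<in> D (v k * v l * v m)"
      then have P: "P \<in> D (v k)" "P \<in> D (v l)" "P \<in> D (v m)" by (auto simp: D_mult)
      then have PX: "P \<in> X" by (simp add: D_iff)
      note kl = ca[OF klm(2,3) P(1,2)] and lm = ca[OF klm(3,4) P(2,3)] and km = ca[OF klm(2,4) P(1,3)]
      have "c k m P = c k l P \<oplus>\<^bsub>L P\<^esub> c l m P"
        using v klm A(2) P by (intro cocycle_equation[OF c]) auto
      then have eq: "fr P (a k m) ((v k * v m) ^ N)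
          = fr P (a k l * (v l * v m) ^ N + a l m * (v k * v l) ^ N) ((v k * v l) ^ N * (v l * v m) ^ N)"
        using kl lm km by (simp add: fr_add)
      have "frac_rel P (a k m) ((v k * v m) ^ N)
          (a k l * (v l * v m) ^ N + a l m * (v k * v l) ^ N) ((v k * v l) ^ N * (v l * v m) ^ N)"
        using eq kl lm km fr_eq_iff[OF conjunct1[OF km] fraction_add[OF conjunct1[OF kl] conjunct1[OF lm]]] by blast
      then obtain w where w: "nonvanishing P w" "w * (a k m * ((v k * v l) ^ N * (v l * v m) ^ N)
          - (a k l * (v l * v m) ^ N + a l m * (v k * v l) ^ N) * (v k * v m) ^ N) \<in> J"
        unfolding frac_rel_def by blast
      have "t k l m * (w * (v k * v l * v m) ^ N) = w * (a k m * ((v k * v l) ^ N * (v l * v m) ^ N)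
          - (a k l * (v l * v m) ^ N + a l m * (v k * v l) ^ N) * (v k * v m) ^ N)"
        unfolding t_def power_mult_distrib by (simp add: algebra_simps)
      moreover have "nonvanishing P (w * (v k * v l * v m) ^ N)"
        using w(1) P by (simp add: nonvanishing_mult[OF PX] nonvanishing_power[OF PX] D_iff)
      ultimately show "\<exists>w. nonvanishing P w \<and> t k l m * w \<in> J" using w(2) by metis
    qed (rule that)
    then show ?thesis using klm(1) by auto
  qed
  then obtain M where M: "\<And>q n. q \<in> A \<times> A \<times> A \<Longrightarrow> n \<ge> M \<Longrightarrow>
      (case q of (k, l, m) \<Rightarrow> (v k * v l * v m) ^ n * t k l m \<in> J)"
    by (rule finite_uniform_bound[of "A \<times> A \<times> A", rotated]) (use A(1) in auto)
  have tJ: "(v l * v m) ^ M * (v k ^ M * t k l m) \<in> J" if "k \<in> A" "l \<in> A" "m \<in> A" for k l m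
  proof -
    have "(v l * v m) ^ M * (v k ^ M * t k l m) = (v k * v l * v m) ^ M * t k l m"
      by (simp only: power_mult_distrib mult_ac)
    also have "\<dots> \<in> J" using M[of "(k, l, m)" M] that by simp
    finally show ?thesis .
  qed
  \<comment> \<open>In the exponent \<open>N + M\<close>, the \<open>N\<close> cancels the
    denominator \<open>v k ^ N\<close> of \<open>c k m\<close>, and the remaining \<open>M\<close>
    is the power of \<open>v k\<close> that annihilates \<open>t k l m\<close>.\<close>
  have v_hom: "homogeneous ((N + M) * d k) (v k ^ (N + M))" if "k \<in> A" for k
    using v[OF that] homogeneous_power by blast
  have cover': "\<exists>k\<in>A. nonvanishing P (v k ^ (N + M))" if P: "P \<in> D h" for P
    using cover[OF P] nonvanishing_power[of P] P unfolding D_iff by blast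
  obtain n0 where n0: "\<And>n. n \<ge> n0 \<Longrightarrow> \<exists>r. (\<forall>k\<in>A. homogeneous (n * e - (N + M) * d k) (r k) \<and> (N + M) * d k \<le> n * e) \<and>
      h ^ n - (\<Sum>k\<in>A. r k * v k ^ (N + M)) \<in> J"
    by (rule partition_of_unity[OF h A(1) v_hom cover']; blast)
  obtain r n where r: "\<And>k. k \<in> A \<Longrightarrow> homogeneous (n * e - (N + M) * d k) (r k) \<and> (N + M) * d k \<le> n * e"
    and x: "h ^ n - (\<Sum>k\<in>A. r k * v k ^ (N + M)) \<in> J"
    using n0[OF order_refl] by blast
  \<comment> \<open>the numerator of the cochain \<open>\<Sum>k\<in>A. \<rho> k * c k m\<close> for the partition of unity
    \<open>\<rho> k = r k * v k ^ (N + M) / h ^ n\<close>\<close>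
  define b where "b m = (\<Sum>k\<in>A. r k * (v k ^ M * a k m))" for m
  have b_hom: "homogeneous (n * e + N * d m) (b m)" if m: "m \<in> A" for m
    unfolding b_def
  proof (rule homogeneous_sum)
    fix k assume k: "k \<in> A"
    have "homogeneous ((n * e - (N + M) * d k) + (M * d k + N * (d k + d m))) (r k * (v k ^ M * a k m))"
      using r[OF k] v[OF k] a[OF k m] by (intro homogeneous_mult homogeneous_power) auto
    moreover have "(n * e - (N + M) * d k) + (M * d k + N * (d k + d m)) = n * e + N * d m"
    proof -
      have "M * d k + N * (d k + d m) = (N + M) * d k + N * d m" by (simp add: algebra_simps)
      then show ?thesis using r[OF k] by linarith
    qed
    ultimately show "homogeneous (n * e + N * d m) (r k * (v k ^ M * a k m))" by simp
  qed
  have frac_b: "fraction P (b m) (h ^ n * v m ^ N)" if m: "m \<in> A" and P: "P \<in> D (v m)" for m P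
  proof -
    have PX: "P \<in> X" "nonvanishing P h" using v[OF m] P by (auto simp: D_iff)
    have "homogeneous (n * e + N * d m) (h ^ n * v m ^ N)"
      using h(1) v[OF m] by (intro homogeneous_mult homogeneous_power) auto
    moreover have "nonvanishing P (h ^ n * v m ^ N)"
      using PX P by (simp add: nonvanishing_mult nonvanishing_power D_iff)
    ultimately show ?thesis using b_hom[OF m] PX unfolding fraction_def by blast
  qed
  show ?thesis
  proof (rule that[of "\<lambda>m P. fr P (b m) (h ^ n * v m ^ N)"])
    show "is_section (D (v m)) (\<lambda>P. fr P (b m) (h ^ n * v m ^ N))" if "m \<in> A" for m
      using v[OF that] frac_b[OF that] is_section_fraction by blast
    fix l m P assume l: "l \<in> A" and m: "m \<in> A" and P: "P \<in> D (v l)" "P \<in> D (v m)"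
    have PX: "P \<in> X" using P by (simp add: D_iff)
    note fl = frac_b[OF l P(1)] and fm = frac_b[OF m P(2)] and clm = ca[OF l m P]
    interpret abelian_group "L P" by (rule sheaf.stalk_group) (simp add: topspace_T PX)
    have "fr P (b m) (h ^ n * v m ^ N) = fr P (a l m) ((v l * v m) ^ N) \<oplus>\<^bsub>L P\<^esub> fr P (b l) (h ^ n * v l ^ N)"
      unfolding fr_add[OF conjunct1[OF clm] fl] fr_eq_iff[OF fm fraction_add[OF conjunct1[OF clm] fl]]
      unfolding frac_rel_def
    proof (intro exI conjI)
      let ?w = "(v l * v m) ^ M"
      show "homogeneous (M * (d l + d m)) ?w"
        using v[OF l] v[OF m] by (intro homogeneous_power homogeneous_mult) auto
      show "nonvanishing P ?w" using P by (simp add: nonvanishing_power[OF PX] nonvanishing_mult[OF PX] D_iff)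
      \<comment> \<open>\<open>S\<close> is the partition sum, congruent to \<open>h ^ n\<close>,
        and \<open>Y\<close> the weighted sum of the cocycle defects, which lies in
        \<open>J\<close>. The required relation combines \<open>Y\<close> with
        \<open>h ^ n - S\<close>.\<close>
      define S where "S = (\<Sum>k\<in>A. r k * v k ^ (N + M))"
      define Y where "Y = (\<Sum>k\<in>A. r k * ((v l * v m) ^ M * (v k ^ M * t k l m)))"
      have Y: "Y = (v l * v m) ^ M * (b m * v l ^ N - b l * v m ^ N - a l m * S)"
        unfolding Y_def b_def S_def t_def sum_distrib_left sum_distrib_right sum_subtractf[symmetric]
        by (intro sum.cong refl) (simp add: algebra_simps power_add)
      have "?w * (b m * ((v l * v m) ^ N * (h ^ n * v l ^ N))
            - (a l m * (h ^ n * v l ^ N) + b l * (v l * v m) ^ N) * (h ^ n * v m ^ N))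
          = (v l * v m) ^ N * h ^ n * (Y - (v l * v m) ^ M * a l m * (h ^ n - S))"
        unfolding Y by (simp add: algebra_simps power_mult_distrib)
      also have "\<dots> \<in> J"
      proof (rule J_closed(3)[OF J_diff])
        show "Y \<in> J" unfolding Y_def
          by (intro homogeneous_ideal_sum[OF J_homogeneous_ideal] J_closed(3) tJ l m)
        show "(v l * v m) ^ M * a l m * (h ^ n - S) \<in> J" unfolding S_def by (rule J_closed(3)[OF x])
      qed
      finally show "?w * (b m * ((v l * v m) ^ N * (h ^ n * v l ^ N))
            - (a l m * (h ^ n * v l ^ N) + b l * (v l * v m) ^ N) * (h ^ n * v m ^ N)) \<in> J" .
    qed
    then have "fr P (b m) (h ^ n * v m ^ N) \<ominus>\<^bsub>L P\<^esub> fr P (b l) (h ^ n * v l ^ N) = fr P (a l m) ((v l * v m) ^ N)"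
      using diff_eq_iff fr_carrier[OF fl] fr_carrier[OF fm] fr_carrier[OF conjunct1[OF clm]] by blast
    then show "c l m P = fr P (b m) (h ^ n * v m ^ N) \<ominus>\<^bsub>L P\<^esub> fr P (b l) (h ^ n * v l ^ N)"
      using clm by simp
  qed
qed

text \<open>The first cohomology of a basic open set vanishes. A splitting for finitely many patches
  extends to every index \<open>y\<close> of the covering as \<open>\<gamma> k + c k y\<close> on
  the k-th patch.\<close>

theorem cocycle_splits_on_basic_open:
  assumes c: "sheaf.pointwise_cocycle U c" and h: "homogeneous e h" "e > 0"
  obtains \<beta> where "\<And>y. y \<in> X \<Longrightarrow> is_section (D h \<inter> U y) (\<beta> y)"
    "\<And>y z P. y \<in> X \<Longrightarrow> z \<in> X \<Longrightarrow> P \<in> D h \<Longrightarrow> P \<in> U y \<Longrightarrow> P \<in> U z \<Longrightarrow> c y z P = \<beta> z P \<ominus>\<^bsub>L P\<^esub> \<beta> y P"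
proof -
  have Uop: "openin T (U y) \<and> y \<in> U y" if "y \<in> X" for y
    using sheaf.pcoverD[OF sheaf.cocycle_cover[OF c]] that by (simp add: topspace_T)
  have "\<exists>v d. homogeneous d v \<and> d > 0 \<and> x \<in> D v \<and> D v \<subseteq> U x \<and> D v \<subseteq> D h" if x: "x \<in> D h" for x
  proof -
    have "openin T (U x)" "x \<in> U x" using Uop x by (auto simp: D_iff)
    then obtain d v where "homogeneous d v" "x \<in> D v" "D v \<subseteq> U x" "D v \<subseteq> D h" "d \<ge> e"
      by (rule local_open_refinement[OF h(1) _ _ x]; blast)
    then show ?thesis using h(2) by (intro exI[of _ v] exI[of _ d]) simp
  qed
  then obtain v d where v: "\<And>x. x \<in> D h \<Longrightarrow> homogeneous (d x) (v x) \<and> d x > 0 \<and> x \<in> D (v x) \<and> D (v x) \<subseteq> U x \<and> D (v x) \<subseteq> D h"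
    by metis
  have v1: "\<exists>d. homogeneous d w" if "w \<in> v ` D h" for w using that v by blast
  have v2: "\<exists>w\<in>v ` D h. nonvanishing P w" if "P \<in> D h" for P using v[OF that] that by (auto simp: D_iff)
  obtain B where B: "finite B" "B \<subseteq> v ` D h" "\<And>P. P \<in> D h \<Longrightarrow> \<exists>w\<in>B. nonvanishing P w"
    by (rule quasi_compact[OF h v1 v2]; blast)
  \<comment> \<open>The finite subcover is indexed by points again, because the entries of the
    cocycle are.\<close>
  obtain A where A: "A \<subseteq> D h" "finite A" "B = v ` A" using finite_subset_image[OF B(1,2)] by blast
  have AX: "A \<subseteq> X" using A(1) by (auto simp: D_iff)
  have vA: "\<And>k. k \<in> A \<Longrightarrow> homogeneous (d k) (v k) \<and> d k > 0 \<and> D (v k) \<subseteq> U k \<and> D (v k) \<subseteq> D h"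
    using A(1) v by blast
  have cover: "\<And>P. P \<in> D h \<Longrightarrow> \<exists>k\<in>A. nonvanishing P (v k)" using B(3) A(3) by blast
  obtain \<gamma> where \<gamma>: "\<And>k. k \<in> A \<Longrightarrow> is_section (D (v k)) (\<gamma> k)"
    and c\<gamma>: "\<And>k l P. k \<in> A \<Longrightarrow> l \<in> A \<Longrightarrow> P \<in> D (v k) \<Longrightarrow> P \<in> D (v l) \<Longrightarrow> c k l P = \<gamma> l P \<ominus>\<^bsub>L P\<^esub> \<gamma> k P"
    by (rule cocycle_splits_finite[OF c h A(2) AX vA cover]; blast)
  define \<kappa> where "\<kappa> P = (SOME k. k \<in> A \<and> nonvanishing P (v k))" for P
  have \<kappa>: "\<kappa> P \<in> A \<and> P \<in> D (v (\<kappa> P))" if "P \<in> D h" for P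
    using someI_ex[of "\<lambda>k. k \<in> A \<and> nonvanishing P (v k)"] cover[OF that] that unfolding \<kappa>_def D_iff by blast
  \<comment> \<open>\<open>\<kappa> P\<close> chooses a patch around each point separately. The
    values do not depend on the choice (\<open>\<beta>_eq\<close>), so near any point one fixed
    patch can be used, which shows that \<open>\<beta> y\<close> is a section.\<close>
  define \<beta> where "\<beta> y P = \<gamma> (\<kappa> P) P \<oplus>\<^bsub>L P\<^esub> c (\<kappa> P) y P" for y P
  have stalkc: "c k y P \<in> carrier (L P)" if "k \<in> X" "y \<in> X" "P \<in> U k" "P \<in> U y" for k y P
    using sheaf.cocycle_stalk[OF c] that by (simp add: topspace_T)
  have \<beta>_eq: "\<beta> y P = \<gamma> k P \<oplus>\<^bsub>L P\<^esub> c k y P" if y: "y \<in> X" "P \<in> U y" and k: "k \<in> A" "P \<in> D (v k)" for y k P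
  proof -
    have Ph: "P \<in> D h" and PX: "P \<in> X" using vA[OF k(1)] k(2) by (auto simp: D_iff)
    note \<kappa>P = \<kappa>[OF Ph]
    interpret abelian_group "L P" by (rule sheaf.stalk_group) (simp add: topspace_T PX)
    have U: "P \<in> U k" "P \<in> U (\<kappa> P)" "k \<in> X" "\<kappa> P \<in> X" using vA[OF k(1)] vA \<kappa>P k AX by auto
    have st: "\<gamma> k P \<in> carrier (L P)" "\<gamma> (\<kappa> P) P \<in> carrier (L P)" "c k y P \<in> carrier (L P)"
      using is_section_stalk[OF \<gamma>] k \<kappa>P stalkc[OF U(3) y(1) U(1) y(2)] by auto
    have ck: "c (\<kappa> P) k P = \<gamma> k P \<ominus>\<^bsub>L P\<^esub> \<gamma> (\<kappa> P) P" using \<kappa>P k by (intro c\<gamma>) auto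
    have "\<beta> y P = \<gamma> (\<kappa> P) P \<oplus>\<^bsub>L P\<^esub> (c (\<kappa> P) k P \<oplus>\<^bsub>L P\<^esub> c k y P)"
      unfolding \<beta>_def using cocycle_equation[OF c U(4,3) y(1) U(2,1) y(2)] by simp
    also have "\<dots> = \<gamma> k P \<oplus>\<^bsub>L P\<^esub> c k y P"
    proof -
      have "\<gamma> k P = (\<gamma> k P \<ominus>\<^bsub>L P\<^esub> \<gamma> (\<kappa> P) P) \<oplus>\<^bsub>L P\<^esub> \<gamma> (\<kappa> P) P"
        by (rule diff_eq_iff[THEN iffD1, OF st(1,2) _ refl]) (use st in simp)
      then show ?thesis
        unfolding ck using st by (simp add: a_assoc[symmetric] a_comm[of "\<gamma> (\<kappa> P) P"])
    qed
    finally show ?thesis .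
  qed
  show ?thesis
  proof (rule that[of \<beta>])
    fix y assume y: "y \<in> X"
    show "is_section (D h \<inter> U y) (\<beta> y)"
    proof (rule is_section_local)
      fix P assume P: "P \<in> D h \<inter> U y"
      then obtain k where k: "k \<in> A" "P \<in> D (v k)" using \<kappa> by blast
      have kX: "k \<in> X" using k AX by blast
      let ?V = "D (v k) \<inter> U y"
      have op: "openin T ?V" using Uop[OF y] vA[OF k(1)] openin_D by (intro openin_Int) auto
      have "is_section ?V (\<lambda>Q. \<gamma> k Q \<oplus>\<^bsub>L Q\<^esub> c k y Q)"
      proof (rule is_section_add)
        show "is_section ?V (\<gamma> k)" by (rule is_section_subset[OF \<gamma>[OF k(1)] op]) simp
        show "is_section ?V (c k y)"
          by (rule is_section_subset[OF cocycle_is_section[OF c kX y] op]) (use vA[OF k(1)] in blast)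
      qed
      moreover have "\<forall>Q\<in>?V. \<beta> y Q = \<gamma> k Q \<oplus>\<^bsub>L Q\<^esub> c k y Q" using \<beta>_eq[OF y _ k(1)] by blast
      moreover have "P \<in> ?V" "?V \<subseteq> D h \<inter> U y" using P k vA[OF k(1)] by blast+
      ultimately show "\<exists>V \<tau>. P \<in> V \<and> V \<subseteq> D h \<inter> U y \<and> is_section V \<tau> \<and> (\<forall>Q\<in>V. \<beta> y Q = \<tau> Q)" by blast
    qed
    fix z P assume z: "z \<in> X" and P: "P \<in> D h" "P \<in> U y" "P \<in> U z"
    note k = \<kappa>[OF P(1)]
    have kX: "\<kappa> P \<in> X" "P \<in> U (\<kappa> P)" using k AX vA by auto
    have PX: "P \<in> X" using P by (simp add: D_iff)
    interpret abelian_group "L P" by (rule sheaf.stalk_group) (simp add: topspace_T PX)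
    have st: "\<gamma> (\<kappa> P) P \<in> carrier (L P)" "c (\<kappa> P) y P \<in> carrier (L P)" "c y z P \<in> carrier (L P)"
      using is_section_stalk[OF \<gamma>] k stalkc kX P y z by auto
    have "\<beta> z P = c y z P \<oplus>\<^bsub>L P\<^esub> \<beta> y P"
      unfolding \<beta>_def using cocycle_equation[OF c kX(1) y z kX(2) P(2,3)] st by (simp add: a_ac)
    then show "c y z P = \<beta> z P \<ominus>\<^bsub>L P\<^esub> \<beta> y P"
      using diff_eq_iff[of "\<beta> z P" "\<beta> y P" "c y z P"] st by (simp add: \<beta>_def)
  qed
qed

end

section \<open>Cohomology classes as Laurent cocycles\<close>

context curve
begin

lemma D_xprod: "I \<noteq> {} \<Longrightarrow> P \<in> D (xprod I) \<longleftrightarrow> (\<forall>i\<in>I. P \<in> D (variable i))"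
  by (auto simp: D_iff xprod_def nonvanishing_prod)

lemma card_pos: "I \<noteq> {} \<Longrightarrow> card (I :: coord set) > 0"
  by (simp add: card_gt_0_iff)

definition laurent_fraction where
  "laurent_fraction P l a s \<longleftrightarrow> fraction P a s \<and> laurent a = l * laurent s"

text \<open>Arbitrary if no fraction represents \<open>l\<close> at \<open>P\<close>.\<close>

definition laurent_value where
  "laurent_value P l = (SOME q. \<exists>a s. laurent_fraction P l a s \<and> q = fr P a s)"

text \<open>Two fractions for the same Laurent polynomial satisfy cross multiplication in the
  polynomial ring, since \<open>laurent\<close> is injective.\<close>

lemma laurent_value_eq:
  assumes "laurent_fraction P l a s"
  shows "laurent_value P l = fr P a s"
  unfolding laurent_value_def
proof (rule some_equality)
  show "\<exists>b t. laurent_fraction P l b t \<and> fr P a s = fr P b t" using assms by blast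
  fix q assume "\<exists>b t. laurent_fraction P l b t \<and> q = fr P b t"
  then obtain b t where bt: "laurent_fraction P l b t" "q = fr P b t" by blast
  have "laurent (b * s) = laurent (a * t)"
    using assms bt(1) by (simp add: laurent_fraction_def laurent_mult mult_ac)
  then have "b * s = a * t" by (simp only: laurent_inject)
  then show "q = fr P a s"
    unfolding bt(2) using assms bt(1) unfolding laurent_fraction_def by (intro fr_eqI) blast+
qed

lemma laurent_fraction_add:
  "laurent_fraction P l a s \<Longrightarrow> laurent_fraction P m b t \<Longrightarrow> laurent_fraction P (l + m) (a * t + b * s) (s * t)"
  by (simp add: laurent_fraction_def fraction_add laurent_add laurent_mult algebra_simps)

lemma laurent_fraction_uminus: "laurent_fraction P l a s \<Longrightarrow> laurent_fraction P (- l) (- a) s"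
  by (simp add: laurent_fraction_def fraction_uminus laurent_uminus)

lemma laurent_fraction_power: "laurent_fraction P l a s \<Longrightarrow> laurent_fraction P (l ^ n) (a ^ n) (s ^ n)"
  by (simp add: laurent_fraction_def fr_power laurent_power power_mult_distrib)

lemma ex_laurent_fraction:
  assumes l: "l \<in> localized I 0" and I: "I \<noteq> {}"
  obtains N where "\<And>n. n \<ge> N \<Longrightarrow> \<exists>a. homogeneous (n * card I) a \<and> l * laurent (xprod I ^ n) = laurent a \<and>
    (\<forall>P\<in>D (xprod I). laurent_fraction P l a (xprod I ^ n))"
proof -
  obtain N where N: "\<forall>n\<ge>N. \<exists>a. homogeneous (n * card I) a \<and> l * laurent (xprod I ^ n) = laurent a"
    using localized_fraction[OF l] by blast
  have "\<exists>a. homogeneous (n * card I) a \<and> l * laurent (xprod I ^ n) = laurent a \<and>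
      (\<forall>P\<in>D (xprod I). laurent_fraction P l a (xprod I ^ n))" if n: "n \<ge> N" for n
  proof -
    obtain a where a: "homogeneous (n * card I) a" "l * laurent (xprod I ^ n) = laurent a" using N n by blast
    have "laurent_fraction P l a (xprod I ^ n)" if P: "P \<in> D (xprod I)" for P
      using a homogeneous_power[OF homogeneous_xprod, of n I] P nonvanishing_power[of P "xprod I" n]
      unfolding laurent_fraction_def fraction_def D_iff by auto
    then show ?thesis using a by blast
  qed
  then show ?thesis by (rule that)
qed

lemma localized_laurent_fraction:
  assumes "l \<in> localized I 0" "I \<noteq> {}" "P \<in> D (xprod I)"
  obtains a s where "laurent_fraction P l a s"
  using ex_laurent_fraction[OF assms(1,2)] assms(3) by (metis order_refl)

lemma laurent_value_section:
  assumes l: "l \<in> localized I 0" and I: "I \<noteq> {}"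
  shows "is_section (D (xprod I)) (\<lambda>P. laurent_value P l)"
proof -
  obtain N where "\<And>n. n \<ge> N \<Longrightarrow> \<exists>a. homogeneous (n * card I) a \<and> l * laurent (xprod I ^ n) = laurent a \<and>
      (\<forall>P\<in>D (xprod I). laurent_fraction P l a (xprod I ^ n))"
    by (rule ex_laurent_fraction[OF l I]; blast)
  then obtain a where a: "\<forall>P\<in>D (xprod I). laurent_fraction P l a (xprod I ^ N)" by blast
  have "is_section (D (xprod I)) (\<lambda>P. fr P a (xprod I ^ N))"
    using a homogeneous_xprod[of I] by (intro is_section_fraction) (auto simp: laurent_fraction_def)
  then show ?thesis by (rule is_section_cong) (use a laurent_value_eq in blast)
qed

lemma laurent_value_add:
  assumes "l \<in> localized I 0" "m \<in> localized I 0" "I \<noteq> {}" "P \<in> D (xprod I)"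
  shows "laurent_value P (l + m) = laurent_value P l \<oplus>\<^bsub>L P\<^esub> laurent_value P m"
proof -
  obtain a s where l: "laurent_fraction P l a s" by (rule localized_laurent_fraction[OF assms(1,3,4)]; blast)
  obtain b t where m: "laurent_fraction P m b t" by (rule localized_laurent_fraction[OF assms(2,3,4)]; blast)
  have "fr P a s \<oplus>\<^bsub>L P\<^esub> fr P b t = fr P (a * t + b * s) (s * t)"
    using l m by (intro fr_add) (simp_all add: laurent_fraction_def)
  then show ?thesis
    by (simp only: laurent_value_eq[OF l] laurent_value_eq[OF m] laurent_value_eq[OF laurent_fraction_add[OF l m]])
qed

lemma laurent_value_uminus:
  assumes "l \<in> localized I 0" "I \<noteq> {}" "P \<in> D (xprod I)"
  shows "laurent_value P (- l) = \<ominus>\<^bsub>L P\<^esub> laurent_value P l"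
proof -
  obtain a s where l: "laurent_fraction P l a s" by (rule localized_laurent_fraction[OF assms]; blast)
  then have "\<ominus>\<^bsub>L P\<^esub> fr P a s = fr P (- a) s" by (intro fr_uminus) (simp add: laurent_fraction_def)
  then show ?thesis
    by (simp only: laurent_value_eq[OF l] laurent_value_eq[OF laurent_fraction_uminus[OF l]])
qed

lemma laurent_value_diff:
  assumes "l \<in> localized I 0" "m \<in> localized I 0" "I \<noteq> {}" "P \<in> D (xprod I)"
  shows "laurent_value P (l - m) = laurent_value P l \<ominus>\<^bsub>L P\<^esub> laurent_value P m"
  using laurent_value_add[OF assms(1) localized_uminus[OF assms(2)] assms(3,4)]
    laurent_value_uminus[OF assms(2-4)] by (simp add: a_minus_def)

lemma laurent_value_power:
  assumes "l \<in> localized I 0" "I \<noteq> {}" "P \<in> D (xprod I)"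
  shows "laurent_value P (l ^ n) = laurent_value P l [^]\<^bsub>L P\<^esub> n"
proof -
  obtain a s where l: "laurent_fraction P l a s" by (rule localized_laurent_fraction[OF assms]; blast)
  then have "fr P a s [^]\<^bsub>L P\<^esub> n = fr P (a ^ n) (s ^ n)" by (intro fr_power) (simp add: laurent_fraction_def)
  then show ?thesis
    by (simp only: laurent_value_eq[OF l] laurent_value_eq[OF laurent_fraction_power[OF l]])
qed

text \<open>Identifies the kernel of evaluation. If all values vanish, the numerator times a power
  of \<open>xprod I\<close> lies in \<open>J\<close>; choosing cofactors of the right degrees and
  dividing by the power exhibits \<open>l\<close> in the ideal.\<close>

lemma laurent_value_eq_zero_iff:
  assumes l: "l \<in> localized I 0" and I: "I \<noteq> {}"
  shows "l \<in> ideal_part I \<longleftrightarrow> (\<forall>P\<in>D (xprod I). laurent_value P l = \<zero>\<^bsub>L P\<^esub>)"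
proof
  assume "l \<in> ideal_part I"
  then obtain u v where uv: "u \<in> localized I (-3)" "v \<in> localized I (-2)" "l = F * u + G * v"
    unfolding ideal_part_def by blast
  obtain N0 where N0: "\<And>n. n \<ge> N0 \<Longrightarrow> \<exists>a. homogeneous (n * card I) a \<and> l * laurent (xprod I ^ n) = laurent a \<and>
      (\<forall>P\<in>D (xprod I). laurent_fraction P l a (xprod I ^ n))"
    by (rule ex_laurent_fraction[OF l I]; blast)
  obtain N1 N2 where N1: "\<forall>n\<ge>N1. \<exists>a. u * laurent (xprod I ^ n) = laurent a"
    and N2: "\<forall>n\<ge>N2. \<exists>a. v * laurent (xprod I ^ n) = laurent a"
    using localized_eventually_polynomial[OF uv(1)] localized_eventually_polynomial[OF uv(2)] by blast
  define n where "n = N0 + N1 + N2"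
  obtain a where a: "l * laurent (xprod I ^ n) = laurent a" "\<forall>P\<in>D (xprod I). laurent_fraction P l a (xprod I ^ n)"
    using N0[of n] by (auto simp: n_def)
  obtain b where b: "u * laurent (xprod I ^ n) = laurent b" using N1[rule_format, of n] by (auto simp: n_def)
  obtain c where c: "v * laurent (xprod I ^ n) = laurent c" using N2[rule_format, of n] by (auto simp: n_def)
  have "laurent a = laurent (f * b + g * c)"
    unfolding a(1)[symmetric] uv(3) laurent_add laurent_mult b[symmetric] c[symmetric]
    by (simp only: distrib_right mult.assoc)
  then have "a = f * b + g * c" by (simp only: laurent_inject)
  then have aJ: "a \<in> J" unfolding J_def by blast
  show "\<forall>P\<in>D (xprod I). laurent_value P l = \<zero>\<^bsub>L P\<^esub>"
  proof
    fix P assume P: "P \<in> D (xprod I)"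
    then have lf: "laurent_fraction P l a (xprod I ^ n)" using a(2) by blast
    then have "fr P a (xprod I ^ n) = \<zero>\<^bsub>L P\<^esub>"
      using P aJ nonvanishing_one[of P] by (intro fr_eq_zeroI[of P a _ 0 1]) (auto simp: laurent_fraction_def D_iff)
    then show "laurent_value P l = \<zero>\<^bsub>L P\<^esub>" by (simp only: laurent_value_eq[OF lf])
  qed
next
  assume zero: "\<forall>P\<in>D (xprod I). laurent_value P l = \<zero>\<^bsub>L P\<^esub>"
  obtain N0 where N0: "\<And>n. n \<ge> N0 \<Longrightarrow> \<exists>a. homogeneous (n * card I) a \<and> l * laurent (xprod I ^ n) = laurent a \<and>
      (\<forall>P\<in>D (xprod I). laurent_fraction P l a (xprod I ^ n))"
    by (rule ex_laurent_fraction[OF l I]; blast)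
  obtain a where a: "homogeneous (N0 * card I) a" "l * laurent (xprod I ^ N0) = laurent a"
    "\<forall>P\<in>D (xprod I). laurent_fraction P l a (xprod I ^ N0)"
    using N0[OF order_refl] by blast
  obtain M where M: "\<And>n. n \<ge> M \<Longrightarrow> xprod I ^ n * a \<in> J"
  proof (rule annihilated_by_power[OF a(1) homogeneous_xprod card_pos[OF I]])
    fix P assume P: "P \<in> D (xprod I)"
    then have lf: "laurent_fraction P l a (xprod I ^ N0)" using a(3) by blast
    then have fa: "fraction P a (xprod I ^ N0)" by (simp add: laurent_fraction_def)
    have "P \<in> X" using P by (simp add: D_iff)
    have "fr P a (xprod I ^ N0) = fr P 0 1"
      using zero P laurent_value_eq[OF lf] by (simp add: fr_zero)
    then have "frac_rel P a (xprod I ^ N0) 0 1"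
      using fr_eq_iff[OF fa fraction_const[OF \<open>P \<in> X\<close> homogeneous_zero]] by simp
    then show "\<exists>w. nonvanishing P w \<and> a * w \<in> J"
      unfolding frac_rel_def by (auto simp: mult.commute)
  qed (rule that)
  \<comment> \<open>The extra 3 makes the degree of the numerator at least that of f and g, so that
    3 and 2 can be subtracted from it for the degrees of the cofactors.\<close>
  define n where "n = N0 + M + 3"
  define A where "A = xprod I ^ (M + 3) * a"
  have AJ: "A \<in> J" unfolding A_def by (rule M) simp
  have lA: "l * laurent (xprod I ^ n) = laurent A"
    unfolding A_def n_def laurent_mult a(2)[symmetric] by (simp add: power_add laurent_mult mult_ac)
  have n3: "3 \<le> n * card I" using mult_le_mono[of 3 n 1 "card I"] card_pos[OF I] by (simp add: n_def)
  have A_hom: "homogeneous (n * card I) A"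
    using homogeneous_mult[OF homogeneous_power[OF homogeneous_xprod] a(1), of "M + 3"]
    by (simp add: A_def n_def algebra_simps)
  obtain b c where bc: "A = f * b + g * c" using AJ unfolding J_def by blast
  define b' where "b' = hpart (n * card I - 3) b"
  define c' where "c' = hpart (n * card I - 2) c"
  have "A = hpart (n * card I) A" using hpart_homogeneous[OF A_hom] by simp
  also have "\<dots> = f * b' + g * c'"
  proof -
    have "3 + (n * card I - 3) = n * card I" "2 + (n * card I - 2) = n * card I" using n3 by linarith+
    then show ?thesis
      using hpart_mult[OF f(1), of "n * card I - 3" b] hpart_mult[OF g(1), of "n * card I - 2" c]
      by (simp only: bc hpart_add b'_def c'_def)
  qed
  finally have A: "A = f * b' + g * c'" .
  define q :: "'k laurent4" where "q = Poly_Mapping.single (xprod_exponent I (- int n)) 1"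
  have q: "q \<in> localized I (- int (n * card I))"
    unfolding q_def by (rule localized_single) (auto split: if_splits)
  have "l = l * (laurent (xprod I ^ n) * q)" unfolding q_def xprod_power_unit by simp
  also have "\<dots> = F * (laurent b' * q) + G * (laurent c' * q)"
    unfolding mult.assoc[symmetric] lA A by (simp only: laurent_add laurent_mult distrib_right mult.assoc)
  finally have "l = F * (laurent b' * q) + G * (laurent c' * q)" .
  moreover have "laurent b' * q \<in> localized I (-3)"
    using localized_mult[OF localized_laurent[of "n * card I - 3" b'] q] n3 by (simp add: b'_def of_nat_diff)
  moreover have "laurent c' * q \<in> localized I (-2)"
    using localized_mult[OF localized_laurent[of "n * card I - 2" c'] q] n3 by (simp add: c'_def of_nat_diff)
  ultimately show "l \<in> ideal_part I" unfolding ideal_part_def by blast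
qed

text \<open>The surjectivity that goes with \<open>laurent_value_eq_zero_iff\<close>: a global
  fraction with denominator \<open>xprod I ^ N\<close> becomes a Laurent polynomial on multiplying
  by the inverse monomial.\<close>

lemma section_is_laurent_value:
  assumes \<sigma>: "is_section (D (xprod I)) \<sigma>" and I: "I \<noteq> {}"
  obtains l where "l \<in> localized I 0" "\<And>P. P \<in> D (xprod I) \<Longrightarrow> \<sigma> P = laurent_value P l"
proof -
  obtain N where "\<And>n. n \<ge> N \<Longrightarrow> \<exists>a. homogeneous (n * card I) a \<and> (\<forall>P\<in>D (xprod I). \<sigma> P = fr P a (xprod I ^ n))"
    by (rule section_is_global_fraction[OF homogeneous_xprod card_pos[OF I] \<sigma>]; blast)
  then obtain a where a: "homogeneous (N * card I) a" "\<And>P. P \<in> D (xprod I) \<Longrightarrow> \<sigma> P = fr P a (xprod I ^ N)" by blast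
  define q :: "'k laurent4" where "q = Poly_Mapping.single (xprod_exponent I (- int N)) 1"
  have q: "q \<in> localized I (- int (N * card I))"
    unfolding q_def by (rule localized_single) (auto split: if_splits)
  show ?thesis
  proof (rule that[of "laurent a * q"])
    show "laurent a * q \<in> localized I 0" using localized_mult[OF localized_laurent[OF a(1)] q] by simp
    fix P assume P: "P \<in> D (xprod I)"
    have "laurent a = laurent a * q * laurent (xprod I ^ N)"
      using xprod_power_unit[of I N, where ?'a = 'k] unfolding q_def[symmetric] mult.assoc mult.commute[of q] by simp
    then have "laurent_fraction P (laurent a * q) a (xprod I ^ N)"
      using a(1) homogeneous_power[OF homogeneous_xprod, of N I] P nonvanishing_power[of P "xprod I" N]
      unfolding laurent_fraction_def fraction_def D_iff by auto
    then show "\<sigma> P = laurent_value P (laurent a * q)" using a(2)[OF P] laurent_value_eq by simp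
  qed
qed

section \<open>Comparison of the four-set covering with the limit\<close>

definition chart :: "'k poly4 set set \<Rightarrow> coord" where
  "chart P = (SOME i. nonvanishing P (variable i))"

lemma chart: "P \<in> X \<Longrightarrow> P \<in> D (variable (chart P))"
  using someI_ex[OF ex_nonvanishing_variable] by (simp add: chart_def D_iff)

abbreviation Dx :: "coord \<Rightarrow> 'k poly4 set set set" where "Dx i \<equiv> D (variable i)"

lemma Dx_open: "openin T (Dx i)"
  by (rule openin_D[OF homogeneous_variable])

lemma D_xprod_1: "D (xprod {i}) = Dx i" and D_xprod_2: "D (xprod {i, j}) = Dx i \<inter> Dx j"
  and D_xprod_3: "D (xprod {i, j, k}) = Dx i \<inter> Dx j \<inter> Dx k"
  by (auto simp: D_xprod)

text \<open>The cohomology admits only coverings indexed by points, so the four coordinate sets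
  enter by choosing one of them for each point.\<close>

definition std_cover where "std_cover = (\<lambda>P. Dx (chart P))"

definition std_cochain where
  "std_cochain c = (\<lambda>x y. \<lambda>P\<in>std_cover x \<inter> std_cover y. laurent_value P (c [chart x, chart y]))"

lemma std_pcover: "sheaf.pcover std_cover"
  by (simp add: pointed_cover_def std_cover_def topspace_T chart Dx_open)

lemma cochain2_localized:
  assumes "c \<in> cochains 2 0" "{i, j} \<subseteq> I"
  shows "c [i, j] \<in> localized I 0"
  using localized_mono[OF cochainsD[OF assms(1), of "[i, j]"]] assms(2) by simp

lemma cochain1_localized:
  assumes "e \<in> cochains 1 0" "i \<in> I"
  shows "e [i] \<in> localized I 0"
  using localized_mono[OF cochainsD[OF assms(1), of "[i]"]] assms(2) by simp

lemma length_2_cases: "length I = 2 \<Longrightarrow> \<exists>i j. I = [i, j]"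
  and length_3_cases: "length I = 3 \<Longrightarrow> \<exists>i j k. I = [i, j, k]"
  by (auto simp: length_Suc_conv eval_nat_numeral)

lemma value_coboundary_2:
  assumes e: "e \<in> cochains 1 0" and P: "P \<in> Dx i" "P \<in> Dx j"
  shows "laurent_value P (coboundary e [i, j]) = laurent_value P (e [j]) \<ominus>\<^bsub>L P\<^esub> laurent_value P (e [i])"
  using laurent_value_diff[of "e [j]" "{i, j}" "e [i]" P] cochain1_localized[OF e] P
  by (simp add: D_xprod_2)

lemma cocycle_ideal_part_iff:
  assumes c: "c \<in> cochains 2 0"
  shows "coboundary c [i, j, k] \<in> ideal_part {i, j, k} \<longleftrightarrow>
    (\<forall>P\<in>Dx i \<inter> Dx j \<inter> Dx k. laurent_value P (c [i, k]) = laurent_value P (c [i, j]) \<oplus>\<^bsub>L P\<^esub> laurent_value P (c [j, k]))"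
proof -
  let ?I = "{i, j, k}"
  have l: "c [j, k] \<in> localized ?I 0" "c [i, k] \<in> localized ?I 0" "c [i, j] \<in> localized ?I 0"
    using cochain2_localized[OF c] by auto
  have d: "coboundary c [i, j, k] = (c [i, j] + c [j, k]) - c [i, k]" by simp
  have "laurent_value P (coboundary c [i, j, k]) = \<zero>\<^bsub>L P\<^esub> \<longleftrightarrow>
      laurent_value P (c [i, k]) = laurent_value P (c [i, j]) \<oplus>\<^bsub>L P\<^esub> laurent_value P (c [j, k])"
    if P: "P \<in> D (xprod ?I)" for P
  proof -
    interpret abelian_group "L P" using P by (intro sheaf.stalk_group) (simp add: topspace_T D_iff)
    have st: "laurent_value P (c [i, k]) \<in> carrier (L P)" "laurent_value P (c [i, j]) \<in> carrier (L P)"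
      "laurent_value P (c [j, k]) \<in> carrier (L P)"
      using is_section_stalk[OF laurent_value_section _] l P by auto
    show ?thesis
      unfolding d laurent_value_diff[OF localized_add[OF l(3,1)] l(2) _ P, simplified]
        laurent_value_add[OF l(3,1) _ P, simplified]
      using diff_eq_iff[of "laurent_value P (c [i, j]) \<oplus>\<^bsub>L P\<^esub> laurent_value P (c [j, k])" "laurent_value P (c [i, k])" "\<zero>\<^bsub>L P\<^esub>"] st
      by auto
  qed
  moreover have "coboundary c [i, j, k] \<in> localized ?I 0"
    unfolding d using l by (intro localized_diff localized_add)
  ultimately show ?thesis using laurent_value_eq_zero_iff[of "coboundary c [i, j, k]" ?I] by (auto simp: D_xprod_3)
qed

lemma laurent_cocycle_iff:
  "laurent_cocycle c \<longleftrightarrow> c \<in> cochains 2 0 \<and> (\<forall>i j k. \<forall>P\<in>Dx i \<inter> Dx j \<inter> Dx k.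
    laurent_value P (c [i, k]) = laurent_value P (c [i, j]) \<oplus>\<^bsub>L P\<^esub> laurent_value P (c [j, k]))"
proof -
  have "(\<forall>I. length I = 3 \<longrightarrow> coboundary c I \<in> ideal_part (set I)) \<longleftrightarrow>
      (\<forall>i j k. coboundary c [i, j, k] \<in> ideal_part {i, j, k})"
  proof (intro iffI allI impI)
    fix i j k assume "\<forall>I. length I = 3 \<longrightarrow> coboundary c I \<in> ideal_part (set I)"
    from this[rule_format, of "[i, j, k]"] show "coboundary c [i, j, k] \<in> ideal_part {i, j, k}" by simp
  next
    fix I :: "coord list" assume A: "\<forall>i j k. coboundary c [i, j, k] \<in> ideal_part {i, j, k}" and "length I = 3"
    then obtain i j k where "I = [i, j, k]" using length_3_cases by blast
    then show "coboundary c I \<in> ideal_part (set I)" using A[rule_format, of i j k] by (simp del: coboundary.simps)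
  qed
  then show ?thesis unfolding laurent_cocycle_def using cocycle_ideal_part_iff by blast
qed

lemma laurent_coboundary_iff:
  assumes c: "c \<in> cochains 2 0"
  shows "laurent_coboundary c \<longleftrightarrow> (\<exists>e\<in>cochains 1 0. \<forall>i j. \<forall>P\<in>Dx i \<inter> Dx j.
    laurent_value P (c [i, j]) = laurent_value P (e [j]) \<ominus>\<^bsub>L P\<^esub> laurent_value P (e [i]))"
proof -
  have eq: "c [i, j] - coboundary e [i, j] \<in> ideal_part {i, j} \<longleftrightarrow> (\<forall>P\<in>Dx i \<inter> Dx j.
      laurent_value P (c [i, j]) = laurent_value P (e [j]) \<ominus>\<^bsub>L P\<^esub> laurent_value P (e [i]))"
    if e: "e \<in> cochains 1 0" for e i j
  proof -
    let ?I = "{i, j}"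
    have l: "c [i, j] \<in> localized ?I 0" "coboundary e [i, j] \<in> localized ?I 0"
      using cochain2_localized[OF c] cochainsD[OF coboundary_cochains[OF e], of "[i, j]"] by (auto simp del: coboundary.simps)
    have "laurent_value P (c [i, j] - coboundary e [i, j]) = \<zero>\<^bsub>L P\<^esub> \<longleftrightarrow>
        laurent_value P (c [i, j]) = laurent_value P (coboundary e [i, j])" if P: "P \<in> D (xprod ?I)" for P
    proof -
      interpret abelian_group "L P" using P by (intro sheaf.stalk_group) (simp add: topspace_T D_iff)
      have st: "laurent_value P (c [i, j]) \<in> carrier (L P)" "laurent_value P (coboundary e [i, j]) \<in> carrier (L P)"
        using is_section_stalk[OF laurent_value_section[OF l(1)] P] is_section_stalk[OF laurent_value_section[OF l(2)] P] by auto
      show ?thesis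
        unfolding laurent_value_diff[OF l insert_not_empty P] diff_eq_iff[OF st zero_closed] l_zero[OF st(2)] ..
    qed
    then show ?thesis
      using laurent_value_eq_zero_iff[OF localized_diff[OF l]] value_coboundary_2[OF e]
      by (auto simp: D_xprod_2 simp del: coboundary.simps)
  qed
  have "(\<forall>I. length I = 2 \<longrightarrow> c I - coboundary e I \<in> ideal_part (set I)) \<longleftrightarrow>
      (\<forall>i j. c [i, j] - coboundary e [i, j] \<in> ideal_part {i, j})" for e
  proof (intro iffI allI impI)
    fix i j assume "\<forall>I. length I = 2 \<longrightarrow> c I - coboundary e I \<in> ideal_part (set I)"
    from this[rule_format, of "[i, j]"] show "c [i, j] - coboundary e [i, j] \<in> ideal_part {i, j}" by simp
  next
    fix I :: "coord list" assume A: "\<forall>i j. c [i, j] - coboundary e [i, j] \<in> ideal_part {i, j}" and "length I = 2"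
    then obtain i j where "I = [i, j]" using length_2_cases by blast
    then show "c I - coboundary e I \<in> ideal_part (set I)" using A[rule_format, of i j] by (simp del: coboundary.simps)
  qed
  then show ?thesis unfolding laurent_coboundary_def using eq by (simp del: coboundary.simps)
qed

lemma value_section_2: "c \<in> cochains 2 0 \<Longrightarrow> is_section (Dx i \<inter> Dx j) (\<lambda>P. laurent_value P (c [i, j]))"
  using laurent_value_section[of "c [i, j]" "{i, j}"] cochain2_localized[of c i j "{i, j}"] by (simp add: D_xprod_2)

lemma value_section_1: "e \<in> cochains 1 0 \<Longrightarrow> is_section (Dx i) (\<lambda>P. laurent_value P (e [i]))"
  using laurent_value_section[of "e [i]" "{i}"] cochain1_localized[of e i "{i}"] by (simp add: D_xprod_1)

lemma std_cocycle:
  assumes "laurent_cocycle c"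
  shows "sheaf.pointwise_cocycle std_cover (std_cochain c)"
  unfolding sheaf.pointwise_cocycle_def topspace_T
proof (intro conjI ballI)
  have c: "c \<in> cochains 2 0" using assms by (simp add: laurent_cocycle_def)
  show "sheaf.pcover std_cover" by (rule std_pcover)
  fix x y assume "x \<in> X" "y \<in> X"
  show "std_cochain c x y \<in> carrier (SF (std_cover x \<inter> std_cover y))"
    unfolding std_cochain_def by (rule restrict_carrier_SF) (simp add: std_cover_def value_section_2[OF c])
  fix z P assume "z \<in> X" and P: "P \<in> std_cover x \<inter> std_cover y \<inter> std_cover z"
  have "laurent_value P (c [chart x, chart z])
      = laurent_value P (c [chart x, chart y]) \<oplus>\<^bsub>L P\<^esub> laurent_value P (c [chart y, chart z])"
    using assms P unfolding laurent_cocycle_iff std_cover_def by blast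
  then show "std_cochain c x z P = std_cochain c x y P \<oplus>\<^bsub>L P\<^esub> std_cochain c y z P"
    using P by (simp add: std_cochain_def)
qed

text \<open>Injectivity into the limit. If the cocycle splits on a refinement \<open>W\<close> by
  \<open>b\<close>, then \<open>b y\<close> plus the cocycle entry from the chart of
  \<open>y\<close> to \<open>i\<close> does not depend on \<open>y\<close>; these pieces glue to a
  section over all of \<open>Dx i\<close>, which splits the cocycle on the standard
  covering.\<close>

theorem std_cls_eq_zero_iff:
  assumes coc: "laurent_cocycle c"
  shows "sheaf.cls std_cover (std_cochain c) = \<zero>\<^bsub>H1 T SF\<^esub> \<longleftrightarrow> laurent_coboundary c"
proof
  have c: "c \<in> cochains 2 0" using coc by (simp add: laurent_cocycle_def)
  have cc: "laurent_value P (c [i, k]) = laurent_value P (c [i, j]) \<oplus>\<^bsub>L P\<^esub> laurent_value P (c [j, k])"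
    if "P \<in> Dx i" "P \<in> Dx j" "P \<in> Dx k" for i j k P using coc that unfolding laurent_cocycle_iff by blast
  have cst: "laurent_value P (c [i, j]) \<in> carrier (L P)" if "P \<in> Dx i" "P \<in> Dx j" for i j P
    using is_section_stalk[OF value_section_2[OF c]] that by blast
  {
    assume "laurent_coboundary c"
    then obtain e where e: "e \<in> cochains 1 0" "\<forall>i j. \<forall>P\<in>Dx i \<inter> Dx j.
        laurent_value P (c [i, j]) = laurent_value P (e [j]) \<ominus>\<^bsub>L P\<^esub> laurent_value P (e [i])"
      unfolding laurent_coboundary_iff[OF c] by blast
    show "sheaf.cls std_cover (std_cochain c) = \<zero>\<^bsub>H1 T SF\<^esub>"
      unfolding sheaf.cls_eq_zero_iff[OF std_cocycle[OF coc]] topspace_T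
    proof (intro exI conjI ballI)
      show "sheaf.pcover std_cover" by (rule std_pcover)
      let ?b = "\<lambda>x. restrict (\<lambda>P. laurent_value P (e [chart x])) (std_cover x)"
      fix x assume "x \<in> X"
      show "std_cover x \<subseteq> std_cover x" by simp
      show "?b x \<in> carrier (SF (std_cover x))"
        by (rule restrict_carrier_SF) (simp add: std_cover_def value_section_1[OF e(1)])
      fix y P assume P: "P \<in> std_cover x \<inter> std_cover y"
      then show "std_cochain c x y P = ?b y P \<ominus>\<^bsub>L P\<^esub> ?b x P"
        using e(2) by (simp add: std_cochain_def std_cover_def)
    qed
  }
  {
    assume "sheaf.cls std_cover (std_cochain c) = \<zero>\<^bsub>H1 T SF\<^esub>"
    then obtain W b where W: "sheaf.pcover W" and Wb: "\<And>x. x \<in> X \<Longrightarrow> W x \<subseteq> std_cover x \<and> b x \<in> carrier (SF (W x))"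
      and b: "\<And>x y P. x \<in> X \<Longrightarrow> y \<in> X \<Longrightarrow> P \<in> W x \<inter> W y \<Longrightarrow> std_cochain c x y P = b y P \<ominus>\<^bsub>L P\<^esub> b x P"
      unfolding sheaf.cls_eq_zero_iff[OF std_cocycle[OF coc]] topspace_T by blast
    have Wx: "openin T (W x) \<and> x \<in> W x" if "x \<in> X" for x using sheaf.pcoverD[OF W] that by (simp add: topspace_T)
    have bsec: "is_section (W x) (b x)" if "x \<in> X" for x using Wb[OF that] by (simp add: carrier_SF)
    \<comment> \<open>The glued section is evaluated with the index \<open>y = P\<close>;
      \<open>\<epsilon>_eq\<close> shows that any other index whose neighbourhood contains
      \<open>P\<close> gives the same value.\<close>
    define \<epsilon> where "\<epsilon> i P = b P P \<oplus>\<^bsub>L P\<^esub> laurent_value P (c [chart P, i])" for i P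
    have \<epsilon>_eq: "\<epsilon> i P = b y P \<oplus>\<^bsub>L P\<^esub> laurent_value P (c [chart y, i])"
      if y: "y \<in> X" "P \<in> W y" and P: "P \<in> Dx i" for i y P
    proof -
      have PX: "P \<in> X" using P by (simp add: D_iff)
      interpret abelian_group "L P" by (rule sheaf.stalk_group) (simp add: topspace_T PX)
      have Py: "P \<in> Dx (chart y)" "P \<in> Dx (chart P)" using Wb[OF y(1)] y(2) chart[OF PX] by (auto simp: std_cover_def)
      have st: "b y P \<in> carrier (L P)" "b P P \<in> carrier (L P)"
        using is_section_stalk[OF bsec] y PX Wx by auto
      have "std_cochain c y P P = laurent_value P (c [chart y, chart P])"
        using Py by (simp add: std_cochain_def std_cover_def)
      then have "laurent_value P (c [chart y, chart P]) = b P P \<ominus>\<^bsub>L P\<^esub> b y P"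
        using b[OF y(1) PX, of P] y(2) Wx[OF PX] by simp
      then have bP: "b P P = laurent_value P (c [chart y, chart P]) \<oplus>\<^bsub>L P\<^esub> b y P"
        using diff_eq_iff[of "b P P" "b y P"] st cst[OF Py] by metis
      show ?thesis
        unfolding \<epsilon>_def cc[OF Py P] bP using st cst[OF Py] cst[OF Py(2) P] by (simp add: a_ac)
    qed
    have "is_section (Dx i) (\<epsilon> i)" for i
    proof (rule is_section_local)
      fix y assume y: "y \<in> Dx i"
      then have yX: "y \<in> X" by (simp add: D_iff)
      let ?V = "W y \<inter> Dx i"
      have op: "openin T ?V" using Wx[OF yX] Dx_open by (intro openin_Int) auto
      have "is_section ?V (\<lambda>Q. b y Q \<oplus>\<^bsub>L Q\<^esub> laurent_value Q (c [chart y, i]))"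
      proof (rule is_section_add)
        show "is_section ?V (b y)" by (rule is_section_subset[OF bsec[OF yX] op]) simp
        show "is_section ?V (\<lambda>Q. laurent_value Q (c [chart y, i]))"
          by (rule is_section_subset[OF value_section_2[OF c] op]) (use Wb[OF yX] in \<open>auto simp: std_cover_def\<close>)
      qed
      moreover have "\<forall>Q\<in>?V. \<epsilon> i Q = b y Q \<oplus>\<^bsub>L Q\<^esub> laurent_value Q (c [chart y, i])"
        using \<epsilon>_eq[OF yX] by blast
      moreover have "y \<in> ?V" using Wx[OF yX] y by blast
      ultimately show "\<exists>V \<tau>. y \<in> V \<and> V \<subseteq> Dx i \<and> is_section V \<tau> \<and> (\<forall>Q\<in>V. \<epsilon> i Q = \<tau> Q)" by blast
    qed
    then have "is_section (D (xprod {i})) (\<epsilon> i)" for i by (simp only: D_xprod_1)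
    then have "\<exists>l. l \<in> localized {i} 0 \<and> (\<forall>P\<in>D (xprod {i}). \<epsilon> i P = laurent_value P l)" for i
      by (rule section_is_laurent_value) blast+
    then have "\<exists>l. l \<in> localized {i} 0 \<and> (\<forall>P\<in>Dx i. \<epsilon> i P = laurent_value P l)" for i
      by (simp only: D_xprod_1)
    then obtain l where l: "\<And>i. l i \<in> localized {i} 0 \<and> (\<forall>P\<in>Dx i. \<epsilon> i P = laurent_value P (l i))" by metis
    show "laurent_coboundary c"
      unfolding laurent_coboundary_iff[OF c]
    proof (intro bexI allI ballI)
      \<comment> \<open>Cochains are functions on lists; \<open>hd\<close> makes one out of a family
        indexed by coordinates.\<close>
      show "(\<lambda>I. l (hd I)) \<in> cochains 1 0"
        unfolding cochains_def using l by (auto simp: length_Suc_conv)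
      fix i j P assume P: "P \<in> Dx i \<inter> Dx j"
      then have PX: "P \<in> X" by (simp add: D_iff)
      interpret abelian_group "L P" by (rule sheaf.stalk_group) (simp add: topspace_T PX)
      have Pc: "P \<in> Dx (chart P)" by (rule chart[OF PX])
      have st: "b P P \<in> carrier (L P)" using is_section_stalk[OF bsec[OF PX]] Wx[OF PX] by blast
      note cs = cst[of P "chart P" i] cst[of P i j] cst[of P "chart P" j]
      have "\<epsilon> j P = laurent_value P (c [i, j]) \<oplus>\<^bsub>L P\<^esub> \<epsilon> i P"
        unfolding \<epsilon>_def using cc[OF Pc, of i j] P Pc st cs by (simp add: a_ac)
      then have "laurent_value P (c [i, j]) = \<epsilon> j P \<ominus>\<^bsub>L P\<^esub> \<epsilon> i P"
        using diff_eq_iff[of "\<epsilon> j P" "\<epsilon> i P" "laurent_value P (c [i, j])"] P Pc st cs by (simp add: \<epsilon>_def)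
      then show "laurent_value P (c [i, j]) = laurent_value P (l (hd [j])) \<ominus>\<^bsub>L P\<^esub> laurent_value P (l (hd [i]))"
        using l P by simp
    qed
  }
qed

text \<open>Surjectivity onto the limit. The given cocycle splits on each coordinate set, by a
  family \<beta> i; the differences of two such splittings are sections on the overlaps and form a
  standard cocycle in the same class.\<close>

theorem ex_std_representative:
  assumes "Z \<in> carrier (H1 T SF)"
  obtains c where "laurent_cocycle c" "Z = sheaf.cls std_cover (std_cochain c)"
proof -
  obtain U d where d: "sheaf.pointwise_cocycle U d" and Z: "Z = sheaf.cls U d"
    using assms unfolding sheaf.carrier_H1 by blast
  have Uy: "openin T (U y) \<and> y \<in> U y" if "y \<in> X" for y
    using sheaf.pcoverD[OF sheaf.cocycle_cover[OF d]] that by (simp add: topspace_T)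
  have "\<exists>\<beta>. (\<forall>y\<in>X. is_section (Dx i \<inter> U y) (\<beta> y)) \<and> (\<forall>y\<in>X. \<forall>z\<in>X. \<forall>P\<in>Dx i \<inter> U y \<inter> U z.
      d y z P = \<beta> z P \<ominus>\<^bsub>L P\<^esub> \<beta> y P)" for i
  proof -
    have "(0::nat) < 1" by simp
    then show ?thesis by (rule cocycle_splits_on_basic_open[OF d homogeneous_variable[of i]]) blast
  qed
  then obtain \<beta> where \<beta>: "\<And>i y. y \<in> X \<Longrightarrow> is_section (Dx i \<inter> U y) (\<beta> i y)"
    and d\<beta>: "\<And>i y z P. y \<in> X \<Longrightarrow> z \<in> X \<Longrightarrow> P \<in> Dx i \<Longrightarrow> P \<in> U y \<Longrightarrow> P \<in> U z \<Longrightarrow> d y z P = \<beta> i z P \<ominus>\<^bsub>L P\<^esub> \<beta> i y P"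
    by (metis IntI)
  have st: "\<beta> i y P \<in> carrier (L P)" if "y \<in> X" "P \<in> Dx i" "P \<in> U y" for i y P
    using is_section_stalk[OF \<beta>[OF that(1)]] that by blast
  \<comment> \<open>\<open>\<beta> i y - \<beta> j y\<close> does not depend on \<open>y\<close>, as both terms split the same cocycle\<close>
  define \<epsilon> where "\<epsilon> i j P = \<beta> i P P \<ominus>\<^bsub>L P\<^esub> \<beta> j P P" for i j P
  have \<epsilon>_eq: "\<epsilon> i j P = \<beta> i y P \<ominus>\<^bsub>L P\<^esub> \<beta> j y P" if y: "y \<in> X" "P \<in> U y" and P: "P \<in> Dx i" "P \<in> Dx j" for i j y P
  proof -
    have PX: "P \<in> X" using P by (simp add: D_iff)
    interpret abelian_group "L P" by (rule sheaf.stalk_group) (simp add: topspace_T PX)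
    have PU: "P \<in> U P" using Uy[OF PX] by blast
    have dst: "d y P P \<in> carrier (L P)"
      using sheaf.cocycle_stalk[OF d, of y P P] y PX PU by (simp add: topspace_T)
    have e: "\<beta> k P P = d y P P \<oplus>\<^bsub>L P\<^esub> \<beta> k y P" if k: "P \<in> Dx k" for k
      using diff_eq_iff[of "\<beta> k P P" "\<beta> k y P" "d y P P"] d\<beta>[OF y(1) PX k y(2) PU] st[OF PX k PU] st[OF y(1) k y(2)] dst
      by metis
    have "\<epsilon> i j P = (d y P P \<ominus>\<^bsub>L P\<^esub> d y P P) \<oplus>\<^bsub>L P\<^esub> (\<beta> i y P \<ominus>\<^bsub>L P\<^esub> \<beta> j y P)"
      unfolding \<epsilon>_def e[OF P(1)] e[OF P(2)]
      using add_diff_add[OF dst st[OF y(1) P(1) y(2)] dst st[OF y(1) P(2) y(2)]] .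
    then show ?thesis using dst st[OF y(1) P(1) y(2)] st[OF y(1) P(2) y(2)] by (simp add: a_minus_def r_neg)
  qed
  have "is_section (Dx i \<inter> Dx j) (\<epsilon> i j)" for i j
  proof (rule is_section_local)
    fix y assume y: "y \<in> Dx i \<inter> Dx j"
    then have yX: "y \<in> X" by (simp add: D_iff)
    let ?V = "U y \<inter> (Dx i \<inter> Dx j)"
    have op: "openin T ?V" using Uy[OF yX] Dx_open by (intro openin_Int) auto
    have "is_section ?V (\<lambda>Q. \<beta> i y Q \<ominus>\<^bsub>L Q\<^esub> \<beta> j y Q)"
      by (rule is_section_diff; rule is_section_subset[OF \<beta>[OF yX] op]) auto
    moreover have "\<forall>Q\<in>?V. \<epsilon> i j Q = \<beta> i y Q \<ominus>\<^bsub>L Q\<^esub> \<beta> j y Q" using \<epsilon>_eq[OF yX] by blast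
    moreover have "y \<in> ?V" using Uy[OF yX] y by blast
    ultimately show "\<exists>V \<tau>. y \<in> V \<and> V \<subseteq> Dx i \<inter> Dx j \<and> is_section V \<tau> \<and> (\<forall>Q\<in>V. \<epsilon> i j Q = \<tau> Q)"
      by (intro exI[of _ ?V] exI[of _ "\<lambda>Q. \<beta> i y Q \<ominus>\<^bsub>L Q\<^esub> \<beta> j y Q"] conjI Int_lower2)
  qed
  then have "is_section (D (xprod {i, j})) (\<epsilon> i j)" for i j by (simp only: D_xprod_2)
  then have "\<exists>l. l \<in> localized {i, j} 0 \<and> (\<forall>P\<in>D (xprod {i, j}). \<epsilon> i j P = laurent_value P l)" for i j
    by (rule section_is_laurent_value[of "{i, j}" "\<epsilon> i j"]) blast+
  then have "\<exists>l. l \<in> localized {i, j} 0 \<and> (\<forall>P\<in>Dx i \<inter> Dx j. \<epsilon> i j P = laurent_value P l)" for i j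
    by (simp only: D_xprod_2)
  then obtain l where l: "\<And>i j. l i j \<in> localized {i, j} 0 \<and> (\<forall>P\<in>Dx i \<inter> Dx j. \<epsilon> i j P = laurent_value P (l i j))"
    by metis
  define c where "c I = l (I ! 0) (I ! 1)" for I :: "coord list"
  have val: "laurent_value P (c [i, j]) = \<epsilon> i j P" if "P \<in> Dx i" "P \<in> Dx j" for i j P
    using l[of i j] that by (simp add: c_def)
  have coc: "laurent_cocycle c"
    unfolding laurent_cocycle_iff
  proof (intro conjI allI ballI)
    show "c \<in> cochains 2 0"
      unfolding cochains_def
    proof (intro CollectI allI impI)
      fix I :: "coord list" assume "length I = 2"
      then obtain i j where "I = [i, j]" using length_2_cases by blast
      then show "c I \<in> localized (set I) 0" using l by (simp add: c_def)
    qed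
    fix i j k P assume P: "P \<in> Dx i \<inter> Dx j \<inter> Dx k"
    then have PX: "P \<in> X" by (simp add: D_iff)
    interpret abelian_group "L P" by (rule sheaf.stalk_group) (simp add: topspace_T PX)
    have PU: "P \<in> U P" using Uy[OF PX] by blast
    show "laurent_value P (c [i, k]) = laurent_value P (c [i, j]) \<oplus>\<^bsub>L P\<^esub> laurent_value P (c [j, k])"
      using P diff_telescope[OF st[OF PX _ PU] st[OF PX _ PU] st[OF PX _ PU]] by (simp add: val \<epsilon>_def)
  qed
  let ?W = "\<lambda>y. std_cover y \<inter> U y"
  have W: "sheaf.pcover ?W" by (rule sheaf.pcover_Int[OF std_pcover sheaf.cocycle_cover[OF d]])
  \<comment> \<open>The cobounding cochain uses, at each index, the splitting that belongs to the
    chart chosen there.\<close>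
  have "sheaf.cobounds ?W (\<lambda>y. restrict (\<beta> (chart y) y) (?W y)) U d std_cover (std_cochain c)"
    unfolding sheaf.cobounds_def topspace_T
  proof (intro conjI ballI)
    show "sheaf.pcover ?W" by (rule W)
    fix y assume y: "y \<in> X"
    show "?W y \<subseteq> U y \<inter> std_cover y" by blast
    show "restrict (\<beta> (chart y) y) (?W y) \<in> carrier (SF (?W y))"
      by (rule restrict_carrier_SF) (simp add: std_cover_def \<beta>[OF y])
    fix z P assume z: "z \<in> X" and P: "P \<in> ?W y \<inter> ?W z"
    then have Pc: "P \<in> Dx (chart y)" "P \<in> Dx (chart z)" "P \<in> U y" "P \<in> U z" by (auto simp: std_cover_def)
    have PX: "P \<in> X" using Pc by (simp add: D_iff)
    interpret abelian_group "L P" by (rule sheaf.stalk_group) (simp add: topspace_T PX)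
    note s = st[OF y Pc(1,3)] st[OF y Pc(2,3)] st[OF z Pc(2,4)]
    have "d y z P = \<beta> (chart z) z P \<ominus>\<^bsub>L P\<^esub> \<beta> (chart z) y P" by (rule d\<beta>[OF y z Pc(2,3,4)])
    also have "\<dots> = (\<beta> (chart z) z P \<ominus>\<^bsub>L P\<^esub> \<beta> (chart y) y P) \<oplus>\<^bsub>L P\<^esub> (\<beta> (chart y) y P \<ominus>\<^bsub>L P\<^esub> \<beta> (chart z) y P)"
      using diff_telescope[OF s(3,1,2)] by simp
    also have "\<beta> (chart y) y P \<ominus>\<^bsub>L P\<^esub> \<beta> (chart z) y P = std_cochain c y z P"
      using \<epsilon>_eq[OF y Pc(3,1,2)] val[OF Pc(1,2)] P by (simp add: std_cochain_def)
    finally have "d y z P \<ominus>\<^bsub>L P\<^esub> std_cochain c y z P = \<beta> (chart z) z P \<ominus>\<^bsub>L P\<^esub> \<beta> (chart y) y P"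
    proof -
      assume a: "d y z P = (\<beta> (chart z) z P \<ominus>\<^bsub>L P\<^esub> \<beta> (chart y) y P) \<oplus>\<^bsub>L P\<^esub> std_cochain c y z P"
      have "std_cochain c y z P \<in> carrier (L P)"
        using sheaf.cocycle_stalk[OF std_cocycle[OF coc], of y z P] y z P by (simp add: topspace_T)
      then show ?thesis using diff_eq_iff[THEN iffD2, OF _ _ _ a] a s by simp
    qed
    then show "d y z P \<ominus>\<^bsub>L P\<^esub> std_cochain c y z P
        = restrict (\<beta> (chart z) z) (?W z) P \<ominus>\<^bsub>L P\<^esub> restrict (\<beta> (chart y) y) (?W y) P"
      using P by simp
  qed
  then have "Z = sheaf.cls std_cover (std_cochain c)"
    unfolding Z using sheaf.cls_eq_iff[OF d std_cocycle[OF coc]] by blast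
  with coc show ?thesis by (rule that)
qed

end

section \<open>The Hasse-Witt matrix\<close>

context curve
begin

lemma frobenius_sheaf:
  assumes p: "CHAR('k) = p" "p > 0"
  shows "frobenius_sheaf T SF L (\<lambda>k P. fr P (scalar k) 1) p"
proof (intro frobenius_sheaf.intro frobenius_sheaf_axioms.intro)
  show "function_sheaf T SF L (\<lambda>k P. fr P (scalar k) 1)" by (rule sheaf.function_sheaf_axioms)
  fix P u v assume "P \<in> topspace T" and uv: "u \<in> carrier (L P)" "v \<in> carrier (L P)"
  then have P: "P \<in> X" by (simp add: topspace_T)
  obtain a s b t where u: "fraction P a s" "u = fr P a s" and v: "fraction P b t" "v = fr P b t"
    using uv unfolding L_carrier[OF P] by blast
  show "(u \<oplus>\<^bsub>L P\<^esub> v) [^]\<^bsub>L P\<^esub> p = u [^]\<^bsub>L P\<^esub> p \<oplus>\<^bsub>L P\<^esub> v [^]\<^bsub>L P\<^esub> p"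
    unfolding u(2) v(2) fr_add[OF u(1) v(1)] fr_power(2)[OF fraction_add[OF u(1) v(1)]]
      fr_power(2)[OF u(1)] fr_power(2)[OF v(1)] fr_add[OF fr_power(1)[OF u(1)] fr_power(1)[OF v(1)]]
    by (simp only: poly_mapping_frobenius_add[OF p] power_mult_distrib)
qed

text \<open>That p-th powers respect the cocycle rule modulo the ideal is read off from the lifted
  Frobenius, whose lift has \<open>c ^ p\<close> as its first entry.\<close>

lemma frobenius_cocycle:
  assumes p: "CHAR('k) = p" "p > 0" and c: "laurent_cocycle c"
  shows "laurent_cocycle (\<lambda>I. c I ^ p)"
proof -
  obtain a b t where lift: "koszul_lift c a b t" by (rule ex_koszul_lift[OF c])
  show ?thesis by (rule koszul_lift_cocycle[OF koszul_lift_frobenius[OF lift p]])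
qed

lemma frobenius_std_cls:
  assumes p: "CHAR('k) = p" "p > 0" and c: "laurent_cocycle c"
  shows "H1_frobenius T SF p (sheaf.cls std_cover (std_cochain c))
    = sheaf.cls std_cover (std_cochain (\<lambda>I. c I ^ p))"
proof -
  interpret frob: frobenius_sheaf T SF L "\<lambda>k P. fr P (scalar k) 1" p by (rule frobenius_sheaf[OF p])
  note sc = std_cocycle[OF c] and scp = std_cocycle[OF frobenius_cocycle[OF p c]]
  have c2: "c \<in> cochains 2 0" using c by (simp add: laurent_cocycle_def)
  show ?thesis
    unfolding frob.H1_frobenius_cls[OF sc]
  proof (rule sheaf.cls_eqI[OF frob.frobenius_cocycle[OF sc] scp])
    fix x y P assume P: "P \<in> std_cover x" "P \<in> std_cover y"
    then have "P \<in> D (xprod {chart x, chart y})" by (simp add: D_xprod_2 std_cover_def)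
    from laurent_value_power[OF cochain2_localized[OF c2 subset_refl] _ this, of p] P
    show "(std_cochain c x y [^]\<^bsub>SF (std_cover x \<inter> std_cover y)\<^esub> p) P = std_cochain (\<lambda>I. c I ^ p) x y P"
      by (simp add: sheaf.sections_power std_cochain_def)
  qed
qed

text \<open>Every class has a standard representative, and vanishing of its image is a statement
  about Laurent coboundaries; this reduces the claim to
  \<open>frobenius_trivial_iff\<close>.\<close>

theorem frobenius_zero_iff:
  assumes p: "CHAR('k) = p" "p > 0"
  shows "(\<forall>Z\<in>carrier (H1 T SF). H1_frobenius T SF p Z = \<zero>\<^bsub>H1 T SF\<^esub>) \<longleftrightarrow>
    (\<forall>i j. Poly_Mapping.lookup ((f * g) ^ (p - 1)) (hasse_witt_monom p i j) = 0)"
proof -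
  have "(\<forall>Z\<in>carrier (H1 T SF). H1_frobenius T SF p Z = \<zero>\<^bsub>H1 T SF\<^esub>) \<longleftrightarrow>
      (\<forall>c. laurent_cocycle c \<longrightarrow> H1_frobenius T SF p (sheaf.cls std_cover (std_cochain c)) = \<zero>\<^bsub>H1 T SF\<^esub>)"
  proof (intro iffI allI impI ballI)
    fix Z assume A: "\<forall>c. laurent_cocycle c \<longrightarrow> H1_frobenius T SF p (sheaf.cls std_cover (std_cochain c)) = \<zero>\<^bsub>H1 T SF\<^esub>"
      and "Z \<in> carrier (H1 T SF)"
    then obtain c where "laurent_cocycle c" "Z = sheaf.cls std_cover (std_cochain c)"
      using ex_std_representative by blast
    then show "H1_frobenius T SF p Z = \<zero>\<^bsub>H1 T SF\<^esub>" using A by simp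
  qed (use sheaf.cls_carrier[OF std_cocycle] in blast)
  also have "\<dots> \<longleftrightarrow> (\<forall>c. laurent_cocycle c \<longrightarrow> laurent_coboundary (\<lambda>I. c I ^ p))"
    using frobenius_std_cls[OF p] std_cls_eq_zero_iff[OF frobenius_cocycle[OF p]] by simp
  finally show ?thesis using frobenius_trivial_iff[OF p] by simp
qed

end

section \<open>Coordinate matrices\<close>

lemma (in vectorspace) lincomb_nth:
  assumes "distinct es" "set es \<subseteq> carrier V" "a \<in> set es \<rightarrow> carrier K"
  shows "lincomb a (set es) = (\<Oplus>\<^bsub>V\<^esub>i\<in>{..<length es}. a (es ! i) \<odot>\<^bsub>V\<^esub> es ! i)"
proof -
  have es: "set es = (!) es ` {..<length es}" by (auto simp: set_conv_nth)
  have "(\<Oplus>\<^bsub>V\<^esub>v\<in>(!) es ` {..<length es}. a v \<odot>\<^bsub>V\<^esub> v)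
      = (\<Oplus>\<^bsub>V\<^esub>i\<in>{..<length es}. a (es ! i) \<odot>\<^bsub>V\<^esub> es ! i)"
  proof (rule M.add.finprod_reindex)
    show "(\<lambda>v. a v \<odot>\<^bsub>V\<^esub> v) \<in> (!) es ` {..<length es} \<rightarrow> carrier V"
      unfolding es[symmetric] using assms by (auto intro!: smult_closed)
    show "inj_on ((!) es) {..<length es}" using assms(1) by (auto simp: inj_on_def nth_eq_iff_index_eq)
  qed
  then show ?thesis unfolding lincomb_def es .
qed

text \<open>Makes the definite description in \<open>hasse_witt_matrix\<close> meaningful: column j
  must consist of the unique coordinates of \<open>y j\<close>.\<close>

lemma ex1_coordinate_matrix:
  fixes V :: "('k::field, 'v, 'm) module_scheme"
  assumes V: "vectorspace class_ring V" and es: "distinct es" "vectorspace.basis class_ring V (set es)"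
    and y: "\<And>j. j < length es \<Longrightarrow> y j \<in> carrier V"
  shows "\<exists>!A. A \<in> carrier_mat (length es) (length es) \<and>
    (\<forall>j<length es. y j = (\<Oplus>\<^bsub>V\<^esub>i\<in>{..<length es}. A $$ (i, j) \<odot>\<^bsub>V\<^esub> es ! i))"
proof -
  interpret vectorspace class_ring V by (rule V)
  have sub: "set es \<subseteq> carrier V" using es(2) unfolding basis_def by blast
  have uniq: "\<exists>!a. a \<in> set es \<rightarrow>\<^sub>E carrier class_ring \<and> lincomb a (set es) = v" if "v \<in> carrier V" for v
    using es(2) basis_criterion[of "set es"] sub that by blast
  have "\<exists>a. a \<in> set es \<rightarrow>\<^sub>E carrier class_ring \<and> lincomb a (set es) = y j" if "j < length es" for j
    using uniq[OF y[OF that]] by blast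
  then obtain a where a: "\<And>j. j < length es \<Longrightarrow> a j \<in> set es \<rightarrow>\<^sub>E carrier class_ring \<and> lincomb (a j) (set es) = y j"
    by metis
  define idx where "idx = the_inv_into {..<length es} ((!) es)"
  have idx: "idx (es ! i) = i" if "i < length es" for i
    unfolding idx_def using es(1) that by (intro the_inv_into_f_f) (auto simp: inj_on_def nth_eq_iff_index_eq)
  define A where "A = mat (length es) (length es) (\<lambda>(i, j). a j (es ! i))"
  show ?thesis
  proof (rule ex1I[of _ A])
    show "A \<in> carrier_mat (length es) (length es) \<and>
        (\<forall>j<length es. y j = (\<Oplus>\<^bsub>V\<^esub>i\<in>{..<length es}. A $$ (i, j) \<odot>\<^bsub>V\<^esub> es ! i))"
    proof (intro conjI allI impI)
      fix j assume j: "j < length es"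
      have "y j = (\<Oplus>\<^bsub>V\<^esub>i\<in>{..<length es}. a j (es ! i) \<odot>\<^bsub>V\<^esub> es ! i)"
        using a[OF j] lincomb_nth[OF es(1) sub, of "a j"] by auto
      also have "\<dots> = (\<Oplus>\<^bsub>V\<^esub>i\<in>{..<length es}. A $$ (i, j) \<odot>\<^bsub>V\<^esub> es ! i)"
        using j sub by (intro M.add.finprod_cong') (auto simp: A_def intro!: smult_closed)
      finally show "y j = (\<Oplus>\<^bsub>V\<^esub>i\<in>{..<length es}. A $$ (i, j) \<odot>\<^bsub>V\<^esub> es ! i)" .
    qed (simp add: A_def)
    fix B assume B: "B \<in> carrier_mat (length es) (length es) \<and>
        (\<forall>j<length es. y j = (\<Oplus>\<^bsub>V\<^esub>i\<in>{..<length es}. B $$ (i, j) \<odot>\<^bsub>V\<^esub> es ! i))"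
    show "B = A"
    proof (rule eq_matI)
      fix i j assume "i < dim_row A" "j < dim_col A"
      then have i: "i < length es" and j: "j < length es" by (simp_all add: A_def)
      \<comment> \<open>Coordinates are unique among extensional functions on the basis, hence the
        restriction.\<close>
      define b where "b = restrict (\<lambda>v. B $$ (idx v, j)) (set es)"
      have "lincomb b (set es) = (\<Oplus>\<^bsub>V\<^esub>i\<in>{..<length es}. b (es ! i) \<odot>\<^bsub>V\<^esub> es ! i)"
        by (rule lincomb_nth[OF es(1) sub]) simp
      also have "\<dots> = (\<Oplus>\<^bsub>V\<^esub>i\<in>{..<length es}. B $$ (i, j) \<odot>\<^bsub>V\<^esub> es ! i)"
        using sub by (intro M.add.finprod_cong') (auto simp: b_def idx intro!: smult_closed)
      also have "\<dots> = y j" using B j by simp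
      finally have "b = a j" using uniq[OF y[OF j]] a[OF j] by (auto simp: b_def)
      then have "b (es ! i) = a j (es ! i)" by simp
      then show "B $$ (i, j) = A $$ (i, j)" using i j by (simp add: b_def idx A_def)
    qed (use B in \<open>auto simp: A_def\<close>)
  qed
qed

text \<open>By uniqueness, the matrix is zero iff the zero matrix satisfies the defining equations,
  and these then say that Frobenius kills each basis vector.\<close>

lemma hasse_witt_matrix_zero_iff:
  assumes V: "vectorspace class_ring (curve_H1 f g)" and es: "H1_ordered_basis f g es"
    and closed: "\<And>Z. Z \<in> carrier (curve_H1 f g) \<Longrightarrow> curve_frobenius f g Z \<in> carrier (curve_H1 f g)"
  shows "hasse_witt_matrix f g es = 0\<^sub>m (length es) (length es) \<longleftrightarrow>
    (\<forall>v\<in>set es. curve_frobenius f g v = \<zero>\<^bsub>curve_H1 f g\<^esub>)"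
proof -
  let ?V = "curve_H1 f g" and ?n = "length es"
  interpret vectorspace class_ring ?V by (rule V)
  have d: "distinct es" and b: "vectorspace.basis class_ring ?V (set es)"
    using es by (simp_all add: H1_ordered_basis_def)
  have sub: "set es \<subseteq> carrier ?V" using b unfolding basis_def by blast
  define Q where "Q A \<longleftrightarrow> A \<in> carrier_mat ?n ?n \<and>
     (\<forall>j<?n. curve_frobenius f g (es ! j) = (\<Oplus>\<^bsub>?V\<^esub>i\<in>{..<?n}. A $$ (i, j) \<odot>\<^bsub>?V\<^esub> es ! i))" for A
  have ex1: "\<exists>!A. Q A"
    unfolding Q_def by (rule ex1_coordinate_matrix[OF V d b], rule closed) (use sub in auto)
  have HW: "hasse_witt_matrix f g es = (THE A. Q A)" by (simp add: hasse_witt_matrix_def Q_def)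
  have "(\<Oplus>\<^bsub>?V\<^esub>i\<in>{..<?n}. (0\<^sub>m ?n ?n) $$ (i, j) \<odot>\<^bsub>?V\<^esub> es ! i) = \<zero>\<^bsub>?V\<^esub>" if j: "j < ?n" for j
  proof -
    have "(\<Oplus>\<^bsub>?V\<^esub>i\<in>{..<?n}. (0\<^sub>m ?n ?n) $$ (i, j) \<odot>\<^bsub>?V\<^esub> es ! i) = (\<Oplus>\<^bsub>?V\<^esub>i\<in>{..<?n}. \<zero>\<^bsub>?V\<^esub>)"
      using sub j smult_l_null nth_mem by (intro M.add.finprod_cong') (simp_all add: subset_iff)
    then show ?thesis by simp
  qed
  then have Q0: "Q (0\<^sub>m ?n ?n) \<longleftrightarrow> (\<forall>j<?n. curve_frobenius f g (es ! j) = \<zero>\<^bsub>?V\<^esub>)"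
    by (auto simp: Q_def)
  have "hasse_witt_matrix f g es = 0\<^sub>m ?n ?n \<longleftrightarrow> Q (0\<^sub>m ?n ?n)"
    unfolding HW using ex1 theI'[OF ex1] the1_equality[OF ex1] by metis
  then show ?thesis unfolding Q0 by (simp add: all_set_conv_all_nth)
qed

text \<open>Here j selects the row of the array (the exponent raised by p) and i the column (the
  exponent lowered by 1); on the diagonal both happen at once and give 2 (p - 1).\<close>

lemma hasse_witt_monom_image:
  "{hasse_witt_monom p i j | i j. True} = {
     mono4 (2*(p-1)) (p-1) (p-1) (p-1), mono4 (2*p-1) (p-2) (p-1) (p-1),
     mono4 (2*p-1) (p-1) (p-2) (p-1),   mono4 (2*p-1) (p-1) (p-1) (p-2),
     mono4 (p-2) (2*p-1) (p-1) (p-1),   mono4 (p-1) (2*(p-1)) (p-1) (p-1),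
     mono4 (p-1) (2*p-1) (p-2) (p-1),   mono4 (p-1) (2*p-1) (p-1) (p-2),
     mono4 (p-2) (p-1) (2*p-1) (p-1),   mono4 (p-1) (p-2) (2*p-1) (p-1),
     mono4 (p-1) (p-1) (2*(p-1)) (p-1), mono4 (p-1) (p-1) (2*p-1) (p-2),
     mono4 (p-2) (p-1) (p-1) (2*p-1),   mono4 (p-1) (p-2) (p-1) (2*p-1),
     mono4 (p-1) (p-1) (p-2) (2*p-1),   mono4 (p-1) (p-1) (p-1) (2*(p-1))}"
  if "p \<ge> 2"
proof -
  have p: "p - 1 + p = 2 * p - 1" "2 * (p - 1) = 2 * p - 2" using that by simp_all
  have eq: "{hasse_witt_monom p i j | i j. True} = (\<Union>j\<in>{Coord_x, Coord_y, Coord_z, Coord_w}.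
      \<Union>i\<in>{Coord_x, Coord_y, Coord_z, Coord_w}. {hasse_witt_monom p i j})"
    unfolding UNIV_coord[symmetric] by blast
  show ?thesis
    unfolding eq by (simp add: hasse_witt_monom_def p insert_commute del: One_nat_def)
qed

theorem corollary3p1p6:
  fixes f g :: "'k::field poly4" and p :: nat and es :: "'k curve_H1 list"
  assumes char: "CHAR('k) = p" "p > 0"
    and perfect: "\<forall>a::'k. \<exists>b. b ^ p = a"
    and f: "homogeneous 3 f" "f \<noteq> 0"
    and g: "homogeneous 2 g" "g \<noteq> 0"
    and coprime: "\<forall>h. h dvd f \<longrightarrow> h dvd g \<longrightarrow> h dvd 1"
    and basis: "H1_ordered_basis f g es"
  shows "hasse_witt_matrix f g es = 0\<^sub>m (length es) (length es) \<longleftrightarrow>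
    (\<forall>m \<in> {
       mono4 (2*(p-1)) (p-1) (p-1) (p-1), mono4 (2*p-1) (p-2) (p-1) (p-1),
       mono4 (2*p-1) (p-1) (p-2) (p-1),   mono4 (2*p-1) (p-1) (p-1) (p-2),
       mono4 (p-2) (2*p-1) (p-1) (p-1),   mono4 (p-1) (2*(p-1)) (p-1) (p-1),
       mono4 (p-1) (2*p-1) (p-2) (p-1),   mono4 (p-1) (2*p-1) (p-1) (p-2),
       mono4 (p-2) (p-1) (2*p-1) (p-1),   mono4 (p-1) (p-2) (2*p-1) (p-1),
       mono4 (p-1) (p-1) (2*(p-1)) (p-1), mono4 (p-1) (p-1) (2*p-1) (p-2),
       mono4 (p-2) (p-1) (p-1) (2*p-1),   mono4 (p-1) (p-2) (p-1) (2*p-1),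
       mono4 (p-1) (p-1) (p-2) (2*p-1),   mono4 (p-1) (p-1) (p-1) (2*(p-1))}.
     Poly_Mapping.lookup ((f * g) ^ (p - 1)) m = 0)"
proof -
  interpret curve f g by (rule curve.intro[OF f g coprime])
  interpret frob: frobenius_sheaf T SF L "\<lambda>k P. fr P (scalar k) 1" p by (rule frobenius_sheaf[OF char])
  let ?V = "curve_H1 f g" and ?F = "curve_frobenius f g"
  have V_eq: "?V = H1 T SF" and F_eq: "?F = H1_frobenius T SF p"
    by (simp_all add: curve_H1_def curve_frobenius_def char(1))
  have V: "vectorspace class_ring ?V"
    unfolding V_eq by (rule vectorspace.intro[OF sheaf.H1_module class_field])
  interpret vectorspace class_ring ?V by (rule V)
  have b: "vectorspace.basis class_ring ?V (set es)" using basis by (simp add: H1_ordered_basis_def)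
  then have sub: "set es \<subseteq> carrier ?V" unfolding basis_def by blast
  note closed = frob.H1_frobenius_closed[folded V_eq F_eq]
    and add = frob.H1_frobenius_add[folded V_eq F_eq]
    and smult = frob.H1_frobenius_smult[folded V_eq F_eq]
  have zero: "?F \<zero>\<^bsub>?V\<^esub> = \<zero>\<^bsub>?V\<^esub>"
    using add[OF M.zero_closed M.zero_closed] closed[OF M.zero_closed] by simp
  \<comment> \<open>Frobenius is additive and multiplies scalars by their p-th powers, so it
    vanishes on all linear combinations once it vanishes on a basis.\<close>
  have "(\<forall>v\<in>set es. ?F v = \<zero>\<^bsub>?V\<^esub>) \<longleftrightarrow> (\<forall>Z\<in>carrier ?V. ?F Z = \<zero>\<^bsub>?V\<^esub>)"
  proof
    assume A: "\<forall>v\<in>set es. ?F v = \<zero>\<^bsub>?V\<^esub>"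
    have lin: "?F (\<Oplus>\<^bsub>?V\<^esub>v\<in>B. a v \<odot>\<^bsub>?V\<^esub> v) = \<zero>\<^bsub>?V\<^esub>" if "finite B" "B \<subseteq> set es" for B and a :: "_ \<Rightarrow> 'k"
      using that
    proof (induction B)
      case empty
      show ?case using zero by simp
    next
      case (insert v B)
      have v: "v \<in> carrier ?V" "a v \<odot>\<^bsub>?V\<^esub> v \<in> carrier ?V" using insert.prems sub by (auto intro!: smult_closed)
      have B: "(\<lambda>v. a v \<odot>\<^bsub>?V\<^esub> v) \<in> B \<rightarrow> carrier ?V" using insert.prems sub by (auto intro!: smult_closed)
      have "?F (\<Oplus>\<^bsub>?V\<^esub>v\<in>insert v B. a v \<odot>\<^bsub>?V\<^esub> v) = ?F (a v \<odot>\<^bsub>?V\<^esub> v \<oplus>\<^bsub>?V\<^esub> (\<Oplus>\<^bsub>?V\<^esub>v\<in>B. a v \<odot>\<^bsub>?V\<^esub> v))"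
        using M.finsum_insert[OF insert.hyps B v(2)] by simp
      also have "\<dots> = (a v ^ p) \<odot>\<^bsub>?V\<^esub> ?F v \<oplus>\<^bsub>?V\<^esub> \<zero>\<^bsub>?V\<^esub>"
        using add[OF v(2) M.finsum_closed[OF B]] smult[OF v(1)] insert by simp
      also have "\<dots> = \<zero>\<^bsub>?V\<^esub>" using A insert.prems smult_r_null[of "a v ^ p"] by simp
      finally show ?case .
    qed
    show "\<forall>Z\<in>carrier ?V. ?F Z = \<zero>\<^bsub>?V\<^esub>"
    proof
      fix Z assume "Z \<in> carrier ?V"
      then obtain a where "lincomb a (set es) = Z"
        using b basis_criterion[of "set es"] sub by blast
      then show "?F Z = \<zero>\<^bsub>?V\<^esub>" using lin[of "set es" a] by (auto simp: lincomb_def)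
    qed
  qed (use sub in blast)
  also have "\<dots> \<longleftrightarrow> (\<forall>i j. Poly_Mapping.lookup ((f * g) ^ (p - 1)) (hasse_witt_monom p i j) = 0)"
    unfolding V_eq F_eq by (rule frobenius_zero_iff[OF char])
  also have "\<dots> \<longleftrightarrow> (\<forall>m\<in>{hasse_witt_monom p i j | i j. True}. Poly_Mapping.lookup ((f * g) ^ (p - 1)) m = 0)"
    by blast
  finally have "(\<forall>v\<in>set es. ?F v = \<zero>\<^bsub>?V\<^esub>) \<longleftrightarrow>
    (\<forall>m\<in>{hasse_witt_monom p i j | i j. True}. Poly_Mapping.lookup ((f * g) ^ (p - 1)) m = 0)" .
  moreover have "hasse_witt_matrix f g es = 0\<^sub>m (length es) (length es) \<longleftrightarrow> (\<forall>v\<in>set es. ?F v = \<zero>\<^bsub>?V\<^esub>)"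
    by (rule hasse_witt_matrix_zero_iff[OF V basis closed])
  ultimately show ?thesis
    unfolding hasse_witt_monom_image[OF prime_ge_2_nat[OF CHAR_prime[OF char]]] by (simp only:)
qed

end
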